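(* Let $\frac12 \le \theta < 1$ and let $y = y(x) = x^{\theta} g(x) \le \frac{x}{2}$, where $g$ is a positive function such that $\log^{\delta} x \ll g(x)$ for some fixed $\delta > 0$, and $g(x) \ll_{\varepsilon} x^{\varepsilon}$ for every $\varepsilon > 0$. Suppose that the following three conditions hold. (1) There are $T_0 \ge 3$ and a non-increasing, non-negative function $\eta$ with $\eta(T) < \frac12$ such that $\zeta(\sigma + iT) \ne 0$ whenever $T \ge T_0$ and $\sigma > 1 - \eta(T)$. (2) There exist a non-decreasing function $h(T)$ and a constant $b$ with $0 < b \le \frac{1}{1-\theta}$ such that $$N(\sigma, T) \ll T^{b(1-\sigma)} h(T)$$ uniformly for $\frac12 \le \sigma \le 1$ as $T \to \infty$. (3) The functions $g, \eta, h$ satisfy the following as $x \to \infty$: - if $\theta > 1 - \frac1b$, then $h(x) = o\left( x^{(1 + b(\theta - 1))\eta(x)} \right)$; - if $\theta = 1 - \frac1b$, then $\displaystyle \left( \frac{\log^{\delta/2} x}{g(x)} \right)^{b\eta(x)} \frac{h(x) \log x}{\log\log x} = o(1)$; - in addition, if $b = 2$ and $\theta = \frac12$, then $\log^{1+\delta} x \ll g(x)$. (Here $\delta$ is the same constant throughout.) Then $$\pi(x) - \pi(x - y) \sim \frac{y}{\log x} \quad \text{as } x \to \infty.$$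
   Context: $\zeta$ is the Riemann zeta function and $\pi(x)$ is the number of primes not exceeding $x$. $N(\sigma, T)$ denotes the number of zeroes $\rho = \beta + i\gamma$ of $\zeta$ (counted with multiplicity) with $\sigma \le \beta \le 1$ and $0 < \gamma \le T$. $f \ll g$ means $|f| \le K g$ for some constant $K>0$ and all sufficiently large values of the variable; subscripts indicate parameters on which $K$ may depend. $\log^{a} x$ means $(\log x)^a$. *)

theory Defs
  imports
    "HOL-Complex_Analysis.Complex_Analysis"
    "HOL-Library.Landau_Symbols"
    "HOL-Computational_Algebra.Primes"
begin

(* The analytic continuation of the Dirichlet series to the plane without 1.  By the identity
   theorem it is determined everywhere except at the pole 1, where its value is arbitrary. *)
definition zeta :: "complex \<Rightarrow> complex" where
  "zeta = (SOME f. f holomorphic_on (- {1}) \<and>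
             (\<forall>s. Re s > 1 \<longrightarrow> (\<lambda>n. 1 / of_nat (Suc n) powr s) sums f s))"

(* The sum is over a finite set, as zeta is not identically zero and the pole 1 is not an
   accumulation point of zeros.  The order of vanishing at a zero is positive, so that the
   conversion from int to nat loses nothing. *)
definition zeta_zero_count :: "real \<Rightarrow> real \<Rightarrow> nat" where
  "zeta_zero_count \<sigma> T =
     (\<Sum>\<rho> | zeta \<rho> = 0 \<and> \<sigma> \<le> Re \<rho> \<and> Re \<rho> \<le> 1 \<and> 0 < Im \<rho> \<and> Im \<rho> \<le> T. nat (zorder zeta \<rho>))"

definition prime_pi :: "real \<Rightarrow> nat" where
  "prime_pi x = card {p::nat. prime p \<and> real p \<le> x}"

end

theory Submission
  imports Defs "HOL-Number_Theory.Prime_Powers" "HOL-Probability.Probability" "HOL-Real_Asymp.Real_Asymp"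
begin

text \<open>
  Put \<open>\<tau> = x / y\<close>. The von Mangoldt sum over \<open>(x - y, x]\<close> is sandwiched between sums with weights
  \<open>n\<^sup>2 w (log n)\<close>, where \<open>w\<close> is an interval indicator convolved \<open>k\<close> times with a window of relative
  size \<open>1 / \<tau>\<close>. Moving the line of integration of the corresponding Perron integral of \<open>\<zeta>' / \<zeta>\<close>
  to \<open>Re s = - 1\<close> turns the main term into the residue at 1, and each zero \<open>\<rho> = \<beta> + i \<gamma>\<close> contributes at
  most a constant times \<open>y x\<^bsup>\<beta> - 1\<^esup> min 1 (\<tau> / \<bar>\<gamma>\<bar>)\<^bsup>k\<^esup>\<close>. For heights in \<open>[2\<^bsup>j\<^esup> \<tau>, 2\<^bsup>j+1\<^esup> \<tau>]\<close> partial summation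
  over \<open>\<beta>\<close> in the density bound, cut off by the zero-free region, gives
  \<open>2\<^bsup>jb\<^esup> h(x) (\<tau>\<^bsup>b\<^esup> / x)\<^bsup>\<eta>(x)\<^esup> log x / log (x / \<tau>\<^bsup>b\<^esup>)\<close>, and condition (3) says that this tends to 0 for \<open>j = 0\<close>;
  the weight makes the sum over \<open>j\<close> converge once \<open>k > b\<close>. Because of the smoothing no truncation
  error of size \<open>x log\<^sup>2 x / T\<close> occurs.
\<close>

section \<open>Contour integrals over strips and logarithmic derivatives of entire functions\<close>

text \<open>Several obstacles shape the development. \<open>zeta\<close> is a choice among functions
  with a stated property, so a witness has to be built; the theta function supplies it together with
  the functional equation, which is what controls the logarithmic derivative on Re s = -1. The zeros
  are then studied through the entire function \<open>xi\<close>. Condition (1) says nothing below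
  the height \<open>T0\<close>: the finitely many zeros there, possible real ones included, must
  still contribute o(y), and non-vanishing on Re s = 1 provides exactly this. The density bound is
  useful only up to height x, since beyond it \<open>h\<close> and \<open>\<eta>\<close> cannot be
  compared with their values at x; zeros above x are covered by the crude count O(u^2) coming from
  the order of growth of \<open>xi\<close>, which suffices because the weight has exponent k >= 6
  and \<open>\<tau>\<^sup>2 \<le> x\<close>. Finally, for \<theta> = 1/2 the squares up to x may
  outweigh y, so that only those inside the interval may be counted.\<close>

lemma rectpath_strip_limit:
  fixes f :: "complex \<Rightarrow> complex" and a b :: real and T M :: "nat \<Rightarrow> real"
  assumes ab: "a < b" and T: "filterlim T at_top sequentially" and Tpos: "\<And>n. T n > 0"
    and cont: "\<And>n. continuous_on (path_image (rectpath (Complex a (- T n)) (Complex b (T n)))) f"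
    and M: "M \<longlonglongrightarrow> 0"
    and hor: "\<And>n x y. a \<le> x \<Longrightarrow> x \<le> b \<Longrightarrow> \<bar>y\<bar> = T n \<Longrightarrow> norm (f (Complex x y)) \<le> M n"
    and inta: "integrable lborel (\<lambda>t. f (Complex a t))"
    and intb: "integrable lborel (\<lambda>t. f (Complex b t))"
  shows "(\<lambda>n. contour_integral (rectpath (Complex a (- T n)) (Complex b (T n))) f)
           \<longlonglongrightarrow> \<i> * (lebesgue_integral lborel (\<lambda>t. f (Complex b t)) -
                   lebesgue_integral lborel (\<lambda>t. f (Complex a t)))"
proof -
  define R where "R n = rectpath (Complex a (- T n)) (Complex b (T n))" for n
  define p1 where "p1 n = Complex a (- T n)" for n
  define p2 where "p2 n = Complex b (- T n)" for n
  define p3 where "p3 n = Complex b (T n)" for n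
  define p4 where "p4 n = Complex a (T n)" for n
  have img: "path_image (R n) = closed_segment (p1 n) (p2 n) \<union> closed_segment (p2 n) (p3 n) \<union>
     closed_segment (p3 n) (p4 n) \<union> closed_segment (p4 n) (p1 n)" for n
    by (simp add: R_def rectpath_def Let_def path_image_join p1_def p2_def p3_def p4_def Un_assoc)
  have ci: "f contour_integrable_on linepath (p1 n) (p2 n)" "f contour_integrable_on linepath (p2 n) (p3 n)"
     "f contour_integrable_on linepath (p3 n) (p4 n)" "f contour_integrable_on linepath (p4 n) (p1 n)" for n
    using cont[of n] unfolding R_def[symmetric] img
    by (auto intro!: contour_integrable_continuous_linepath elim: continuous_on_subset)
  have split: "contour_integral (R n) f = contour_integral (linepath (p1 n) (p2 n)) f +
     contour_integral (linepath (p2 n) (p3 n)) f + contour_integral (linepath (p3 n) (p4 n)) f +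
     contour_integral (linepath (p4 n) (p1 n)) f" for n
  proof -
    have "R n = linepath (p1 n) (p2 n) +++ linepath (p2 n) (p3 n) +++ linepath (p3 n) (p4 n) +++ linepath (p4 n) (p1 n)"
      by (simp add: R_def rectpath_def Let_def p1_def p2_def p3_def p4_def)
    then show ?thesis using ci[of n]
      by (simp add: contour_integral_join contour_integrable_join valid_path_join)
  qed
  have vert: "(\<lambda>n. integral {- T n..T n} (\<lambda>t. f (Complex c t))) \<longlonglongrightarrow> lebesgue_integral lborel (\<lambda>t. f (Complex c t))"
    if int: "integrable lborel (\<lambda>t. f (Complex c t))" for c
  proof -
    have eq: "integral {- T n..T n} (\<lambda>t. f (Complex c t)) =
       (\<integral>t. indicator {- T n..T n} t *\<^sub>R f (Complex c t) \<partial>lborel)" for n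
    proof -
      have "set_integrable lborel {- T n..T n} (\<lambda>t. f (Complex c t))"
        unfolding set_integrable_def by (rule integrable_mult_indicator[OF _ int]) auto
      from set_borel_integral_eq_integral(2)[OF this] show ?thesis
        by (simp add: set_lebesgue_integral_def)
    qed
    have "(\<lambda>n. \<integral>t. indicator {- T n..T n} t *\<^sub>R f (Complex c t) \<partial>lborel) \<longlonglongrightarrow> lebesgue_integral lborel (\<lambda>t. f (Complex c t))"
    proof (rule integral_dominated_convergence[where w = "\<lambda>t. norm (f (Complex c t))"])
      show "integrable lborel (\<lambda>t. norm (f (Complex c t)))" using int by simp
      show "(\<lambda>t. f (Complex c t)) \<in> borel_measurable lborel" using int by auto
      show "(\<lambda>t. indicator {- T n..T n} t *\<^sub>R f (Complex c t)) \<in> borel_measurable lborel" for n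
        using int by (intro borel_measurable_scaleR) auto
      show "AE x in lborel. (\<lambda>n. indicator {- T n..T n} x *\<^sub>R f (Complex c x)) \<longlonglongrightarrow> f (Complex c x)"
      proof (rule AE_I2)
        fix x :: real
        have "eventually (\<lambda>n. T n \<ge> \<bar>x\<bar>) sequentially" using T by (simp add: filterlim_at_top)
        then have "eventually (\<lambda>n. indicator {- T n..T n} x *\<^sub>R f (Complex c x) = f (Complex c x)) sequentially"
          by eventually_elim (auto simp: indicator_def)
        then show "(\<lambda>n. indicator {- T n..T n} x *\<^sub>R f (Complex c x)) \<longlonglongrightarrow> f (Complex c x)"
          by (rule tendsto_eventually)
      qed
      show "AE x in lborel. norm (indicator {- T n..T n} x *\<^sub>R f (Complex c x)) \<le> norm (f (Complex c x))" for n
        by (auto simp: indicator_def)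
    qed
    then show ?thesis by (simp add: eq)
  qed
  have seg: "contour_integral (linepath (p2 n) (p3 n)) f = \<i> * integral {- T n..T n} (\<lambda>t. f (Complex b t))" 
     "contour_integral (linepath (p4 n) (p1 n)) f = - (\<i> * integral {- T n..T n} (\<lambda>t. f (Complex a t)))" for n
  proof -
    show "contour_integral (linepath (p2 n) (p3 n)) f = \<i> * integral {- T n..T n} (\<lambda>t. f (Complex b t))"
      by (rule contour_integral_linepath_same_Re) (use Tpos[of n] in \<open>auto simp: p2_def p3_def\<close>)
    have "contour_integral (linepath (p1 n) (p4 n)) f = \<i> * integral {- T n..T n} (\<lambda>t. f (Complex a t))"
      by (rule contour_integral_linepath_same_Re) (use Tpos[of n] in \<open>auto simp: p1_def p4_def\<close>)
    moreover have "contour_integral (linepath (p4 n) (p1 n)) f = - contour_integral (linepath (p1 n) (p4 n)) f"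
      using contour_integral_reversepath[of "linepath (p1 n) (p4 n)" f] by simp
    ultimately show "contour_integral (linepath (p4 n) (p1 n)) f = - (\<i> * integral {- T n..T n} (\<lambda>t. f (Complex a t)))"
      by simp
  qed
  have Mnn: "M n \<ge> 0" for n
    using hor[of a "T n" n] ab Tpos[of n] norm_ge_zero order_trans by (metis abs_of_pos less_imp_le order_refl)
  have h1: "(\<lambda>n. contour_integral (linepath (p1 n) (p2 n)) f) \<longlonglongrightarrow> 0"
  proof (rule Lim_null_comparison)
    show "eventually (\<lambda>n. norm (contour_integral (linepath (p1 n) (p2 n)) f) \<le> M n * (b - a)) sequentially"
    proof (rule always_eventually, rule allI)
      fix n
      have "norm (contour_integral (linepath (p1 n) (p2 n)) f) \<le> M n * norm (p2 n - p1 n)"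
      proof (rule contour_integral_bound_linepath[OF ci(1) Mnn])
        fix x assume "x \<in> closed_segment (p1 n) (p2 n)"
        then have "x = Complex (Re x) (- T n)" "a \<le> Re x" "Re x \<le> b"
          using ab by (auto simp: p1_def p2_def closed_segment_same_Im closed_segment_eq_real_ivl complex_eq_iff)
        then show "norm (f x) \<le> M n" using hor[of "Re x" "- T n" n] Tpos[of n] by simp
      qed
      also have "norm (p2 n - p1 n) = b - a"
        using ab by (simp add: p1_def p2_def norm_complex_def)
      finally show "norm (contour_integral (linepath (p1 n) (p2 n)) f) \<le> M n * (b - a)" .
    qed
    show "(\<lambda>n. M n * (b - a)) \<longlonglongrightarrow> 0" using tendsto_mult_left_zero[OF M] .
  qed
  have h2: "(\<lambda>n. contour_integral (linepath (p3 n) (p4 n)) f) \<longlonglongrightarrow> 0"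
  proof (rule Lim_null_comparison)
    show "eventually (\<lambda>n. norm (contour_integral (linepath (p3 n) (p4 n)) f) \<le> M n * (b - a)) sequentially"
    proof (rule always_eventually, rule allI)
      fix n
      have "norm (contour_integral (linepath (p3 n) (p4 n)) f) \<le> M n * norm (p4 n - p3 n)"
      proof (rule contour_integral_bound_linepath[OF ci(3) Mnn])
        fix x assume "x \<in> closed_segment (p3 n) (p4 n)"
        then have "x = Complex (Re x) (T n)" "a \<le> Re x" "Re x \<le> b"
          using ab by (auto simp: p3_def p4_def closed_segment_same_Im closed_segment_eq_real_ivl complex_eq_iff)
        then show "norm (f x) \<le> M n" using hor[of "Re x" "T n" n] Tpos[of n] by simp
      qed
      also have "norm (p4 n - p3 n) = b - a"
        using ab by (simp add: p3_def p4_def norm_complex_def)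
      finally show "norm (contour_integral (linepath (p3 n) (p4 n)) f) \<le> M n * (b - a)" .
    qed
    show "(\<lambda>n. M n * (b - a)) \<longlonglongrightarrow> 0" using tendsto_mult_left_zero[OF M] .
  qed
  have "(\<lambda>n. contour_integral (R n) f) \<longlonglongrightarrow> 0 + \<i> * lebesgue_integral lborel (\<lambda>t. f (Complex b t)) + 0 +
     - (\<i> * lebesgue_integral lborel (\<lambda>t. f (Complex a t)))"
    unfolding split seg
    by (intro tendsto_add h1 h2 tendsto_minus tendsto_mult tendsto_const vert inta intb)
  then show ?thesis by (simp add: R_def algebra_simps)
qed

text \<open>The map u -> u / (2 M - u) carries the half-plane Re u < M into the unit disc and fixes
  0, so the Schwarz lemma bounds it by 1/2 on the disc of half the radius. Solving back gives |h| <=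
  2 M there, and Cauchy's estimate on discs of radius r / 4 turns this into a bound for the
  derivative.\<close>

lemma Borel_Caratheodory_deriv:
  fixes h :: "complex \<Rightarrow> complex"
  assumes hol: "h holomorphic_on ball c r" and h0: "h c = 0" and r: "r > 0"
    and Re: "\<And>z. z \<in> ball c r \<Longrightarrow> Re (h z) < M" and z: "z \<in> cball c (r / 4)"
  shows "norm (deriv h z) \<le> 16 * M / r"
proof -
  have M: "M > 0" using Re[of c] h0 r by simp
  define \<phi> where "\<phi> w = h (c + of_real r * w) / (2 * of_real M - h (c + of_real r * w))" for w :: complex
  have inb: "c + of_real r * w \<in> ball c r" if "norm w < 1" for w :: complex
    using that r by (simp add: dist_norm norm_mult)
  have nz: "2 * of_real M - h u \<noteq> 0" if "u \<in> ball c r" for u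
    using Re[OF that] M by (auto simp: complex_eq_iff)
  have lt: "norm (h u) < norm (2 * of_real M - h u)" if "u \<in> ball c r" for u
  proof -
    have "(norm (h u))\<^sup>2 < (norm (2 * of_real M - h u))\<^sup>2"
      using mult_pos_pos[OF M, of "M - Re (h u)"] Re[OF that] unfolding cmod_power2
      by (simp add: power2_eq_square algebra_simps)
    then show ?thesis by (simp add: power2_less_imp_less)
  qed
  have holphi: "\<phi> holomorphic_on ball 0 1"
  proof -
    have "(\<lambda>w. h (c + of_real r * w)) holomorphic_on ball 0 1"
      by (rule holomorphic_on_compose_gen[OF _ hol, unfolded o_def]) (auto intro!: holomorphic_intros simp: inb simp del: mem_ball)
    then show ?thesis unfolding \<phi>_def
      using nz[OF inb] by (intro holomorphic_intros) auto
  qed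
  have phibound: "norm (\<phi> w) \<le> norm w" if "norm w < 1" for w
  proof (rule Schwarz_Lemma(1)[OF holphi _ _ that])
    show "\<phi> 0 = 0" by (simp add: \<phi>_def h0)
    fix z :: complex assume "norm z < 1"
    from lt[OF inb[OF this]] show "norm (\<phi> z) < 1"
      by (simp add: \<phi>_def norm_divide divide_less_eq)
  qed
  have hb: "norm (h u) \<le> 2 * M" if u: "u \<in> cball c (r / 2)" for u
  proof -
    define w where "w = (u - c) / of_real r"
    have nw: "norm w \<le> 1 / 2" using u r by (simp add: w_def norm_divide dist_norm norm_minus_commute field_simps)
    have uw: "u = c + of_real r * w" using r by (simp add: w_def)
    have ub: "u \<in> ball c r" using u r by simp
    have p: "norm (\<phi> w) \<le> 1 / 2" using phibound[of w] nw by simp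
    have "h u = \<phi> w * (2 * of_real M - h u)" using nz[OF ub] by (simp add: \<phi>_def uw)
    then have "norm (h u) = norm (\<phi> w) * norm (2 * of_real M - h u)" by (metis norm_mult)
    also have "\<dots> \<le> 1 / 2 * (2 * M + norm (h u))"
    proof (intro mult_mono p)
      show "norm (2 * of_real M - h u) \<le> 2 * M + norm (h u)"
        using norm_triangle_ineq4[of "2 * of_real M" "h u"] M by (simp add: norm_mult)
    qed auto
    finally show ?thesis by simp
  qed
  \<comment> \<open>Cauchy's estimate is applied with values in an open ball, so the bound 2 M is
    relaxed to 4 M; division by r / 4 gives 16 M / r.\<close>
  have "norm ((deriv ^^ 1) h z) \<le> fact 1 * (4 * M) / (r / 4) ^ 1"
  proof (rule Cauchy_higher_deriv_bound[where y = 0])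
    have sub: "cball z (r / 4) \<subseteq> cball c (r / 2)"
    proof
      fix x assume "x \<in> cball z (r / 4)"
      then show "x \<in> cball c (r / 2)" using z dist_triangle[of c x z] by (simp add: mem_cball)
    qed
    have sub2: "cball c (r / 2) \<subseteq> ball c r" using r by auto
    show "h holomorphic_on ball z (r / 4)"
      by (rule holomorphic_on_subset[OF hol]) (use sub sub2 ball_subset_cball in blast)
    show "continuous_on (cball z (r / 4)) h"
      by (rule holomorphic_on_imp_continuous_on, rule holomorphic_on_subset[OF hol]) (use sub sub2 in blast)
    fix w assume "w \<in> ball z (r / 4)"
    then have "w \<in> cball c (r / 2)" using sub ball_subset_cball by blast
    from hb[OF this] show "h w \<in> ball 0 (4 * M)" using M by simp
  qed (use r in auto)
  then show ?thesis by simp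
qed

text \<open>Induction over \<open>Z\<close>: the other factors do not vanish at the new point, so
  \<open>f\<close> and the quotient obtained so far have the same order there. The last conjunct
  records that nothing is left over; it makes the quotient zero-free on a disc all of whose zeros
  lie in \<open>Z\<close>.\<close>

lemma factor_out_zeros:
  fixes f :: "complex \<Rightarrow> complex"
  assumes hol: "f holomorphic_on UNIV" and nz: "f c \<noteq> 0" and Z: "finite Z" "\<And>z. z \<in> Z \<Longrightarrow> f z = 0"
  shows "\<exists>g. g holomorphic_on UNIV \<and> (\<forall>z. f z = g z * (\<Prod>\<rho>\<in>Z. (z - \<rho>) ^ nat (zorder f \<rho>))) \<and> (\<forall>\<rho>\<in>Z. g \<rho> \<noteq> 0)"
  using Z
proof (induction Z rule: finite_induct)
  case empty
  then show ?case using hol by (intro exI[of _ f]) auto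
next
  case (insert p Z)
  from insert.IH insert.prems obtain g where g: "g holomorphic_on UNIV"
    "\<And>z. f z = g z * (\<Prod>\<rho>\<in>Z. (z - \<rho>) ^ nat (zorder f \<rho>))" "\<And>\<rho>. \<rho> \<in> Z \<Longrightarrow> g \<rho> \<noteq> 0" by auto
  define P where "P z = (\<Prod>\<rho>\<in>Z. (z - \<rho>) ^ nat (zorder f \<rho>))" for z
  have Pp: "P p \<noteq> 0" using insert.hyps by (auto simp: P_def)
  have holP: "P holomorphic_on UNIV" unfolding P_def by (intro holomorphic_intros)
  have gc: "g c \<noteq> 0" using nz g(2)[of c] by auto
  define n where "n = nat (zorder g p)"
  define k where "k = zor_poly g p"
  from zorder_exist_zero[OF g(1) open_UNIV connected_UNIV UNIV_I, of p] gc
  obtain r where r: "r > 0" "k holomorphic_on cball p r" "\<And>w. w \<in> cball p r \<Longrightarrow> g w = k w * (w - p) ^ n \<and> k w \<noteq> 0"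
    unfolding n_def k_def by blast
  have ord: "zorder f p = int n"
  proof (rule zorder_eqI[of "ball p r" p "\<lambda>w. k w * P w"])
    show "(\<lambda>w. k w * P w) holomorphic_on ball p r"
      using r(2) holP by (intro holomorphic_intros) (auto elim: holomorphic_on_subset)
    fix w assume w: "w \<in> ball p r" "w \<noteq> p"
    have "f w = g w * P w" using g(2)[of w] by (simp add: P_def)
    then show "f w = k w * P w * (w - p) powi int n"
      using r(3)[of w] w by simp
  qed (use r Pp in auto)
  \<comment> \<open>The value \<open>k p\<close> fills the removable singularity of g / (w - p)^n.
    Holomorphy is checked separately near p, where the quotient equals \<open>k\<close>, and away
    from p.\<close>
  define g' where "g' w = (if w = p then k p else g w / (w - p) ^ n)" for w
  have g'k: "g' w = k w" if "w \<in> cball p r" for w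
    using r(3)[OF that] by (auto simp: g'_def)
  have hol1: "g' holomorphic_on ball p r"
    by (rule holomorphic_transform[OF holomorphic_on_subset[OF r(2)]]) (auto simp: g'k)
  have hol2: "g' holomorphic_on (- {p})"
  proof (rule holomorphic_transform)
    show "(\<lambda>w. g w / (w - p) ^ n) holomorphic_on (- {p})"
      by (intro holomorphic_intros holomorphic_on_subset[OF g(1)]) auto
  qed (auto simp: g'_def)
  have "g' holomorphic_on (ball p r \<union> (- {p}))"
    by (rule holomorphic_on_Un[OF hol1 hol2]) auto
  moreover have "ball p r \<union> (- {p}) = UNIV" using r(1) by auto
  ultimately have hol': "g' holomorphic_on UNIV" by simp
  have gg': "g z = g' z * (z - p) ^ n" for z
    using r(3)[of p] r(1) by (cases "z = p") (auto simp: g'_def)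
  show ?case
  proof (intro exI[of _ g'] conjI allI ballI hol')
    show "f z = g' z * (\<Prod>\<rho>\<in>insert p Z. (z - \<rho>) ^ nat (zorder f \<rho>))" for z
      using insert.hyps g(2)[of z] gg'[of z] ord by (simp add: mult_ac)
    fix \<rho> assume "\<rho> \<in> insert p Z"
    then show "g' \<rho> \<noteq> 0"
      using g(3)[of \<rho>] gg'[of \<rho>] g'k[of p] r(3)[of p] r(1) by auto
  qed
qed


lemma finite_zeros_compact:
  fixes f :: "complex \<Rightarrow> complex"
  assumes hol: "f holomorphic_on UNIV" and nz: "f c \<noteq> 0" and K: "compact K"
  shows "finite {z \<in> K. f z = 0}"
proof (cases "f constant_on UNIV")
  case True
  then obtain k where "\<And>z. f z = k" by (auto simp: constant_on_def)
  with nz have "\<And>z. f z \<noteq> 0" by metis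
  then show ?thesis by auto
next
  case False
  show ?thesis
    by (rule holomorphic_compact_finite_zeros[OF hol]) (use False K in auto)
qed

text \<open>Dividing out the zeros in a disc by factors that equal 1 at the centre and have modulus at
  least 2 on the sphere of three times the radius makes the maximum principle give both claims.\<close>

lemma logderiv_partial_fractions:
  fixes f :: "complex \<Rightarrow> complex" and A :: real
  assumes hol: "f holomorphic_on UNIV" and nz: "f c \<noteq> 0" and A: "A \<ge> 0"
    and growth: "\<And>s. norm (f s) \<le> exp (A * (1 + norm s)\<^sup>2)"
  shows "\<exists>C>0. \<forall>r\<ge>1. (\<Sum>\<rho> | \<rho> \<in> cball c r \<and> f \<rho> = 0. real (nat (zorder f \<rho>))) \<le> C * r\<^sup>2 \<and>
    (\<forall>z\<in>cball c (r / 4). f z \<noteq> 0 \<longrightarrow>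
      norm (deriv f z / f z - (\<Sum>\<rho> | \<rho> \<in> cball c r \<and> f \<rho> = 0. of_nat (nat (zorder f \<rho>)) / (z - \<rho>))) \<le> C * r)"
proof -
  \<comment> \<open>On the circle of radius 3 r about c one has 1 + |s| <= 1 + |c| + 3 r <= (4 +
    |c|) r for r >= 1, so \<open>K1 * r\<^sup>2\<close> bounds the exponent of growth there.\<close>
  define K1 where "K1 = A * (4 + norm c)\<^sup>2"
  define K2 where "K2 = max 0 (- ln (norm (f c)))"
  \<comment> \<open>The extra 1 gives the strict inequality that
    \<open>Borel_Caratheodory_deriv\<close> asks for.\<close>
  define C0 where "C0 = K1 + K2 + 1"
  have K: "K1 \<ge> 0" "K2 \<ge> 0" using A by (auto simp: K1_def K2_def)
  have C0: "C0 \<ge> 1" using K by (simp add: C0_def)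
  show ?thesis
  proof (intro exI[of _ "16 * C0"] conjI allI impI ballI)
    show "16 * C0 > 0" using C0 by simp
    fix r :: real assume r: "r \<ge> 1"
    define Z where "Z = {\<rho>. \<rho> \<in> cball c r \<and> f \<rho> = 0}"
    define m where "m \<rho> = nat (zorder f \<rho>)" for \<rho>
    define N where "N = (\<Sum>\<rho>\<in>Z. m \<rho>)"
    have fin: "finite Z" using finite_zeros_compact[OF hol nz compact_cball] by (simp add: Z_def)
    obtain g where g: "g holomorphic_on UNIV" "\<And>z. f z = g z * (\<Prod>\<rho>\<in>Z. (z - \<rho>) ^ m \<rho>)"
      "\<And>\<rho>. \<rho> \<in> Z \<Longrightarrow> g \<rho> \<noteq> 0"
    proof -
      have "f z = 0" if "z \<in> Z" for z using that by (simp add: Z_def)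
      from factor_out_zeros[OF hol nz fin this, folded m_def] that show ?thesis by blast
    qed
    define P where "P = (\<Prod>\<rho>\<in>Z. (c - \<rho>) ^ m \<rho>)"
    define q where "q z = (\<Prod>\<rho>\<in>Z. ((z - \<rho>) / (c - \<rho>)) ^ m \<rho>)" for z
    define F where "F z = g z * P" for z
    have cZ: "c \<noteq> \<rho>" if "\<rho> \<in> Z" for \<rho> using that nz by (auto simp: Z_def)
    have P0: "P \<noteq> 0" using fin cZ by (auto simp: P_def)
    have fF: "f z = F z * q z" for z
    proof -
      have "q z = (\<Prod>\<rho>\<in>Z. (z - \<rho>) ^ m \<rho>) / P"
        by (simp add: q_def P_def power_divide prod_dividef)
      then show ?thesis using P0 g(2)[of z] by (simp add: F_def)
    qed
    have qc: "q c = 1" using cZ by (simp add: q_def)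
    have holF: "F holomorphic_on UNIV" unfolding F_def using g(1) by (intro holomorphic_intros)
    have F0: "F z \<noteq> 0" if "z \<in> cball c r" for z
    proof (cases "z \<in> Z")
      case True then show ?thesis using g(3) P0 by (simp add: F_def)
    next
      case False then show ?thesis using fF[of z] that by (auto simp: Z_def)
    qed
    have Fc: "F c = f c" using fF[of c] qc by simp
    have q2: "norm (q z) \<ge> 2 ^ N" if "z \<in> sphere c (3 * r)" for z
    proof -
      have "(\<Prod>\<rho>\<in>Z. (2::real) ^ m \<rho>) \<le> (\<Prod>\<rho>\<in>Z. norm (((z - \<rho>) / (c - \<rho>)) ^ m \<rho>))"
      proof (rule prod_mono, intro conjI)
        fix \<rho> assume \<rho>: "\<rho> \<in> Z"
        have a: "norm (c - \<rho>) \<le> r" "norm (c - \<rho>) > 0"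
          using \<rho> cZ[OF \<rho>] by (auto simp: Z_def dist_norm)
        have "3 * r = norm ((z - \<rho>) - (c - \<rho>))" using that by (simp add: dist_norm norm_minus_commute)
        also have "\<dots> \<le> norm (z - \<rho>) + norm (c - \<rho>)" by (rule norm_triangle_ineq4)
        finally have "norm (z - \<rho>) \<ge> 2 * norm (c - \<rho>)" using a by linarith
        then have "2 \<le> norm ((z - \<rho>) / (c - \<rho>))" using a by (simp add: norm_divide field_simps)
        then show "2 ^ m \<rho> \<le> norm (((z - \<rho>) / (c - \<rho>)) ^ m \<rho>)"
          unfolding norm_power by (intro power_mono) auto
      qed simp
      then show ?thesis by (simp add: q_def N_def power_sum prod_norm)
    qed
    define B where "B = A * (1 + norm c + 3 * r)\<^sup>2"
    have B: "B \<le> K1 * r\<^sup>2"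
    proof -
      have "1 + norm c + 3 * r \<le> (4 + norm c) * r"
        using r mult_left_mono[of 1 r "norm c"] by (simp add: algebra_simps)
      then have "(1 + norm c + 3 * r)\<^sup>2 \<le> ((4 + norm c) * r)\<^sup>2"
        using r by (intro power_mono) auto
      then show ?thesis using A by (simp add: B_def K1_def power_mult_distrib mult_left_mono mult.assoc)
    qed
    \<comment> \<open>The gain 2^N over the trivial bound limits the number of zeros when it is
      evaluated at the centre. For the logarithmic derivative only 2^N >= 1 is kept.\<close>
    have Fmax: "norm (F z) \<le> exp B / 2 ^ N" if z: "z \<in> cball c (3 * r)" for z
    proof (rule maximum_modulus_frontier[of F "cball c (3 * r)"])
      fix z assume "z \<in> frontier (cball c (3 * r))"
      then have z: "z \<in> sphere c (3 * r)" using r by (simp add: frontier_cball)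
      have "norm z \<le> norm c + 3 * r" using z norm_triangle_sub[of z c] by (simp add: dist_norm norm_minus_commute)
      then have "A * (1 + norm z)\<^sup>2 \<le> B" unfolding B_def using A
        by (intro mult_left_mono power_mono) auto
      then have "norm (f z) \<le> exp B" using growth[of z] by (meson exp_le_cancel_iff order_trans)
      moreover have "norm (f z) = norm (F z) * norm (q z)" by (simp add: fF norm_mult)
      ultimately have "norm (F z) * 2 ^ N \<le> exp B"
        using mult_left_mono[OF q2[OF z], of "norm (F z)"] by simp
      then show "norm (F z) \<le> exp B / 2 ^ N" by (simp add: field_simps)
    qed (use z in \<open>auto intro!: holomorphic_on_subset[OF holF] holomorphic_on_imp_continuous_on\<close>)
    have expK2: "norm (f c) \<ge> exp (- K2)"
    proof -
      have "- K2 \<le> ln (norm (f c))" by (simp add: K2_def)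
      then have "exp (- K2) \<le> exp (ln (norm (f c)))" by simp
      then show ?thesis using nz by simp
    qed
    have r2: "r\<^sup>2 \<ge> 1" using r by simp
    have Mb: "B + K2 \<le> (K1 + K2) * r\<^sup>2"
      using B mult_left_mono[OF r2 K(2)] by (simp add: algebra_simps)
    have N: "real N \<le> 2 * ((K1 + K2) * r\<^sup>2)"
    proof -
      have "exp (- K2) * 2 ^ N \<le> exp B"
      proof -
        have "norm (f c) \<le> exp B / 2 ^ N" using Fmax[of c] r Fc by simp
        then have "norm (f c) * 2 ^ N \<le> exp B" by (simp add: field_simps)
        moreover have "exp (- K2) * 2 ^ N \<le> norm (f c) * 2 ^ N" by (intro mult_right_mono expK2) auto
        ultimately show ?thesis by linarith
      qed
      then have "(2::real) ^ N \<le> exp (B + K2)" by (simp add: exp_add exp_minus field_simps)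
      then have "ln ((2::real) ^ N) \<le> ln (exp (B + K2))" by (subst ln_le_cancel_iff) auto
      then have "real N * ln 2 \<le> (K1 + K2) * r\<^sup>2" using Mb by (simp add: ln_realpow)
      moreover have "ln (2::real) \<ge> 1 / 2" using ln2_ge_two_thirds by simp
      ultimately show ?thesis
        using mult_left_mono[of "1 / 2" "ln (2::real)" "real N"] by simp
    qed
    have Zset: "{\<rho>. \<rho> \<in> cball c r \<and> f \<rho> = 0} = Z" by (simp add: Z_def)
    show "(\<Sum>\<rho> | \<rho> \<in> cball c r \<and> f \<rho> = 0. real (nat (zorder f \<rho>))) \<le> 16 * C0 * r\<^sup>2"
    proof -
      have "(\<Sum>\<rho> | \<rho> \<in> cball c r \<and> f \<rho> = 0. real (nat (zorder f \<rho>))) = real N"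
        unfolding Zset by (simp add: N_def m_def)
      also have "\<dots> \<le> 2 * ((K1 + K2) * r\<^sup>2)" by (rule N)
      also have "\<dots> = 2 * (K1 + K2) * r\<^sup>2" by simp
      also have "\<dots> \<le> 16 * C0 * r\<^sup>2" using K by (intro mult_right_mono) (auto simp: C0_def)
      finally show ?thesis .
    qed
    fix z assume z: "z \<in> cball c (r / 4)" and fz: "f z \<noteq> 0"
    \<comment> \<open>\<open>F\<close> has no zeros in the disc and so has a logarithm. The
      logarithmic derivative of f is then the derivative of l plus that of q, and the latter is the
      sum over the zeros.\<close>
    obtain l where l: "l holomorphic_on ball c r" "\<And>x. x \<in> ball c r \<Longrightarrow> exp (l x) = F x"
    proof (rule holomorphic_logarithm_exists[of "ball c r" F c])
      show "F holomorphic_on ball c r" using holF by (rule holomorphic_on_subset) auto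
    qed (use F0 r in auto)
    define h where "h x = l x - l c" for x
    have zb: "z \<in> ball c r" using z r by auto
    have "norm (deriv h z) \<le> 16 * (C0 * r\<^sup>2) / r"
    proof (rule Borel_Caratheodory_deriv[of h c r])
      show "h holomorphic_on ball c r" unfolding h_def using l(1) by (intro holomorphic_intros)
      fix x assume x: "x \<in> ball c r"
      have "exp (h x) = F x / F c" using l(2)[OF x] l(2)[of c] r by (simp add: h_def exp_diff)
      then have "exp (Re (h x)) = norm (F x) / norm (f c)" by (metis norm_exp_eq_Re norm_divide Fc)
      also have "\<dots> \<le> exp B / exp (- K2)"
      proof (rule frac_le)
        show "norm (F x) \<le> exp B"
        proof -
          have "norm (F x) \<le> exp B / 2 ^ N" using Fmax[of x] x r by simp
          also have "\<dots> \<le> exp B / 1" by (intro divide_left_mono) auto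
          finally show ?thesis by simp
        qed
      qed (use expK2 in auto)
      also have "\<dots> = exp (B + K2)" by (simp add: exp_minus exp_add field_simps)
      finally have "Re (h x) \<le> B + K2" by simp
      also have "\<dots> < C0 * r\<^sup>2" using Mb r2 by (simp add: C0_def algebra_simps)
      finally show "Re (h x) < C0 * r\<^sup>2" .
    qed (use r z in \<open>auto simp: h_def\<close>)
    also have "16 * (C0 * r\<^sup>2) / r = 16 * C0 * r" using r by (simp add: power2_eq_square)
    finally have dh: "norm (deriv h z) \<le> 16 * C0 * r" .
    have hd: "(h has_field_derivative deriv h z) (at z)"
      by (rule holomorphic_derivI[of _ "ball c r"]) (use l(1) zb in \<open>auto simp: h_def[abs_def] intro!: holomorphic_intros\<close>)
    have ld: "(l has_field_derivative deriv h z) (at z)"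
    proof -
      have "l = (\<lambda>x. h x + l c)" by (auto simp: h_def)
      then show ?thesis using DERIV_add[OF hd DERIV_const[of "l c"]] by simp
    qed
    have Fd: "(F has_field_derivative F z * deriv h z) (at z)"
    proof (rule has_field_derivative_transform_within_open)
      show "((\<lambda>x. exp (l x)) has_field_derivative F z * deriv h z) (at z)"
        using l(2)[OF zb] by (auto intro!: derivative_eq_intros ld)
      fix x assume x: "x \<in> ball c r"
      show "exp (l x) = F x" using l(2)[OF x] .
    qed (use zb in auto)
    have zZ: "z \<noteq> \<rho>" if "\<rho> \<in> Z" for \<rho> using that fz by (auto simp: Z_def)
    have qd: "(q has_field_derivative q z * (\<Sum>\<rho>\<in>Z. of_nat (m \<rho>) / (z - \<rho>))) (at z)"
    proof -
      have "((\<lambda>x. \<Prod>\<rho>\<in>Z. ((x - \<rho>) / (c - \<rho>)) ^ m \<rho>) has_field_derivative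
        (\<Prod>\<rho>\<in>Z. ((z - \<rho>) / (c - \<rho>)) ^ m \<rho>) *
        (\<Sum>\<rho>\<in>Z. (of_nat (m \<rho>) / (z - \<rho>) * ((z - \<rho>) / (c - \<rho>)) ^ m \<rho>) / ((z - \<rho>) / (c - \<rho>)) ^ m \<rho>)) (at z)"
      proof (rule has_field_derivative_prod')
        fix \<rho> assume \<rho>: "\<rho> \<in> Z"
        show "((z - \<rho>) / (c - \<rho>)) ^ m \<rho> \<noteq> 0" using zZ[OF \<rho>] cZ[OF \<rho>] by simp
        have "((\<lambda>x. ((x - \<rho>) / (c - \<rho>)) ^ m \<rho>) has_field_derivative
           of_nat (m \<rho>) * ((z - \<rho>) / (c - \<rho>)) ^ (m \<rho> - 1) * (1 / (c - \<rho>))) (at z)"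
          using cZ[OF \<rho>] by (auto intro!: derivative_eq_intros)
        also have "of_nat (m \<rho>) * ((z - \<rho>) / (c - \<rho>)) ^ (m \<rho> - 1) * (1 / (c - \<rho>)) =
          of_nat (m \<rho>) / (z - \<rho>) * ((z - \<rho>) / (c - \<rho>)) ^ m \<rho>"
        proof -
          have "of_nat k * (a / b) ^ (k - 1) * (1 / b) = of_nat k / a * (a / b) ^ k"
            if "a \<noteq> 0" "b \<noteq> 0" for a b :: complex and k :: nat
            using that by (cases k) simp_all
          from this[of "z - \<rho>" "c - \<rho>" "m \<rho>"] show ?thesis using zZ[OF \<rho>] cZ[OF \<rho>] by simp
        qed
        finally show "((\<lambda>x. ((x - \<rho>) / (c - \<rho>)) ^ m \<rho>) has_field_derivative
          of_nat (m \<rho>) / (z - \<rho>) * ((z - \<rho>) / (c - \<rho>)) ^ m \<rho>) (at z)" .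
      qed
      also have "(\<Sum>\<rho>\<in>Z. (of_nat (m \<rho>) / (z - \<rho>) * ((z - \<rho>) / (c - \<rho>)) ^ m \<rho>) / ((z - \<rho>) / (c - \<rho>)) ^ m \<rho>)
         = (\<Sum>\<rho>\<in>Z. of_nat (m \<rho>) / (z - \<rho>))"
        using zZ cZ by (intro sum.cong) auto
      finally show ?thesis by (simp add: q_def[abs_def])
    qed
    have "((\<lambda>x. F x * q x) has_field_derivative F z * deriv h z * q z + q z * (\<Sum>\<rho>\<in>Z. of_nat (m \<rho>) / (z - \<rho>)) * F z) (at z)"
      by (rule DERIV_mult[OF Fd qd])
    moreover have "(\<lambda>x. F x * q x) = f" using fF by auto
    ultimately have "deriv f z = F z * deriv h z * q z + q z * (\<Sum>\<rho>\<in>Z. of_nat (m \<rho>) / (z - \<rho>)) * F z"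
      by (simp add: DERIV_imp_deriv)
    also have "\<dots> = f z * (deriv h z + (\<Sum>\<rho>\<in>Z. of_nat (m \<rho>) / (z - \<rho>)))"
      by (simp add: fF algebra_simps)
    finally have "deriv f z / f z - (\<Sum>\<rho>\<in>Z. of_nat (m \<rho>) / (z - \<rho>)) = deriv h z"
      using fz by simp
    then show "norm (deriv f z / f z - (\<Sum>\<rho> | \<rho> \<in> cball c r \<and> f \<rho> = 0. of_nat (nat (zorder f \<rho>)) / (z - \<rho>))) \<le> 16 * C0 * r"
      using dh unfolding Zset by (simp add: m_def)
  qed
qed

text \<open>Pigeonhole: the disc holds k = O(T^2) zeros, and [T, T + 1] is divided into k + 1 slots
  of length \<open>2 * \<delta>\<close>, so the middle of some slot is at distance at least \<delta>
  from every |Im \<rho>|, where 1 / \<delta> = O(T^2). Each partial fraction is then O(T^2), and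
  there are O(T^2) of them with multiplicity; hence T^4. Taking absolute values of the ordinates
  makes T' serve both the upper and the lower edge of a rectangle.\<close>

lemma logderiv_polynomial_heights:
  fixes f :: "complex \<Rightarrow> complex" and A :: real
  assumes hol: "f holomorphic_on UNIV" and nz: "f 2 \<noteq> 0" and A: "A \<ge> 0"
    and growth: "\<And>s. norm (f s) \<le> exp (A * (1 + norm s)\<^sup>2)"
  shows "\<exists>C>0. \<forall>T\<ge>1. \<exists>T'. T \<le> T' \<and> T' \<le> T + 1 \<and>
    (\<forall>s. \<bar>Im s\<bar> = T' \<and> -1 \<le> Re s \<and> Re s \<le> 2 \<longrightarrow> f s \<noteq> 0 \<and> norm (deriv f s / f s) \<le> C * T ^ 4)"
proof -
  from logderiv_partial_fractions[OF hol nz A growth] obtain C where C: "C > 0"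
    and num: "\<And>r. r \<ge> 1 \<Longrightarrow> (\<Sum>\<rho> | \<rho> \<in> cball 2 r \<and> f \<rho> = 0. real (nat (zorder f \<rho>))) \<le> C * r\<^sup>2"
    and pf: "\<And>r z. r \<ge> 1 \<Longrightarrow> z\<in>cball 2 (r / 4) \<Longrightarrow> f z \<noteq> 0 \<Longrightarrow>
      norm (deriv f z / f z - (\<Sum>\<rho> | \<rho> \<in> cball 2 r \<and> f \<rho> = 0. of_nat (nat (zorder f \<rho>)) / (z - \<rho>))) \<le> C * r"
    by blast
  define D where "D = C * 576 * (2 * (C * 576 + 1)) + C * 24"
  show ?thesis
  proof (rule exI[of _ D], intro conjI allI impI)
    show "D > 0" using C by (auto simp: D_def intro!: add_pos_pos mult_pos_pos)
    fix T :: real assume T: "T \<ge> 1"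
    \<comment> \<open>Points with |Im s| <= T + 1 and -1 <= Re s <= 2 lie within T + 4 of the centre
      2, hence in the disc of radius r / 4 where the partial fraction estimate holds.\<close>
    define r where "r = 4 * (T + 5)"
    have r: "r \<ge> 1" "r \<le> 24 * T" using T by (auto simp: r_def)
    define Z where "Z = {\<rho>. \<rho> \<in> cball 2 r \<and> f \<rho> = 0}"
    define m where "m \<rho> = nat (zorder f \<rho>)" for \<rho>
    have fin: "finite Z" using finite_zeros_compact[OF hol nz compact_cball] by (simp add: Z_def)
    have mpos: "m \<rho> \<ge> 1" if "\<rho> \<in> Z" for \<rho>
    proof -
      have "\<exists>w\<in>UNIV. f w \<noteq> 0" using nz by blast
      from zorder_exist_zero[OF hol open_UNIV connected_UNIV UNIV_I this, of \<rho>] that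
      have "zorder f \<rho> > 0" by (auto simp: Z_def)
      then show ?thesis by (simp add: m_def)
    qed
    have N: "(\<Sum>\<rho>\<in>Z. real (m \<rho>)) \<le> C * 576 * T\<^sup>2"
    proof -
      have "(\<Sum>\<rho>\<in>Z. real (m \<rho>)) \<le> C * r\<^sup>2" using num[OF r(1)] by (simp add: Z_def m_def)
      also have "\<dots> \<le> C * (24 * T)\<^sup>2" using r C by (intro mult_left_mono power_mono) auto
      finally show ?thesis by (simp add: power_mult_distrib)
    qed
    define k where "k = card Z"
    have k: "real k \<le> C * 576 * T\<^sup>2"
    proof -
      have "real k = (\<Sum>\<rho>\<in>Z. 1)" by (simp add: k_def)
      also have "\<dots> \<le> (\<Sum>\<rho>\<in>Z. real (m \<rho>))" by (rule sum_mono) (use mpos in force)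
      finally show ?thesis using N by simp
    qed
    define \<delta> where "\<delta> = 1 / (2 * (real k + 1))"
    have \<delta>: "\<delta> > 0" by (simp add: \<delta>_def add_nonneg_pos)
    define t where "t j = T + (2 * real j + 1) * \<delta>" for j :: nat
    have "\<exists>j\<le>k. \<forall>\<rho>\<in>Z. \<bar>\<bar>Im \<rho>\<bar> - t j\<bar> \<ge> \<delta>"
    proof (rule ccontr)
      assume "\<not> ?thesis"
      then have "\<forall>j\<in>{..k}. \<exists>\<rho>\<in>Z. \<bar>\<bar>Im \<rho>\<bar> - t j\<bar> < \<delta>" by (meson atMost_iff not_le)
      then obtain z where z: "\<And>j. j \<le> k \<Longrightarrow> z j \<in> Z \<and> \<bar>\<bar>Im (z j)\<bar> - t j\<bar> < \<delta>"
        by (metis atMost_iff)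
      have "inj_on z {..k}"
      proof (rule inj_onI)
        fix i j assume ij: "i \<in> {..k}" "j \<in> {..k}" "z i = z j"
        have "\<bar>t i - t j\<bar> < 2 * \<delta>" using z[of i] z[of j] ij by auto
        also have "t i - t j = 2 * \<delta> * (real i - real j)" by (simp add: t_def algebra_simps)
        finally have "\<bar>real i - real j\<bar> < 1" using \<delta> by (simp add: abs_mult)
        then show "i = j" by linarith
      qed
      moreover have "z ` {..k} \<subseteq> Z" using z by auto
      ultimately have "card {..k} \<le> card Z" using fin by (metis card_inj_on_le)
      then show False by (simp add: k_def)
    qed
    then obtain j where j: "j \<le> k" "\<And>\<rho>. \<rho> \<in> Z \<Longrightarrow> \<bar>\<bar>Im \<rho>\<bar> - t j\<bar> \<ge> \<delta>" by auto
    have "(2 * real j + 1) * \<delta> \<le> (2 * (real k + 1)) * \<delta>" using j \<delta> by (intro mult_right_mono) auto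
    also have "\<dots> = 1" by (simp add: \<delta>_def)
    finally have tj: "T \<le> t j" "t j \<le> T + 1" using \<delta> by (auto simp: t_def)
    show "\<exists>T'. T \<le> T' \<and> T' \<le> T + 1 \<and>
      (\<forall>s. \<bar>Im s\<bar> = T' \<and> -1 \<le> Re s \<and> Re s \<le> 2 \<longrightarrow> f s \<noteq> 0 \<and> norm (deriv f s / f s) \<le> D * T ^ 4)"
    proof (intro exI[of _ "t j"] conjI allI impI tj)
      fix s assume s: "\<bar>Im s\<bar> = t j \<and> -1 \<le> Re s \<and> Re s \<le> 2"
      have "norm (s - 2) \<le> \<bar>Re (s - 2)\<bar> + \<bar>Im (s - 2)\<bar>" by (rule cmod_le)
      also have "\<dots> \<le> 3 + (T + 1)" using s tj by auto
      also have "\<dots> \<le> r / 4" using T by (simp add: r_def)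
      finally have sb: "s \<in> cball 2 (r / 4)" by (simp add: dist_norm norm_minus_commute)
      have far: "norm (s - \<rho>) \<ge> \<delta>" if "\<rho> \<in> Z" for \<rho>
      proof -
        have "\<delta> \<le> \<bar>\<bar>Im \<rho>\<bar> - \<bar>Im s\<bar>\<bar>" using j(2)[OF that] s by simp
        also have "\<dots> \<le> \<bar>Im (s - \<rho>)\<bar>" by auto
        also have "\<dots> \<le> norm (s - \<rho>)" by (rule abs_Im_le_cmod)
        finally show ?thesis .
      qed
      show fs: "f s \<noteq> 0"
      proof
        assume "f s = 0"
        moreover have "s \<in> cball 2 r" using sb r by auto
        ultimately have "s \<in> Z" by (simp add: Z_def)
        from far[OF this] show False using \<delta> by simp
      qed
      have "norm (\<Sum>\<rho>\<in>Z. of_nat (m \<rho>) / (s - \<rho>)) \<le> (\<Sum>\<rho>\<in>Z. real (m \<rho>) * (1 / \<delta>))"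
      proof (rule sum_norm_le)
        fix \<rho> assume "\<rho> \<in> Z"
        from far[OF this] show "norm (of_nat (m \<rho>) / (s - \<rho>)) \<le> real (m \<rho>) * (1 / \<delta>)"
          using \<delta> by (auto simp: norm_divide intro!: divide_left_mono mult_pos_pos)
      qed
      also have "\<dots> = (\<Sum>\<rho>\<in>Z. real (m \<rho>)) * (2 * (real k + 1))"
        by (simp add: sum_distrib_right \<delta>_def)
      also have "\<dots> \<le> (C * 576 * T\<^sup>2) * (2 * (C * 576 * T\<^sup>2 + T\<^sup>2))"
        using N k one_le_power[OF T, of 2] C by (intro mult_mono) (auto simp: sum_nonneg)
      also have "\<dots> = C * 576 * (2 * (C * 576 + 1)) * T ^ 4"
        by (simp add: algebra_simps power2_eq_square power4_eq_xxxx)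
      finally have S: "norm (\<Sum>\<rho>\<in>Z. of_nat (m \<rho>) / (s - \<rho>)) \<le> C * 576 * (2 * (C * 576 + 1)) * T ^ 4" .
      have "norm (deriv f s / f s) \<le> norm (deriv f s / f s - (\<Sum>\<rho>\<in>Z. of_nat (m \<rho>) / (s - \<rho>))) + norm (\<Sum>\<rho>\<in>Z. of_nat (m \<rho>) / (s - \<rho>))"
        by (metis add.commute add_diff_cancel_left' diff_add_cancel norm_triangle_ineq)
      also have "\<dots> \<le> C * r + C * 576 * (2 * (C * 576 + 1)) * T ^ 4"
        using pf[OF r(1) sb fs] S by (intro add_mono) (auto simp: Z_def m_def)
      also have "C * r \<le> C * 24 * T ^ 4"
      proof -
        have "T \<le> T ^ 4" using T by (rule self_le_power) auto
        then show ?thesis using r C by (simp add: mult.assoc mult_left_mono)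
      qed
      finally show "norm (deriv f s / f s) \<le> D * T ^ 4" by (simp add: D_def algebra_simps)
    qed
  qed
qed


section \<open>The theta function\<close>

text \<open>This is the characteristic function of the standard normal distribution after the
  substitution u = c t with c = sqrt (2 pi x).\<close>

lemma gauss_fourier:
  fixes x y :: real
  assumes x: "x > 0"
  shows "integrable lborel (\<lambda>t. of_real (exp (- (pi * x * t\<^sup>2))) * exp (\<i> * of_real (2 * pi * y * t)) :: complex)"
    and "lebesgue_integral lborel (\<lambda>t. of_real (exp (- (pi * x * t\<^sup>2))) * exp (\<i> * of_real (2 * pi * y * t)) :: complex)
      = of_real (exp (- (pi * y\<^sup>2 / x)) / sqrt x)"
proof -
  define c where "c = sqrt (2 * pi * x)"
  have c: "c > 0" "c\<^sup>2 = 2 * pi * x" using x by (auto simp: c_def)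
  define s where "s = 2 * pi * y / c"
  define f where "f u = of_real (std_normal_density u) * iexp (s * u)" for u :: real
  have f_int: "integrable lborel f"
  proof -
    have "integrable lborel std_normal_density" using integrable_std_normal_moment[of 0] by simp
    then have "integrable lborel (\<lambda>u. complex_of_real (std_normal_density u))" by simp
    then show ?thesis
      by (rule Bochner_Integration.integrable_bound) (auto simp: f_def[abs_def] norm_mult)
  qed
  have f_val: "lebesgue_integral lborel f = of_real (exp (- s\<^sup>2 / 2))"
  proof -
    have "char std_normal_distribution s = of_real (exp (- s\<^sup>2 / 2))"
      by (simp add: char_std_normal_distribution)
    also have "char std_normal_distribution s = (\<integral>u. std_normal_density u *\<^sub>R iexp (s * u) \<partial>lborel)"
      unfolding char_def by (subst integral_density) (auto simp: normal_density_nonneg)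
    finally show ?thesis by (simp add: f_def[abs_def] scaleR_conv_of_real)
  qed
  have eq: "of_real (exp (- (pi * x * t\<^sup>2))) * exp (\<i> * of_real (2 * pi * y * t)) = of_real (sqrt (2 * pi)) * f (0 + c * t)" for t
  proof -
    have "(c * t)\<^sup>2 / 2 = pi * x * t\<^sup>2" using c by (simp add: power_mult_distrib)
    moreover have *: "s * (c * t) = 2 * pi * y * t" using c by (simp add: s_def)
    ultimately have "f (0 + c * t) = of_real (1 / sqrt (2 * pi) * exp (- (pi * x * t\<^sup>2))) * iexp (2 * pi * y * t)"
      unfolding f_def add_0_left * std_normal_density_def by simp
    then show ?thesis by simp
  qed
  show "integrable lborel (\<lambda>t. of_real (exp (- (pi * x * t\<^sup>2))) * exp (\<i> * of_real (2 * pi * y * t)) :: complex)"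
    unfolding eq using lborel_integrable_real_affine[OF f_int, of c 0] c by (intro integrable_mult_right) auto
  have "lebesgue_integral lborel f = c *\<^sub>R (\<integral>t. f (0 + c * t) \<partial>lborel)"
    using lborel_integral_real_affine[of c f 0] c by simp
  then have "(\<integral>t. f (0 + c * t) \<partial>lborel) = of_real (exp (- s\<^sup>2 / 2) / c)"
    unfolding f_val using c by (simp add: scaleR_conv_of_real field_simps)
  moreover have "sqrt (2 * pi) * (exp (- s\<^sup>2 / 2) / c) = exp (- (pi * y\<^sup>2 / x)) / sqrt x"
  proof -
    have "s\<^sup>2 / 2 = pi * y\<^sup>2 / x"
      using x c by (simp add: s_def power_divide power_mult_distrib) (simp add: power2_eq_square)
    moreover have "c = sqrt (2 * pi) * sqrt x" by (simp add: c_def real_sqrt_mult)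
    ultimately show ?thesis by simp
  qed
  ultimately have "of_real (sqrt (2 * pi)) * (\<integral>t. f (0 + c * t) \<partial>lborel) = of_real (exp (- (pi * y\<^sup>2 / x)) / sqrt x)"
    by (simp only: of_real_mult[symmetric])
  then show "lebesgue_integral lborel (\<lambda>t. of_real (exp (- (pi * x * t\<^sup>2))) * exp (\<i> * of_real (2 * pi * y * t)) :: complex)
      = of_real (exp (- (pi * y\<^sup>2 / x)) / sqrt x)"
    unfolding eq by simp
qed

text \<open>\<open>1 + 2 * omega x\<close> is Jacobi's theta function, the sum of exp(- pi n^2 x)
  over all integers n.\<close>

definition omega :: "real \<Rightarrow> real" where
  "omega x = (\<Sum>n. exp (- (pi * (real (Suc n))\<^sup>2 * x)))"

lemma omega_term_le:
  assumes "x > 0"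
  shows "exp (- (pi * (real (Suc n))\<^sup>2 * x)) \<le> exp (- (pi * x)) ^ Suc n"
proof -
  have "real (Suc n) \<le> (real (Suc n))\<^sup>2" by (rule self_le_power) auto
  then have "pi * x * real (Suc n) \<le> pi * x * (real (Suc n))\<^sup>2" using assms by (intro mult_left_mono) auto
  then have "exp (- (pi * (real (Suc n))\<^sup>2 * x)) \<le> exp (real (Suc n) * (- (pi * x)))"
    by (simp add: mult_ac del: of_nat_Suc)
  also have "\<dots> = exp (- (pi * x)) ^ Suc n" by (rule exp_of_nat_mult)
  finally show ?thesis .
qed

lemma omega_sums:
  assumes "x > 0"
  shows "(\<lambda>n. exp (- (pi * (real (Suc n))\<^sup>2 * x))) sums omega x"
proof -
  have "summable (\<lambda>n. exp (- (pi * x)) ^ Suc n)"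
    using assms by (subst summable_Suc_iff) (auto intro!: summable_geometric)
  then have "summable (\<lambda>n. exp (- (pi * (real (Suc n))\<^sup>2 * x)))"
    by (rule summable_comparison_test'[of _ 0]) (use omega_term_le[OF assms] in auto)
  then show ?thesis unfolding omega_def by (rule summable_sums)
qed

text \<open>A residue argument in place of Poisson summation. The function \<open>f\<close> has
  simple poles at the points i k with residues exp(- pi k^2 x) / (2 pi), which add up to the
  left-hand side. On the lines Re w = 1 and Re w = -1 the factor 1 / (exp(2 pi w) - 1) expands into
  geometric series in exp(- 2 pi w) and exp(2 pi w), and each term is a Gaussian integral that
  yields one term of the right-hand side.\<close>

lemma theta_transform:
  assumes x: "x > 0"
  shows "1 + 2 * omega x = (1 + 2 * omega (1 / x)) / sqrt x"
proof -
  define f :: "complex \<Rightarrow> complex" where "f w = exp (of_real (pi * x) * w\<^sup>2) / (exp (of_real (2 * pi) * w) - 1)" for w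
  \<comment> \<open>At half-integer heights exp(2 pi w) is a negative real number, so the
    denominator has modulus at least 1 on the horizontal edges.\<close>
  define T where "T n = real n + 1 / 2" for n
  define pts where "pts n = (\<lambda>k. \<i> * of_int k) ` {- int n..int n}" for n
  have pole: "exp (of_real (2 * pi) * w) = 1 \<longleftrightarrow> Re w = 0 \<and> (\<exists>k::int. Im w = of_int k)" for w :: complex
    by (auto simp: exp_eq_1)
  have g: "\<exists>F. integrable lborel F \<and> lebesgue_integral lborel F = of_real (exp (- (pi * (real m)\<^sup>2 / x)) / sqrt x) \<and>
       (\<forall>t. F t = exp (of_real (pi * x) * (Complex \<sigma> t)\<^sup>2) * exp (- of_real (2 * pi * \<sigma>) * Complex \<sigma> t) ^ m)
       \<and> lebesgue_integral lborel (\<lambda>t. norm (F t)) = exp (pi * x - 2 * pi * real m) / sqrt x"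
    if \<sigma>: "\<sigma> = 1 \<or> \<sigma> = -1" for m :: nat and \<sigma> :: real
  proof -
    \<comment> \<open>Completing the square: with this y the term on the line Re w = \<sigma> is a
      constant times the integrand of \<open>gauss_fourier\<close>, and the constants combine to
      exp(- pi m^2 / x) / sqrt x.\<close>
    define y where "y = \<sigma> * (x - real m)"
    have y2: "y\<^sup>2 = (x - real m)\<^sup>2" using \<sigma> by (auto simp: y_def power2_eq_square algebra_simps)
    define G where "G t = of_real (exp (- (pi * x * t\<^sup>2))) * exp (\<i> * of_real (2 * pi * y * t))" for t :: real
    define F where "F t = of_real (exp (pi * x - 2 * pi * real m)) * G t" for t :: real
    have "integrable lborel F" unfolding F_def G_def by (intro integrable_mult_right gauss_fourier x)
    moreover have "lebesgue_integral lborel F = of_real (exp (pi * x - 2 * pi * real m)) * of_real (exp (- (pi * y\<^sup>2 / x)) / sqrt x)"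
      unfolding F_def G_def by (subst integral_mult_right_zero) (subst gauss_fourier[OF x], rule refl)
    moreover have "exp (pi * x - 2 * pi * real m) * (exp (- (pi * y\<^sup>2 / x)) / sqrt x) = exp (- (pi * (real m)\<^sup>2 / x)) / sqrt x"
    proof -
      have "pi * x - 2 * pi * real m + - (pi * y\<^sup>2 / x) = - (pi * (real m)\<^sup>2 / x)"
        using x by (subst y2) (simp add: field_simps power2_eq_square)
      then have "exp (pi * x - 2 * pi * real m) * exp (- (pi * y\<^sup>2 / x)) = exp (- (pi * (real m)\<^sup>2 / x))"
        by (metis exp_add)
      then show ?thesis by simp
    qed
    moreover have "F t = exp (of_real (pi * x) * (Complex \<sigma> t)\<^sup>2) * exp (- of_real (2 * pi * \<sigma>) * Complex \<sigma> t) ^ m" for t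
    proof -
      have "of_real (pi * x) * (Complex \<sigma> t)\<^sup>2 + of_nat m * (- of_real (2 * pi * \<sigma>) * Complex \<sigma> t) =
        of_real (pi * x - 2 * pi * real m) + (of_real (- (pi * x * t\<^sup>2)) + \<i> * of_real (2 * pi * y * t))"
        using \<sigma> by (auto simp: complex_eq_iff y_def power2_eq_square algebra_simps)
      then have "exp (of_real (pi * x) * (Complex \<sigma> t)\<^sup>2) * exp (of_nat m * (- of_real (2 * pi * \<sigma>) * Complex \<sigma> t)) =
        exp (of_real (pi * x - 2 * pi * real m)) * (exp (of_real (- (pi * x * t\<^sup>2))) * exp (\<i> * of_real (2 * pi * y * t)))"
        by (metis exp_add)
      then show ?thesis by (simp only: F_def G_def exp_of_nat_mult exp_of_real)
    qed
    moreover have "lebesgue_integral lborel (\<lambda>t. norm (F t)) = exp (pi * x - 2 * pi * real m) / sqrt x"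
    proof -
      have "norm (F t) = exp (pi * x - 2 * pi * real m) * exp (- (pi * x * t\<^sup>2))" for t
        by (simp add: F_def G_def norm_mult)
      moreover have "(\<integral>t. exp (- (pi * x * t\<^sup>2)) \<partial>lborel) = 1 / sqrt x"
      proof -
        have "complex_of_real (\<integral>t. exp (- (pi * x * t\<^sup>2)) \<partial>lborel) = (\<integral>t. of_real (exp (- (pi * x * t\<^sup>2))) \<partial>lborel)"
          by (rule integral_complex_of_real[symmetric])
        also have "\<dots> = of_real (1 / sqrt x)" using gauss_fourier(2)[OF x, of 0] by simp
        finally show ?thesis using of_real_eq_iff by blast
      qed
      ultimately show ?thesis by simp
    qed
    ultimately show ?thesis by (intro exI[of _ F]) (simp flip: of_real_mult)
  qed
  \<comment> \<open>The offset d is the first exponent of the geometric series: 1 on the right, from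
    1 / (q - 1) with |q| > 1, and 0 on the left, where |q| < 1. The integrals of the norms form a
    geometric series too, which permits termwise integration.\<close>
  have line: "integrable lborel (\<lambda>t. exp (of_real (pi * x) * (Complex \<sigma> t)\<^sup>2) * (\<Sum>m. exp (- of_real (2 * pi * \<sigma>) * Complex \<sigma> t) ^ (m + d)))"
    "(\<lambda>m. of_real (exp (- (pi * (real (m + d))\<^sup>2 / x)) / sqrt x)) sums
      lebesgue_integral lborel (\<lambda>t. exp (of_real (pi * x) * (Complex \<sigma> t)\<^sup>2) * (\<Sum>m. exp (- of_real (2 * pi * \<sigma>) * Complex \<sigma> t) ^ (m + d)))"
    if \<sigma>: "\<sigma> = 1 \<or> \<sigma> = -1" for d :: nat and \<sigma> :: real
  proof -
    have "\<forall>m. \<exists>F. integrable lborel F \<and> lebesgue_integral lborel F = of_real (exp (- (pi * (real m)\<^sup>2 / x)) / sqrt x) \<and>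
       (\<forall>t. F t = exp (of_real (pi * x) * (Complex \<sigma> t)\<^sup>2) * exp (- of_real (2 * pi * \<sigma>) * Complex \<sigma> t) ^ m)
       \<and> lebesgue_integral lborel (\<lambda>t. norm (F t)) = exp (pi * x - 2 * pi * real m) / sqrt x"
      using g[OF \<sigma>] by blast
    then obtain F where F: "\<And>m. integrable lborel (F m)"
      "\<And>m. lebesgue_integral lborel (F m) = of_real (exp (- (pi * (real m)\<^sup>2 / x)) / sqrt x)"
      "\<And>m t. F m t = exp (of_real (pi * x) * (Complex \<sigma> t)\<^sup>2) * exp (- of_real (2 * pi * \<sigma>) * Complex \<sigma> t) ^ m"
      "\<And>m. lebesgue_integral lborel (\<lambda>t. norm (F m t)) = exp (pi * x - 2 * pi * real m) / sqrt x"
      by metis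
    have nq: "norm (exp (- of_real (2 * pi * \<sigma>) * Complex \<sigma> t)) = exp (- 2 * pi)" for t
      using \<sigma> by auto
    have sm: "summable (\<lambda>m. norm (exp (- of_real (2 * pi * \<sigma>) * Complex \<sigma> t) ^ (m + d)))" for t
      unfolding norm_power nq by (subst summable_iff_shift) (auto intro!: summable_geometric)
    have 1: "AE t in lborel. summable (\<lambda>m. norm (F (m + d) t))"
    proof (rule AE_I2)
      fix t :: real
      show "summable (\<lambda>m. norm (F (m + d) t))" unfolding F(3) norm_mult
        by (intro summable_mult sm)
    qed
    have 2: "summable (\<lambda>m. lebesgue_integral lborel (\<lambda>t. norm (F (m + d) t)))"
    proof -
      have "summable (\<lambda>m. exp (pi * x) / sqrt x * exp (- 2 * pi) ^ (m + d))"
        by (intro summable_mult, subst summable_iff_shift) (auto intro!: summable_geometric)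
      also have "(\<lambda>m. exp (pi * x) / sqrt x * exp (- 2 * pi) ^ (m + d)) = (\<lambda>m. lebesgue_integral lborel (\<lambda>t. norm (F (m + d) t)))"
        unfolding F(4) by (rule ext) (simp add: exp_of_nat_mult[symmetric] exp_diff exp_minus field_simps del: of_nat_add)
      finally show ?thesis .
    qed
    have S: "(\<Sum>m. F (m + d) t) = exp (of_real (pi * x) * (Complex \<sigma> t)\<^sup>2) * (\<Sum>m. exp (- of_real (2 * pi * \<sigma>) * Complex \<sigma> t) ^ (m + d))" for t
      unfolding F(3) by (rule suminf_mult) (rule summable_norm_cancel[OF sm])
    show "integrable lborel (\<lambda>t. exp (of_real (pi * x) * (Complex \<sigma> t)\<^sup>2) * (\<Sum>m. exp (- of_real (2 * pi * \<sigma>) * Complex \<sigma> t) ^ (m + d)))"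
      using integrable_suminf[OF F(1) 1 2] unfolding S .
    show "(\<lambda>m. of_real (exp (- (pi * (real (m + d))\<^sup>2 / x)) / sqrt x)) sums
      lebesgue_integral lborel (\<lambda>t. exp (of_real (pi * x) * (Complex \<sigma> t)\<^sup>2) * (\<Sum>m. exp (- of_real (2 * pi * \<sigma>) * Complex \<sigma> t) ^ (m + d)))"
      using sums_integral[OF F(1) 1 2] unfolding S F(2) .
  qed
  have fr: "exp (of_real (pi * x) * (Complex 1 t)\<^sup>2) * (\<Sum>m. exp (- of_real (2 * pi * 1) * Complex 1 t) ^ (m + 1)) = f (Complex 1 t)" for t
  proof -
    define q where "q = exp (of_real (2 * pi) * Complex 1 t)"
    have q: "norm q > 1" "q \<noteq> 0" by (auto simp: q_def)
    then have "norm (inverse q) < 1" by (simp add: norm_inverse inverse_less_1_iff)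
    from geometric_sums[OF this] have "(\<lambda>m. inverse q * inverse q ^ m) sums (inverse q * (1 / (1 - inverse q)))" by (rule sums_mult)
    moreover have "inverse q * (1 / (1 - inverse q)) = 1 / (q - 1)" using q by (auto simp: field_simps)
    ultimately have "(\<Sum>m. inverse q ^ (m + 1)) = 1 / (q - 1)" by (simp add: sums_iff)
    moreover have "exp (- of_real (2 * pi * 1) * Complex 1 t) = inverse q" by (simp add: q_def exp_minus)
    ultimately show ?thesis by (simp add: f_def q_def)
  qed
  have fl: "exp (of_real (pi * x) * (Complex (-1) t)\<^sup>2) * (\<Sum>m. exp (- of_real (2 * pi * (-1)) * Complex (-1) t) ^ (m + 0)) = - f (Complex (-1) t)" for t
  proof -
    define q where "q = exp (of_real (2 * pi) * Complex (-1) t)"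
    have q: "norm q < 1" by (auto simp: q_def)
    then have "(\<Sum>m. q ^ m) = 1 / (1 - q)" by (rule suminf_geometric)
    moreover have "1 / (1 - q) = - (1 / (q - 1))" by (metis minus_diff_eq minus_divide_right)
    ultimately have "(\<Sum>m. q ^ m) = - (1 / (q - 1))" by simp
    moreover have "exp (- of_real (2 * pi * (-1)) * Complex (-1) t) = q" by (simp add: q_def)
    ultimately show ?thesis by (simp add: f_def q_def)
  qed
  have intr: "integrable lborel (\<lambda>t. f (Complex 1 t))" using line(1)[of 1 1] unfolding fr by simp
  have intl: "integrable lborel (\<lambda>t. f (Complex (-1) t))"
    using line(1)[of "-1" 0] unfolding fl by simp
  have xi: "1 / x > 0" using x by simp
  have Ir: "lebesgue_integral lborel (\<lambda>t. f (Complex 1 t)) = of_real (omega (1 / x) / sqrt x)"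
  proof -
    have "(\<lambda>m. of_real (exp (- (pi * (real (m + 1))\<^sup>2 / x)) / sqrt x) :: complex) sums of_real (omega (1 / x) / sqrt x)"
      using sums_divide[OF omega_sums[OF xi], of "sqrt x"] by (subst sums_of_real_iff) (simp add: field_simps)
    moreover have "(\<lambda>m. of_real (exp (- (pi * (real (m + 1))\<^sup>2 / x)) / sqrt x)) sums lebesgue_integral lborel (\<lambda>t. f (Complex 1 t))"
      using line(2)[of 1 1] unfolding fr by simp
    ultimately show ?thesis by (metis sums_unique2)
  qed
  have Il: "lebesgue_integral lborel (\<lambda>t. f (Complex (-1) t)) = - of_real ((1 + omega (1 / x)) / sqrt x)"
  proof -
    have "(\<lambda>m. exp (- (pi * (real m)\<^sup>2 / x)) / sqrt x) sums ((omega (1 / x)) / sqrt x + exp (- (pi * (real 0)\<^sup>2 / x)) / sqrt x)"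
      by (subst sums_Suc_iff[symmetric]) (use sums_divide[OF omega_sums[OF xi], of "sqrt x"] in simp)
    then have "(\<lambda>m. of_real (exp (- (pi * (real (m + 0))\<^sup>2 / x)) / sqrt x) :: complex) sums of_real ((1 + omega (1 / x)) / sqrt x)"
      by (subst sums_of_real_iff) (simp add: add_divide_distrib add.commute)
    moreover have "(\<lambda>m. of_real (exp (- (pi * (real (m + 0))\<^sup>2 / x)) / sqrt x)) sums - lebesgue_integral lborel (\<lambda>t. f (Complex (-1) t))"
      using line(2)[of "-1" 0] unfolding fl by simp
    ultimately have "- lebesgue_integral lborel (\<lambda>t. f (Complex (-1) t)) = of_real ((1 + omega (1 / x)) / sqrt x)"
      by (metis sums_unique2)
    then show ?thesis by (metis add.inverse_inverse)
  qed
  have Tlim: "filterlim T at_top sequentially" unfolding T_def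
    by (rule filterlim_tendsto_add_at_top[OF _ filterlim_real_sequentially, of "\<lambda>_. 1/2", simplified add.commute]) auto
  have Tpos: "T n > 0" for n by (simp add: T_def)
  have denom: "exp (of_real (2 * pi) * w) \<noteq> 1" if "\<bar>Im w\<bar> = T n \<or> \<bar>Re w\<bar> = 1" for w n
  proof
    assume "exp (of_real (2 * pi) * w) = 1"
    then obtain k :: int where k: "Re w = 0" "Im w = of_int k" using pole by auto
    then have "\<bar>of_int k\<bar> = T n" using that by auto
    then have "of_int (2 * \<bar>k\<bar>) = (of_int (2 * int n + 1) :: real)" by (simp add: T_def)
    then have "2 * \<bar>k\<bar> = 2 * int n + 1" by (simp only: of_int_eq_iff)
    then show False by presburger
  qed
  have img: "path_image (rectpath (Complex (-1) (- T n)) (Complex 1 (T n))) \<subseteq> {w. \<bar>Im w\<bar> = T n \<or> \<bar>Re w\<bar> = 1}" for n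
    using Tpos[of n] by (auto simp: path_image_rectpath)
  have lim: "(\<lambda>n. contour_integral (rectpath (Complex (-1) (- T n)) (Complex 1 (T n))) f)
     \<longlonglongrightarrow> \<i> * (lebesgue_integral lborel (\<lambda>t. f (Complex 1 t)) - lebesgue_integral lborel (\<lambda>t. f (Complex (-1) t)))"
  proof (rule rectpath_strip_limit[OF _ Tlim Tpos _ _ _ intl intr, where M = "\<lambda>n. exp (pi * x) * exp (- (pi * x)) ^ n"])
    show "continuous_on (path_image (rectpath (Complex (- 1) (- T n)) (Complex 1 (T n)))) f" for n
      unfolding f_def by (intro continuous_intros) (use img[of n] denom[of _ n] in auto)
    show "(\<lambda>n. exp (pi * x) * exp (- (pi * x)) ^ n) \<longlonglongrightarrow> 0"
      by (rule tendsto_mult_right_zero) (use x in \<open>auto intro!: LIMSEQ_realpow_zero\<close>)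
    fix n u v assume uv: "-1 \<le> u" "u \<le> (1::real)" "\<bar>v\<bar> = T n"
    have c: "cos (2 * pi * v) = -1" "sin (2 * pi * v) = 0"
    proof -
      have "2 * pi * \<bar>v\<bar> = pi + 2 * real n * pi" by (simp add: uv(3) T_def algebra_simps)
      then have "cos (2 * pi * \<bar>v\<bar>) = -1" "sin (2 * pi * \<bar>v\<bar>) = 0"
        using cos_npi[of "2 * n"] sin_npi[of "2*n"] by (simp_all add: cos_add sin_add)
      then show "cos (2 * pi * v) = -1" "sin (2 * pi * v) = 0"
        by (auto simp: abs_if split: if_splits)
    qed
    have e: "exp (of_real (2 * pi) * Complex u v) = - of_real (exp (2 * pi * u))"
      using c by (simp add: complex_eq_iff Re_exp Im_exp)
    have "norm (exp (of_real (2 * pi) * Complex u v) - 1) = exp (2 * pi * u) + 1"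
    proof -
      have "exp (of_real (2 * pi) * Complex u v) - 1 = - of_real (exp (2 * pi * u) + 1)" using e by simp
      then show ?thesis by (simp only: norm_minus_cancel norm_of_real) simp
    qed
    then have d: "norm (exp (of_real (2 * pi) * Complex u v) - 1) \<ge> 1" by simp
    have "norm (exp (of_real (pi * x) * (Complex u v)\<^sup>2)) = exp (pi * x * (u\<^sup>2 - v\<^sup>2))"
      by (simp add: power2_eq_square algebra_simps)
    also have "\<dots> \<le> exp (pi * x * (1 - real n))"
    proof -
      have "u\<^sup>2 \<le> 1" using uv by (simp add: abs_square_le_1 abs_le_iff)
      moreover have "v\<^sup>2 \<ge> real n"
      proof -
        have "v\<^sup>2 = (T n)\<^sup>2" using uv(3) by (metis power2_abs)
        also have "\<dots> = (real n)\<^sup>2 + real n + 1 / 4" by (simp add: T_def power2_eq_square algebra_simps)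
        finally show ?thesis by simp
      qed
      ultimately show ?thesis using x by simp
    qed
    also have "\<dots> = exp (pi * x) * exp (- (pi * x)) ^ n"
      by (simp add: exp_of_nat_mult[symmetric] exp_diff exp_minus field_simps)
    finally have n: "norm (exp (of_real (pi * x) * (Complex u v)\<^sup>2)) \<le> exp (pi * x) * exp (- (pi * x)) ^ n" .
    have "norm (f (Complex u v)) \<le> (exp (pi * x) * exp (- (pi * x)) ^ n) / 1"
      unfolding f_def norm_divide using n d by (intro frac_le) auto
    then show "norm (f (Complex u v)) \<le> exp (pi * x) * exp (- (pi * x)) ^ n" by simp
  qed auto
  have res: "contour_integral (rectpath (Complex (-1) (- T n)) (Complex 1 (T n))) f =
     \<i> * of_real (1 + 2 * (\<Sum>k<n. exp (- (pi * (real (Suc k))\<^sup>2 * x))))" for n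
  proof -
    define S where "S = box (Complex (-2) (- real n - 1)) (Complex 2 (real n + 1))"
    have ne: "exp (of_real (2 * pi) * w) \<noteq> 1" if "w \<in> S - pts n" for w
    proof
      assume "exp (of_real (2 * pi) * w) = 1"
      then obtain k :: int where k: "Re w = 0" "Im w = of_int k" using pole by auto
      have "\<bar>Im w\<bar> < real n + 1" using that by (auto simp: S_def in_box_complex_iff)
      then have "\<bar>k\<bar> \<le> int n" using k by linarith
      then have "w \<in> pts n" using k by (auto simp: pts_def complex_eq_iff intro!: image_eqI[of _ _ k])
      then show False using that by simp
    qed
    have "contour_integral (rectpath (Complex (-1) (- T n)) (Complex 1 (T n))) f =
       2 * pi * \<i> * (\<Sum>p\<in>pts n. winding_number (rectpath (Complex (-1) (- T n)) (Complex 1 (T n))) p * residue f p)"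
    proof (rule Residue_theorem)
      show "open S" "connected S" by (auto simp: S_def intro: convex_connected)
      show "f holomorphic_on S - pts n" unfolding f_def using ne by (intro holomorphic_intros) auto
      have "path_image (rectpath (Complex (-1) (- T n)) (Complex 1 (T n))) \<subseteq> cbox (Complex (-1) (- T n)) (Complex 1 (T n))"
        by (rule path_image_rectpath_subset_cbox) (use Tpos[of n] in auto)
      also have sub: "\<dots> \<subseteq> S" by (auto simp: S_def T_def in_box_complex_iff in_cbox_complex_iff)
      finally have "path_image (rectpath (Complex (-1) (- T n)) (Complex 1 (T n))) \<subseteq> S" .
      moreover have "w \<notin> pts n" if "w \<in> path_image (rectpath (Complex (-1) (- T n)) (Complex 1 (T n)))" for w
      proof
        assume "w \<in> pts n"
        then have "exp (of_real (2 * pi) * w) = 1" by (subst pole) (auto simp: pts_def)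
        moreover have "\<bar>Im w\<bar> = T n \<or> \<bar>Re w\<bar> = 1" using img[of n] that by auto
        ultimately show False using denom by blast
      qed
      ultimately show "path_image (rectpath (Complex (-1) (- T n)) (Complex 1 (T n))) \<subseteq> S - pts n" by blast
      show "\<forall>z. z \<notin> S \<longrightarrow> winding_number (rectpath (Complex (-1) (- T n)) (Complex 1 (T n))) z = 0"
        using sub Tpos[of n] by (auto intro!: winding_number_rectpath_outside)
    qed (auto simp: pts_def)
    also have "(\<Sum>p\<in>pts n. winding_number (rectpath (Complex (-1) (- T n)) (Complex 1 (T n))) p * residue f p) =
      (\<Sum>k\<in>{- int n..int n}. of_real (exp (- (pi * (of_int k)\<^sup>2 * x)) / (2 * pi)))"
      unfolding pts_def
    proof (subst sum.reindex)
      show "inj_on (\<lambda>k. \<i> * of_int k) {- int n..int n}" by (auto simp: inj_on_def)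
      show "sum ((\<lambda>p. winding_number (rectpath (Complex (-1) (- T n)) (Complex 1 (T n))) p * residue f p) \<circ> (\<lambda>k. \<i> * of_int k)) {- int n..int n} =
        (\<Sum>k\<in>{- int n..int n}. of_real (exp (- (pi * (of_int k)\<^sup>2 * x)) / (2 * pi)))"
      proof (rule sum.cong)
        fix k assume k: "k \<in> {- int n..int n}"
        have "winding_number (rectpath (Complex (-1) (- T n)) (Complex 1 (T n))) (\<i> * of_int k) = 1"
        proof (rule winding_number_rectpath)
          have "\<bar>real_of_int k\<bar> < T n" using k by (auto simp: T_def abs_if)
          then show "\<i> * of_int k \<in> box (Complex (-1) (- T n)) (Complex 1 (T n))"
            by (auto simp: in_box_complex_iff abs_less_iff)
        qed
        moreover have "residue f (\<i> * of_int k) = of_real (exp (- (pi * (of_int k)\<^sup>2 * x)) / (2 * pi))"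
        proof -
          have one: "exp (of_real (2 * pi) * (\<i> * of_int k)) = 1" by (subst pole) auto
          have "residue f (\<i> * of_int k) = exp (of_real (pi * x) * (\<i> * of_int k)\<^sup>2) / (of_real (2 * pi))"
            unfolding f_def
          proof (rule residue_simple_pole_deriv[where s = UNIV])
            show "((\<lambda>w. exp (of_real (2 * pi) * w) - 1) has_field_derivative of_real (2 * pi)) (at (\<i> * of_int k))"
              using one by (auto intro!: derivative_eq_intros)
          qed (use one in \<open>auto intro!: holomorphic_intros\<close>)
          also have "of_real (pi * x) * (\<i> * of_int k)\<^sup>2 = of_real (- (pi * (of_int k)\<^sup>2 * x))"
            by (simp add: power_mult_distrib)
          finally show ?thesis by (simp only: exp_of_real of_real_divide)
        qed
        ultimately show "((\<lambda>p. winding_number (rectpath (Complex (-1) (- T n)) (Complex 1 (T n))) p * residue f p) \<circ> (\<lambda>k. \<i> * of_int k)) k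
          = of_real (exp (- (pi * (of_int k)\<^sup>2 * x)) / (2 * pi))" by simp
      qed simp
    qed
    also have "\<dots> = of_real ((\<Sum>k\<in>{- int n..int n}. exp (- (pi * (of_int k)\<^sup>2 * x))) / (2 * pi))"
      by (simp add: sum_divide_distrib)
    also have "(\<Sum>k\<in>{- int n..int n}. exp (- (pi * (of_int k)\<^sup>2 * x))) = 1 + 2 * (\<Sum>k<n. exp (- (pi * (real (Suc k))\<^sup>2 * x)))"
    proof (induction n)
      case (Suc n)
      have "{- int (Suc n)..int (Suc n)} = insert (int (Suc n)) (insert (- int (Suc n)) {- int n..int n})" by auto
      moreover have "(- 1 - real n)\<^sup>2 = (1 + real n)\<^sup>2" by (simp add: power2_eq_square algebra_simps)
      ultimately show ?case using Suc.IH by simp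
    qed simp
    finally show ?thesis by simp
  qed
  have "(\<lambda>n. \<i> * of_real (1 + 2 * (\<Sum>k<n. exp (- (pi * (real (Suc k))\<^sup>2 * x))))) \<longlonglongrightarrow> \<i> * of_real (1 + 2 * omega x)"
    by (intro tendsto_intros) (use omega_sums[OF x] in \<open>simp add: sums_def\<close>)
  from LIMSEQ_unique[OF this lim[unfolded res]]
  have "of_real (1 + 2 * omega x) = complex_of_real (omega (1 / x) / sqrt x + (1 + omega (1 / x)) / sqrt x)"
    unfolding Ir Il by simp
  then have "1 + 2 * omega x = omega (1 / x) / sqrt x + (1 + omega (1 / x)) / sqrt x" by (simp only: of_real_eq_iff)
  then show ?thesis by (simp add: add_divide_distrib)
qed


section \<open>Dirichlet series to the right of 1\<close>

text \<open>The term (n + 1)^(-s), indexed from 0 like the series in \<open>zeta\<close>. The real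
  logarithm makes it visibly entire in s.\<close>

definition npow :: "nat \<Rightarrow> complex \<Rightarrow> complex" where
  "npow n s = exp (- (s * of_real (ln (real (Suc n)))))"

lemma norm_npow: "norm (npow n s) = real (Suc n) powr (- Re s)"
  by (simp add: npow_def powr_def)

lemma npow_conv_powr: "npow n s = 1 / of_nat (Suc n) powr s"
proof -
  have "Ln (of_nat (Suc n)) = of_real (ln (real (Suc n)))"
    by (metis Ln_of_real of_nat_0_less_iff of_real_of_nat_eq zero_less_Suc)
  moreover have "(of_nat (Suc n) :: complex) \<noteq> 0" by (simp del: of_nat_Suc)
  ultimately show ?thesis by (simp add: npow_def powr_def exp_minus inverse_eq_divide del: of_nat_Suc)
qed

lemma npow_powr_mono: "Re s \<ge> \<sigma> \<Longrightarrow> norm (npow n s) \<le> real (Suc n) powr (- \<sigma>)"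
  unfolding norm_npow by (rule powr_mono) auto

text \<open>On the ball of radius d = (Re s - 1) / 2 about s the real part stays above 1 + d, so the
  assumed absolute convergence at the single point 1 + d is a uniform majorant near s; termwise
  differentiation follows.\<close>

lemma dirichlet_series:
  fixes a :: "nat \<Rightarrow> complex"
  assumes sm: "\<And>\<sigma>. \<sigma> > 1 \<Longrightarrow> summable (\<lambda>n. norm (a n) * real (Suc n) powr (- \<sigma>))"
  shows "Re s > 1 \<Longrightarrow> summable (\<lambda>n. norm (a n * npow n s))"
    and "Re s > 1 \<Longrightarrow> ((\<lambda>s. \<Sum>n. a n * npow n s) has_field_derivative (\<Sum>n. - (of_real (ln (real (Suc n))) * a n) * npow n s)) (at s)"
    and "Re s > 1 \<Longrightarrow> (\<lambda>n. - (of_real (ln (real (Suc n))) * a n) * npow n s) sums deriv (\<lambda>s. \<Sum>n. a n * npow n s) s"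
    and "(\<lambda>s. \<Sum>n. a n * npow n s) holomorphic_on {s. Re s > 1}"
proof -
  show sn: "summable (\<lambda>n. norm (a n * npow n s))" if "Re s > 1" for s
    using sm[OF that] by (simp add: norm_mult norm_npow)
  have op: "open {s. Re s > 1}" by (rule open_halfspace_Re_gt)
  have "\<exists>g g'. \<forall>s \<in> {s. Re s > 1}. ((\<lambda>n. a n * npow n s) sums g s) \<and>
    ((\<lambda>n. - (of_real (ln (real (Suc n))) * a n) * npow n s) sums g' s) \<and> (g has_field_derivative g' s) (at s)"
  proof (rule series_and_derivative_comparison_local[OF op])
    have dd: "((\<lambda>s. a n * npow n s) has_field_derivative - (of_real (ln (real (Suc n))) * a n) * npow n s) (at s)" for n s
      unfolding npow_def by (auto intro!: derivative_eq_intros)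
    fix n s
    show "((\<lambda>s. a n * npow n s) has_field_derivative - (of_real (ln (real (Suc n))) * a n) * npow n s) (at s)" by (rule dd)
  next
    fix s :: complex assume s: "s \<in> {s. Re s > 1}"
    define d where "d = (Re s - 1) / 2"
    have d: "d > 0" using s by (simp add: d_def)
    show "\<exists>d h. 0 < d \<and> summable h \<and> (\<forall>\<^sub>F n in sequentially. \<forall>y\<in>ball s d \<inter> {s. Re s > 1}. norm (a n * npow n y) \<le> h n)"
    proof (intro exI[of _ d] exI[of _ "\<lambda>n. norm (a n) * real (Suc n) powr (- (1 + d))"] conjI d always_eventually allI ballI)
      show "summable (\<lambda>n. norm (a n) * real (Suc n) powr (- (1 + d)))" using sm[of "1 + d"] d by simp
      fix n y assume y: "y \<in> ball s d \<inter> {s. Re s > 1}"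
      have "\<bar>Re (s - y)\<bar> \<le> norm (s - y)" by (rule abs_Re_le_cmod)
      also have "\<dots> < d" using y by (simp add: dist_norm)
      finally have "\<bar>Re s - Re y\<bar> < d" by simp
      moreover have "Re s = 1 + 2 * d" by (simp add: d_def field_simps)
      ultimately have "Re y \<ge> 1 + d" by linarith
      from npow_powr_mono[OF this] show "norm (a n * npow n y) \<le> norm (a n) * real (Suc n) powr (- (1 + d))"
        by (simp add: norm_mult mult_left_mono)
    qed
  qed
  then obtain g g' where g: "\<And>s. Re s > 1 \<Longrightarrow> (\<lambda>n. a n * npow n s) sums g s"
    "\<And>s. Re s > 1 \<Longrightarrow> (\<lambda>n. - (of_real (ln (real (Suc n))) * a n) * npow n s) sums g' s"
    "\<And>s. Re s > 1 \<Longrightarrow> (g has_field_derivative g' s) (at s)" by auto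
  have geq: "(\<Sum>n. a n * npow n s) = g s" if "Re s > 1" for s using g(1)[OF that] by (simp add: sums_iff)
  have dg: "((\<lambda>s. \<Sum>n. a n * npow n s) has_field_derivative g' s) (at s)" if "Re s > 1" for s
    by (rule has_field_derivative_transform_within_open[OF g(3)[OF that] op]) (use that geq in auto)
  show "((\<lambda>s. \<Sum>n. a n * npow n s) has_field_derivative (\<Sum>n. - (of_real (ln (real (Suc n))) * a n) * npow n s)) (at s)" if "Re s > 1" for s
    using dg[OF that] g(2)[OF that] by (simp add: sums_iff)
  show "(\<lambda>n. - (of_real (ln (real (Suc n))) * a n) * npow n s) sums deriv (\<lambda>s. \<Sum>n. a n * npow n s) s" if "Re s > 1" for s
    using g(2)[OF that] DERIV_imp_deriv[OF dg[OF that]] by simp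
  show "(\<lambda>s. \<Sum>n. a n * npow n s) holomorphic_on {s. Re s > 1}"
    using dg by (subst holomorphic_on_open[OF op]) blast
qed

lemma summable_powr_Suc: "\<sigma> > 1 \<Longrightarrow> summable (\<lambda>n. real (Suc n) powr (- \<sigma>))"
  by (subst summable_Suc_iff) (simp add: summable_real_powr_iff)

lemma summable_ln_powr_Suc:
  assumes "\<sigma> > 1" shows "summable (\<lambda>n. ln (real (Suc n)) * real (Suc n) powr (- \<sigma>))"
proof -
  \<comment> \<open>Half of the excess of \<sigma> over 1 pays for the logarithm, through e ln n <=
    n^e.\<close>
  define e where "e = (\<sigma> - 1) / 2"
  have e: "e > 0" using assms by (simp add: e_def)
  have "summable (\<lambda>n. 1 / e * real (Suc n) powr (- (1 + e)))"
    using e by (intro summable_mult summable_powr_Suc) auto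
  then show ?thesis
  proof (rule summable_comparison_test'[of _ 0])
    fix n
    have "e * ln (real (Suc n)) \<le> real (Suc n) powr e"
    proof -
      have "e * ln (real (Suc n)) \<le> exp (e * ln (real (Suc n)))"
        using exp_ge_add_one_self[of "e * ln (real (Suc n))"] by linarith
      then show ?thesis by (simp add: powr_def del: of_nat_Suc)
    qed
    then have "ln (real (Suc n)) \<le> 1 / e * real (Suc n) powr e" using e by (simp add: field_simps)
    then have "ln (real (Suc n)) * real (Suc n) powr (- \<sigma>) \<le> 1 / e * real (Suc n) powr e * real (Suc n) powr (- \<sigma>)"
      by (intro mult_right_mono) auto
    also have "\<dots> = 1 / e * real (Suc n) powr (- (1 + e))"
    proof -
      have "e + - \<sigma> = - (1 + e)" by (simp add: e_def field_simps)
      then show ?thesis by (simp only: mult.assoc powr_add[symmetric])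
    qed
    finally show "norm (ln (real (Suc n)) * real (Suc n) powr (- \<sigma>)) \<le> 1 / e * real (Suc n) powr (- (1 + e))"
      by (simp add: abs_mult)
  qed
qed

lemma summable_mangoldt_powr_Suc:
  assumes "\<sigma> > 1" shows "summable (\<lambda>n. mangoldt (Suc n) * real (Suc n) powr (- \<sigma>))"
  by (rule summable_comparison_test'[OF summable_ln_powr_Suc[OF assms], of 0])
     (auto simp: abs_mult mangoldt_nonneg intro!: mult_right_mono mangoldt_le simp del: of_nat_Suc)

text \<open>The factor 1 makes this literally the case of constant coefficients 1 in
  \<open>dirichlet_series\<close>. Its companion \<open>dmang\<close> turns out to be minus the
  logarithmic derivative.\<close>

definition dzeta :: "complex \<Rightarrow> complex" where "dzeta s = (\<Sum>n. 1 * npow n s)"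
definition dmang :: "complex \<Rightarrow> complex" where "dmang s = (\<Sum>n. mangoldt (Suc n) * npow n s)"

lemma dzeta_facts:
  shows dzeta_sums: "Re s > 1 \<Longrightarrow> (\<lambda>n. npow n s) sums dzeta s"
    and dzeta_summable: "Re s > 1 \<Longrightarrow> summable (\<lambda>n. norm (npow n s))"
    and dzeta_holomorphic: "dzeta holomorphic_on {s. Re s > 1}"
    and dzeta_deriv_sums: "Re s > 1 \<Longrightarrow> (\<lambda>n. - (of_real (ln (real (Suc n))) * npow n s)) sums deriv dzeta s"
proof -
  have sm: "summable (\<lambda>n. norm (1::complex) * real (Suc n) powr (- \<sigma>))" if "\<sigma> > 1" for \<sigma>
    using summable_powr_Suc[OF that] by simp
  note D = dirichlet_series[of "\<lambda>_. 1", OF sm]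
  show 1: "summable (\<lambda>n. norm (npow n s))" if "Re s > 1" for s using D(1)[OF _ that] by simp
  show "(\<lambda>n. npow n s) sums dzeta s" if "Re s > 1"
    using summable_sums[OF summable_norm_cancel[OF 1[OF that]]] by (simp add: dzeta_def)
  show "dzeta holomorphic_on {s. Re s > 1}" using D(4) by (simp add: dzeta_def[abs_def])
  show "(\<lambda>n. - (of_real (ln (real (Suc n))) * npow n s)) sums deriv dzeta s" if "Re s > 1"
    using D(3)[OF _ that] by (simp add: dzeta_def[abs_def])
qed

lemma dmang_facts:
  shows dmang_sums: "Re s > 1 \<Longrightarrow> (\<lambda>n. mangoldt (Suc n) * npow n s) sums dmang s"
    and dmang_summable: "Re s > 1 \<Longrightarrow> summable (\<lambda>n. norm (mangoldt (Suc n) * npow n s))"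
    and dmang_holomorphic: "dmang holomorphic_on {s. Re s > 1}"
proof -
  have sm: "summable (\<lambda>n. norm (mangoldt (Suc n) :: complex) * real (Suc n) powr (- \<sigma>))" if "\<sigma> > 1" for \<sigma>
    using summable_mangoldt_powr_Suc[OF that] by simp
  note D = dirichlet_series[of "\<lambda>n. mangoldt (Suc n)", OF sm]
  show 1: "summable (\<lambda>n. norm (mangoldt (Suc n) * npow n s))" if "Re s > 1" for s using D(1)[OF _ that] by simp
  show "(\<lambda>n. mangoldt (Suc n) * npow n s) sums dmang s" if "Re s > 1"
    using summable_sums[OF summable_norm_cancel[OF 1[OF that]]] by (simp add: dmang_def)
  show "dmang holomorphic_on {s. Re s > 1}" using D(4) by (simp add: dmang_def[abs_def])
qed

lemma npow_mult: "npow m s * npow k s = npow (Suc m * Suc k - 1) s"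
proof -
  have "Suc (Suc m * Suc k - 1) = Suc m * Suc k" by simp
  then have "real (Suc (Suc m * Suc k - 1)) = real (Suc m) * real (Suc k)" by (metis of_nat_mult)
  then show ?thesis
    unfolding npow_def exp_add[symmetric] by (simp add: ln_mult algebra_simps del: of_nat_Suc)
qed

text \<open>The Dirichlet convolution of the von Mangoldt function with the constant function 1 is the logarithm.\<close>

lemma deriv_dzeta:
  assumes s: "Re s > 1"
  shows "deriv dzeta s = - (dmang s * dzeta s)"
proof -
  define A where "A n = mangoldt (Suc n) * npow n s" for n
  define B where "B n = npow n s" for n
  have sA: "(\<lambda>n. norm (A n)) summable_on UNIV" "(A has_sum dmang s) UNIV"
    using dmang_summable[OF s] dmang_sums[OF s] unfolding A_def[symmetric]
    by (auto intro!: norm_summable_imp_summable_on norm_summable_imp_has_sum)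
  have sB: "(\<lambda>n. norm (B n)) summable_on UNIV" "(B has_sum dzeta s) UNIV"
    using dzeta_summable[OF s] dzeta_sums[OF s] unfolding B_def[symmetric]
    by (auto intro!: norm_summable_imp_summable_on norm_summable_imp_has_sum)
  have smP: "(\<lambda>(m, k). A m * B k) summable_on (UNIV \<times> UNIV)"
  proof (rule Infinite_Sum.abs_summable_summable, subst Infinite_Sum.abs_summable_on_Sigma_iff, intro conjI ballI)
    show "(\<lambda>k. norm (case (m, k) of (m, k) \<Rightarrow> A m * B k)) summable_on UNIV" for m
      using summable_on_cmult_right[OF sB(1), of "norm (A m)"] by (simp add: norm_mult)
    show "(\<lambda>m. norm (\<Sum>\<^sub>\<infinity>k. norm (case (m, k) of (m, k) \<Rightarrow> A m * B k))) summable_on UNIV"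
      using summable_on_cmult_left[OF sA(1), of "infsum (\<lambda>k. norm (B k)) UNIV"]
      by (simp add: norm_mult infsum_cmult_right' abs_mult infsum_nonneg)
  qed
  have prodval: "infsum (\<lambda>(m, k). A m * B k) (UNIV \<times> UNIV) = dmang s * dzeta s"
  proof -
    have "infsum (\<lambda>(m, k). A m * B k) (UNIV \<times> UNIV) = infsum (\<lambda>m. infsum (\<lambda>k. A m * B k) UNIV) UNIV"
      by (rule infsum_Sigma'_banach[symmetric]) (use smP in simp)
    also have "\<dots> = infsum (\<lambda>m. A m * dzeta s) UNIV"
      using sB(2) by (simp add: infsum_cmult_right' infsumI)
    also have "\<dots> = dmang s * dzeta s" using sA(2) by (simp add: infsum_cmult_left' infsumI)
    finally show ?thesis .
  qed
  define D where "D n = {d. Suc d dvd Suc n}" for n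
  have finD: "finite (D n)" for n
  proof (rule finite_subset)
    show "D n \<subseteq> {..n}" by (auto simp: D_def dest: dvd_imp_le)
  qed auto
  define h where "h = (\<lambda>(n, d). mangoldt (Suc d) * npow n s :: complex)"
  have bij: "infsum (\<lambda>(m, k). A m * B k) (UNIV \<times> UNIV) = infsum h (Sigma UNIV D)"
    "(\<lambda>(m, k). A m * B k) summable_on (UNIV \<times> UNIV) \<longleftrightarrow> h summable_on (Sigma UNIV D)"
  proof -
    \<comment> \<open>The pair (m, k) corresponds to (n, d) with n + 1 = (m + 1) (k + 1) and d = m;
      the subtractions of 1 only undo the index shift.\<close>
    let ?i = "\<lambda>(n, d). (d, Suc n div Suc d - 1)" and ?j = "\<lambda>(m, k). (Suc m * Suc k - 1, m)"
    have w: "\<And>a. a \<in> UNIV \<times> UNIV \<Longrightarrow> ?i (?j a) = a" "\<And>a. a \<in> UNIV \<times> UNIV \<Longrightarrow> ?j a \<in> Sigma UNIV D"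
      "\<And>b. b \<in> Sigma UNIV D \<Longrightarrow> ?j (?i b) = b" "\<And>b. b \<in> Sigma UNIV D \<Longrightarrow> ?i b \<in> UNIV \<times> UNIV"
      "\<And>a. a \<in> UNIV \<times> UNIV \<Longrightarrow> h (?j a) = (\<lambda>(m, k). A m * B k) a"
    proof -
      show "?i (?j a) = a" for a :: "nat \<times> nat"
      proof (cases a)
        case (Pair m k)
        have "Suc (Suc m * Suc k - 1) div Suc m = Suc k" by (metis Suc_diff_1 mult_pos_pos nonzero_mult_div_cancel_left old.nat.distinct(2) zero_less_Suc)
        then show ?thesis by (simp add: Pair)
      qed
      show "?j a \<in> Sigma UNIV D" for a :: "nat \<times> nat"
      proof (cases a)
        case (Pair m k)
        have "Suc (Suc m * Suc k - 1) = Suc m * Suc k" by simp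
        then have "Suc m dvd Suc (Suc m * Suc k - 1)" by (metis dvd_triv_left)
        then show ?thesis by (simp add: Pair D_def)
      qed
      show "?j (?i b) = b" if "b \<in> Sigma UNIV D" for b
      proof (cases b)
        case (Pair n d)
        then have "Suc d dvd Suc n" using that by (auto simp: D_def)
        then obtain q where q: "Suc n = Suc d * q" by auto
        then have "q > 0" by (cases q) auto
        moreover have "Suc n div Suc d = q" using q by (metis nonzero_mult_div_cancel_left nat.distinct(1))
        moreover from \<open>q > 0\<close> obtain k where "q = Suc k" using gr0_implies_Suc by blast
        ultimately show ?thesis using q by (simp add: Pair)
      qed
      show "h (?j a) = (\<lambda>(m, k). A m * B k) a" for a :: "nat \<times> nat"
        by (cases a) (simp add: h_def A_def B_def npow_mult mult.assoc)
    qed auto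
    show "infsum (\<lambda>(m, k). A m * B k) (UNIV \<times> UNIV) = infsum h (Sigma UNIV D)"
      by (rule infsum_reindex_bij_witness[of _ ?i ?j]) (use w in blast)+
    show "(\<lambda>(m, k). A m * B k) summable_on (UNIV \<times> UNIV) \<longleftrightarrow> h summable_on (Sigma UNIV D)"
      by (rule summable_on_reindex_bij_witness[of _ ?i ?j]) (use w in blast)+
  qed
  have sh: "h summable_on Sigma UNIV D" using smP bij(2) by simp
  have inner: "infsum (\<lambda>d. h (n, d)) (D n) = of_real (ln (real (Suc n))) * npow n s" for n
  proof -
    have "infsum (\<lambda>d. h (n, d)) (D n) = (\<Sum>d\<in>D n. mangoldt (Suc d)) * npow n s"
      using finD by (simp add: h_def sum_distrib_right)
    also have "(\<Sum>d\<in>D n. mangoldt (Suc d) :: complex) = (\<Sum>d | d dvd Suc n. mangoldt d)"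
      by (rule sum.reindex_bij_witness[of _ "\<lambda>d. d - 1" Suc]) (auto simp: D_def elim!: dvdE intro: Suc_pred, (metis Suc_pred dvd_0_left_iff dvd_triv_left gr0I nat.distinct(1))+)
    also have "\<dots> = of_real (ln (real (Suc n)))" by (rule mangoldt_sum) simp
    finally show ?thesis .
  qed
  have S1: "infsum h (Sigma UNIV D) = infsum (\<lambda>n. of_real (ln (real (Suc n))) * npow n s) UNIV"
    using infsum_Sigma_banach[of h UNIV D] sh by (simp add: inner)
  have S2: "(\<lambda>n. of_real (ln (real (Suc n))) * npow n s) summable_on UNIV"
    using summable_on_Sigma_banach[of "\<lambda>n d. h (n, d)" UNIV D] sh by (simp add: inner)
  have "((\<lambda>n. of_real (ln (real (Suc n))) * npow n s) has_sum (dmang s * dzeta s)) UNIV"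
    using S2 S1 bij(1) prodval by (metis has_sum_infsum)
  then have "(\<lambda>n. of_real (ln (real (Suc n))) * npow n s) sums (dmang s * dzeta s)"
    by (rule has_sum_imp_sums)
  then have "(\<lambda>n. - (of_real (ln (real (Suc n))) * npow n s)) sums - (dmang s * dzeta s)"
    by (rule sums_minus)
  with dzeta_deriv_sums[OF s] show ?thesis by (rule sums_unique2)
qed

lemma dzeta_2_nonzero: "dzeta 2 \<noteq> 0"
proof
  assume "dzeta 2 = 0"
  have r: "npow n 2 = of_real (real (Suc n) powr (- 2))" for n
  proof -
    have "npow n 2 = exp (of_real (- 2 * ln (real (Suc n))))" by (simp add: npow_def)
    also have "\<dots> = of_real (exp (- 2 * ln (real (Suc n))))" by (rule exp_of_real)
    finally show ?thesis by (simp add: powr_def)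
  qed
  have "(\<lambda>n. complex_of_real (real (Suc n) powr (- 2))) sums of_real 0"
    using dzeta_sums[of 2] \<open>dzeta 2 = 0\<close> unfolding r by simp
  then have "(\<lambda>n. real (Suc n) powr (- 2)) sums 0" by (simp only: sums_of_real_iff)
  then have "\<forall>n. real (Suc n) powr (- 2) = 0"
    by (subst (asm) sums_iff) (auto simp: suminf_eq_zero_iff)
  then show False by simp
qed

text \<open>The argument rests on \<open>deriv_dzeta\<close> rather than on an Euler product. At a
  zero s of order n, inserting g(w) (w - s)^n and cancelling (w - s)^(n - 1) leaves an identity
  whose limit at s is n g(s) = 0, because \<open>dmang\<close> is continuous at s; but g(s) is not
  0.\<close>

lemma dzeta_nonzero:
  assumes s: "Re s > 1"
  shows "dzeta s \<noteq> 0"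
proof
  let ?S = "{s. Re s > 1}"
  assume 0: "dzeta s = 0"
  have op: "open ?S" "connected ?S" "s \<in> ?S"
    using s by (auto simp: open_halfspace_Re_gt intro!: convex_connected convex_halfspace_Re_gt)
  have nc: "\<exists>w\<in>?S. dzeta w \<noteq> 0" using dzeta_2_nonzero by (intro bexI[of _ 2]) auto
  define n where "n = nat (zorder dzeta s)"
  define g where "g = zor_poly dzeta s"
  from zorder_exist_zero[OF dzeta_holomorphic op nc] 0 obtain r where r: "r > 0" "cball s r \<subseteq> ?S" "g holomorphic_on cball s r"
     "\<And>w. w \<in> cball s r \<Longrightarrow> dzeta w = g w * (w - s) ^ n \<and> g w \<noteq> 0" and n: "n > 0"
    unfolding g_def n_def by (auto split: if_splits)
  obtain k where k: "n = Suc k" using n by (cases n) auto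
  have id: "deriv g w * (w - s) + of_nat n * g w = - (dmang w * (w - s) * g w)" if w: "w \<in> ball s r - {s}" for w
  proof -
    have gd: "(g has_field_derivative deriv g w) (at w)"
      by (rule holomorphic_derivI[of _ "ball s r"]) (use r(3) w in \<open>auto intro: holomorphic_on_subset\<close>)
    have "((\<lambda>w. g w * (w - s) ^ n) has_field_derivative deriv g w * (w - s) ^ n + of_nat n * (w - s) ^ (n - 1) * g w) (at w)"
      by (auto intro!: derivative_eq_intros gd)
    then have "(dzeta has_field_derivative deriv g w * (w - s) ^ n + of_nat n * (w - s) ^ (n - 1) * g w) (at w)"
      by (rule has_field_derivative_transform_within_open[of _ _ _ "ball s r"]) (use r(4) w in auto)
    then have "deriv dzeta w = deriv g w * (w - s) ^ n + of_nat n * (w - s) ^ (n - 1) * g w"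
      by (rule DERIV_imp_deriv)
    moreover have "Re w > 1" using r(2) w ball_subset_cball by blast
    ultimately have "deriv g w * (w - s) ^ n + of_nat n * (w - s) ^ (n - 1) * g w = - (dmang w * (g w * (w - s) ^ n))"
      using deriv_dzeta[of w] r(4)[of w] w by simp
    then have "(w - s) ^ k * (deriv g w * (w - s) + of_nat n * g w) = (w - s) ^ k * (- (dmang w * (w - s) * g w))"
      by (simp add: k algebra_simps)
    moreover have "(w - s) ^ k \<noteq> 0" using w by simp
    ultimately show ?thesis by (metis mult_left_cancel)
  qed
  have cg: "continuous_on (ball s r) g" "continuous_on (ball s r) (deriv g)" "continuous_on (ball s r) dmang"
  proof -
    have hg: "g holomorphic_on ball s r" using r(3) by (rule holomorphic_on_subset) auto
    then show "continuous_on (ball s r) g" "continuous_on (ball s r) (deriv g)"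
      by (auto intro!: holomorphic_on_imp_continuous_on holomorphic_deriv)
    have "ball s r \<subseteq> ?S" using r(2) ball_subset_cball by blast
    then show "continuous_on (ball s r) dmang"
      using dmang_holomorphic by (blast intro: holomorphic_on_imp_continuous_on holomorphic_on_subset)
  qed
  have sb: "s \<in> ball s r" using r(1) by simp
  have lim: "((\<lambda>w. deriv g w * (w - s) + of_nat n * g w + dmang w * (w - s) * g w) \<longlongrightarrow>
     deriv g s * (s - s) + of_nat n * g s + dmang s * (s - s) * g s) (at s)"
    using cg sb by (intro tendsto_intros) (auto simp: continuous_on_eq_continuous_at isCont_def)
  have "eventually (\<lambda>w. deriv g w * (w - s) + of_nat n * g w + dmang w * (w - s) * g w = 0) (at s)"
  proof -
    have "eventually (\<lambda>w. w \<in> ball s r - {s}) (at s)"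
      using r(1) by (auto simp: eventually_at dist_commute intro!: exI[of _ r])
    then show ?thesis by eventually_elim (use id in simp)
  qed
  then have "((\<lambda>w. deriv g w * (w - s) + of_nat n * g w + dmang w * (w - s) * g w) \<longlongrightarrow> 0) (at s)"
    by (rule tendsto_eventually)
  from tendsto_unique[OF _ lim this] have "of_nat n * g s = 0" by simp
  then show False using n r(4)[of s] r(1) by simp
qed


section \<open>Analytic continuation and functional equation\<close>

lemma exp_minus_pi_le_half: "exp (- pi) \<le> 1 / 2"
proof -
  have "1 + pi \<le> exp pi" by (rule exp_ge_add_one_self)
  then have "2 \<le> exp pi" using pi_gt3 by linarith
  then show ?thesis by (simp add: exp_minus field_simps)
qed

lemma omega_nonneg: "x > 0 \<Longrightarrow> omega x \<ge> 0"
  by (rule sums_le[OF _ sums_zero omega_sums]) auto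

lemma omega_le:
  assumes x: "x \<ge> 1"
  shows "omega x \<le> 2 * exp (- (pi * x))"
proof -
  define r where "r = exp (- (pi * x))"
  have "r \<le> exp (- pi)" using x by (simp add: r_def)
  then have r: "0 < r" "r \<le> 1 / 2" using exp_minus_pi_le_half by (simp add: r_def, linarith)
  have *: "(\<lambda>n. r * r ^ n) sums (r * (1 / (1 - r)))" using r by (intro sums_mult geometric_sums) auto
  have "omega x \<le> r * (1 / (1 - r))"
    by (rule sums_le[OF _ omega_sums *]) (use x omega_term_le[of x] in \<open>auto simp: r_def\<close>)
  also have "\<dots> \<le> r * 2" using r by (intro mult_left_mono) (auto simp: field_simps)
  finally show ?thesis by (simp add: r_def)
qed

lemma omega_measurable [measurable]: "omega \<in> borel_measurable borel"
  unfolding omega_def[abs_def] by measurable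

lemma continuous_on_omega: "continuous_on {1..} omega"
proof -
  have "uniform_limit {1..} (\<lambda>n x. \<Sum>i<n. exp (- (pi * (real (Suc i))\<^sup>2 * x))) omega sequentially"
    unfolding omega_def[abs_def]
  proof (rule Weierstrass_m_test)
    show "summable (\<lambda>n. exp (- (pi * (real (Suc n))\<^sup>2 * 1)))" using omega_sums[of 1] by (simp add: sums_iff)
    fix n and x :: real assume "x \<in> {1..}"
    then show "norm (exp (- (pi * (real (Suc n))\<^sup>2 * x))) \<le> exp (- (pi * (real (Suc n))\<^sup>2 * 1))"
      by (simp del: of_nat_Suc)
  qed
  then show ?thesis
    by (rule uniform_limit_theorem[rotated]) (auto intro!: always_eventually continuous_intros)
qed

text \<open>The substitution \<open>x = e\<^bsup>2u\<^esup>\<close> turns the inversion \<open>x \<mapsto> 1 / x\<close> of the theta function into a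
  reflection, and the Mellin transform into a Laplace transform over a half line.\<close>

definition kern :: "real \<Rightarrow> real" where "kern u = omega (exp (2 * u))"

lemma kern_measurable [measurable]: "kern \<in> borel_measurable borel"
  unfolding kern_def[abs_def] by measurable

lemma kern_nonneg: "kern u \<ge> 0" by (simp add: kern_def omega_nonneg)

lemma continuous_on_kern: "continuous_on {0..} kern"
  unfolding kern_def by (rule continuous_on_compose2[OF continuous_on_omega]) (auto intro!: continuous_intros)

lemma kern_minus: "kern (- u) = (exp u - 1) / 2 + exp u * kern u"
proof -
  have "1 + 2 * omega (exp (- (2 * u))) = (1 + 2 * omega (1 / exp (- (2 * u)))) / sqrt (exp (- (2 * u)))"
    by (rule theta_transform) simp
  moreover have "1 / exp (- (2 * u)) = exp (2 * u)" by (simp add: exp_minus field_simps)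
  moreover have "sqrt (exp (- (2 * u))) = exp (- u)"
    by (rule real_sqrt_unique) (auto simp: exp_of_nat_mult[symmetric])
  ultimately have "1 + 2 * omega (exp (- (2 * u))) = (1 + 2 * omega (exp (2 * u))) * exp u"
    by (simp add: exp_minus divide_inverse)
  then show ?thesis by (simp add: kern_def field_simps)
qed

lemma kern_le:
  assumes u: "u \<ge> 0" shows "kern u \<le> 2 * exp (- 2 * u\<^sup>2)"
proof -
  have "exp (2 * u) \<ge> 1 + 2 * u + (2 * u)\<^sup>2 / 2" by (rule exp_lower_Taylor_quadratic) (use u in simp)
  then have "2 * u\<^sup>2 \<le> exp (2 * u)" using u by (simp add: power2_eq_square)
  also have "\<dots> \<le> pi * exp (2 * u)" using pi_gt3 by simp
  finally have *: "exp (- (pi * exp (2 * u))) \<le> exp (- 2 * u\<^sup>2)" by simp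
  have "kern u \<le> 2 * exp (- (pi * exp (2 * u)))" unfolding kern_def by (rule omega_le) (use u in simp)
  then show ?thesis using * by linarith
qed

text \<open>Folding the Mellin integral over the whole line at u = 0 with \<open>kern_minus\<close>
  leaves this integrand on u > 0, apart from elementary terms that give 1 / s and 1 / (s - 1). Its
  invariance under s -> 1 - s is the functional equation.\<close>

definition xi_integrand :: "complex \<Rightarrow> real \<Rightarrow> complex" where
  "xi_integrand s u = of_real (kern u) * (exp (s * of_real u) + exp ((1 - s) * of_real u))"

text \<open>Completing the square trades the linear exponent (1 + A) u for half of the Gaussian
  decay and a factor exp((1 + A)^2). The resulting growth of order two in s is cruder than the true
  one, but it is what all later zero counts rest on.\<close>

lemma xi_integrand_bound:
  assumes u: "u \<ge> 0" and A: "norm s \<le> A"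
  shows "norm (xi_integrand s u) \<le> 4 * exp ((1 + A)\<^sup>2) * exp (- u\<^sup>2)"
proof -
  have A0: "A \<ge> 0" using A norm_ge_zero order_trans by blast
  have "\<bar>Re s\<bar> \<le> A" using A abs_Re_le_cmod order_trans by blast
  then have "norm (exp (s * of_real u)) \<le> exp ((1 + A) * u)" "norm (exp ((1 - s) * of_real u)) \<le> exp ((1 + A) * u)"
    using u by (auto intro!: mult_right_mono)
  then have "norm (exp (s * of_real u) + exp ((1 - s) * of_real u)) \<le> 2 * exp ((1 + A) * u)"
    using norm_triangle_ineq[of "exp (s * of_real u)" "exp ((1 - s) * of_real u)"] by linarith
  then have "norm (xi_integrand s u) \<le> (2 * exp (- 2 * u\<^sup>2)) * (2 * exp ((1 + A) * u))"
    unfolding xi_integrand_def norm_mult using kern_le[OF u] kern_nonneg by (intro mult_mono) auto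
  also have "\<dots> = 4 * exp (- 2 * u\<^sup>2 + (1 + A) * u)" by (subst exp_add) simp
  also have "\<dots> \<le> 4 * exp ((1 + A)\<^sup>2 - u\<^sup>2)"
  proof -
    have "0 \<le> (u - (1 + A) / 2)\<^sup>2" by simp
    then have "(1 + A) * u \<le> u\<^sup>2 + (1 + A)\<^sup>2 / 4" by (simp add: power2_eq_square algebra_simps)
    also have "\<dots> \<le> u\<^sup>2 + (1 + A)\<^sup>2" by simp
    finally show ?thesis by simp
  qed
  finally show ?thesis by (simp add: exp_diff exp_minus divide_inverse)
qed

lemma gaussian_integrable: "integrable lborel (\<lambda>u::real. exp (- u\<^sup>2))"
proof -
  have "integrable lborel (\<lambda>t. norm (of_real (exp (- (pi * (1 / pi) * t\<^sup>2))) * exp (\<i> * of_real (2 * pi * 0 * t)) :: complex))"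
    by (intro integrable_norm gauss_fourier) simp
  then show ?thesis by simp
qed

lemma xi_integrand_measurable [measurable]: "xi_integrand s \<in> borel_measurable borel"
  unfolding xi_integrand_def[abs_def] by measurable

definition xi_int :: "complex \<Rightarrow> complex" where
  "xi_int s = 2 * (\<integral>u. indicator {0<..} u *\<^sub>R xi_integrand s u \<partial>lborel)"

lemma xi_integrable: "integrable lborel (\<lambda>u. indicator {0<..} u *\<^sub>R xi_integrand s u)"
proof (rule Bochner_Integration.integrable_bound)
  show "integrable lborel (\<lambda>u::real. 4 * exp ((1 + norm s)\<^sup>2) * exp (- u\<^sup>2))"
    by (intro integrable_mult_right gaussian_integrable)
  show "AE u in lborel. norm (indicator {0<..} u *\<^sub>R xi_integrand s u) \<le> norm (4 * exp ((1 + norm s)\<^sup>2) * exp (- u\<^sup>2))"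
    by (auto simp: indicator_def intro!: xi_integrand_bound)
qed measurable

lemma xi_int_bound: "\<exists>C>0. \<forall>s. norm (xi_int s) \<le> C * exp ((1 + norm s)\<^sup>2)"
proof -
  define G where "G = lebesgue_integral lborel (\<lambda>u::real. exp (- u\<^sup>2))"
  have G: "G \<ge> 0" by (simp add: G_def)
  show ?thesis
  proof (rule exI[of _ "8 * G + 1"], intro conjI allI)
    show "8 * G + 1 > 0" using G by simp
    fix s
    have "norm (\<integral>u. indicator {0<..} u *\<^sub>R xi_integrand s u \<partial>lborel) \<le> (\<integral>u. 4 * exp ((1 + norm s)\<^sup>2) * exp (- u\<^sup>2) \<partial>lborel)"
      by (rule Bochner_Integration.integral_norm_bound_integral[OF xi_integrable])
         (auto simp: indicator_def intro!: xi_integrand_bound gaussian_integrable)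
    also have "\<dots> = 4 * exp ((1 + norm s)\<^sup>2) * G" by (simp add: G_def)
    finally have "norm (xi_int s) \<le> 8 * G * exp ((1 + norm s)\<^sup>2)" by (simp add: xi_int_def norm_mult mult_ac)
    also have "\<dots> \<le> (8 * G + 1) * exp ((1 + norm s)\<^sup>2)" by simp
    finally show "norm (xi_int s) \<le> (8 * G + 1) * exp ((1 + norm s)\<^sup>2)" .
  qed
qed

lemma xi_int_reflect: "xi_int (1 - s) = xi_int s"
  by (simp add: xi_int_def xi_integrand_def add.commute)

lemma xi_int_cnj: "xi_int (cnj s) = cnj (xi_int s)"
proof -
  have "xi_integrand (cnj s) u = cnj (xi_integrand s u)" for u
    by (simp add: xi_integrand_def exp_cnj)
  then have "indicator {0<..} u *\<^sub>R xi_integrand (cnj s) u = cnj (indicator {0<..} u *\<^sub>R xi_integrand s u)" for u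
    by simp
  then show ?thesis unfolding xi_int_def by (simp only: Bochner_Integration.integral_cnj complex_cnj_mult complex_cnj_numeral)
qed

text \<open>The integrals over [0, N] are holomorphic by differentiation under the integral sign.
  They converge locally uniformly, since by \<open>xi_integrand_bound\<close> the remaining tail is
  at most a Gaussian tail times a factor depending only on a bound for |s|.\<close>

lemma xi_int_holomorphic: "xi_int holomorphic_on UNIV"
proof -
  define I where "I N s = integral (cbox 0 (real N)) (xi_integrand s)" for N s
  have eqI: "I N s = (\<integral>u. indicator {0..real N} u *\<^sub>R xi_integrand s u \<partial>lborel)"
    and intI: "integrable lborel (\<lambda>u. indicator {0..real N} u *\<^sub>R xi_integrand s u)" for N s
  proof -
    show i: "integrable lborel (\<lambda>u. indicator {0..real N} u *\<^sub>R xi_integrand s u)"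
    proof (rule Bochner_Integration.integrable_bound)
      show "integrable lborel (\<lambda>u::real. 4 * exp ((1 + norm s)\<^sup>2) * exp (- u\<^sup>2))"
        by (intro integrable_mult_right gaussian_integrable)
      show "AE u in lborel. norm (indicator {0..real N} u *\<^sub>R xi_integrand s u) \<le> norm (4 * exp ((1 + norm s)\<^sup>2) * exp (- u\<^sup>2))"
        by (auto simp: indicator_def intro!: xi_integrand_bound)
    qed measurable
    then show "I N s = (\<integral>u. indicator {0..real N} u *\<^sub>R xi_integrand s u \<partial>lborel)"
      using set_borel_integral_eq_integral(2)[of "{0..real N}" "xi_integrand s"]
      by (simp add: set_integrable_def set_lebesgue_integral_def I_def)
  qed
  have kc: "continuous_on (cbox 0 (real N)) kern" for N
    using continuous_on_kern by (rule continuous_on_subset) auto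
  have holI: "I N holomorphic_on UNIV" for N
    unfolding I_def
  proof (rule leibniz_rule_holomorphic[where fx = "\<lambda>(s::complex) u. of_real (kern u) * (of_real u * exp (s * of_real u) - of_real u * exp ((1 - s) * of_real u))"])
    fix s u
    show "((\<lambda>s. xi_integrand s u) has_field_derivative of_real (kern u) * (of_real u * exp (s * of_real u) - of_real u * exp ((1 - s) * of_real u))) (at s within UNIV)"
      unfolding xi_integrand_def by (auto intro!: derivative_eq_intros simp: algebra_simps)
    show "xi_integrand s integrable_on cbox 0 (real N)"
      unfolding xi_integrand_def by (intro integrable_continuous continuous_intros kc)
  next
    have c: "continuous_on (UNIV \<times> cbox 0 (real N)) (\<lambda>x. exp (fst x * complex_of_real (snd x)))"
      "continuous_on (UNIV \<times> cbox 0 (real N)) (\<lambda>x. exp ((1 - fst x) * complex_of_real (snd x)))"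
      by (intro continuous_intros)+
    have k: "continuous_on (UNIV \<times> cbox 0 (real N)) (\<lambda>x::complex \<times> real. kern (snd x))"
      by (rule continuous_on_compose2[OF kc[of N]]) (auto intro!: continuous_intros)
    show "continuous_on (UNIV \<times> cbox 0 (real N)) (\<lambda>(s::complex, u::real). of_real (kern u) * (of_real u * exp (s * of_real u) - of_real u * exp ((1 - s) * of_real u)))"
      unfolding case_prod_unfold
      by (intro continuous_on_mult continuous_on_diff continuous_on_of_real c k continuous_on_snd continuous_on_id)
  qed auto
  define tl where "tl N = (\<integral>u. indicator {real N<..} u * exp (- u\<^sup>2) \<partial>lborel)" for N
  have tl0: "tl \<longlonglongrightarrow> 0"
  proof -
    have "(\<lambda>N. \<integral>u. indicator {real N<..} u * exp (- u\<^sup>2) \<partial>lborel) \<longlonglongrightarrow> lebesgue_integral lborel (\<lambda>u::real. 0)"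
    proof (rule integral_dominated_convergence[where w = "\<lambda>u. exp (- u\<^sup>2)"])
      show "AE u in lborel. (\<lambda>N. indicator {real N<..} u * exp (- u\<^sup>2)) \<longlonglongrightarrow> 0"
      proof (rule AE_I2)
        fix u :: real
        have "eventually (\<lambda>N. real N \<ge> u) sequentially"
          using filterlim_real_sequentially by (simp add: filterlim_at_top)
        then have "eventually (\<lambda>N. indicator {real N<..} u * exp (- u\<^sup>2) = 0) sequentially"
          by eventually_elim auto
        then show "(\<lambda>N. indicator {real N<..} u * exp (- u\<^sup>2)) \<longlonglongrightarrow> 0" by (rule tendsto_eventually)
      qed
    qed (auto simp: gaussian_integrable indicator_def)
    then show ?thesis by (simp add: tl_def[abs_def])
  qed
  have diff: "norm (xi_int s - 2 * I N s) \<le> 8 * exp ((1 + A)\<^sup>2) * tl N" if A: "norm s \<le> A" for s A N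
  proof -
    have "(\<integral>u. indicator {0..real N} u *\<^sub>R xi_integrand s u \<partial>lborel) = (\<integral>u. indicator {0<..real N} u *\<^sub>R xi_integrand s u \<partial>lborel)"
    proof (rule integral_cong_AE)
      show "AE u in lborel. indicator {0..real N} u *\<^sub>R xi_integrand s u = indicator {0<..real N} u *\<^sub>R xi_integrand s u"
        using AE_lborel_singleton[of "0::real"] by eventually_elim (auto simp: indicator_def)
    qed measurable
    have i2: "integrable lborel (\<lambda>u. indicator {real N<..} u *\<^sub>R (indicator {0<..} u *\<^sub>R xi_integrand s u))"
      by (rule integrable_mult_indicator[OF _ xi_integrable]) simp
    have "(\<integral>u. indicator {0<..} u *\<^sub>R xi_integrand s u \<partial>lborel) - I N s =
       (\<integral>u. indicator {0<..} u *\<^sub>R xi_integrand s u - indicator {0..real N} u *\<^sub>R xi_integrand s u \<partial>lborel)"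
      unfolding eqI by (rule Bochner_Integration.integral_diff[symmetric]) (auto intro: xi_integrable intI)
    also have "\<dots> = (\<integral>u. indicator {real N<..} u *\<^sub>R (indicator {0<..} u *\<^sub>R xi_integrand s u) \<partial>lborel)"
    proof (rule integral_cong_AE)
      show "AE u in lborel. indicator {0<..} u *\<^sub>R xi_integrand s u - indicator {0..real N} u *\<^sub>R xi_integrand s u =
        indicator {real N<..} u *\<^sub>R (indicator {0<..} u *\<^sub>R xi_integrand s u)"
        using AE_lborel_singleton[of "0::real"] by eventually_elim (auto simp: indicator_def)
    qed measurable
    also have "norm \<dots> \<le> (\<integral>u. 4 * exp ((1 + A)\<^sup>2) * (indicator {real N<..} u * exp (- u\<^sup>2)) \<partial>lborel)"
    proof (rule Bochner_Integration.integral_norm_bound_integral[OF i2])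
      show "integrable lborel (\<lambda>u. 4 * exp ((1 + A)\<^sup>2) * (indicator {real N<..} u * exp (- u\<^sup>2)))"
        using integrable_mult_indicator[OF _ gaussian_integrable, of "{real N<..}"] by (intro integrable_mult_right) auto
      show "norm (indicator {real N<..} u *\<^sub>R (indicator {0<..} u *\<^sub>R xi_integrand s u))
          \<le> 4 * exp ((1 + A)\<^sup>2) * (indicator {real N<..} u * exp (- u\<^sup>2))" for u
        using xi_integrand_bound[OF _ A, of u] by (auto simp: indicator_def)
    qed
    also have "\<dots> = 4 * exp ((1 + A)\<^sup>2) * tl N" by (simp add: tl_def)
    finally have "norm ((\<integral>u. indicator {0<..} u *\<^sub>R xi_integrand s u \<partial>lborel) - I N s) \<le> 4 * exp ((1 + A)\<^sup>2) * tl N" .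
    then show ?thesis unfolding xi_int_def right_diff_distrib[symmetric] norm_mult by (simp add: mult_ac)
  qed
  show ?thesis
  proof (rule holomorphic_uniform_sequence[of _ "\<lambda>N s. 2 * I N s"])
    fix x :: complex
    show "\<exists>d>0. cball x d \<subseteq> UNIV \<and> uniform_limit (cball x d) (\<lambda>N s. 2 * I N s) xi_int sequentially"
    proof (intro exI[of _ 1] conjI)
      show "uniform_limit (cball x 1) (\<lambda>N s. 2 * I N s) xi_int sequentially"
      proof (rule uniform_limitI)
        fix e :: real assume e: "e > 0"
        define A where "A = norm x + 1"
        have "(\<lambda>N. 8 * exp ((1 + A)\<^sup>2) * tl N) \<longlonglongrightarrow> 0" by (rule tendsto_mult_right_zero[OF tl0])
        then have "eventually (\<lambda>N. 8 * exp ((1 + A)\<^sup>2) * tl N < e) sequentially" using e by (rule order_tendstoD)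
        then show "\<forall>\<^sub>F N in sequentially. \<forall>s\<in>cball x 1. dist (2 * I N s) (xi_int s) < e"
        proof eventually_elim
          case (elim N)
          show ?case
          proof
            fix s assume "s \<in> cball x 1"
            then have "norm s \<le> A" using norm_triangle_sub[of s x] by (simp add: A_def dist_norm norm_minus_commute)
            from diff[OF this, of N] elim show "dist (2 * I N s) (xi_int s) < e" by (simp add: dist_norm norm_minus_commute)
          qed
        qed
      qed
    qed auto
  qed (auto intro!: holomorphic_intros holI)
qed


section \<open>The Mellin transform of the theta function at real points\<close>

lemma has_bochner_integral_nonneg_has_integral:
  fixes f :: "real \<Rightarrow> real"
  assumes "f \<in> borel_measurable borel" "\<And>x. f x \<ge> 0" "(f has_integral I) UNIV"
  shows "has_bochner_integral lborel f I"
proof (rule has_bochner_integral_nn_integral)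
  show "integral\<^sup>N lborel f = ennreal I" by (rule nn_integral_has_integral_lborel) (use assms in auto)
  show "0 \<le> I" using assms(3) by (rule has_integral_nonneg) (use assms in auto)
qed (use assms in auto)

text \<open>Euler's integral under the substitution t = exp v.\<close>

lemma Gamma_exp_integral:
  fixes z :: real
  assumes z: "z > 0"
  shows "has_bochner_integral lborel (\<lambda>v. exp (z * v - exp v)) (Gamma z)"
proof (rule has_bochner_integral_nonneg_has_integral)
  define f where "f t = t powr (z - 1) / exp t" for t :: real
  have f0: "f 0 = 0" by (simp add: f_def)
  have rexp: "range (exp :: real \<Rightarrow> real) = {0<..}" by (auto simp: image_iff) (metis exp_ln)
  have "(f has_integral Gamma z) {0..}" using Gamma_integral_real[OF z] by (simp add: f_def[abs_def])
  moreover have "(f has_integral Gamma z) {0<..} \<longleftrightarrow> (f has_integral Gamma z) {0..}"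
  proof (rule has_integral_spike_set_eq)
    have *: "{x \<in> {0<..} - {0..}. f x \<noteq> 0} = {}" "{x \<in> {0..} - {0<..}. f x \<noteq> 0} = {}" using f0 by (auto simp: not_less)
    show "negligible {x \<in> {0<..} - {0..}. f x \<noteq> 0}" "negligible {x \<in> {0..} - {0<..}. f x \<noteq> 0}" unfolding * by simp_all
  qed
  ultimately have fI: "(f has_integral Gamma z) {0<..}" by simp
  then have "f absolutely_integrable_on {0<..}"
    by (intro nonnegative_absolutely_integrable_1) (auto simp: f_def integrable_on_def)
  moreover have "integral {0<..} f = Gamma z" using fI by (rule integral_unique)
  ultimately have "f absolutely_integrable_on (exp ` UNIV) \<and> integral (exp ` UNIV) f = Gamma z"
    unfolding rexp by simp
  then have "(\<lambda>x. \<bar>exp x\<bar> * f (exp x)) absolutely_integrable_on UNIV \<and> integral UNIV (\<lambda>x. \<bar>exp x\<bar> * f (exp x)) = Gamma z"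
    by (subst has_absolute_integral_change_of_variables_1') (auto intro!: derivative_eq_intros simp: inj_on_def)
  moreover have "\<bar>exp x\<bar> * f (exp x) = exp (z * x - exp x)" for x
  proof -
    have "exp (z * x - exp x) = exp x * exp ((z - 1) * x) / exp (exp x)"
      by (simp only: exp_add[symmetric] exp_diff[symmetric]) (simp add: algebra_simps)
    then show ?thesis by (simp add: f_def powr_def)
  qed
  ultimately show "((\<lambda>v. exp (z * v - exp v)) has_integral Gamma z) UNIV"
    by (simp add: has_integral_iff set_lebesgue_integral_eq_integral(1))
qed auto

text \<open>The further substitution v = ln c + 2 u, which fits the variable exp(2 u) of
  \<open>kern\<close>.\<close>

lemma Gamma_gauss_integral:
  fixes c s :: real
  assumes c: "c > 0" and s: "s > 0"
  shows "integrable lborel (\<lambda>u. exp (- (c * exp (2 * u))) * exp (s * u))"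
    and "lebesgue_integral lborel (\<lambda>u. exp (- (c * exp (2 * u))) * exp (s * u)) = Gamma (s / 2) / 2 * c powr (- (s / 2))"
proof -
  define F where "F v = exp (s / 2 * v - exp v)" for v :: real
  have F: "integrable lborel F" "lebesgue_integral lborel F = Gamma (s / 2)"
    using Gamma_exp_integral[of "s / 2"] s by (auto simp: F_def[abs_def] has_bochner_integral_iff)
  have eq: "F (ln c + 2 * u) = c powr (s / 2) * (exp (- (c * exp (2 * u))) * exp (s * u))" for u
  proof -
    have "exp (ln c + 2 * u) = c * exp (2 * u)" using c by (simp add: exp_add)
    then have "F (ln c + 2 * u) = exp (s / 2 * ln c + (- (c * exp (2 * u)) + s * u))"
      by (simp add: F_def algebra_simps)
    then show ?thesis using c by (simp only: exp_add powr_def) simp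
  qed
  have cp: "c powr (s / 2) > 0" using c by simp
  have "integrable lborel (\<lambda>u. F (ln c + 2 * u))" by (rule lborel_integrable_real_affine[OF F(1)]) simp
  then have "integrable lborel (\<lambda>u. inverse (c powr (s / 2)) * F (ln c + 2 * u))" by (rule integrable_mult_right)
  then show "integrable lborel (\<lambda>u. exp (- (c * exp (2 * u))) * exp (s * u))"
    unfolding eq using cp by (simp add: mult.assoc[symmetric])
  have "Gamma (s / 2) = 2 * (c powr (s / 2) * lebesgue_integral lborel (\<lambda>u. exp (- (c * exp (2 * u))) * exp (s * u)))"
    using lborel_integral_real_affine[of 2 F "ln c"] F(2) unfolding eq by simp
  then show "lebesgue_integral lborel (\<lambda>u. exp (- (c * exp (2 * u))) * exp (s * u)) = Gamma (s / 2) / 2 * c powr (- (s / 2))"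
    using cp by (simp add: powr_minus field_simps)
qed

lemma kern_mellin:
  fixes s :: real
  assumes s: "s > 1"
  shows "integrable lborel (\<lambda>u. kern u * exp (s * u))"
    and "(\<lambda>n. Gamma (s / 2) / 2 * pi powr (- (s / 2)) * real (Suc n) powr (- s)) sums lebesgue_integral lborel (\<lambda>u. kern u * exp (s * u))"
proof -
  define F where "F n u = exp (- (pi * (real (Suc n))\<^sup>2 * exp (2 * u))) * exp (s * u)" for n u
  have pos: "pi * (real (Suc n))\<^sup>2 > 0" for n by (intro mult_pos_pos) auto
  have Fi: "integrable lborel (F n)" for n
    unfolding F_def[abs_def] using Gamma_gauss_integral(1)[OF pos, of s] s by simp
  have Fv: "lebesgue_integral lborel (F n) = Gamma (s / 2) / 2 * pi powr (- (s / 2)) * real (Suc n) powr (- s)" for n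
  proof -
    have "lebesgue_integral lborel (F n) = Gamma (s / 2) / 2 * (pi * (real (Suc n))\<^sup>2) powr (- (s / 2))"
      unfolding F_def[abs_def] using Gamma_gauss_integral(2)[OF pos, of s] s by simp
    also have "(pi * (real (Suc n))\<^sup>2) powr (- (s / 2)) = pi powr (- (s / 2)) * ((real (Suc n))\<^sup>2) powr (- (s / 2))"
      by (subst powr_mult) auto
    also have "((real (Suc n))\<^sup>2) powr (- (s / 2)) = real (Suc n) powr (- s)"
    proof -
      have "(real (Suc n))\<^sup>2 = real (Suc n) powr 2" by (simp add: powr_numeral del: of_nat_Suc)
      then show ?thesis by (subst \<open>(real (Suc n))\<^sup>2 = _\<close>, subst powr_powr) simp
    qed
    finally show ?thesis by simp
  qed
  have sumF: "(\<lambda>n. F n u) sums (kern u * exp (s * u))" for u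
    unfolding F_def kern_def by (intro sums_mult2 omega_sums) simp
  have nF: "norm (F n u) = F n u" for n u by (simp add: F_def)
  have 1: "AE u in lborel. summable (\<lambda>n. norm (F n u))"
    unfolding nF using sumF by (auto simp: sums_iff)
  have 2: "summable (\<lambda>n. lebesgue_integral lborel (\<lambda>u. norm (F n u)))"
    unfolding nF Fv using summable_powr_Suc[OF s] by (intro summable_mult) simp
  have e: "(\<Sum>n. F n u) = kern u * exp (s * u)" for u using sumF[of u] by (simp add: sums_iff)
  show "integrable lborel (\<lambda>u. kern u * exp (s * u))" using integrable_suminf[OF Fi 1 2] unfolding e .
  show "(\<lambda>n. Gamma (s / 2) / 2 * pi powr (- (s / 2)) * real (Suc n) powr (- s)) sums lebesgue_integral lborel (\<lambda>u. kern u * exp (s * u))"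
    using sums_integral[OF Fi 1 2] unfolding e Fv .
qed

lemma exp_integral_half_line:
  fixes a :: real
  assumes a: "a > 0"
  shows "has_bochner_integral lborel (\<lambda>u. indicator {0<..} u * exp (- (a * u))) (1 / a)"
proof (rule has_bochner_integral_nonneg_has_integral)
  have "((\<lambda>u. exp (- a * u)) has_integral 1 / a) {0..}"
    using has_integral_exp_minus_to_infinity[OF a, of 0] by simp
  moreover have "((\<lambda>u. exp (- a * u)) has_integral 1 / a) {0<..} \<longleftrightarrow> ((\<lambda>u. exp (- a * u)) has_integral 1 / a) {0..}"
  proof (rule has_integral_spike_set_eq)
    have *: "{x \<in> {0<..} - {0..}. exp (- a * x) \<noteq> 0} = {}" "{x \<in> {0..} - {0<..}. exp (- a * x) \<noteq> 0} = {0}" by auto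
    show "negligible {x \<in> {0<..} - {0..}. exp (- a * x) \<noteq> 0}" "negligible {x \<in> {0..} - {0<..}. exp (- a * x) \<noteq> 0}" unfolding * by simp_all
  qed
  ultimately have "((\<lambda>u. exp (- a * u)) has_integral 1 / a) {0<..}" by blast
  then have "((\<lambda>u. if u \<in> {0<..} then exp (- a * u) else 0) has_integral 1 / a) UNIV"
    by (subst has_integral_restrict_UNIV)
  moreover have "(\<lambda>u. if u \<in> {0<..} then exp (- a * u) else 0) = (\<lambda>u. indicator {0<..} u * exp (- (a * u)))"
    by (auto simp: indicator_def)
  ultimately show "((\<lambda>u. indicator {0<..} u * exp (- (a * u))) has_integral 1 / a) UNIV" by simp
qed auto

text \<open>The integral over u < 0 is reflected to u > 0, where \<open>kern_minus\<close> splits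
  off (exp u - 1) / 2; integrated against exp(- s u) this gives half of 1 / (s - 1) - 1 / s. Real s
  > 1 are enough, since the identity theorem extends the comparison with the Dirichlet
  series.\<close>

lemma xi_int_real:
  fixes s :: real
  assumes s: "s > 1"
  shows "xi_int (of_real s) = of_real (2 * lebesgue_integral lborel (\<lambda>u. kern u * exp (s * u)) - 1 / (s - 1) + 1 / s)"
proof -
  define F where "F u = kern u * exp (s * u)" for u
  have F: "integrable lborel F" unfolding F_def by (rule kern_mellin(1)[OF s])
  define G where "G u = indicator {0<..} u * (kern u * (exp (s * u) + exp ((1 - s) * u)))" for u :: real
  have xG: "indicator {0<..} u *\<^sub>R xi_integrand (of_real s) u = of_real (G u)" for u
    by (simp add: xi_integrand_def G_def scaleR_conv_of_real exp_of_real[symmetric])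
  have "integrable lborel (\<lambda>u. complex_of_real (G u))" using xi_integrable[of "of_real s"] unfolding xG .
  then have "integrable lborel (\<lambda>u. Re (complex_of_real (G u)))" by (rule integrable_Re)
  then have G: "integrable lborel G" by simp
  have xi: "xi_int (of_real s) = of_real (2 * lebesgue_integral lborel G)"
    unfolding xi_int_def xG by simp
  have Fp: "integrable lborel (\<lambda>u. indicator {0<..} u * F u)" "integrable lborel (\<lambda>u. indicator {..<0} u * F u)"
    using integrable_mult_indicator[OF _ F, of "{0<..}"] integrable_mult_indicator[OF _ F, of "{..<0}"] by auto
  have "lebesgue_integral lborel F = (\<integral>u. indicator {0<..} u * F u + indicator {..<0} u * F u \<partial>lborel)"
  proof (rule integral_cong_AE)
    show "AE u in lborel. F u = indicator {0<..} u * F u + indicator {..<0} u * F u"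
      using AE_lborel_singleton[of "0::real"] by eventually_elim (auto simp: indicator_def)
  qed (use F Fp in auto)
  also have "\<dots> = (\<integral>u. indicator {0<..} u * F u \<partial>lborel) + (\<integral>u. indicator {..<0} u * F u \<partial>lborel)"
    by (rule Bochner_Integration.integral_add[OF Fp])
  also have "(\<integral>u. indicator {..<0} u * F u \<partial>lborel) = (\<integral>u. indicator {..<0} (- u) * F (- u) \<partial>lborel)"
    using lborel_integral_real_affine[of "-1" "\<lambda>u. indicator {..<0} u * F u" 0] by simp
  also have "(\<lambda>u. indicator {..<0} (- u) * F (- u)) = (\<lambda>u. indicator {0<..} u * exp (- ((s - 1) * u)) / 2 - indicator {0<..} u * exp (- (s * u)) / 2
      + indicator {0<..} u * (kern u * exp ((1 - s) * u)))"
    by (rule ext) (auto simp: indicator_def F_def kern_minus exp_add[symmetric] algebra_simps exp_diff exp_minus field_simps)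
  finally have 1: "lebesgue_integral lborel F = (\<integral>u. indicator {0<..} u * F u \<partial>lborel) + (\<integral>u. indicator {0<..} u * exp (- ((s - 1) * u)) / 2 - indicator {0<..} u * exp (- (s * u)) / 2
      + indicator {0<..} u * (kern u * exp ((1 - s) * u)) \<partial>lborel)" .
  have H: "integrable lborel (\<lambda>u. indicator {0<..} u * (kern u * exp ((1 - s) * u)))"
  proof -
    have "integrable lborel (\<lambda>u. G u - indicator {0<..} u * F u)" by (intro Bochner_Integration.integrable_diff G Fp)
    then show ?thesis by (simp add: G_def F_def algebra_simps)
  qed
  define p q where "p = 1 / (s - 1) / 2" and "q = 1 / s / 2"
  have pq: "1 / (s - 1) = 2 * p" "1 / s = 2 * q" 
  proof -
    have "x = 2 * (x / 2)" for x :: real by simp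
    then show "1 / (s - 1) = 2 * p" "1 / s = 2 * q" unfolding p_def q_def by blast+
  qed
  have E: "integrable lborel (\<lambda>u. indicator {0<..} u * exp (- ((s - 1) * u)) / 2)" "integrable lborel (\<lambda>u. indicator {0<..} u * exp (- (s * u)) / 2)"
    "(\<integral>u. indicator {0<..} u * exp (- ((s - 1) * u)) / 2 \<partial>lborel) = p"
    "(\<integral>u. indicator {0<..} u * exp (- (s * u)) / 2 \<partial>lborel) = q"
    using exp_integral_half_line[of "s - 1"] exp_integral_half_line[of s] s by (auto simp: has_bochner_integral_iff p_def q_def)
  have 2: "(\<integral>u. indicator {0<..} u * exp (- ((s - 1) * u)) / 2 - indicator {0<..} u * exp (- (s * u)) / 2
      + indicator {0<..} u * (kern u * exp ((1 - s) * u)) \<partial>lborel)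
     = p - q + (\<integral>u. indicator {0<..} u * (kern u * exp ((1 - s) * u)) \<partial>lborel)"
    by (subst Bochner_Integration.integral_add[OF Bochner_Integration.integrable_diff[OF E(1,2)] H],
        subst Bochner_Integration.integral_diff[OF E(1,2)]) (simp only: E(3,4))
  have 3: "lebesgue_integral lborel G = (\<integral>u. indicator {0<..} u * F u \<partial>lborel) + (\<integral>u. indicator {0<..} u * (kern u * exp ((1 - s) * u)) \<partial>lborel)"
    by (subst Bochner_Integration.integral_add[OF Fp(1) H, symmetric]) (simp add: G_def[abs_def] F_def algebra_simps)
  have "2 * lebesgue_integral lborel G = 2 * lebesgue_integral lborel F - 1 / (s - 1) + 1 / s"
    unfolding pq using 1 2 3 by linarith
  then show ?thesis unfolding xi F_def[abs_def] by simp
qed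

text \<open>\<open>xi s\<close> is \<open>s (s - 1) \<pi>\<^bsup>-s/2\<^esup> \<Gamma>(s / 2) \<zeta>(s)\<close>, twice Riemann's function; \<open>hfac s\<close> is
  \<open>\<pi>\<^bsup>s/2\<^esup> / (s \<Gamma>(s / 2))\<close>, written without the removable singularity at 0.\<close>

definition xi :: "complex \<Rightarrow> complex" where "xi s = s * (s - 1) * xi_int s + 1"

definition hfac :: "complex \<Rightarrow> complex" where
  "hfac s = exp (s * of_real (ln pi / 2)) * rGamma (s / 2 + 1) / 2"

definition zeta_ext :: "complex \<Rightarrow> complex" where "zeta_ext s = hfac s * xi s / (s - 1)"

lemma xi_holomorphic: "xi holomorphic_on UNIV"
  unfolding xi_def[abs_def] by (intro holomorphic_intros xi_int_holomorphic)

lemma hfac_holomorphic: "hfac holomorphic_on S"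
  unfolding hfac_def[abs_def] by (intro holomorphic_intros holomorphic_on_compose_gen[of "\<lambda>s. s / 2 + 1" _ rGamma UNIV, unfolded o_def] holomorphic_rGamma) auto

lemma zeta_ext_holomorphic: "zeta_ext holomorphic_on (- {1})"
  unfolding zeta_ext_def[abs_def]
  by (intro holomorphic_intros hfac_holomorphic holomorphic_on_subset[OF xi_holomorphic]) auto

lemma npow_of_real: "npow n (of_real s) = of_real (real (Suc n) powr (- s))"
proof -
  have "npow n (of_real s) = exp (of_real (- s * ln (real (Suc n))))" by (simp add: npow_def)
  also have "\<dots> = of_real (exp (- s * ln (real (Suc n))))" by (rule exp_of_real)
  finally show ?thesis by (simp add: powr_def)
qed

lemma zeta_ext_real:
  fixes s :: real
  assumes s: "s > 1"
  shows "zeta_ext (of_real s) = dzeta (of_real s)"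
proof -
  define Z where "Z = (\<Sum>n. real (Suc n) powr (- s))"
  have Z: "(\<lambda>n. real (Suc n) powr (- s)) sums Z" unfolding Z_def using summable_powr_Suc[OF s] by (rule summable_sums)
  have "(\<lambda>n. complex_of_real (real (Suc n) powr (- s))) sums of_real Z" using Z by (simp only: sums_of_real_iff)
  then have d: "dzeta (of_real s) = of_real Z"
    using dzeta_sums[of "of_real s"] s unfolding npow_of_real by (simp add: sums_iff)
  define V where "V = lebesgue_integral lborel (\<lambda>u. kern u * exp (s * u))"
  have V: "V = Gamma (s / 2) / 2 * pi powr (- (s / 2)) * Z"
    using sums_unique2[OF kern_mellin(2)[OF s] sums_mult[OF Z]] by (simp add: V_def)
  have x: "xi (of_real s) = of_real (s * (s - 1) * (2 * V))"
  proof -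
    \<comment> \<open>The summand 1 in \<open>xi\<close> cancels s (s - 1) (- 1 / (s - 1) + 1 / s) =
      - 1.\<close>
    have "s * (s - 1) * (2 * V - 1 / (s - 1) + 1 / s) + 1 = s * (s - 1) * (2 * V)" using s by (simp add: field_simps)
    moreover have "xi (of_real s) = of_real (s * (s - 1) * (2 * V - 1 / (s - 1) + 1 / s) + 1)"
      unfolding xi_def xi_int_real[OF s] V_def by simp
    ultimately show ?thesis by metis
  qed
  have G: "Gamma (s / 2 + 1) = s / 2 * Gamma (s / 2)" 
    using Gamma_plus1[of "s / 2"] nonpos_Ints_nonpos[of "s / 2"] s by force
  have Gp: "Gamma (s / 2) > 0" using s by (intro Gamma_real_pos) auto
  have h: "hfac (of_real s) = of_real (pi powr (s / 2) * inverse (s / 2 * Gamma (s / 2)) / 2)"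
  proof -
    have "exp (of_real s * of_real (ln pi / 2)) = complex_of_real (pi powr (s / 2))"
      unfolding of_real_mult[symmetric] exp_of_real by (simp add: powr_def)
    moreover have "rGamma (of_real s / 2 + 1) = complex_of_real (rGamma (s / 2 + 1))"
      using rGamma_complex_of_real[of "s / 2 + 1"] by simp
    moreover have "rGamma (s / 2 + 1) = inverse (s / 2 * Gamma (s / 2))"
      using G by (simp only: rGamma_inverse_Gamma)
    ultimately show ?thesis by (simp add: hfac_def)
  qed
  have "zeta_ext (of_real s) = of_real (pi powr (s / 2) * inverse (s / 2 * Gamma (s / 2)) / 2 * (s * (s - 1) * (2 * V)) / (s - 1))"
    unfolding zeta_ext_def h x by simp
  also have "pi powr (s / 2) * inverse (s / 2 * Gamma (s / 2)) / 2 * (s * (s - 1) * (2 * V)) / (s - 1) = pi powr (s / 2) * (2 * V) / Gamma (s / 2)"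
  proof -
    have "P * inverse (s / 2 * G) / 2 * (s * w * (2 * V)) / w = P * (2 * V) / G" if "w \<noteq> 0" "G \<noteq> 0" "s \<noteq> 0" for P G w s V :: real
      using that by (simp add: field_simps)
    then show ?thesis using s Gp by simp
  qed
  also have "\<dots> = Z" using Gp by (simp add: V powr_minus field_simps)
  finally show ?thesis using d by simp
qed

lemma zeta_ext_eq_dzeta:
  assumes "Re s > 1" shows "zeta_ext s = dzeta s"
proof -
  let ?S = "{s. Re s > 1}"
  have hol: "(\<lambda>s. zeta_ext s - dzeta s) holomorphic_on ?S"
    by (intro holomorphic_intros dzeta_holomorphic holomorphic_on_subset[OF zeta_ext_holomorphic]) auto
  have op: "open ?S" "connected ?S"
    by (auto simp: open_halfspace_Re_gt intro!: convex_connected convex_halfspace_Re_gt)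
  have "zeta_ext s - dzeta s = 0"
  proof (rule analytic_continuation[OF hol op, of "of_real ` {1<..}" 2])
    show "(2::complex) islimpt of_real ` {1<..}"
      unfolding islimpt_approachable
    proof (intro allI impI)
      fix e :: real assume e: "e > 0"
      show "\<exists>x'\<in>complex_of_real ` {1<..}. x' \<noteq> 2 \<and> dist x' 2 < e"
      proof (rule bexI[of _ "of_real (2 + e / 2)"], rule conjI)
        show "complex_of_real (2 + e / 2) \<noteq> 2" using e by (simp add: complex_eq_iff)
        have "dist (complex_of_real (2 + e / 2)) 2 = norm (complex_of_real (e / 2))" by (simp add: dist_norm)
        also have "\<dots> < e" using e by (simp only: norm_of_real)
        finally show "dist (complex_of_real (2 + e / 2)) 2 < e" .
        show "complex_of_real (2 + e / 2) \<in> complex_of_real ` {1<..}" using e by (intro imageI) simp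
      qed
    qed
  qed (use assms zeta_ext_real in auto)
  then show ?thesis by simp
qed

text \<open>\<open>zeta\<close> is a choice, so its defining property is available only once a
  witness is exhibited; \<open>zeta_ext\<close> is that witness.\<close>

lemma zeta_spec: "zeta holomorphic_on (- {1}) \<and> (\<forall>s. Re s > 1 \<longrightarrow> (\<lambda>n. 1 / of_nat (Suc n) powr s) sums zeta s)"
  unfolding zeta_def
proof (rule someI[of _ zeta_ext], intro conjI allI impI)
  fix s :: complex assume "Re s > 1"
  then show "(\<lambda>n. 1 / of_nat (Suc n) powr s) sums zeta_ext s"
    using dzeta_sums[of s] zeta_ext_eq_dzeta[of s] by (simp add: npow_conv_powr)
qed (rule zeta_ext_holomorphic)

lemma zeta_eq_dzeta: "Re s > 1 \<Longrightarrow> zeta s = dzeta s"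
  using zeta_spec dzeta_sums[of s] unfolding npow_conv_powr by (metis sums_unique2)

text \<open>At 1 the value of \<open>zeta\<close> is arbitrary, whereas \<open>zeta_ext 1\<close> is
  0 by the convention for division by zero; hence the exclusion.\<close>

lemma zeta_eq_ext:
  assumes "s \<noteq> 1" shows "zeta s = zeta_ext s"
proof -
  have hol: "(\<lambda>s. zeta s - zeta_ext s) holomorphic_on (- {1})"
    using zeta_spec by (intro holomorphic_intros zeta_ext_holomorphic) auto
  have op: "open (- {1::complex})" "connected (- {1::complex})"
    by (auto intro!: connected_punctured_universe)
  have "zeta s - zeta_ext s = 0"
  proof (rule analytic_continuation[OF hol op, of "{s. Re s > 1}" 2])
    have "2 \<in> {s. Re s > 1}" by simp
    then show "(2::complex) islimpt {s. Re s > 1}"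
      by (rule interior_limit_point[OF interior_open[OF open_halfspace_Re_gt, THEN equalityD2, THEN subsetD]])
  qed (use assms zeta_eq_dzeta zeta_ext_eq_dzeta in auto)
  then show ?thesis by simp
qed

lemma xi_reflect: "xi (1 - s) = xi s"
  by (simp add: xi_def xi_int_reflect algebra_simps)

lemma xi_cnj: "xi (cnj s) = cnj (xi s)"
  by (simp add: xi_def xi_int_cnj)

lemma xi_growth: "\<exists>A\<ge>0. \<forall>s. norm (xi s) \<le> exp (A * (1 + norm s)\<^sup>2)"
proof -
  obtain C where C: "C > 0" "\<And>s. norm (xi_int s) \<le> C * exp ((1 + norm s)\<^sup>2)" using xi_int_bound by auto
  have "norm (xi s) \<le> exp ((C + 3) * (1 + norm s)\<^sup>2)" for s
  proof -
    define r where "r = (1 + norm s)\<^sup>2"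
    have r1: "r \<ge> 1" by (simp add: r_def one_le_power)
    have "norm (s * (s - 1)) \<le> norm s * (norm s + 1)"
      unfolding norm_mult using norm_triangle_ineq4[of s 1] by (intro mult_left_mono) auto
    also have "\<dots> \<le> r" by (simp add: r_def power2_eq_square algebra_simps)
    finally have 1: "norm (s * (s - 1)) \<le> r" .
    have "norm (xi s) \<le> norm (s * (s - 1) * xi_int s) + 1"
      unfolding xi_def using norm_triangle_ineq[of "s * (s - 1) * xi_int s" 1] by simp
    also have "norm (s * (s - 1) * xi_int s) \<le> r * (C * exp r)"
      unfolding norm_mult[of "s * (s - 1)"] using 1 C(2)[of s] r1 by (intro mult_mono) (auto simp: r_def)
    also have "r * (C * exp r) + 1 \<le> exp r * (exp (C * r) * exp r)"
    proof -
      have a: "r \<le> exp r" using exp_ge_add_one_self[of r] by linarith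
      have "C \<le> C * r" using r1 C(1) by simp
      then have "C + 1 \<le> exp (C * r)" using exp_ge_add_one_self[of "C * r"] by linarith
      then have b: "C * exp r + 1 \<le> exp (C * r) * exp r"
      proof -
        have "1 \<le> exp r" using r1 by simp
        moreover have "(C + 1) * exp r \<le> exp (C * r) * exp r" using \<open>C + 1 \<le> exp (C * r)\<close> by (rule mult_right_mono) simp
        ultimately show ?thesis by (simp only: ring_distribs)
      qed
      have "r * (C * exp r) + 1 \<le> r * (C * exp r + 1)" using r1 by (simp add: algebra_simps)
      also have "\<dots> \<le> exp r * (exp (C * r) * exp r)"
        using a b C(1) r1 by (intro mult_mono) auto
      finally show ?thesis .
    qed
    also have "\<dots> = exp (r + C * r + r)" by (simp only: exp_add mult.assoc)
    also have "\<dots> \<le> exp ((C + 3) * r)" using r1 by (simp add: algebra_simps)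
    finally show ?thesis by (simp add: r_def)
  qed
  then show ?thesis using C(1) by (intro exI[of _ "C + 3"]) auto
qed


lemma
  fixes f :: "complex \<Rightarrow> complex"
  assumes hol: "f holomorphic_on UNIV" and nz: "f c \<noteq> 0"
  shows entire_zero_factor: "\<exists>k r. r > 0 \<and> k holomorphic_on ball p r \<and> k p \<noteq> 0 \<and>
      (\<forall>w\<in>ball p r. f w = k w * (w - p) ^ nat (zorder f p) \<and> k w \<noteq> 0)"
    and entire_zorder: "if f p = 0 then zorder f p > 0 else zorder f p = 0"
proof -
  have "\<exists>w\<in>UNIV. f w \<noteq> 0" using nz by blast
  from zorder_exist_zero[OF hol open_UNIV connected_UNIV UNIV_I this, of p]
  obtain r where r: "r > 0" "zor_poly f p holomorphic_on cball p r"
    "\<And>w. w \<in> cball p r \<Longrightarrow> f w = zor_poly f p w * (w - p) ^ nat (zorder f p) \<and> zor_poly f p w \<noteq> 0"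
    and n: "if f p = 0 then zorder f p > 0 else zorder f p = 0" by blast
  show "if f p = 0 then zorder f p > 0 else zorder f p = 0" by (rule n)
  have "zor_poly f p holomorphic_on ball p r" using r(2) by (rule holomorphic_on_subset) auto
  then show "\<exists>k r. r > 0 \<and> k holomorphic_on ball p r \<and> k p \<noteq> 0 \<and>
      (\<forall>w\<in>ball p r. f w = k w * (w - p) ^ nat (zorder f p) \<and> k w \<noteq> 0)"
    using r by (intro exI[of _ "zor_poly f p"] exI[of _ r]) auto
qed

text \<open>The order of vanishing is the residue of the logarithmic derivative. Points where f does
  not vanish are included, with order 0, so that all points of the line Re s = 1 can be treated
  alike.\<close>

lemma tendsto_logderiv_zorder:
  fixes f :: "complex \<Rightarrow> complex"
  assumes hol: "f holomorphic_on UNIV" and nz: "f c \<noteq> 0"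
  shows "((\<lambda>w. (w - p) * (deriv f w / f w)) \<longlongrightarrow> of_int (zorder f p)) (at p)"
proof -
  obtain k r where k: "r > 0" "k holomorphic_on ball p r" "k p \<noteq> 0"
    "\<And>w. w \<in> ball p r \<Longrightarrow> f w = k w * (w - p) ^ nat (zorder f p) \<and> k w \<noteq> 0"
    using entire_zero_factor[OF hol nz, of p] by blast
  have ord: "zorder f p \<ge> 0" using entire_zorder[OF hol nz, of p] by (auto split: if_splits)
  define n where "n = nat (zorder f p)"
  have id: "(w - p) * (deriv f w / f w) = (w - p) * (deriv k w / k w) + of_nat n" if w: "w \<in> ball p r - {p}" for w
  proof -
    have kd: "(k has_field_derivative deriv k w) (at w)"
      by (rule holomorphic_derivI[OF k(2)]) (use w in auto)
    have "((\<lambda>w. k w * (w - p) ^ n) has_field_derivative deriv k w * (w - p) ^ n + of_nat n * (w - p) ^ (n - 1) * k w) (at w)"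
      by (auto intro!: derivative_eq_intros kd)
    then have "(f has_field_derivative deriv k w * (w - p) ^ n + of_nat n * (w - p) ^ (n - 1) * k w) (at w)"
      by (rule has_field_derivative_transform_within_open[of _ _ _ "ball p r"]) (use k(4) w in \<open>auto simp: n_def\<close>)
    then have "deriv f w = deriv k w * (w - p) ^ n + of_nat n * (w - p) ^ (n - 1) * k w" by (rule DERIV_imp_deriv)
    moreover have "f w = k w * (w - p) ^ n" "k w \<noteq> 0" using k(4)[of w] w by (auto simp: n_def)
    moreover have "w - p \<noteq> 0" using w by simp
    moreover have "x * ((K' * x ^ n + of_nat n * x ^ (n - 1) * K) / (K * x ^ n)) = x * (K' / K) + of_nat n"
      if "x \<noteq> 0" "K \<noteq> 0" for x K K' :: complex
      using that by (cases n) (simp_all add: field_simps)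
    ultimately show ?thesis by simp
  qed
  have c: "continuous_on (ball p r) k" "continuous_on (ball p r) (deriv k)"
    using k(2) by (auto intro!: holomorphic_on_imp_continuous_on holomorphic_deriv)
  have "((\<lambda>w. (w - p) * (deriv k w / k w) + of_nat n) \<longlongrightarrow> (p - p) * (deriv k p / k p) + of_nat n) (at p)"
    using c k(1,3) by (intro tendsto_intros) (auto simp: continuous_on_eq_continuous_at isCont_def)
  moreover have "eventually (\<lambda>w. (w - p) * (deriv k w / k w) + of_nat n = (w - p) * (deriv f w / f w)) (at p)"
  proof -
    have "eventually (\<lambda>w. w \<in> ball p r - {p}) (at p)"
      using k(1) by (auto simp: eventually_at dist_commute intro!: exI[of _ r])
    then show ?thesis by eventually_elim (use id in simp)
  qed
  ultimately have "((\<lambda>w. (w - p) * (deriv f w / f w)) \<longlongrightarrow> (p - p) * (deriv k p / k p) + of_nat n) (at p)"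
    by (rule Lim_transform_eventually)
  then show ?thesis using ord by (simp add: n_def)
qed

section \<open>The logarithmic derivative of zeta\<close>

lemma hfac_arg: "Re s > -2 \<Longrightarrow> s / 2 + 1 \<notin> \<int>\<^sub>\<le>\<^sub>0"
proof
  assume s: "Re s > -2" and "s / 2 + 1 \<in> \<int>\<^sub>\<le>\<^sub>0"
  then obtain n where "s / 2 + 1 = - of_nat n" by (auto elim!: nonpos_Ints_cases')
  then have "Re (s / 2 + 1) = - real n" by simp
  then show False using s by simp
qed

lemma hfac_nonzero: "Re s > -2 \<Longrightarrow> hfac s \<noteq> 0"
  using hfac_arg[of s] by (simp add: hfac_def rGamma_eq_zero_iff)

text \<open>The logarithmic derivative of \<open>hfac\<close>; for Re s > -2 the argument s / 2 + 1
  avoids the poles of the digamma function.\<close>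

definition hlog :: "complex \<Rightarrow> complex" where "hlog s = of_real (ln pi / 2) - Digamma (s / 2 + 1) / 2"

lemma hfac_deriv:
  assumes "Re s > -2" shows "(hfac has_field_derivative hfac s * hlog s) (at s)"
proof -
  have r: "(rGamma has_field_derivative - rGamma (s / 2 + 1) * Digamma (s / 2 + 1)) (at (s / 2 + 1))"
    by (rule has_field_derivative_rGamma_no_nonpos_int[OF hfac_arg[OF assms]])
  have "((\<lambda>s. rGamma (s / 2 + 1)) has_field_derivative - rGamma (s / 2 + 1) * Digamma (s / 2 + 1) * (1 / 2)) (at s)"
    by (rule DERIV_chain2[where f = rGamma and g = "\<lambda>s. s / 2 + 1", OF r]) (auto intro!: derivative_eq_intros)
  moreover have "((\<lambda>s. exp (s * of_real (ln pi / 2))) has_field_derivative exp (s * of_real (ln pi / 2)) * of_real (ln pi / 2)) (at s)"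
    by (auto intro!: derivative_eq_intros)
  ultimately have "((\<lambda>s. exp (s * of_real (ln pi / 2)) * rGamma (s / 2 + 1) / 2) has_field_derivative
     (exp (s * of_real (ln pi / 2)) * of_real (ln pi / 2) * rGamma (s / 2 + 1) +
      - rGamma (s / 2 + 1) * Digamma (s / 2 + 1) * (1 / 2) * exp (s * of_real (ln pi / 2))) / 2) (at s)"
    by (intro DERIV_cdivide DERIV_mult)
  also have "(exp (s * of_real (ln pi / 2)) * of_real (ln pi / 2) * rGamma (s / 2 + 1) +
      - rGamma (s / 2 + 1) * Digamma (s / 2 + 1) * (1 / 2) * exp (s * of_real (ln pi / 2))) / 2 = hfac s * hlog s"
    by (simp add: hfac_def hlog_def right_diff_distrib diff_divide_distrib mult_ac)
  finally show ?thesis by (simp only: hfac_def[abs_def])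
qed

text \<open>In the series for the digamma function the k-th term is (z - 1) / ((k + 1) (z + k)), and
  |z + k| >= (k + 1) / 2 for Re z >= 1/2. This gives linear instead of logarithmic growth, which the
  decay of the smoothing kernel absorbs.\<close>

lemma hlog_bound: "\<exists>C>0. \<forall>s. Re s \<ge> -1 \<longrightarrow> norm (hlog s) \<le> C * (1 + norm s)"
proof -
  define S where "S = (\<Sum>k. 2 * inverse ((real (Suc k))\<^sup>2))"
  have sm: "summable (\<lambda>k. 2 * inverse ((real (Suc k))\<^sup>2))"
    using summable_powr_Suc[of 2] by (intro summable_mult) (simp add: powr_minus powr_numeral del: of_nat_Suc)
  have S: "S \<ge> 0" unfolding S_def by (intro suminf_nonneg sm) auto
  have dig: "norm (Digamma z) \<le> norm (z - 1) * S + euler_mascheroni" if z: "Re z \<ge> 1 / 2" for z :: complex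
  proof -
    have z0: "z \<noteq> 0" using z by auto
    have t: "norm (inverse (of_nat (Suc k)) - inverse (z + of_nat k)) \<le> norm (z - 1) * (2 * inverse ((real (Suc k))\<^sup>2))" for k
    proof -
      have "Re (z + of_nat k) \<le> norm (z + of_nat k)" by (rule complex_Re_le_cmod)
      then have n: "norm (z + of_nat k) \<ge> real (Suc k) / 2" using z by simp
      then have nz: "z + of_nat k \<noteq> 0" by (auto simp del: of_nat_Suc)
      have "inverse (of_nat (Suc k)) - inverse (z + of_nat k) = (z - 1) / (of_nat (Suc k) * (z + of_nat k))"
      proof -
        have "(of_nat (Suc k) :: complex) \<noteq> 0" by (simp del: of_nat_Suc)
        then show ?thesis using nz by (simp add: divide_simps)
      qed
      then have "norm (inverse (of_nat (Suc k)) - inverse (z + of_nat k)) = norm (z - 1) / (real (Suc k) * norm (z + of_nat k))"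
        by (simp add: norm_divide norm_mult del: of_nat_Suc)
      also have "\<dots> \<le> norm (z - 1) / (real (Suc k) * (real (Suc k) / 2))"
      proof (rule divide_left_mono)
        show "real (Suc k) * (real (Suc k) / 2) \<le> real (Suc k) * norm (z + of_nat k)"
          using n by (rule mult_left_mono) simp
        have "real (Suc k) > 0" "norm (z + of_nat k) > 0" using nz by (simp_all del: of_nat_Suc)
        then show "0 < real (Suc k) * norm (z + of_nat k) * (real (Suc k) * (real (Suc k) / 2))"
          by (simp del: of_nat_Suc)
      qed simp
      also have "\<dots> = norm (z - 1) * (2 * inverse ((real (Suc k))\<^sup>2))"
      proof -
        have "x / (a * (a / 2)) = x * (2 * inverse (a\<^sup>2))" if "a \<noteq> 0" for a x :: real
          using that by (simp add: field_simps power2_eq_square)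
        then show ?thesis by (simp del: of_nat_Suc)
      qed
      finally show ?thesis .
    qed
    have "norm (\<Sum>k. inverse (of_nat (Suc k)) - inverse (z + of_nat k)) \<le> (\<Sum>k. norm (z - 1) * (2 * inverse ((real (Suc k))\<^sup>2)))"
      by (rule norm_suminf_le[OF t summable_mult[OF sm]])
    also have "\<dots> = norm (z - 1) * S" unfolding S_def by (rule suminf_mult[OF sm])
    finally have "norm (\<Sum>k. inverse (of_nat (Suc k)) - inverse (z + of_nat k)) \<le> norm (z - 1) * S" .
    moreover have "norm (euler_mascheroni :: complex) = euler_mascheroni"
      by (metis of_real_euler_mascheroni norm_of_real abs_of_pos euler_mascheroni_pos)
    ultimately show ?thesis
      unfolding Digamma_def using norm_triangle_ineq4[of "\<Sum>k. inverse (of_nat (Suc k)) - inverse (z + of_nat k)" "euler_mascheroni"]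
      by linarith
  qed
  define C where "C = \<bar>ln pi\<bar> + S + euler_mascheroni + 1"
  have eg: "(euler_mascheroni :: real) > 0" by (rule euler_mascheroni_pos)
  show ?thesis
  proof (rule exI[of _ C], intro conjI allI impI)
    show "C > 0" using S eg by (simp add: C_def)
    fix s :: complex assume s: "Re s \<ge> -1"
    have "norm (hlog s) \<le> norm (of_real (ln pi / 2) :: complex) + norm (Digamma (s / 2 + 1) / 2)"
      unfolding hlog_def by (rule norm_triangle_ineq4)
    also have "norm (of_real (ln pi / 2) :: complex) \<le> \<bar>ln pi\<bar>" by (simp only: norm_of_real)
    also have "norm (Digamma (s / 2 + 1) / 2) \<le> norm s * S + euler_mascheroni"
    proof -
      have "Re (s / 2 + 1) \<ge> 1 / 2" using s by simp
      from dig[OF this] have "norm (Digamma (s / 2 + 1)) \<le> norm s / 2 * S + euler_mascheroni" by (simp add: norm_divide)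
      also have "\<dots> \<le> norm s * S + euler_mascheroni" using S by (intro add_right_mono mult_right_mono) auto
      finally have "norm (Digamma (s / 2 + 1)) \<le> norm s * S + euler_mascheroni" .
      moreover have "norm (Digamma (s / 2 + 1) / 2) \<le> norm (Digamma (s / 2 + 1))" by (simp add: norm_divide)
      ultimately show ?thesis by linarith
    qed
    also have "\<bar>ln pi\<bar> + (norm s * S + euler_mascheroni) \<le> C * (1 + norm s)"
    proof -
      have "C * (1 + norm s) = C + C * norm s" by (simp add: algebra_simps)
      moreover have "norm s * S \<le> C * norm s"
        using S eg mult_right_mono[of S C "norm s"] by (simp add: C_def mult.commute)
      moreover have "\<bar>ln pi\<bar> + euler_mascheroni \<le> C" using S by (simp add: C_def)
      ultimately show ?thesis by linarith
    qed
    finally show "norm (hlog s) \<le> C * (1 + norm s)" by simp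
  qed
qed

lemma xi_deriv: "(xi has_field_derivative deriv xi s) (at s)"
  by (rule holomorphic_derivI[OF xi_holomorphic]) auto

lemma zeta_logderiv:
  assumes s: "Re s > -2" "s \<noteq> 1" "xi s \<noteq> 0"
  shows "deriv zeta s / zeta s = hlog s + deriv xi s / xi s - 1 / (s - 1)"
proof -
  have "((\<lambda>s. hfac s * xi s / (s - 1)) has_field_derivative
     ((hfac s * hlog s * xi s + deriv xi s * hfac s) * (s - 1) - hfac s * xi s) / ((s - 1) * (s - 1))) (at s)"
    using s by (auto intro!: derivative_eq_intros hfac_deriv xi_deriv)
  then have "(zeta has_field_derivative
     ((hfac s * hlog s * xi s + deriv xi s * hfac s) * (s - 1) - hfac s * xi s) / ((s - 1) * (s - 1))) (at s)"
    by (rule has_field_derivative_transform_within_open[of _ _ _ "- {1}"]) (use s zeta_eq_ext in \<open>auto simp: zeta_ext_def\<close>)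
  then have d: "deriv zeta s = ((hfac s * hlog s * xi s + deriv xi s * hfac s) * (s - 1) - hfac s * xi s) / ((s - 1) * (s - 1))"
    by (rule DERIV_imp_deriv)
  have z: "zeta s = hfac s * xi s / (s - 1)" using s zeta_eq_ext by (simp add: zeta_ext_def)
  have gen: "((h * l * x + x' * h) * w - h * x) / (w * w) / (h * x / w) = l + x' / x - 1 / w"
    if "h \<noteq> 0" "x \<noteq> 0" "w \<noteq> 0" for h l x x' w :: complex
    using that by (simp add: divide_simps) (simp add: algebra_simps)
  show ?thesis unfolding d z by (rule gen) (use s hfac_nonzero in auto)
qed

lemma xi_1 [simp]: "xi 1 = 1" and xi_0 [simp]: "xi 0 = 1" by (simp_all add: xi_def)

lemma xi_nonzero_gt_1: assumes "Re s > 1" shows "xi s \<noteq> 0"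
proof -
  have s1: "s \<noteq> 1" using assms by auto
  have "zeta s \<noteq> 0" using zeta_eq_dzeta[OF assms] dzeta_nonzero[OF assms] by simp
  then show ?thesis using zeta_eq_ext[OF s1] by (auto simp: zeta_ext_def)
qed

lemma zeta_logderiv_dmang:
  assumes "Re s > 1" shows "deriv zeta s / zeta s = - dmang s"
proof -
  have "deriv zeta s = deriv dzeta s"
  proof (rule deriv_cong_ev)
    have "eventually (\<lambda>x. x \<in> {s. Re s > 1}) (nhds s)"
      using assms by (intro eventually_nhds_in_open open_halfspace_Re_gt) auto
    then show "\<forall>\<^sub>F x in nhds s. zeta x = dzeta x" by eventually_elim (simp add: zeta_eq_dzeta)
  qed simp
  then show ?thesis using deriv_dzeta[OF assms] dzeta_nonzero[OF assms] zeta_eq_dzeta[OF assms] by simp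
qed

lemma dmang_norm_le:
  assumes "Re s \<ge> 2" shows "norm (dmang s) \<le> (\<Sum>n. mangoldt (Suc n) * real (Suc n) powr (- 2))"
proof -
  have sm: "summable (\<lambda>n. mangoldt (Suc n) * real (Suc n) powr (- 2))" by (rule summable_mangoldt_powr_Suc) simp
  show ?thesis unfolding dmang_def
  proof (rule norm_suminf_le[OF _ sm])
    fix n show "norm (mangoldt (Suc n) * npow n s) \<le> mangoldt (Suc n) * real (Suc n) powr (- 2)"
      using npow_powr_mono[OF assms, of n] by (simp add: norm_mult mult_left_mono mangoldt_nonneg del: of_nat_Suc)
  qed
qed

section \<open>Non-vanishing on the line Re s = 1\<close>

lemma re_dmang_341:
  assumes \<sigma>: "\<sigma> > 1"
  shows "Re (3 * dmang (of_real \<sigma>) + 4 * dmang (Complex \<sigma> t) + dmang (Complex \<sigma> (2 * t))) \<ge> 0"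
proof -
  have R: "Re (npow n (Complex \<sigma> u)) = real (Suc n) powr (- \<sigma>) * cos (u * ln (real (Suc n)))" for n u
    by (simp add: npow_def Re_exp powr_def)
  have S: "(\<lambda>n. Re (3 * (mangoldt (Suc n) * npow n (of_real \<sigma>)) + 4 * (mangoldt (Suc n) * npow n (Complex \<sigma> t)) + mangoldt (Suc n) * npow n (Complex \<sigma> (2 * t))))
    sums Re (3 * dmang (of_real \<sigma>) + 4 * dmang (Complex \<sigma> t) + dmang (Complex \<sigma> (2 * t)))"
    using \<sigma> by (intro sums_Re sums_add sums_mult dmang_sums) auto
  show ?thesis
  proof (rule sums_le[OF _ sums_zero S])
    fix n
    define c where "c = cos (t * ln (real (Suc n)))"
    have c2: "cos (2 * t * ln (real (Suc n))) = 2 * c\<^sup>2 - 1"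
      unfolding c_def using cos_double_cos[of "t * ln (real (Suc n))"] by (simp add: mult.assoc)
    have m: "Re (mangoldt (Suc n) * z) = mangoldt (Suc n) * Re z" for z :: complex by simp
    have r: "Re (npow n (of_real \<sigma>)) = real (Suc n) powr (- \<sigma>)" by (simp add: npow_of_real del: of_nat_Suc)
    have "Re (3 * (mangoldt (Suc n) * npow n (of_real \<sigma>)) + 4 * (mangoldt (Suc n) * npow n (Complex \<sigma> t)) + mangoldt (Suc n) * npow n (Complex \<sigma> (2 * t)))
      = 3 * Re (mangoldt (Suc n) * npow n (of_real \<sigma>)) + 4 * Re (mangoldt (Suc n) * npow n (Complex \<sigma> t)) + Re (mangoldt (Suc n) * npow n (Complex \<sigma> (2 * t)))"
      by (simp only: plus_complex.simps) simp
    also have "\<dots> = mangoldt (Suc n) * real (Suc n) powr (- \<sigma>) * (3 + 4 * c + (2 * c\<^sup>2 - 1))"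
      unfolding m R r c2 c_def[symmetric] by (simp add: algebra_simps)
    \<comment> \<open>Mertens' inequality: the combination 3, 4, 1 of cosines is twice a
      square.\<close>
    also have "3 + 4 * c + (2 * c\<^sup>2 - 1) = 2 * (1 + c)\<^sup>2" by (simp add: power2_eq_square algebra_simps)
    also have "mangoldt (Suc n) * real (Suc n) powr (- \<sigma>) * (2 * (1 + c)\<^sup>2) \<ge> 0"
      by (intro mult_nonneg_nonneg mangoldt_nonneg) auto
    finally show "0 \<le> Re (3 * (mangoldt (Suc n) * npow n (of_real \<sigma>)) + 4 * (mangoldt (Suc n) * npow n (Complex \<sigma> t)) + mangoldt (Suc n) * npow n (Complex \<sigma> (2 * t)))" .
  qed
qed

text \<open>The limit is the residue of \<open>dmang\<close>, continued to the line, at 1 + i t,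
  approached horizontally from the right. The pole of \<open>zeta\<close> contributes 1 when t = 0,
  a zero of \<open>xi\<close> subtracts its order, and \<open>hlog\<close> is continuous there and
  drops out.\<close>

lemma dmang_limit:
  "((\<lambda>\<sigma>. of_real (\<sigma> - 1) * dmang (Complex \<sigma> t)) \<longlongrightarrow> (if t = 0 then 1 else 0) - of_int (zorder xi (Complex 1 t))) (at_right 1)"
proof -
  define p where "p = Complex 1 t"
  have nz: "xi 1 \<noteq> 0" by simp
  have Cc: "((\<lambda>\<sigma>. Complex \<sigma> t) \<longlongrightarrow> p) (at_right 1)"
    unfolding p_def by (intro tendsto_intros)
  have fl: "filterlim (\<lambda>\<sigma>. Complex \<sigma> t) (at p) (at_right 1)"
    unfolding filterlim_at using Cc eventually_at_right_less[of "1::real"]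
    by (auto simp: p_def elim!: eventually_mono)
  have l1: "((\<lambda>\<sigma>. (Complex \<sigma> t - p) * (deriv xi (Complex \<sigma> t) / xi (Complex \<sigma> t))) \<longlongrightarrow> of_int (zorder xi p)) (at_right 1)"
    by (rule filterlim_compose[OF tendsto_logderiv_zorder[OF xi_holomorphic nz] fl])
  have s0: "((\<lambda>\<sigma>. of_real (\<sigma> - 1)) \<longlongrightarrow> (0::complex)) (at_right 1)"
    by (auto intro!: tendsto_eq_intros)
  have hc: "((\<lambda>\<sigma>. hlog (Complex \<sigma> t)) \<longlongrightarrow> hlog p) (at_right 1)"
  proof (rule isCont_tendsto_compose[OF _ Cc])
    have "(\<lambda>s. hlog s) = (\<lambda>s. of_real (ln pi / 2) - Digamma (s / 2 + 1) / 2)" by (simp add: hlog_def)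
    moreover have "isCont (\<lambda>s. Digamma (s / 2 + 1)) p"
      by (rule isCont_Polygamma)
         (use hfac_arg[of p] in \<open>auto simp: p_def intro!: continuous_intros\<close>)
    ultimately show "isCont hlog p" by (auto intro!: continuous_intros)
  qed
  have l2: "((\<lambda>\<sigma>. of_real (\<sigma> - 1) * (1 / (Complex \<sigma> t - 1))) \<longlongrightarrow> (if t = 0 then 1 else 0)) (at_right 1)"
  proof (cases "t = 0")
    case True
    have "eventually (\<lambda>\<sigma>. 1 = of_real (\<sigma> - 1) * (1 / (Complex \<sigma> t - 1))) (at_right 1)"
      using eventually_at_right_less[of "1::real"]
    proof eventually_elim
      case (elim \<sigma>)
      have "Complex \<sigma> t - 1 = of_real (\<sigma> - 1)" using True by (simp add: complex_eq_iff)
      moreover have "complex_of_real (\<sigma> - 1) \<noteq> 0" using elim by (simp add: complex_eq_iff)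
      ultimately show ?case by simp
    qed
    from Lim_transform_eventually[OF tendsto_const this] show ?thesis using True by simp
  next
    case False
    have "p - 1 \<noteq> 0" using False by (simp add: p_def complex_eq_iff)
    then have "((\<lambda>\<sigma>. of_real (\<sigma> - 1) * (1 / (Complex \<sigma> t - 1))) \<longlongrightarrow> 0 * (1 / (p - 1))) (at_right 1)"
      by (intro tendsto_intros s0 Cc)
    then show ?thesis using False by simp
  qed
  have "((\<lambda>\<sigma>. of_real (\<sigma> - 1) * (1 / (Complex \<sigma> t - 1)) - (Complex \<sigma> t - p) * (deriv xi (Complex \<sigma> t) / xi (Complex \<sigma> t)) - of_real (\<sigma> - 1) * hlog (Complex \<sigma> t))
     \<longlongrightarrow> (if t = 0 then 1 else 0) - of_int (zorder xi p) - 0 * hlog p) (at_right 1)"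
    by (intro tendsto_diff tendsto_mult l1 l2 s0 hc)
  moreover have "eventually (\<lambda>\<sigma>. of_real (\<sigma> - 1) * (1 / (Complex \<sigma> t - 1)) - (Complex \<sigma> t - p) * (deriv xi (Complex \<sigma> t) / xi (Complex \<sigma> t)) - of_real (\<sigma> - 1) * hlog (Complex \<sigma> t)
     = of_real (\<sigma> - 1) * dmang (Complex \<sigma> t)) (at_right 1)"
    using eventually_at_right_less[of "1::real"]
  proof eventually_elim
    case (elim \<sigma>)
    have e: "Complex \<sigma> t - p = of_real (\<sigma> - 1)" by (simp add: p_def complex_eq_iff)
    have "Complex \<sigma> t \<noteq> 1" using elim by (auto simp: complex_eq_iff)
    then have "- dmang (Complex \<sigma> t) = hlog (Complex \<sigma> t) + deriv xi (Complex \<sigma> t) / xi (Complex \<sigma> t) - 1 / (Complex \<sigma> t - 1)"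
      using zeta_logderiv[of "Complex \<sigma> t"] zeta_logderiv_dmang[of "Complex \<sigma> t"] xi_nonzero_gt_1[of "Complex \<sigma> t"] elim by simp
    then have "dmang (Complex \<sigma> t) = 1 / (Complex \<sigma> t - 1) - deriv xi (Complex \<sigma> t) / xi (Complex \<sigma> t) - hlog (Complex \<sigma> t)"
      by (simp add: algebra_simps add_eq_0_iff)
    then show ?case unfolding e by (simp only: right_diff_distrib)
  qed
  ultimately show ?thesis by (simp add: p_def Lim_transform_eventually)
qed

text \<open>Multiplying the inequality of \<open>re_dmang_341\<close> by \<sigma> - 1 and letting
  \<sigma> tend to 1 gives 3 - 4 m - m' >= 0 for the orders m and m' at 1 + i t and 1 + 2 i t, hence
  m = 0. This is what makes each single zero contribute o(y), also below the height where condition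
  (1) begins.\<close>

lemma xi_nonzero_line_1: "xi (Complex 1 t) \<noteq> 0"
proof (cases "t = 0")
  case True
  then have "Complex 1 t = 1" by (simp add: complex_eq_iff)
  then show ?thesis by simp
next
  case False
  have nz: "xi 1 \<noteq> 0" by simp
  define m where "m = zorder xi (Complex 1 t)"
  define m' where "m' = zorder xi (Complex 1 (2 * t))"
  have ord: "zorder xi p \<ge> 0" "xi p = 0 \<Longrightarrow> zorder xi p > 0" "xi p \<noteq> 0 \<Longrightarrow> zorder xi p = 0" for p
    using entire_zorder[OF xi_holomorphic nz, of p] by (auto split: if_splits)
  have "Complex 1 0 = 1" by (simp add: complex_eq_iff)
  then have z0: "zorder xi (Complex 1 0) = 0" using ord(3)[of 1] by simp
  have "((\<lambda>\<sigma>. Re (3 * (of_real (\<sigma> - 1) * dmang (Complex \<sigma> 0)) + 4 * (of_real (\<sigma> - 1) * dmang (Complex \<sigma> t)) + of_real (\<sigma> - 1) * dmang (Complex \<sigma> (2 * t))))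
     \<longlongrightarrow> Re (3 * ((if (0::real) = 0 then 1 else 0) - of_int (zorder xi (Complex 1 0))) + 4 * ((if t = 0 then 1 else 0) - of_int (zorder xi (Complex 1 t)))
        + ((if 2 * t = 0 then 1 else 0) - of_int (zorder xi (Complex 1 (2 * t)))))) (at_right 1)"
    by (intro tendsto_Re tendsto_add tendsto_mult tendsto_const dmang_limit)
  then have lim: "((\<lambda>\<sigma>. Re (3 * (of_real (\<sigma> - 1) * dmang (Complex \<sigma> 0)) + 4 * (of_real (\<sigma> - 1) * dmang (Complex \<sigma> t)) + of_real (\<sigma> - 1) * dmang (Complex \<sigma> (2 * t))))
     \<longlongrightarrow> 3 - 4 * of_int m - of_int m') (at_right 1)"
    using False z0 by (simp add: m_def m'_def)
  have "3 - 4 * of_int m - of_int m' \<ge> (0::real)"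
  proof (rule tendsto_lowerbound[OF lim])
    show "\<forall>\<^sub>F \<sigma> in at_right 1. 0 \<le> Re (3 * (of_real (\<sigma> - 1) * dmang (Complex \<sigma> 0)) + 4 * (of_real (\<sigma> - 1) * dmang (Complex \<sigma> t)) + of_real (\<sigma> - 1) * dmang (Complex \<sigma> (2 * t)))"
      using eventually_at_right_less[of "1::real"]
    proof eventually_elim
      case (elim \<sigma>)
      have c0: "Complex \<sigma> 0 = of_real \<sigma>" by (simp add: complex_eq_iff)
      have "3 * (of_real (\<sigma> - 1) * dmang (Complex \<sigma> 0)) + 4 * (of_real (\<sigma> - 1) * dmang (Complex \<sigma> t)) + of_real (\<sigma> - 1) * dmang (Complex \<sigma> (2 * t))
        = of_real (\<sigma> - 1) * (3 * dmang (of_real \<sigma>) + 4 * dmang (Complex \<sigma> t) + dmang (Complex \<sigma> (2 * t)))"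
        unfolding c0 by (simp only: ring_distribs mult_ac)
      then have "Re (3 * (of_real (\<sigma> - 1) * dmang (Complex \<sigma> 0)) + 4 * (of_real (\<sigma> - 1) * dmang (Complex \<sigma> t)) + of_real (\<sigma> - 1) * dmang (Complex \<sigma> (2 * t)))
        = (\<sigma> - 1) * Re (3 * dmang (of_real \<sigma>) + 4 * dmang (Complex \<sigma> t) + dmang (Complex \<sigma> (2 * t)))"
        by (simp only: Re_complex_of_real times_complex.simps Im_complex_of_real)
      then show ?case using re_dmang_341[of \<sigma> t] elim by simp
    qed
  qed simp
  then have "4 * m + m' \<le> 3" by linarith
  then have "m \<le> 0" using ord(1)[of "Complex 1 (2 * t)"] by (simp add: m'_def)
  then show ?thesis using ord(2)[of "Complex 1 t"] by (auto simp: m_def)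
qed

lemma xi_zero_strip:
  assumes "xi s = 0" shows "0 < Re s" "Re s < 1"
proof -
  have *: "Re s < 1" if "xi s = 0" for s
  proof (rule ccontr)
    assume "\<not> Re s < 1"
    then consider "Re s > 1" | "s = Complex 1 (Im s)" by (auto simp: complex_eq_iff not_less less_le)
    then show False using xi_nonzero_gt_1 xi_nonzero_line_1 that by (cases) metis+
  qed
  show "Re s < 1" using *[OF assms] .
  have "xi (1 - s) = 0" using assms by (simp add: xi_reflect)
  from *[OF this] show "0 < Re s" by simp
qed


text \<open>The point s' = 1 - s lies on Re s' = 2, where \<open>dmang\<close> is bounded by its
  series at 2. The reflection of \<open>xi\<close> carries this over to s, and only the two values
  of \<open>hlog\<close> grow with t.\<close>

lemma zeta_logderiv_left: "\<exists>C>0. \<forall>t. norm (deriv zeta (Complex (-1) t) / zeta (Complex (-1) t)) \<le> C * (1 + \<bar>t\<bar>)"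
proof -
  obtain H where H: "H > 0" "\<And>s. Re s \<ge> -1 \<Longrightarrow> norm (hlog s) \<le> H * (1 + norm s)" using hlog_bound by auto
  define M where "M = (\<Sum>n. mangoldt (Suc n) * real (Suc n) powr (- 2))"
  have M: "M \<ge> 0" unfolding M_def by (rule order_trans[OF norm_ge_zero dmang_norm_le[of 2]]) simp
  define C where "C = 5 * H + M + 2"
  show ?thesis
  proof (rule exI[of _ C], intro conjI allI)
    show "C > 0" using H M by (simp add: C_def)
    fix t
    define s where "s = Complex (-1) t"
    define s' where "s' = 1 - s"
    have s': "Re s' = 2" "s' \<noteq> 1" by (auto simp: s'_def s_def complex_eq_iff)
    have xs': "xi s' \<noteq> 0" by (rule xi_nonzero_gt_1) (simp add: s')
    have xs: "xi s \<noteq> 0" using xs' by (simp add: s'_def xi_reflect)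
    have "deriv xi s = - deriv xi s'"
    proof -
      have "((\<lambda>w. xi (1 - w)) has_field_derivative deriv xi s' * (-1)) (at s)"
        unfolding s'_def by (rule DERIV_chain2[OF xi_deriv]) (auto intro!: derivative_eq_intros)
      then have "(xi has_field_derivative - deriv xi s') (at s)" by (simp add: xi_reflect)
      then show ?thesis by (rule DERIV_imp_deriv)
    qed
    then have xr: "deriv xi s / xi s = - (deriv xi s' / xi s')" by (simp add: s'_def xi_reflect)
    have 1: "deriv zeta s / zeta s = hlog s + deriv xi s / xi s - 1 / (s - 1)"
      by (rule zeta_logderiv) (use xs in \<open>auto simp: s_def complex_eq_iff\<close>)
    have 2: "- dmang s' = hlog s' + deriv xi s' / xi s' - 1 / (s' - 1)"
      using zeta_logderiv[of s'] zeta_logderiv_dmang[of s'] s' xs' by simp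
    have eq: "deriv zeta s / zeta s = hlog s + (dmang s' + hlog s' - 1 / (s' - 1)) - 1 / (s - 1)"
      unfolding 1 xr using 2 by (simp add: algebra_simps)
    have n1: "norm (hlog s) \<le> H * (2 + \<bar>t\<bar>)"
    proof -
      have "norm s \<le> 1 + \<bar>t\<bar>" using cmod_le[of s] by (simp add: s_def)
      then have "H * (1 + norm s) \<le> H * (2 + \<bar>t\<bar>)" using H(1) by (intro mult_left_mono) auto
      then show ?thesis using H(2)[of s] by (simp add: s_def)
    qed
    have n2: "norm (hlog s') \<le> H * (3 + \<bar>t\<bar>)"
    proof -
      have "norm s' \<le> 2 + \<bar>t\<bar>" using cmod_le[of s'] by (simp add: s_def s'_def)
      then have "H * (1 + norm s') \<le> H * (3 + \<bar>t\<bar>)" using H(1) by (intro mult_left_mono) auto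
      then show ?thesis using H(2)[of s'] s' by simp
    qed
    have n3: "norm (dmang s') \<le> M" unfolding M_def by (rule dmang_norm_le) (simp add: s')
    have inv: "norm (1 / (w - 1)) \<le> 1" if "\<bar>Re (w - 1)\<bar> \<ge> 1" for w :: complex
    proof -
      have "norm (w - 1) \<ge> 1" using that abs_Re_le_cmod[of "w - 1"] by linarith
      then show ?thesis by (simp add: norm_divide divide_le_eq)
    qed
    have n4: "norm (1 / (s - 1)) \<le> 1" "norm (1 / (s' - 1)) \<le> 1"
      by (rule inv; simp add: s_def s'_def)+
    have "norm (deriv zeta s / zeta s) \<le> norm (hlog s) + (norm (dmang s') + norm (hlog s') + norm (1 / (s' - 1))) + norm (1 / (s - 1))"
      unfolding eq by (intro norm_triangle_le norm_triangle_le_diff add_mono order_refl)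
    also have "\<dots> \<le> H * (2 + \<bar>t\<bar>) + (M + H * (3 + \<bar>t\<bar>) + 1) + 1"
      using n1 n2 n3 n4 by linarith
    also have "\<dots> \<le> C * (1 + \<bar>t\<bar>)"
    proof -
      have "C * (1 + \<bar>t\<bar>) - (H * (2 + \<bar>t\<bar>) + (M + H * (3 + \<bar>t\<bar>) + 1) + 1) = (3 * H + M + 2) * \<bar>t\<bar>"
        by (simp add: C_def algebra_simps)
      moreover have "\<dots> \<ge> 0" using H(1) M by simp
      ultimately show ?thesis by linarith
    qed
    finally show "norm (deriv zeta (Complex (-1) t) / zeta (Complex (-1) t)) \<le> C * (1 + \<bar>t\<bar>)" by (simp add: s_def)
  qed
qed

text \<open>The heights found for \<open>xi\<close> also serve \<open>zeta\<close>, because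
  \<open>hlog\<close> and 1 / (s - 1) are dominated by the fourth power of the height. One height
  from each [n + 1, n + 2] makes the rectangles exhaust the strip.\<close>

lemma zeta_logderiv_heights:
  "\<exists>(T :: nat \<Rightarrow> real) C. C > 0 \<and> (\<forall>n. real n + 1 \<le> T n \<and> T n \<le> real n + 2) \<and>
    (\<forall>n s. \<bar>Im s\<bar> = T n \<and> -1 \<le> Re s \<and> Re s \<le> 2 \<longrightarrow> xi s \<noteq> 0 \<and> norm (deriv zeta s / zeta s) \<le> C * (real n + 1) ^ 4)"
proof -
  obtain H where H: "H > 0" "\<And>s. Re s \<ge> -1 \<Longrightarrow> norm (hlog s) \<le> H * (1 + norm s)" using hlog_bound by auto
  obtain A where A: "A \<ge> 0" "\<And>s. norm (xi s) \<le> exp (A * (1 + norm s)\<^sup>2)" using xi_growth by auto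
  have x2: "xi 2 \<noteq> 0" by (rule xi_nonzero_gt_1) simp
  from logderiv_polynomial_heights[OF xi_holomorphic x2 A(1) A(2)] obtain C where C: "C > 0"
    "\<And>T. T \<ge> 1 \<Longrightarrow> \<exists>T'. T \<le> T' \<and> T' \<le> T + 1 \<and>
    (\<forall>s. \<bar>Im s\<bar> = T' \<and> -1 \<le> Re s \<and> Re s \<le> 2 \<longrightarrow> xi s \<noteq> 0 \<and> norm (deriv xi s / xi s) \<le> C * T ^ 4)" by auto
  have "\<forall>n::nat. \<exists>T'. real n + 1 \<le> T' \<and> T' \<le> real n + 1 + 1 \<and>
    (\<forall>s. \<bar>Im s\<bar> = T' \<and> -1 \<le> Re s \<and> Re s \<le> 2 \<longrightarrow> xi s \<noteq> 0 \<and> norm (deriv xi s / xi s) \<le> C * (real n + 1) ^ 4)"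
    by (intro allI C(2)) simp
  then obtain T where T: "\<And>n::nat. real n + 1 \<le> T n" "\<And>n. T n \<le> real n + 1 + 1"
    "\<And>n s. \<bar>Im s\<bar> = T n \<and> -1 \<le> Re s \<and> Re s \<le> 2 \<Longrightarrow> xi s \<noteq> 0 \<and> norm (deriv xi s / xi s) \<le> C * (real n + 1) ^ 4"
    by metis
  show ?thesis
  proof (rule exI[of _ T], rule exI[of _ "5 * H + C + 1"], intro conjI allI impI)
    show "5 * H + C + 1 > 0" using H C by simp
    show "real n + 1 \<le> T n" "T n \<le> real n + 2" for n using T(1,2)[of n] by auto
    fix n s assume s: "\<bar>Im s\<bar> = T n \<and> -1 \<le> Re s \<and> Re s \<le> 2"
    from T(3)[OF s] show x: "xi s \<noteq> 0" by blast
    define N where "N = real n + 1"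
    have N: "N \<ge> 1" by (simp add: N_def)
    have TN: "N \<le> T n" "T n \<le> N + 1" using T(1,2)[of n] by (auto simp: N_def)
    have s1: "s \<noteq> 1" using s TN N by auto
    have eq: "deriv zeta s / zeta s = hlog s + deriv xi s / xi s - 1 / (s - 1)"
      by (rule zeta_logderiv) (use x s s1 in auto)
    have "norm s \<le> 2 + (N + 1)" using cmod_le[of s] s TN by (simp add: abs_le_iff) linarith
    then have "norm (hlog s) \<le> H * (4 + N)"
      using H(2)[of s] s mult_left_mono[of "1 + norm s" "4 + N" H] H(1) by linarith
    also have "\<dots> \<le> H * (5 * N ^ 4)"
      using H(1) N self_le_power[of N 4] by (intro mult_left_mono) auto
    finally have n1: "norm (hlog s) \<le> 5 * H * N ^ 4" by simp
    have n2: "norm (1 / (s - 1)) \<le> 1 * N ^ 4"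
    proof -
      have "norm (s - 1) \<ge> 1" using abs_Im_le_cmod[of "s - 1"] s TN N by simp
      then have "norm (1 / (s - 1)) \<le> 1" by (simp add: norm_divide divide_le_eq)
      also have "\<dots> \<le> N ^ 4" using N by (rule one_le_power)
      finally show ?thesis by simp
    qed
    have n3: "norm (deriv xi s / xi s) \<le> C * N ^ 4" using T(3)[OF s] by (simp add: N_def)
    have "norm (deriv zeta s / zeta s) \<le> norm (hlog s) + norm (deriv xi s / xi s) + norm (1 / (s - 1))"
      unfolding eq by (intro norm_triangle_le norm_triangle_le_diff add_mono order_refl)
    also have "\<dots> \<le> 5 * H * N ^ 4 + C * N ^ 4 + 1 * N ^ 4" by (intro add_mono n1 n2 n3)
    also have "\<dots> = (5 * H + C + 1) * N ^ 4" by (simp add: ring_distribs)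
    finally show "norm (deriv zeta s / zeta s) \<le> (5 * H + C + 1) * (real n + 1) ^ 4" by (simp add: N_def)
  qed
qed

section \<open>Orders of the zeros and of the pole of zeta\<close>

lemma zorder_zeta_eq_xi:
  assumes "Re p > -2" "p \<noteq> 1"
  shows "zorder zeta p = zorder xi p"
proof -
  have nz: "xi 1 \<noteq> 0" by simp
  obtain k r where k: "r > 0" "k holomorphic_on ball p r" "k p \<noteq> 0"
    "\<And>w. w \<in> ball p r \<Longrightarrow> xi w = k w * (w - p) ^ nat (zorder xi p)"
    using entire_zero_factor[OF xi_holomorphic nz, of p] by blast
  have ord: "zorder xi p \<ge> 0" using entire_zorder[OF xi_holomorphic nz, of p] by (auto split: if_splits)
  show ?thesis
  proof (rule zorder_eqI[of "ball p r \<inter> - {1}" p "\<lambda>w. hfac w * k w / (w - 1)"])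
    show "open (ball p r \<inter> - {1})" by auto
    show "(\<lambda>w. hfac w * k w / (w - 1)) holomorphic_on ball p r \<inter> - {1}"
      by (intro holomorphic_intros hfac_holomorphic holomorphic_on_subset[OF k(2)]) auto
    fix w assume w: "w \<in> ball p r \<inter> - {1}" "w \<noteq> p"
    then have "zeta w = hfac w * xi w / (w - 1)" using zeta_eq_ext[of w] by (simp add: zeta_ext_def)
    also have "xi w = k w * (w - p) ^ nat (zorder xi p)" using k(4) w by auto
    also have "(w - p) ^ nat (zorder xi p) = (w - p) powi zorder xi p" using ord by (simp add: power_int_def)
    finally show "zeta w = hfac w * k w / (w - 1) * (w - p) powi zorder xi p" by simp
  qed (use k assms hfac_nonzero in auto)
qed

lemma zorder_zeta_1: "zorder zeta 1 = -1" and is_pole_zeta_1: "is_pole zeta 1"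
proof -
  have h: "(\<lambda>w. hfac w * xi w) holomorphic_on UNIV" by (intro holomorphic_intros hfac_holomorphic xi_holomorphic)
  have nz: "hfac 1 * xi 1 \<noteq> 0" using hfac_nonzero[of 1] by simp
  show "zorder zeta 1 = -1"
    by (rule zorder_eqI[OF open_UNIV UNIV_I h nz]) (simp add: zeta_eq_ext zeta_ext_def power_int_minus divide_inverse)
  have "is_pole (\<lambda>w. hfac w * xi w / (w - 1) ^ 1) 1" by (rule is_pole_basic[OF h open_UNIV UNIV_I nz]) simp
  moreover have ev: "eventually (\<lambda>w. hfac w * xi w / (w - 1) ^ 1 = zeta w) (at 1)"
    by (auto simp: eventually_at_filter zeta_eq_ext zeta_ext_def)
  ultimately show "is_pole zeta 1" using is_pole_cong[OF ev refl] by simp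
qed

text \<open>The local factorisation k(w) (w - p)^n is transported by conjugation and then by w -> 1
  - w. Only the non-vanishing factor changes, by conjugation and by the sign (-1)^n.\<close>

lemma zorder_xi_reflect: "zorder xi (1 - cnj p) = zorder xi p" and zorder_xi_cnj: "zorder xi (cnj p) = zorder xi p"
proof -
  have nz: "xi 1 \<noteq> 0" by simp
  define n where "n = nat (zorder xi p)"
  obtain k r where k: "r > 0" "k holomorphic_on ball p r" "k p \<noteq> 0"
    "\<And>w. w \<in> ball p r \<Longrightarrow> xi w = k w * (w - p) ^ n"
    using entire_zero_factor[OF xi_holomorphic nz, of p] unfolding n_def by blast
  have ord: "zorder xi p = int n" using entire_zorder[OF xi_holomorphic nz, of p] by (auto simp: n_def split: if_splits)
  have dc: "dist (cnj p) w = dist p (cnj w)" for w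
    by (metis complex_cnj_cnj complex_cnj_diff complex_mod_cnj dist_norm)
  have hc: "(\<lambda>w. cnj (k (cnj w))) holomorphic_on ball (cnj p) r"
  proof -
    have "cnj ` ball (cnj p) r = ball p r"
    proof (intro equalityI subsetI)
      fix z assume "z \<in> ball p r"
      then show "z \<in> cnj ` ball (cnj p) r" by (intro image_eqI[of _ _ "cnj z"]) (auto simp: dc)
    qed (auto simp: dc)
    then show ?thesis using holomorphic_on_compose_cnj_cnj[of k "ball (cnj p) r"] k(2) by (simp add: o_def)
  qed
  have xc: "xi w = cnj (k (cnj w)) * (w - cnj p) ^ n" if "w \<in> ball (cnj p) r" for w
  proof -
    have "cnj w \<in> ball p r" using that by (simp add: dc)
    from k(4)[OF this] have "cnj (xi (cnj w)) = cnj (k (cnj w) * (cnj w - p) ^ n)" by simp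
    then show ?thesis by (simp add: xi_cnj)
  qed
  show c: "zorder xi (cnj p) = zorder xi p" unfolding ord
    by (rule zorder_eqI[OF _ _ hc]) (use k(1,3) xc in auto)
  have dr: "dist (1 - cnj p) w = dist (cnj p) (1 - w)" for w
    by (metis diff_diff_eq2 dist_commute dist_norm norm_minus_commute add_diff_cancel_left' add_diff_eq diff_add_eq_diff_diff_swap minus_diff_eq)
  have hr: "(\<lambda>w. (-1) ^ n * cnj (k (cnj (1 - w)))) holomorphic_on ball (1 - cnj p) r"
    by (intro holomorphic_intros holomorphic_on_compose_gen[of "\<lambda>w. 1 - w" _ _ "ball (cnj p) r", OF _ hc, unfolded o_def]) (auto simp: dr)
  show "zorder xi (1 - cnj p) = zorder xi p" unfolding ord
  proof (rule zorder_eqI[OF _ _ hr])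
    fix w assume w: "w \<in> ball (1 - cnj p) r" "w \<noteq> 1 - cnj p"
    have "xi w = xi (1 - w)" by (simp add: xi_reflect)
    also have "\<dots> = cnj (k (cnj (1 - w))) * ((1 - w) - cnj p) ^ n" by (rule xc) (use w in \<open>simp add: dr\<close>)
    also have "(1 - w) - cnj p = (-1) * (w - (1 - cnj p))" by simp
    also have "\<dots> ^ n = (-1) ^ n * (w - (1 - cnj p)) ^ n" by (rule power_mult_distrib)
    finally show "xi w = (-1) ^ n * cnj (k (cnj (1 - w))) * (w - (1 - cnj p)) powi int n" by simp
  qed (use k(1,3) in auto)
qed


section \<open>A smoothed Perron formula\<close>

lemma integrable_inverse_quadratic: "integrable lborel (\<lambda>t::real. inverse (1 + t\<^sup>2))"
  using integrable_inverse_1_plus_square by (simp add: set_integrable_def)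

lemma deriv_pow_exp: "(deriv ^^ k) (\<lambda>z. exp (of_real v * z)) = (\<lambda>z. of_real v ^ k * exp (of_real v * z) :: complex)"
proof (induction k)
  case (Suc k)
  have "deriv (\<lambda>z. of_real v ^ k * exp (of_real v * z)) z = of_real v ^ Suc k * exp (of_real v * z)" for z :: complex
    by (rule DERIV_imp_deriv) (auto intro!: derivative_eq_intros)
  then show ?case using Suc by auto
qed simp

text \<open>The inverse Laplace transform of z^(-k-1), as a function of v.\<close>

definition perron :: "nat \<Rightarrow> real \<Rightarrow> real" where "perron k v = (max 0 v) ^ k / fact k"

context
  fixes k :: nat and v :: real
  assumes k: "k \<ge> 1"
begin

definition pf :: "complex \<Rightarrow> complex" where "pf z = exp (of_real v * z) / z ^ Suc k"

lemma pf_measurable [measurable]: "(\<lambda>t. pf (Complex c t)) \<in> borel_measurable borel"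
proof -
  have "Complex c = (\<lambda>t. of_real c + \<i> * of_real t)" by (auto simp: complex_eq_iff)
  then show ?thesis unfolding pf_def by simp
qed

lemma pf_bound:
  assumes "\<bar>c\<bar> \<ge> 1" shows "norm (pf (Complex c t)) \<le> exp (v * c) * inverse (c\<^sup>2 + t\<^sup>2)"
proof -
  have n: "norm (Complex c t) \<ge> 1" using assms abs_Re_le_cmod[of "Complex c t"] by simp
  have "c\<^sup>2 + t\<^sup>2 = norm (Complex c t) ^ 2" by (simp add: cmod_power2)
  also have "\<dots> \<le> norm (Complex c t) ^ Suc k" using n k by (intro power_increasing) auto
  finally have "c\<^sup>2 + t\<^sup>2 \<le> norm (Complex c t) ^ Suc k" .
  moreover have "c\<^sup>2 + t\<^sup>2 > 0" using assms by (intro add_pos_nonneg) auto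
  ultimately have "inverse (norm (Complex c t) ^ Suc k) \<le> inverse (c\<^sup>2 + t\<^sup>2)" by (rule le_imp_inverse_le)
  then show ?thesis by (simp add: pf_def norm_divide norm_power divide_inverse mult_left_mono norm_mult norm_inverse)
qed

lemma pf_integrable: assumes "\<bar>c\<bar> \<ge> 1" shows "integrable lborel (\<lambda>t. pf (Complex c t))"
proof (rule Bochner_Integration.integrable_bound)
  show "integrable lborel (\<lambda>t::real. exp (v * c) * inverse (1 + t\<^sup>2))"
    by (intro integrable_mult_right integrable_inverse_quadratic)
  show "AE t in lborel. norm (pf (Complex c t)) \<le> norm (exp (v * c) * inverse (1 + t\<^sup>2))"
  proof (rule AE_I2)
    fix t :: real
    have "c\<^sup>2 \<ge> 1" using assms by (simp add: abs_le_square_iff[of 1 c, simplified])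
    then have "inverse (c\<^sup>2 + t\<^sup>2) \<le> inverse (1 + t\<^sup>2)" by (intro le_imp_inverse_le) (auto intro: add_pos_nonneg)
    then have "exp (v * c) * inverse (c\<^sup>2 + t\<^sup>2) \<le> exp (v * c) * inverse (1 + t\<^sup>2)" by simp
    then have "norm (pf (Complex c t)) \<le> exp (v * c) * inverse (1 + t\<^sup>2)" using pf_bound[OF assms, of t] by linarith
    then show "norm (pf (Complex c t)) \<le> norm (exp (v * c) * inverse (1 + t\<^sup>2))" by (simp add: abs_mult)
  qed
qed measurable

definition pline :: "real \<Rightarrow> complex" where "pline c = lebesgue_integral lborel (\<lambda>t. pf (Complex c t))"

lemma pline_shift:
  assumes ab: "a < b" "\<bar>a\<bar> \<ge> 1" "\<bar>b\<bar> \<ge> 1"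
  shows "pline b - pline a = (if a < 0 \<and> 0 < b then 2 * pi * v ^ k / fact k else 0)"
proof -
  define T where "T n = real n + 1" for n
  have T: "filterlim T at_top sequentially" unfolding T_def
    by real_asymp
  have Tp: "T n > 0" for n by (simp add: T_def)
  define R where "R n = rectpath (Complex a (- T n)) (Complex b (T n))" for n
  have im: "path_image (R n) \<subseteq> - {0}" for n
    using ab Tp[of n] by (auto simp: R_def path_image_rectpath)
  have lim: "(\<lambda>n. contour_integral (R n) pf) \<longlonglongrightarrow> \<i> * (pline b - pline a)"
    unfolding R_def pline_def
  proof (rule rectpath_strip_limit[OF ab(1) T Tp _ _ _ pf_integrable[OF ab(2)] pf_integrable[OF ab(3)], where M = "\<lambda>n. exp (\<bar>v\<bar> * (\<bar>a\<bar> + \<bar>b\<bar>)) * inverse (real (Suc n))"])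
    show "continuous_on (path_image (rectpath (Complex a (- T n)) (Complex b (T n)))) pf" for n
      unfolding pf_def using im[of n] by (intro continuous_intros) (auto simp: R_def)
    show "(\<lambda>n. exp (\<bar>v\<bar> * (\<bar>a\<bar> + \<bar>b\<bar>)) * inverse (real (Suc n))) \<longlonglongrightarrow> 0"
      by (intro tendsto_mult_right_zero LIMSEQ_inverse_real_of_nat)
    fix n x y assume xy: "a \<le> x" "x \<le> b" "\<bar>y\<bar> = T n"
    have ny: "norm (Complex x y) \<ge> T n" using abs_Im_le_cmod[of "Complex x y"] xy by simp
    have "real (Suc n) = T n" by (simp add: T_def)
    also have "\<dots> \<le> T n ^ Suc k" by (rule self_le_power) (auto simp: T_def)
    also have "\<dots> \<le> norm (Complex x y) ^ Suc k" using ny Tp[of n] by (intro power_mono) auto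
    finally have "inverse (norm (Complex x y) ^ Suc k) \<le> inverse (real (Suc n))" by (intro le_imp_inverse_le) auto
    moreover have "exp (v * x) \<le> exp (\<bar>v\<bar> * (\<bar>a\<bar> + \<bar>b\<bar>))"
    proof -
      have "v * x \<le> \<bar>v\<bar> * \<bar>x\<bar>" by (simp add: abs_mult[symmetric])
      also have "\<dots> \<le> \<bar>v\<bar> * (\<bar>a\<bar> + \<bar>b\<bar>)" using xy by (intro mult_left_mono) auto
      finally show ?thesis by simp
    qed
    ultimately have "exp (v * x) * inverse (norm (Complex x y) ^ Suc k) \<le> exp (\<bar>v\<bar> * (\<bar>a\<bar> + \<bar>b\<bar>)) * inverse (real (Suc n))"
      by (intro mult_mono) auto
    then show "norm (pf (Complex x y)) \<le> exp (\<bar>v\<bar> * (\<bar>a\<bar> + \<bar>b\<bar>)) * inverse (real (Suc n))"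
      by (simp add: pf_def norm_divide norm_power divide_inverse norm_mult norm_inverse del: of_nat_Suc power_Suc)
  qed
  have val: "contour_integral (R n) pf = 2 * pi * \<i> * (winding_number (R n) 0 * (v ^ k / fact k))" for n
  proof -
    have "contour_integral (R n) pf = 2 * pi * \<i> * (\<Sum>p\<in>{0}. winding_number (R n) p * residue pf p)"
    proof (rule Residue_theorem[of UNIV])
      show "pf holomorphic_on UNIV - {0}" unfolding pf_def by (intro holomorphic_intros) auto
    qed (use im[of n] in \<open>auto simp: R_def\<close>)
    also have "(\<Sum>p\<in>{0}. winding_number (R n) p * residue pf p) = winding_number (R n) 0 * residue pf 0" by simp
    also have "residue pf 0 = (deriv ^^ k) (\<lambda>z. exp (of_real v * z)) 0 / fact k"
      unfolding pf_def by (rule residue_holomorphic_over_power'[of UNIV]) (auto intro!: holomorphic_intros)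
    also have "\<dots> = of_real (v ^ k / fact k)" by (simp add: deriv_pow_exp)
    finally show ?thesis by simp
  qed
  have w: "winding_number (R n) 0 = (if a < 0 \<and> 0 < b then 1 else 0)" for n
  proof (cases "a < 0 \<and> 0 < b")
    case True
    then show ?thesis using Tp[of n] unfolding R_def by (auto intro!: winding_number_rectpath simp: in_box_complex_iff)
  next
    case False
    then have "0 \<notin> cbox (Complex a (- T n)) (Complex b (T n))" using ab by (auto simp: in_cbox_complex_iff)
    then show ?thesis using Tp[of n] ab False unfolding R_def by (auto intro!: winding_number_rectpath_outside)
  qed
  have "(\<lambda>n. contour_integral (R n) pf) \<longlonglongrightarrow> 2 * pi * \<i> * ((if a < 0 \<and> 0 < b then 1 else 0) * complex_of_real (v ^ k / fact k))"
    unfolding val w by (rule tendsto_const)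
  from LIMSEQ_unique[OF lim this]
  have "\<i> * (pline b - pline a) = \<i> * (if a < 0 \<and> 0 < b then 2 * pi * v ^ k / fact k else 0)"
    by (simp add: mult_ac)
  then show ?thesis by (metis complex_i_not_zero mult_left_cancel)
qed

lemma pline_tendsto_zero:
  assumes "\<sigma> = 1 \<or> \<sigma> = -1" "v * \<sigma> \<le> 0"
  shows "(\<lambda>n. pline (\<sigma> * real (Suc n))) \<longlonglongrightarrow> 0"
proof -
  have "(\<lambda>n. pline (\<sigma> * real (Suc n))) \<longlonglongrightarrow> lebesgue_integral lborel (\<lambda>t::real. 0 :: complex)"
    unfolding pline_def
  proof (rule integral_dominated_convergence[where w = "\<lambda>t. inverse (1 + t\<^sup>2)"])
    have c: "\<bar>\<sigma> * real (Suc n)\<bar> \<ge> 1" for n using assms(1) by auto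
    have le: "norm (pf (Complex (\<sigma> * real (Suc n)) t)) \<le> inverse ((real (Suc n))\<^sup>2 + t\<^sup>2)" for n t
    proof -
      have "v * (\<sigma> * real (Suc n)) \<le> 0" using assms(2) by (metis mult.assoc mult_nonpos_nonneg of_nat_0_le_iff)
      then have "exp (v * (\<sigma> * real (Suc n))) \<le> 1" by simp
      moreover have "(\<sigma> * real (Suc n))\<^sup>2 = (real (Suc n))\<^sup>2" using assms(1) by (auto simp: power2_eq_square algebra_simps)
      ultimately have "exp (v * (\<sigma> * real (Suc n))) * inverse ((\<sigma> * real (Suc n))\<^sup>2 + t\<^sup>2) \<le> 1 * inverse ((real (Suc n))\<^sup>2 + t\<^sup>2)"
        by (intro mult_mono) auto
      then show ?thesis using pf_bound[OF c, of n t] by simp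
    qed
    show "AE t in lborel. norm (pf (Complex (\<sigma> * real (Suc n)) t)) \<le> inverse (1 + t\<^sup>2)" for n
    proof (rule AE_I2)
      fix t :: real
      have "1 + t\<^sup>2 \<le> (real (Suc n))\<^sup>2 + t\<^sup>2" using power_mono[of 1 "real (Suc n)" 2] by simp
      then have "inverse ((real (Suc n))\<^sup>2 + t\<^sup>2) \<le> inverse (1 + t\<^sup>2)" by (intro le_imp_inverse_le) (auto intro: add_pos_nonneg)
      then show "norm (pf (Complex (\<sigma> * real (Suc n)) t)) \<le> inverse (1 + t\<^sup>2)" using le[of n t] by simp
    qed
    show "AE t in lborel. (\<lambda>n. pf (Complex (\<sigma> * real (Suc n)) t)) \<longlonglongrightarrow> 0"
    proof (rule AE_I2)
      fix t :: real
      show "(\<lambda>n. pf (Complex (\<sigma> * real (Suc n)) t)) \<longlonglongrightarrow> 0"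
      proof (rule Lim_null_comparison)
        show "\<forall>\<^sub>F n in sequentially. norm (pf (Complex (\<sigma> * real (Suc n)) t)) \<le> inverse (real (Suc n))"
        proof (rule always_eventually, rule allI)
          fix n
          have "real (Suc n) \<le> (real (Suc n))\<^sup>2" by (rule self_le_power) auto
          then have "real (Suc n) \<le> (real (Suc n))\<^sup>2 + t\<^sup>2" by (rule order_trans) simp
          then have "inverse ((real (Suc n))\<^sup>2 + t\<^sup>2) \<le> inverse (real (Suc n))" by (intro le_imp_inverse_le) auto
          then show "norm (pf (Complex (\<sigma> * real (Suc n)) t)) \<le> inverse (real (Suc n))" using le[of n t] by linarith
        qed
      qed (rule LIMSEQ_inverse_real_of_nat)
    qed
  qed (auto simp: integrable_inverse_quadratic)
  then show ?thesis by simp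
qed

text \<open>For v <= 0 the line is pushed to plus infinity, where exp(v c) stays bounded, and meets
  no pole; for v > 0 it is pushed to minus infinity and picks up the residue v^k / k! at 0.
  Restricting to lines with |c| >= 1 gives one integrable majorant, 1 / (1 + t^2), for the whole
  limit process.\<close>

lemma perron_formula_aux:
  assumes c: "c \<ge> 1"
  shows "pline c = of_real (2 * pi * perron k v)"
proof (cases "v \<le> 0")
  case True
  have ev: "eventually (\<lambda>n. pline (1 * real (Suc n)) = pline c) sequentially"
  proof -
    have "eventually (\<lambda>n. real n \<ge> c) sequentially" using filterlim_real_sequentially by (simp add: filterlim_at_top)
    then show ?thesis
    proof eventually_elim
      case (elim n)
      then show ?case using pline_shift[of c "real (Suc n)"] c by auto
    qed
  qed
  have "(\<lambda>n. pline (1 * real (Suc n))) \<longlonglongrightarrow> 0" by (rule pline_tendsto_zero) (use True in auto)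
  from Lim_transform_eventually[OF this ev] have "(\<lambda>n. pline c) \<longlonglongrightarrow> 0" .
  then have "pline c = 0" by (simp add: LIMSEQ_const_iff)
  moreover have "perron k v = 0" using True k by (simp add: perron_def max_def)
  ultimately show ?thesis by simp
next
  case False
  have eq: "pline (-1 * real (Suc n)) = pline c - of_real (2 * pi * v ^ k / fact k)" for n
    using pline_shift[of "-1 * real (Suc n)" c] c by (auto simp: algebra_simps)
  have "(\<lambda>n. pline (-1 * real (Suc n))) \<longlonglongrightarrow> 0" by (rule pline_tendsto_zero) (use False in auto)
  then have "(\<lambda>n. pline c - of_real (2 * pi * v ^ k / fact k)) \<longlonglongrightarrow> 0" unfolding eq .
  then have "pline c = of_real (2 * pi * v ^ k / fact k)" by (simp add: LIMSEQ_const_iff)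
  then show ?thesis using False by (simp add: perron_def max_def)
qed

end

lemma perron_formula:
  assumes "k \<ge> 1" "c \<ge> 1"
  shows "integrable lborel (\<lambda>t. exp (of_real v * Complex c t) / Complex c t ^ Suc k)"
    and "lebesgue_integral lborel (\<lambda>t. exp (of_real v * Complex c t) / Complex c t ^ Suc k) = of_real (2 * pi * perron k v)"
  using pf_integrable[OF assms(1), of c v] perron_formula_aux[OF assms, of v] assms
  unfolding pf_def[OF assms(1)] pline_def[OF assms(1)] by simp_all

text \<open>Iterated forward differences. A difference with step a multiplies the transform by exp(a
  z) - 1, which is how the factors of \<open>smooth_kernel\<close> arise.\<close>

fun fdiff :: "real list \<Rightarrow> (real \<Rightarrow> real) \<Rightarrow> real \<Rightarrow> real" where
  "fdiff [] f v = f v"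
| "fdiff (a # as) f v = fdiff as f (v + a) - fdiff as f v"

lemma perron_formula_fdiff:
  assumes "k \<ge> 1" "c \<ge> 1"
  shows "integrable lborel (\<lambda>t. exp (of_real v * Complex c t) * (\<Prod>a\<leftarrow>as. exp (of_real a * Complex c t) - 1) / Complex c t ^ Suc k) \<and>
     lebesgue_integral lborel (\<lambda>t. exp (of_real v * Complex c t) * (\<Prod>a\<leftarrow>as. exp (of_real a * Complex c t) - 1) / Complex c t ^ Suc k)
       = of_real (2 * pi * fdiff as (perron k) v)"
proof (induction as arbitrary: v)
  case Nil
  then show ?case using perron_formula[OF assms, of v] by simp
next
  case (Cons a as)
  let ?I = "\<lambda>v t. exp (of_real v * Complex c t) * (\<Prod>a\<leftarrow>as. exp (of_real a * Complex c t) - 1) / Complex c t ^ Suc k"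
  have eq: "exp (of_real v * Complex c t) * (\<Prod>a\<leftarrow>a # as. exp (of_real a * Complex c t) - 1) / Complex c t ^ Suc k = ?I (v + a) t - ?I v t" for t
    by (simp add: exp_add ring_distribs diff_divide_distrib mult.assoc[symmetric])
  show ?case unfolding eq
    using Cons.IH[of "v + a"] Cons.IH[of v] by (simp add: algebra_simps)
qed

text \<open>The indicator of \<open>[- L, 0]\<close> convolved with the indicators of \<open>k\<close> intervals of length \<open>\<kappa>\<close>, so
  that its Laplace transform decays like \<open>\<bar>s\<bar>\<^bsup>-k-1\<^esup>\<close>.\<close>

definition smooth_box :: "real \<Rightarrow> real \<Rightarrow> nat \<Rightarrow> real \<Rightarrow> real" where
  "smooth_box L \<kappa> k v = fdiff (replicate k \<kappa> @ [L]) (perron k) v"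

section \<open>The shape of the smoothed indicator\<close>

lemma perron_1: "perron 1 v = max 0 v" by (simp add: perron_def)

lemma perron_deriv:
  assumes "k \<ge> 1" shows "(perron (Suc k) has_real_derivative perron k v) (at v)"
proof -
  consider "v > 0" | "v < 0" | "v = 0" by linarith
  then show ?thesis
  proof cases
    case 1
    show ?thesis
    proof (rule has_field_derivative_transform_within_open[of "\<lambda>v. v ^ Suc k / fact (Suc k)" _ _ "{0<..}"])
      show "((\<lambda>v. v ^ Suc k / fact (Suc k)) has_real_derivative perron k v) (at v)"
      proof -
        have "((\<lambda>v. v ^ Suc k / fact (Suc k)) has_real_derivative real (Suc k) * v ^ k / fact (Suc k)) (at v)"
          by (rule derivative_eq_intros refl | simp)+
        also have "real (Suc k) * v ^ k / fact (Suc k) = perron k v"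
          using 1 by (simp add: perron_def max_def fact_Suc del: of_nat_Suc)
        finally show ?thesis .
      qed
    qed (use 1 in \<open>auto simp: perron_def\<close>)
  next
    case 2
    show ?thesis
    proof (rule has_field_derivative_transform_within_open[of "\<lambda>v. 0" _ _ "{..<0}"])
      show "((\<lambda>v. 0) has_real_derivative perron k v) (at v)"
        using 2 assms by (simp add: perron_def max_def zero_power)
    qed (use 2 in \<open>auto simp: perron_def max_def\<close>)
  next
    case 3
    \<comment> \<open>At 0 the branches v^(k+1) / (k+1)! and 0 meet; the difference quotient is at
      most |h|^k, which tends to 0 since k >= 1.\<close>
    have "((\<lambda>h. perron (Suc k) h / h) \<longlongrightarrow> 0) (at 0)"
    proof (rule Lim_null_comparison)
      show "\<forall>\<^sub>F h in at 0. norm (perron (Suc k) h / h) \<le> \<bar>h\<bar> ^ k"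
      proof (rule always_eventually, rule allI)
        fix h :: real
        have f: "(fact (Suc k) :: real) \<ge> 1" by (rule fact_ge_1)
        show "norm (perron (Suc k) h / h) \<le> \<bar>h\<bar> ^ k"
        proof (cases "h > 0")
          case True
          then have "norm (perron (Suc k) h / h) = h ^ k / fact (Suc k)" by (simp add: perron_def)
          also have "\<dots> \<le> h ^ k / 1" using f True by (intro divide_left_mono) auto
          finally show ?thesis using True by simp
        next
          case False
          then show ?thesis by (simp add: perron_def max_def)
        qed
      qed
      show "((\<lambda>h::real. \<bar>h\<bar> ^ k) \<longlongrightarrow> 0) (at 0)"
        using assms by (auto intro!: tendsto_eq_intros)
    qed
    moreover have "perron k 0 = 0" "perron (Suc k) 0 = 0" using assms by (simp_all add: perron_def zero_power)
    ultimately show ?thesis using 3 by (simp add: DERIV_def)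
  qed
qed

lemma fdiff_deriv:
  assumes "\<And>v. (f has_real_derivative f' v) (at v)"
  shows "(fdiff as f has_real_derivative fdiff as f' v) (at v)"
proof (induction as arbitrary: v)
  case Nil
  have "fdiff [] f = f" by (rule ext) simp
  then show ?case using assms[of v] by simp
next
  case (Cons a as)
  have "fdiff (a # as) f = (\<lambda>v. fdiff as f (v + a) - fdiff as f v)" by (rule ext) simp
  moreover have "((\<lambda>v. fdiff as f (v + a)) has_real_derivative fdiff as f' (v + a)) (at v)"
    using DERIV_shift[of "fdiff as f" "fdiff as f' (v + a)" v a] Cons.IH[of "v + a"] by simp
  ultimately show ?case using DERIV_diff[OF _ Cons.IH[of v]] by simp
qed

text \<open>Averaging over a window is expressed by the mean value theorem instead of a convolution
  integral: the box of index k + 1 is the increment over [v, v + \<kappa>] of a primitive of the box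
  of index k. Bounds, support and plateau can then be read off at \<xi>.\<close>

lemma smooth_box_step:
  assumes k: "k \<ge> 1" and \<kappa>: "\<kappa> > 0"
  shows "\<exists>\<xi>. v < \<xi> \<and> \<xi> < v + \<kappa> \<and> smooth_box L \<kappa> (Suc k) v = \<kappa> * smooth_box L \<kappa> k \<xi>"
proof -
  let ?R = "fdiff (replicate k \<kappa> @ [L]) (perron (Suc k))"
  have "\<exists>\<xi>. v < \<xi> \<and> \<xi> < v + \<kappa> \<and> ?R (v + \<kappa>) - ?R v = (v + \<kappa> - v) * smooth_box L \<kappa> k \<xi>"
    unfolding smooth_box_def using \<kappa> by (intro MVT2) (auto intro!: fdiff_deriv perron_deriv k)
  then show ?thesis by (simp add: smooth_box_def)
qed

text \<open>For k = 1 the function is piecewise linear, a trapezoid when \<kappa> < L. Each further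
  average over (v, v + \<kappa>) moves the left end of the support and the right end of the plateau
  to the left by \<kappa> and keeps the other two ends.\<close>

lemma smooth_box_facts:
  assumes \<kappa>: "\<kappa> > 0" and L: "L > 0" and k: "k \<ge> 1"
  shows "0 \<le> smooth_box L \<kappa> k v \<and> smooth_box L \<kappa> k v \<le> \<kappa> ^ k \<and>
    (v \<ge> 0 \<longrightarrow> smooth_box L \<kappa> k v = 0) \<and>
    (v \<le> - (L + real k * \<kappa>) \<longrightarrow> smooth_box L \<kappa> k v = 0) \<and>
    (- L \<le> v \<and> v \<le> - (real k * \<kappa>) \<longrightarrow> smooth_box L \<kappa> k v = \<kappa> ^ k)"
  using k
proof (induction k arbitrary: v rule: nat_induct_at_least)
  case base
  have "smooth_box L \<kappa> 1 v = max 0 (v + \<kappa> + L) - max 0 (v + \<kappa>) - (max 0 (v + L) - max 0 v)"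
    by (simp add: smooth_box_def perron_1[unfolded One_nat_def])
  moreover have "max 0 (v + \<kappa> + L) - max 0 (v + \<kappa>) - (max 0 (v + L) - max 0 v) \<ge> 0"
    "max 0 (v + \<kappa> + L) - max 0 (v + \<kappa>) - (max 0 (v + L) - max 0 v) \<le> \<kappa>"
    "v \<ge> 0 \<Longrightarrow> max 0 (v + \<kappa> + L) - max 0 (v + \<kappa>) - (max 0 (v + L) - max 0 v) = 0"
    "v \<le> - (L + \<kappa>) \<Longrightarrow> max 0 (v + \<kappa> + L) - max 0 (v + \<kappa>) - (max 0 (v + L) - max 0 v) = 0"
    "- L \<le> v \<Longrightarrow> v \<le> - \<kappa> \<Longrightarrow> max 0 (v + \<kappa> + L) - max 0 (v + \<kappa>) - (max 0 (v + L) - max 0 v) = \<kappa>"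
    using \<kappa> L by linarith+
  ultimately show ?case by simp
next
  case (Suc k v)
  from smooth_box_step[OF Suc.hyps \<kappa>, of v L] obtain \<xi> where x: "v < \<xi>" "\<xi> < v + \<kappa>"
    "smooth_box L \<kappa> (Suc k) v = \<kappa> * smooth_box L \<kappa> k \<xi>" by auto
  note I = Suc.IH[of \<xi>]
  have kS: "real (Suc k) * \<kappa> = real k * \<kappa> + \<kappa>" by (simp add: algebra_simps)
  show ?case
  proof (intro conjI impI)
    show "0 \<le> smooth_box L \<kappa> (Suc k) v" using I x(3) \<kappa> by simp
    show "smooth_box L \<kappa> (Suc k) v \<le> \<kappa> ^ Suc k" using I x(3) \<kappa> by simp
    show "smooth_box L \<kappa> (Suc k) v = 0" if "v \<ge> 0"
    proof -
      have "\<xi> \<ge> 0" using that x by linarith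
      then show ?thesis using I x(3) by simp
    qed
    show "smooth_box L \<kappa> (Suc k) v = 0" if "v \<le> - (L + real (Suc k) * \<kappa>)"
    proof -
      have "\<xi> \<le> - (L + real k * \<kappa>)" using that x kS by linarith
      then show ?thesis using I x(3) by simp
    qed
    show "smooth_box L \<kappa> (Suc k) v = \<kappa> ^ Suc k" if "- L \<le> v \<and> v \<le> - (real (Suc k) * \<kappa>)"
    proof -
      have "- L \<le> \<xi>" "\<xi> \<le> - (real k * \<kappa>)" using that x kS by linarith+
      then show ?thesis using I x(3) by simp
    qed
  qed
qed


section \<open>The explicit formula\<close>

text \<open>The shift by 2 moves the pole of the kernel to \<open>- 2\<close>, to the left of the contour \<open>Re s = - 1\<close>;
  it is the reason for the weight \<open>n\<^sup>2\<close> in the sum over primes.\<close>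

definition smooth_kernel :: "nat \<Rightarrow> real \<Rightarrow> real \<Rightarrow> real \<Rightarrow> complex \<Rightarrow> complex" where
  "smooth_kernel k \<kappa> L V s = exp (of_real V * (s + 2)) *
     ((exp (of_real \<kappa> * (s + 2)) - 1) ^ k * (exp (of_real L * (s + 2)) - 1)) / (s + 2) ^ Suc k"

lemma smooth_kernel_holomorphic: "smooth_kernel k \<kappa> L V holomorphic_on {s. Re s > -2}"
proof -
  have "s + 2 \<noteq> 0" if "Re s > -2" for s using that by (auto simp: complex_eq_iff)
  then have "(s + 2) ^ Suc k \<noteq> 0" if "Re s > -2" for s using that power_not_zero by blast
  then show ?thesis unfolding smooth_kernel_def[abs_def] by (intro holomorphic_intros) auto
qed

lemma smooth_kernel_line:
  assumes k: "k \<ge> 1"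
  shows "integrable lborel (\<lambda>t. smooth_kernel k \<kappa> L V (Complex 2 t))"
    and "lebesgue_integral lborel (\<lambda>t. smooth_kernel k \<kappa> L V (Complex 2 t)) = of_real (2 * pi * smooth_box L \<kappa> k V)"
proof -
  have e: "Complex 2 t + 2 = Complex 4 t" for t by (simp add: complex_eq_iff)
  have p: "(\<Prod>a\<leftarrow>replicate k \<kappa> @ [L]. exp (of_real a * z) - 1) = (exp (of_real \<kappa> * z) - 1) ^ k * (exp (of_real L * z) - 1)" for z :: complex
    by simp
  show "integrable lborel (\<lambda>t. smooth_kernel k \<kappa> L V (Complex 2 t))"
    "lebesgue_integral lborel (\<lambda>t. smooth_kernel k \<kappa> L V (Complex 2 t)) = of_real (2 * pi * smooth_box L \<kappa> k V)"
    using perron_formula_fdiff[OF k, of 4 V "replicate k \<kappa> @ [L]"]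
    unfolding p smooth_kernel_def e smooth_box_def by simp_all
qed

text \<open>Writing (n + 1)^(-s) as (n + 1)^2 exp(- ln (n + 1) (s + 2)) shows that multiplication by
  it lowers V by ln (n + 1).\<close>

lemma npow_smooth_kernel:
  "npow n s * smooth_kernel k \<kappa> L V s = of_real ((real (Suc n))\<^sup>2) * smooth_kernel k \<kappa> L (V - ln (real (Suc n))) s"
proof -
  define l where "l = ln (real (Suc n))"
  have l2: "exp (2 * of_real l :: complex) = of_real ((real (Suc n))\<^sup>2)"
  proof -
    have "exp (2 * l) = (exp l)\<^sup>2" using exp_of_nat_mult[of 2 l] by simp
    also have "exp l = real (Suc n)" by (simp add: l_def del: of_nat_Suc)
    finally have "complex_of_real (exp (2 * l)) = of_real ((real (Suc n))\<^sup>2)" by simp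
    then show ?thesis by (simp add: exp_of_real[symmetric])
  qed
  have "npow n s * exp (of_real V * (s + 2)) = exp (2 * of_real l) * exp (of_real (V - l) * (s + 2))"
    unfolding npow_def l_def[symmetric] exp_add[symmetric] by (simp add: algebra_simps)
  then show ?thesis unfolding smooth_kernel_def l_def[symmetric] l2 by (simp add: mult_ac)
qed

lemma mangoldt_smooth_sum:
  fixes \<kappa> L V :: real
  assumes k: "k \<ge> 1"
  defines "f \<equiv> \<lambda>n. mangoldt (Suc n) * (real (Suc n))\<^sup>2 * smooth_box L \<kappa> k (V - ln (real (Suc n)))"
  shows "integrable lborel (\<lambda>t. dmang (Complex 2 t) * smooth_kernel k \<kappa> L V (Complex 2 t))"
    and "f sums suminf f"
    and "lebesgue_integral lborel (\<lambda>t. dmang (Complex 2 t) * smooth_kernel k \<kappa> L V (Complex 2 t)) = of_real (2 * pi * suminf f)"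
proof -
  define F where "F n t = mangoldt (Suc n) * (npow n (Complex 2 t) * smooth_kernel k \<kappa> L V (Complex 2 t))" for n t
  have Fe: "F n t = (mangoldt (Suc n) * of_real ((real (Suc n))\<^sup>2)) * smooth_kernel k \<kappa> L (V - ln (real (Suc n))) (Complex 2 t)" for n t
    unfolding F_def npow_smooth_kernel by (simp only: mult.assoc)
  have Fi: "integrable lborel (F n)" for n
    unfolding Fe[abs_def] by (intro integrable_mult_right smooth_kernel_line k)
  have Fv: "lebesgue_integral lborel (F n) = of_real (2 * pi * f n)" for n
  proof -
    have "lebesgue_integral lborel (F n) = (mangoldt (Suc n) * of_real ((real (Suc n))\<^sup>2)) * of_real (2 * pi * smooth_box L \<kappa> k (V - ln (real (Suc n))))"
      unfolding Fe[abs_def] by (subst integral_mult_right_zero) (subst smooth_kernel_line[OF k], rule refl)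
    also have "\<dots> = of_real (2 * pi * f n)"
      unfolding f_def of_real_mult of_real_mangoldt by (simp only: mult_ac)
    finally show ?thesis .
  qed
  have nF: "norm (F n t) = mangoldt (Suc n) * real (Suc n) powr (- 2) * norm (smooth_kernel k \<kappa> L V (Complex 2 t))" for n t
    by (simp add: F_def norm_mult norm_npow del: of_nat_Suc)
  have sm: "summable (\<lambda>n. mangoldt (Suc n) * real (Suc n) powr (- 2))" by (rule summable_mangoldt_powr_Suc) simp
  have 1: "AE t in lborel. summable (\<lambda>n. norm (F n t))"
    unfolding nF by (intro AE_I2 summable_mult2 sm)
  have 2: "summable (\<lambda>n. lebesgue_integral lborel (\<lambda>t. norm (F n t)))"
    unfolding nF by (simp del: of_nat_Suc) (intro summable_mult2 sm)
  have S: "(\<Sum>n. F n t) = dmang (Complex 2 t) * smooth_kernel k \<kappa> L V (Complex 2 t)" for t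
  proof -
    have "(\<lambda>n. mangoldt (Suc n) * npow n (Complex 2 t) * smooth_kernel k \<kappa> L V (Complex 2 t)) sums
      (dmang (Complex 2 t) * smooth_kernel k \<kappa> L V (Complex 2 t))"
      by (intro sums_mult2 dmang_sums) simp
    then show ?thesis by (simp add: F_def sums_iff mult.assoc)
  qed
  show "integrable lborel (\<lambda>t. dmang (Complex 2 t) * smooth_kernel k \<kappa> L V (Complex 2 t))"
    using integrable_suminf[OF Fi 1 2] unfolding S .
  have s: "(\<lambda>n. complex_of_real (2 * pi * f n)) sums lebesgue_integral lborel (\<lambda>t. dmang (Complex 2 t) * smooth_kernel k \<kappa> L V (Complex 2 t))"
    using sums_integral[OF Fi 1 2] unfolding S Fv .
  from sums_Re[OF this] have "(\<lambda>n. 2 * pi * f n) sums Re (lebesgue_integral lborel (\<lambda>t. dmang (Complex 2 t) * smooth_kernel k \<kappa> L V (Complex 2 t)))"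
    by simp
  then have "summable (\<lambda>n. inverse (2 * pi) * (2 * pi * f n))" by (intro summable_mult sums_summable)
  then have "summable f" by simp
  then show sf: "f sums suminf f" by (rule summable_sums)
  have "(\<lambda>n. complex_of_real (2 * pi * f n)) sums of_real (2 * pi * suminf f)"
    by (subst sums_of_real_iff) (intro sums_mult sf)
  then show "lebesgue_integral lborel (\<lambda>t. dmang (Complex 2 t) * smooth_kernel k \<kappa> L V (Complex 2 t)) = of_real (2 * pi * suminf f)"
    using s sums_unique2 by blast
qed

lemma norm_exp_minus_1_le:
  fixes w :: complex assumes "Re w \<le> B" "B \<ge> 0"
  shows "norm (exp w - 1) \<le> exp B * norm w"
proof -
  have "norm (exp w - exp 0) \<le> exp B * norm (w - 0)"
  proof (rule field_differentiable_bound[of "{z. Re z \<le> B}" exp exp "exp B" w 0])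
    show "convex {z. Re z \<le> B}" by (rule convex_halfspace_Re_le)
    show "(exp has_field_derivative exp z) (at z within {z. Re z \<le> B})" for z :: complex
      by (rule DERIV_exp[THEN has_field_derivative_at_within])
  qed (use assms in auto)
  then show ?thesis by simp
qed

text \<open>Each factor (exp(\<kappa> z) - 1) / z with z = s + 2 is bounded in two ways: by a
  multiple of \<kappa>, through the derivative of exp, and by a multiple of 1 / |z|, through the
  triangle inequality. Since Re z <= 4 and \<kappa>, L <= 1, the constant exp 4 + 1 serves both,
  once for each of the k + 1 factors.\<close>

lemma smooth_kernel_bound:
  assumes \<kappa>: "0 < \<kappa>" "\<kappa> \<le> 1" and L: "0 < L" "L \<le> 1" and s: "-1 \<le> Re s" "Re s \<le> 2"
  shows "norm (smooth_kernel k \<kappa> L V s) \<le> (exp 4 + 1) ^ Suc k * exp (V * (Re s + 2)) * L * min \<kappa> (1 / norm (s + 2)) ^ k"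
proof -
  define z where "z = s + 2"
  have z: "1 \<le> Re z" "Re z \<le> 4" using s by (auto simp: z_def)
  have nz: "norm z \<ge> 1" using z complex_Re_le_cmod[of z] by linarith
  then have z0: "z \<noteq> 0" by auto
  have R: "Re (of_real a * z) \<le> 4" if "0 < a" "a \<le> 1" for a
    using mult_mono[of a 1 "Re z" 4] that z by simp
  have E: "norm (exp (of_real a * z) - 1) \<le> exp 4 * (a * norm z)" if "0 < a" "a \<le> 1" for a
    using norm_exp_minus_1_le[OF R[OF that]] that by (simp add: norm_mult)
  have 1: "norm ((exp (of_real L * z) - 1) / z) \<le> (exp 4 + 1) * L"
  proof -
    have "norm ((exp (of_real L * z) - 1) / z) \<le> exp 4 * L"
      using E[OF L] nz z0 by (simp add: norm_divide divide_le_eq mult_ac)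
    also have "\<dots> \<le> (exp 4 + 1) * L" using L by simp
    finally show ?thesis .
  qed
  have 2: "norm ((exp (of_real \<kappa> * z) - 1) / z) \<le> (exp 4 + 1) * min \<kappa> (1 / norm z)"
  proof -
    have "norm ((exp (of_real \<kappa> * z) - 1) / z) \<le> exp 4 * \<kappa>"
      using E[OF \<kappa>] nz z0 by (simp add: norm_divide divide_le_eq mult_ac)
    also have "\<dots> \<le> (exp 4 + 1) * \<kappa>" using \<kappa> by simp
    finally have a: "norm ((exp (of_real \<kappa> * z) - 1) / z) \<le> (exp 4 + 1) * \<kappa>" .
    have "norm (exp (of_real \<kappa> * z) - 1) \<le> norm (exp (of_real \<kappa> * z)) + norm (1::complex)" by (rule norm_triangle_ineq4)
    also have "\<dots> \<le> exp 4 + 1" using R[OF \<kappa>] by simp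
    finally have b: "norm ((exp (of_real \<kappa> * z) - 1) / z) \<le> (exp 4 + 1) * (1 / norm z)"
      using nz by (simp add: norm_divide divide_right_mono)
    show ?thesis using a b by (simp add: min_def)
  qed
  have "smooth_kernel k \<kappa> L V s = exp (of_real V * z) * ((exp (of_real \<kappa> * z) - 1) / z) ^ k * ((exp (of_real L * z) - 1) / z)"
    by (simp add: smooth_kernel_def z_def[symmetric] power_divide mult.commute)
  then have "norm (smooth_kernel k \<kappa> L V s) = norm (exp (of_real V * z)) * norm ((exp (of_real \<kappa> * z) - 1) / z) ^ k * norm ((exp (of_real L * z) - 1) / z)"
    by (simp only: norm_mult norm_power)
  also have "\<dots> \<le> exp (V * Re z) * ((exp 4 + 1) * min \<kappa> (1 / norm z)) ^ k * ((exp 4 + 1) * L)"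
    using 1 2 \<kappa> L by (intro mult_mono power_mono) auto
  also have "\<dots> = (exp 4 + 1) ^ Suc k * exp (V * (Re s + 2)) * L * min \<kappa> (1 / norm (s + 2)) ^ k"
    by (simp add: z_def power_mult_distrib)
  finally show ?thesis .
qed

definition xi_zeros :: "real \<Rightarrow> complex set" where "xi_zeros T = {\<rho>. xi \<rho> = 0 \<and> \<bar>Im \<rho>\<bar> \<le> T}"

text \<open>Multiplicities are those of \<open>zeta\<close>, as in \<open>zeta_zero_count\<close>;
  \<open>zmult_eq_xi\<close> passes to \<open>xi\<close>, where the symmetries are visible.\<close>

definition zmult :: "complex \<Rightarrow> real" where "zmult \<rho> = real (nat (zorder zeta \<rho>))"

lemma zmult_nonneg: "zmult \<rho> \<ge> 0" by (simp add: zmult_def)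

lemma finite_xi_zeros: "finite (xi_zeros T)"
proof -
  have nz: "xi 1 \<noteq> 0" by simp
  have "finite {z \<in> cbox (Complex 0 (- T)) (Complex 1 T). xi z = 0}"
    by (rule finite_zeros_compact[OF xi_holomorphic nz]) (rule compact_cbox)
  moreover have "xi_zeros T \<subseteq> {z \<in> cbox (Complex 0 (- T)) (Complex 1 T). xi z = 0}"
    using xi_zero_strip by (auto simp: xi_zeros_def in_cbox_complex_iff abs_le_iff less_imp_le)
  ultimately show ?thesis by (rule rev_finite_subset)
qed

text \<open>Three of the k factors are spent on decay: on Re s = -1 they turn the linear growth of
  the logarithmic derivative into an integrable 1 / |s + 2|^2. The others keep the power of
  \<kappa>.\<close>

lemma min_power_bound:
  fixes x \<kappa> :: real
  assumes "0 < \<kappa>" "\<kappa> \<le> 1" "x \<ge> 1" "k \<ge> 3"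
  shows "min \<kappa> (1 / x) ^ k \<le> \<kappa> ^ (k - 3) * (1 / x) ^ 3"
proof -
  have "min \<kappa> (1 / x) ^ k = min \<kappa> (1 / x) ^ (k - 3) * min \<kappa> (1 / x) ^ 3"
    using assms(4) by (simp add: power_add[symmetric])
  also have "\<dots> \<le> \<kappa> ^ (k - 3) * (1 / x) ^ 3" using assms by (intro mult_mono power_mono) auto
  finally show ?thesis .
qed

text \<open>On the horizontal edges the logarithmic derivative is O(n^4) and the kernel O(n^(-5)),
  which is the reason for k >= 5. The zeros enter only through a bound B for the sums of absolute
  values along the heights \<open>T n\<close>, and this bound passes to the limit. \<open>T\<close>
  and \<open>C\<close> are chosen before \<kappa>, L and V, since these will vary with x. The last
  term bounds the integral over Re s = -1.\<close>

theorem smooth_explicit_formula: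
  assumes k: "k \<ge> 5"
  shows "\<exists>(T :: nat \<Rightarrow> real) C. C > 0 \<and> (\<forall>\<kappa> L V B.
    0 < \<kappa> \<and> \<kappa> \<le> 1 \<and> 0 < L \<and> L \<le> 1 \<and>
    (\<forall>n. (\<Sum>\<rho>\<in>xi_zeros (T n). zmult \<rho> * norm (smooth_kernel k \<kappa> L V \<rho>)) \<le> B) \<longrightarrow>
    \<bar>(\<Sum>n. mangoldt (Suc n) * (real (Suc n))\<^sup>2 * smooth_box L \<kappa> k (V - ln (real (Suc n))))
      - Re (smooth_kernel k \<kappa> L V 1)\<bar> \<le> B + C * exp V * L * \<kappa> ^ (k - 3))"
proof -
  obtain T C where C: "C > 0" and T: "\<And>n::nat. real n + 1 \<le> T n" "\<And>n. T n \<le> real n + 2"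
    and hT: "\<And>n s. \<bar>Im s\<bar> = T n \<and> -1 \<le> Re s \<and> Re s \<le> 2 \<Longrightarrow> xi s \<noteq> 0 \<and> norm (deriv zeta s / zeta s) \<le> C * (real n + 1) ^ 4"
    using zeta_logderiv_heights by blast
  obtain C1 where C1: "C1 > 0" "\<And>t. norm (deriv zeta (Complex (-1) t) / zeta (Complex (-1) t)) \<le> C1 * (1 + \<bar>t\<bar>)"
    using zeta_logderiv_left by blast
  define K where "K = (exp 4 + 1 :: real) ^ Suc k"
  have K: "K > 0" unfolding K_def by (intro zero_less_power add_pos_pos) auto
  define J where "J = lebesgue_integral lborel (\<lambda>t::real. inverse (1 + t\<^sup>2))"
  have J: "J \<ge> 0" by (simp add: J_def)
  define C2 where "C2 = 2 * C1 * K * J + 1"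
  have Tpos: "T n > 0" for n using T(1)[of n] by linarith
  have Tlim: "filterlim T at_top sequentially"
  proof (rule filterlim_at_top_mono)
    show "filterlim (\<lambda>n. real n + 1) at_top sequentially" by real_asymp
  qed (use T(1) in auto)
  have main: "\<bar>suminf (\<lambda>n. mangoldt (Suc n) * (real (Suc n))\<^sup>2 * smooth_box L \<kappa> k (V - ln (real (Suc n))))
      - Re (smooth_kernel k \<kappa> L V 1)\<bar> \<le> B + C2 * exp V * L * \<kappa> ^ (k - 3)"
    if \<kappa>: "0 < \<kappa>" "\<kappa> \<le> 1" and L: "0 < L" "L \<le> 1"
    and B: "\<And>n. (\<Sum>\<rho>\<in>xi_zeros (T n). zmult \<rho> * norm (smooth_kernel k \<kappa> L V \<rho>)) \<le> B" for \<kappa> L V B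
  proof -
    define F where "F = smooth_kernel k \<kappa> L V"
    define S where "S = suminf (\<lambda>n. mangoldt (Suc n) * (real (Suc n))\<^sup>2 * smooth_box L \<kappa> k (V - ln (real (Suc n))))"
    have k1: "k \<ge> 1" using k by simp
    note ms = mangoldt_smooth_sum[OF k1, of \<kappa> L V, folded S_def F_def]
    \<comment> \<open>The factors are ordered as in \<open>argument_principle\<close>.\<close>
    define f where "f s = deriv zeta s * F s / zeta s" for s
    have Fhol: "F holomorphic_on {s. Re s > -2}" unfolding F_def by (rule smooth_kernel_holomorphic)
    have zhol: "zeta holomorphic_on - {1}" using zeta_spec by simp
    have dzhol: "deriv zeta holomorphic_on - {1}" by (intro holomorphic_deriv zhol) auto
    have zz: "zeta s = 0 \<longleftrightarrow> xi s = 0" if "Re s > -2" "s \<noteq> 1" for s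
      using zeta_eq_ext[OF that(2)] hfac_nonzero[OF that(1)] that(2) by (simp add: zeta_ext_def)
    define Rp where "Rp n = rectpath (Complex (-1) (- T n)) (Complex 2 (T n))" for n
    have img: "path_image (Rp n) \<subseteq> {s. Re s > -2 \<and> s \<noteq> 1 \<and> xi s \<noteq> 0}" for n
    proof
      fix s assume "s \<in> path_image (Rp n)"
      then have "Re s = -1 \<or> Re s = 2 \<or> (\<bar>Im s\<bar> = T n \<and> -1 \<le> Re s \<and> Re s \<le> 2)" "Re s \<ge> -1"
        using Tpos[of n] by (auto simp: Rp_def path_image_rectpath abs_if)
      then show "s \<in> {s. Re s > -2 \<and> s \<noteq> 1 \<and> xi s \<noteq> 0}"
        using xi_zero_strip[of s] hT[of s n] Tpos[of n] by (auto simp: complex_eq_iff)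
    qed
    have fcont: "continuous_on {s. Re s > -2 \<and> s \<noteq> 1 \<and> xi s \<noteq> 0} f"
      unfolding f_def
      by (intro continuous_intros holomorphic_on_imp_continuous_on holomorphic_on_subset[OF dzhol]
           holomorphic_on_subset[OF zhol] holomorphic_on_subset[OF Fhol]) (use zz in auto)
    have Fb: "norm (F s) \<le> K * exp (V * (Re s + 2)) * L * min \<kappa> (1 / norm (s + 2)) ^ k" if "-1 \<le> Re s" "Re s \<le> 2" for s
      unfolding F_def K_def by (rule smooth_kernel_bound[OF \<kappa> L that])
    have left_bound: "norm (f (Complex (-1) t)) \<le> (2 * C1 * K * exp V * L * \<kappa> ^ (k - 3)) * inverse (1 + t\<^sup>2)" for t
    proof -
      define x where "x = norm (Complex 1 t)"
      have x2: "x\<^sup>2 = 1 + t\<^sup>2" by (simp add: x_def cmod_power2)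
      have x1: "x \<ge> 1" using complex_Re_le_cmod[of "Complex 1 t"] by (simp add: x_def)
      have xt: "1 + \<bar>t\<bar> \<le> 2 * x" using abs_Im_le_cmod[of "Complex 1 t"] x1 by (simp add: x_def)
      have e: "Complex (-1) t + 2 = Complex 1 t" by (simp add: complex_eq_iff)
      have "norm (F (Complex (-1) t)) \<le> K * exp V * L * min \<kappa> (1 / x) ^ k"
        using Fb[of "Complex (-1) t"] unfolding e x_def[symmetric] by simp
      also have "\<dots> \<le> K * exp V * L * (\<kappa> ^ (k - 3) * (1 / x) ^ 3)"
        using min_power_bound[OF \<kappa> x1, of k] k K L by (intro mult_left_mono) auto
      finally have b: "norm (F (Complex (-1) t)) \<le> K * exp V * L * (\<kappa> ^ (k - 3) * (1 / x) ^ 3)" .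
      have "norm (f (Complex (-1) t)) = norm (deriv zeta (Complex (-1) t) / zeta (Complex (-1) t)) * norm (F (Complex (-1) t))"
        by (simp add: f_def norm_mult norm_divide)
      also have "\<dots> \<le> (C1 * (2 * x)) * (K * exp V * L * (\<kappa> ^ (k - 3) * (1 / x) ^ 3))"
      proof (intro mult_mono b)
        show "norm (deriv zeta (Complex (-1) t) / zeta (Complex (-1) t)) \<le> C1 * (2 * x)"
          using C1(2)[of t] mult_left_mono[OF xt, of C1] C1(1) by linarith
      qed (use C1 x1 in auto)
      also have "\<dots> = (2 * C1 * K * exp V * L * \<kappa> ^ (k - 3)) * (x * (1 / x) ^ 3)" by simp
      also have "x * (1 / x) ^ 3 = inverse (x\<^sup>2)" using x1 by (simp add: power3_eq_cube power2_eq_square field_simps)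
      finally show ?thesis unfolding x2 .
    qed
    have inta: "integrable lborel (\<lambda>t. f (Complex (-1) t))"
    proof (rule Bochner_Integration.integrable_bound)
      show "integrable lborel (\<lambda>t. (2 * C1 * K * exp V * L * \<kappa> ^ (k - 3)) * inverse (1 + t\<^sup>2))"
        by (intro integrable_mult_right integrable_inverse_quadratic)
      have "continuous_on UNIV (\<lambda>t. f (Complex (-1) t))"
      proof (rule continuous_on_compose2[OF fcont])
        have "Complex (-1) = (\<lambda>t. -1 + \<i> * of_real t)" by (auto simp: complex_eq_iff)
        then show "continuous_on UNIV (Complex (-1))" by (auto intro!: continuous_intros)
        show "range (Complex (-1)) \<subseteq> {s. Re s > -2 \<and> s \<noteq> 1 \<and> xi s \<noteq> 0}"
          using xi_zero_strip by (auto simp: complex_eq_iff) (metis complex.sel(1) less_minus_one_simps(1) not_less_iff_gr_or_eq)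
      qed
      then show "(\<lambda>t. f (Complex (-1) t)) \<in> borel_measurable lborel"
        by (simp add: borel_measurable_continuous_onI)
      show "AE t in lborel. norm (f (Complex (-1) t)) \<le> norm ((2 * C1 * K * exp V * L * \<kappa> ^ (k - 3)) * inverse (1 + t\<^sup>2))"
        using left_bound by (intro AE_I2) (metis abs_ge_self order_trans real_norm_def)
    qed
    have f2: "f (Complex 2 t) = - (dmang (Complex 2 t) * F (Complex 2 t))" for t
    proof -
      have "f (Complex 2 t) = (deriv zeta (Complex 2 t) / zeta (Complex 2 t)) * F (Complex 2 t)" by (simp add: f_def)
      then show ?thesis using zeta_logderiv_dmang[of "Complex 2 t"] by simp
    qed
    have intb: "integrable lborel (\<lambda>t. f (Complex 2 t))" unfolding f2 using ms(1) by simp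
    have vb: "lebesgue_integral lborel (\<lambda>t. f (Complex 2 t)) = - of_real (2 * pi * S)" unfolding f2 using ms(3) by simp
    define I where "I = lebesgue_integral lborel (\<lambda>t. f (Complex (-1) t))"
    have Ib: "norm I \<le> 2 * C1 * K * exp V * L * \<kappa> ^ (k - 3) * J"
    proof -
      have "norm I \<le> (\<integral>t. (2 * C1 * K * exp V * L * \<kappa> ^ (k - 3)) * inverse (1 + t\<^sup>2) \<partial>lborel)"
        unfolding I_def by (rule Bochner_Integration.integral_norm_bound_integral[OF inta])
          (auto intro!: integrable_inverse_quadratic left_bound)
      then show ?thesis by (simp add: J_def)
    qed
    \<comment> \<open>V is fixed while n tends to infinity, so a bound that is crude in V does no
      harm; 4 is the largest value of Re s + 2.\<close>
    define A where "A = K * exp (4 * \<bar>V\<bar>) * L"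
    have lim: "(\<lambda>n. contour_integral (Rp n) f) \<longlonglongrightarrow> \<i> * (- of_real (2 * pi * S) - I)"
      unfolding Rp_def I_def vb[symmetric]
    proof (rule rectpath_strip_limit[OF _ Tlim Tpos _ _ _ inta intb, where M = "\<lambda>n. C * A * inverse (real (Suc n))"])
      show "continuous_on (path_image (rectpath (Complex (- 1) (- T n)) (Complex 2 (T n)))) f" for n
        using continuous_on_subset[OF fcont img[of n]] by (simp add: Rp_def)
      show "(\<lambda>n. C * A * inverse (real (Suc n))) \<longlonglongrightarrow> 0"
        by (intro tendsto_mult_right_zero LIMSEQ_inverse_real_of_nat)
      fix n x y assume xy: "-1 \<le> x" "x \<le> (2::real)" "\<bar>y\<bar> = T n"
      define s where "s = Complex x y"
      define N where "N = real (Suc n)"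
      have N: "N \<ge> 1" by (simp add: N_def)
      have ns: "norm (s + 2) \<ge> N" using abs_Im_le_cmod[of "s + 2"] xy T(1)[of n] by (simp add: s_def N_def)
      have h: "norm (deriv zeta s / zeta s) \<le> C * N ^ 4" using hT[of s n] xy by (simp add: s_def N_def add.commute)
      have "norm (F s) \<le> K * exp (V * (Re s + 2)) * L * min \<kappa> (1 / norm (s + 2)) ^ k"
        by (rule Fb) (use xy in \<open>auto simp: s_def\<close>)
      also have "\<dots> \<le> K * exp (4 * \<bar>V\<bar>) * L * (1 / N) ^ 5"
      proof (intro mult_mono)
        have "V * (Re s + 2) \<le> \<bar>V\<bar> * 4"
          using mult_mono[of "V" "\<bar>V\<bar>" "Re s + 2" 4] xy by (simp add: s_def)
        then show "exp (V * (Re s + 2)) \<le> exp (4 * \<bar>V\<bar>)" by (simp add: mult.commute)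
        have n0: "norm (s + 2) > 0" using ns N by linarith
        have "1 / norm (s + 2) \<le> 1 / N" by (rule divide_left_mono) (use ns N n0 in auto)
        then have m: "min \<kappa> (1 / norm (s + 2)) \<le> 1 / N" by (rule min.coboundedI2)
        have m0: "0 \<le> min \<kappa> (1 / norm (s + 2))" using \<kappa> by auto
        have "min \<kappa> (1 / norm (s + 2)) ^ k \<le> (1 / N) ^ k" by (rule power_mono[OF m m0])
        also have "\<dots> \<le> (1 / N) ^ 5" using N k by (intro power_decreasing) auto
        finally show "min \<kappa> (1 / norm (s + 2)) ^ k \<le> (1 / N) ^ 5" .
      qed (use K L \<kappa> in auto)
      finally have Fs: "norm (F s) \<le> A * (1 / N) ^ 5" by (simp add: A_def)
      have "norm (f s) = norm (deriv zeta s / zeta s) * norm (F s)" by (simp add: f_def norm_mult norm_divide)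
      also have "\<dots> \<le> (C * N ^ 4) * (A * (1 / N) ^ 5)" using h Fs C by (intro mult_mono) auto
      also have "\<dots> = C * A * (N ^ 4 * (1 / N) ^ 5)" by simp
      also have "N ^ 4 * (1 / N) ^ 5 = inverse N" using N by (simp add: power_one_over field_simps eval_nat_numeral)
      finally show "norm (f (Complex x y)) \<le> C * A * inverse (real (Suc n))" by (simp add: s_def N_def)
    qed simp
    have res: "contour_integral (Rp n) f = 2 * pi * \<i> * ((\<Sum>\<rho>\<in>xi_zeros (T n). of_real (zmult \<rho>) * F \<rho>) - F 1)" for n
    proof -
      \<comment> \<open>An open box slightly larger than the contour. Its left edge stays to the
        right of -2, where \<open>hfac\<close> has no zeros and the kernel no pole, so that in D the
        zeros of \<open>zeta\<close> are zeros of \<open>xi\<close>. Zeros between the contour and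
        the edge of the box have winding number 0.\<close>
      define D where "D = box (Complex (-3/2) (- T n - 1)) (Complex 3 (T n + 1))"
      define pz where "pz = {w \<in> D. zeta w = 0 \<or> w \<in> {1}}"
      have D2: "D \<subseteq> {s. Re s > -2}" by (auto simp: D_def in_box_complex_iff)
      have finD: "finite pz"
      proof (rule finite_subset)
        show "pz \<subseteq> insert 1 (xi_zeros (T n + 1))"
          using zz D2 by (auto simp: pz_def xi_zeros_def D_def in_box_complex_iff abs_le_iff)
      qed (simp add: finite_xi_zeros)
      have cb: "cbox (Complex (-1) (- T n)) (Complex 2 (T n)) \<subseteq> D"
        by (auto simp: D_def in_box_complex_iff in_cbox_complex_iff)
      have pi_sub: "path_image (Rp n) \<subseteq> cbox (Complex (-1) (- T n)) (Complex 2 (T n))"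
        unfolding Rp_def by (rule path_image_rectpath_subset_cbox) (use Tpos[of n] in auto)
      have "contour_integral (Rp n) (\<lambda>x. deriv zeta x * F x / zeta x) = 2 * pi * \<i> * (\<Sum>p\<in>pz. winding_number (Rp n) p * F p * zorder zeta p)"
        unfolding pz_def
      proof (rule argument_principle)
        show "open D" "connected D" by (auto simp: D_def intro: convex_connected)
        show "zeta holomorphic_on D - {1}" using zhol by (rule holomorphic_on_subset) auto
        show "F holomorphic_on D" using Fhol D2 by (rule holomorphic_on_subset)
        show "path_image (Rp n) \<subseteq> D - {w \<in> D. zeta w = 0 \<or> w \<in> {1}}"
        proof
          fix s assume s: "s \<in> path_image (Rp n)"
          then have "s \<in> D" using pi_sub cb by blast
          moreover have "zeta s \<noteq> 0" "s \<noteq> 1" using img[of n] s zz by auto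
          ultimately show "s \<in> D - {w \<in> D. zeta w = 0 \<or> w \<in> {1}}" by simp
        qed
        show "\<forall>z. z \<notin> D \<longrightarrow> winding_number (Rp n) z = 0"
          unfolding Rp_def using cb Tpos[of n] by (auto intro!: winding_number_rectpath_outside)
        show "finite {w \<in> D. zeta w = 0 \<or> w \<in> {1}}" using finD by (simp add: pz_def)
        show "\<forall>p\<in>D \<inter> {1}. is_pole zeta p" using is_pole_zeta_1 by simp
      qed (auto simp: Rp_def)
      also have "(\<lambda>x. deriv zeta x * F x / zeta x) = f" by (simp add: f_def[abs_def])
      also have "(\<Sum>p\<in>pz. winding_number (Rp n) p * F p * zorder zeta p) = (\<Sum>p\<in>insert 1 (xi_zeros (T n)). winding_number (Rp n) p * F p * zorder zeta p)"
      proof (rule sum.mono_neutral_right[OF finD])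
        have "1 \<in> pz" using Tpos[of n] by (simp add: pz_def D_def in_box_complex_iff)
        moreover have "p \<in> pz" if "p \<in> xi_zeros (T n)" for p
        proof -
          have x: "xi p = 0" "\<bar>Im p\<bar> \<le> T n" using that by (auto simp: xi_zeros_def)
          have "0 < Re p" "Re p < 1" using xi_zero_strip[OF x(1)] by auto
          then show ?thesis using x zz[of p] by (auto simp: pz_def D_def in_box_complex_iff abs_le_iff)
        qed
        ultimately show "insert 1 (xi_zeros (T n)) \<subseteq> pz" by auto
        show "\<forall>p\<in>pz - insert 1 (xi_zeros (T n)). winding_number (Rp n) p * F p * zorder zeta p = 0"
        proof
          fix p assume p: "p \<in> pz - insert 1 (xi_zeros (T n))"
          then have "p \<noteq> 1" "zeta p = 0" "Re p > -2" using D2 by (auto simp: pz_def)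
          then have "xi p = 0" using zz by auto
          then have "\<not> \<bar>Im p\<bar> \<le> T n" using p by (auto simp: xi_zeros_def)
          then have "p \<notin> cbox (Complex (-1) (- T n)) (Complex 2 (T n))" by (auto simp: in_cbox_complex_iff abs_le_iff)
          then have "winding_number (Rp n) p = 0" unfolding Rp_def using Tpos[of n] by (intro winding_number_rectpath_outside) auto
          then show "winding_number (Rp n) p * F p * zorder zeta p = 0" by simp
        qed
      qed
      also have "\<dots> = winding_number (Rp n) 1 * F 1 * zorder zeta 1 + (\<Sum>p\<in>xi_zeros (T n). winding_number (Rp n) p * F p * zorder zeta p)"
        by (rule sum.insert[OF finite_xi_zeros]) (simp add: xi_zeros_def)
      also have "winding_number (Rp n) 1 = 1"
        unfolding Rp_def by (rule winding_number_rectpath) (use Tpos[of n] in \<open>auto simp: in_box_complex_iff\<close>)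
      also have "(\<Sum>p\<in>xi_zeros (T n). winding_number (Rp n) p * F p * zorder zeta p) = (\<Sum>\<rho>\<in>xi_zeros (T n). of_real (zmult \<rho>) * F \<rho>)"
      proof (rule sum.cong)
        fix p assume "p \<in> xi_zeros (T n)"
        then have x: "xi p = 0" "\<bar>Im p\<bar> \<le> T n" by (auto simp: xi_zeros_def)
        have s: "0 < Re p" "Re p < 1" using xi_zero_strip[OF x(1)] by auto
        \<comment> \<open>The heights were chosen to avoid all zeros, so the zeros counted here lie
          strictly inside the contour.\<close>
        have "\<bar>Im p\<bar> \<noteq> T n" using hT[of p n] x(1) s by auto
        then have "winding_number (Rp n) p = 1"
          unfolding Rp_def using x(2) s by (intro winding_number_rectpath) (auto simp: in_box_complex_iff abs_less_iff less_le abs_le_iff)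
        moreover have "zorder zeta p \<ge> 0"
        proof -
          have "p \<noteq> 1" using s by auto
          moreover have "(1::complex) \<noteq> 0" by simp
          ultimately show ?thesis using zorder_zeta_eq_xi[of p] entire_zorder[OF xi_holomorphic, of 1 p] s x(1) by simp
        qed
        ultimately show "winding_number (Rp n) p * F p * zorder zeta p = of_real (zmult p) * F p" by (simp add: zmult_def)
      qed simp
      finally show ?thesis by (simp add: zorder_zeta_1)
    qed
    define Q where "Q n = (\<Sum>\<rho>\<in>xi_zeros (T n). of_real (zmult \<rho>) * F \<rho>)" for n
    have Qb: "norm (Q n) \<le> B" for n
    proof -
      have "norm (Q n) \<le> (\<Sum>\<rho>\<in>xi_zeros (T n). zmult \<rho> * norm (F \<rho>))"
        unfolding Q_def by (rule sum_norm_le) (simp add: norm_mult zmult_nonneg)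
      then show ?thesis using B[of n] unfolding F_def by linarith
    qed
    have "(\<lambda>n. 2 * pi * \<i> * (Q n - F 1)) \<longlonglongrightarrow> \<i> * (- of_real (2 * pi * S) - I)"
      using lim unfolding res Q_def[symmetric] .
    from tendsto_add[OF tendsto_divide[OF this tendsto_const[of "2 * pi * \<i>"]] tendsto_const[of "F 1"]]
    have l: "(\<lambda>n. 2 * pi * \<i> * (Q n - F 1) / (2 * pi * \<i>) + F 1) \<longlonglongrightarrow> \<i> * (- of_real (2 * pi * S) - I) / (2 * pi * \<i>) + F 1"
      by simp
    have e1: "2 * pi * \<i> * (Q n - F 1) / (2 * pi * \<i>) + F 1 = Q n" for n by simp
    have e2: "\<i> * (- of_real (2 * pi * S) - I) / (2 * pi * \<i>) + F 1 = F 1 - of_real S - I / (2 * pi)"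
      by (simp add: field_simps)
    have Ql: "Q \<longlonglongrightarrow> F 1 - of_real S - I / (2 * pi)" using l unfolding e1 e2 .
    have "norm (F 1 - of_real S - I / (2 * pi)) \<le> B"
      by (rule LIMSEQ_le_const2[OF tendsto_norm[OF Ql]]) (use Qb in auto)
    moreover have "norm (I / (2 * pi)) \<le> norm I"
    proof -
      have "norm (I / (2 * pi)) = norm I / (2 * pi)" by (simp add: norm_divide)
      also have "\<dots> \<le> norm I / 1" using pi_gt3 by (intro divide_left_mono) auto
      finally show ?thesis by simp
    qed
    moreover have "norm (F 1 - of_real S) \<le> norm (F 1 - of_real S - I / (2 * pi)) + norm (I / (2 * pi))"
      using norm_triangle_ineq[of "F 1 - of_real S - I / (2 * pi)" "I / (2 * pi)"] by simp
    moreover have "\<bar>S - Re (F 1)\<bar> \<le> norm (F 1 - of_real S)"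
      using abs_Re_le_cmod[of "F 1 - of_real S"] by (simp add: abs_minus_commute)
    ultimately have "\<bar>S - Re (F 1)\<bar> \<le> B + 2 * C1 * K * exp V * L * \<kappa> ^ (k - 3) * J" using Ib by linarith
    also have "2 * C1 * K * exp V * L * \<kappa> ^ (k - 3) * J \<le> C2 * exp V * L * \<kappa> ^ (k - 3)"
    proof -
      have "(2 * C1 * K * J) * (exp V * L * \<kappa> ^ (k - 3)) \<le> C2 * (exp V * L * \<kappa> ^ (k - 3))"
        using \<kappa> L by (intro mult_right_mono) (auto simp: C2_def)
      then show ?thesis by (simp add: mult_ac)
    qed
    finally show ?thesis by (simp add: S_def F_def)
  qed
  have "C2 > 0" using C1(1) K J by (simp add: C2_def add_nonneg_pos)
  then show ?thesis using main by (intro exI[of _ T] exI[of _ C2]) auto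
qed


section \<open>Sums over zeros\<close>

text \<open>Up to the symmetries \<rho> -> \<open>cnj \<rho>\<close> and \<rho> -> 1 - \<rho> these
  represent all non-real zeros, and for \<sigma> >= 1/2 they include all that
  \<open>zeta_zero_count\<close> counts.\<close>

definition quarter_zeros :: "real \<Rightarrow> complex set" where
  "quarter_zeros U = {\<rho>. xi \<rho> = 0 \<and> 1 / 2 \<le> Re \<rho> \<and> 0 < Im \<rho> \<and> Im \<rho> \<le> U}"

text \<open>\<open>zeta_zero_count\<close> sees only positive ordinates. Real zeros are therefore
  carried along as a finite set of points with Re \<rho> < 1.\<close>

definition real_zeros :: "complex set" where "real_zeros = {\<rho>. xi \<rho> = 0 \<and> Im \<rho> = 0}"

lemma finite_quarter_zeros: "finite (quarter_zeros U)"
  by (rule finite_subset[OF _ finite_xi_zeros[of U]]) (auto simp: quarter_zeros_def xi_zeros_def)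

lemma finite_real_zeros: "finite real_zeros"
  by (rule finite_subset[OF _ finite_xi_zeros[of 0]]) (auto simp: real_zeros_def xi_zeros_def)

lemma zeta_eq_0_iff_xi:
  assumes "Re s > -2" "s \<noteq> 1" shows "zeta s = 0 \<longleftrightarrow> xi s = 0"
  using zeta_eq_ext[OF assms(2)] hfac_nonzero[OF assms(1)] assms(2) by (simp add: zeta_ext_def)

lemma zeta_zero_count_eq:
  assumes "\<sigma> \<ge> 1 / 2"
  shows "real (zeta_zero_count \<sigma> U) = (\<Sum>\<rho> | \<rho> \<in> quarter_zeros U \<and> \<sigma> \<le> Re \<rho>. zmult \<rho>)"
proof -
  have "{\<rho>. zeta \<rho> = 0 \<and> \<sigma> \<le> Re \<rho> \<and> Re \<rho> \<le> 1 \<and> 0 < Im \<rho> \<and> Im \<rho> \<le> U} = {\<rho>. \<rho> \<in> quarter_zeros U \<and> \<sigma> \<le> Re \<rho>}"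
  proof (intro set_eqI iffI)
    fix \<rho> assume \<rho>: "\<rho> \<in> {\<rho>. zeta \<rho> = 0 \<and> \<sigma> \<le> Re \<rho> \<and> Re \<rho> \<le> 1 \<and> 0 < Im \<rho> \<and> Im \<rho> \<le> U}"
    then have "\<rho> \<noteq> 1" "Re \<rho> > -2" using assms by auto
    then show "\<rho> \<in> {\<rho>. \<rho> \<in> quarter_zeros U \<and> \<sigma> \<le> Re \<rho>}"
      using \<rho> assms zeta_eq_0_iff_xi[of \<rho>] by (auto simp: quarter_zeros_def)
  next
    fix \<rho> assume \<rho>: "\<rho> \<in> {\<rho>. \<rho> \<in> quarter_zeros U \<and> \<sigma> \<le> Re \<rho>}"
    then have "\<rho> \<noteq> 1" "Re \<rho> > -2" "Re \<rho> < 1" using assms xi_zero_strip[of \<rho>] by (auto simp: quarter_zeros_def)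
    then show "\<rho> \<in> {\<rho>. zeta \<rho> = 0 \<and> \<sigma> \<le> Re \<rho> \<and> Re \<rho> \<le> 1 \<and> 0 < Im \<rho> \<and> Im \<rho> \<le> U}"
      using \<rho> assms zeta_eq_0_iff_xi[of \<rho>] by (auto simp: quarter_zeros_def)
  qed
  then show ?thesis by (simp add: zeta_zero_count_def zmult_def)
qed

lemma zmult_eq_xi:
  assumes "xi \<rho> = 0" shows "zmult \<rho> = real (nat (zorder xi \<rho>))"
proof -
  have "\<rho> \<noteq> 1" "Re \<rho> > -2" using xi_zero_strip[OF assms] by auto
  then show ?thesis using zorder_zeta_eq_xi[of \<rho>] by (simp add: zmult_def)
qed

lemma zmult_symmetries:
  assumes "xi \<rho> = 0"
  shows "zmult (cnj \<rho>) = zmult \<rho>" "zmult (1 - cnj \<rho>) = zmult \<rho>" "zmult (1 - \<rho>) = zmult \<rho>"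
    "xi (cnj \<rho>) = 0" "xi (1 - cnj \<rho>) = 0" "xi (1 - \<rho>) = 0"
proof -
  show z: "xi (cnj \<rho>) = 0" "xi (1 - cnj \<rho>) = 0" "xi (1 - \<rho>) = 0"
    using assms by (simp_all add: xi_cnj xi_reflect)
  show "zmult (cnj \<rho>) = zmult \<rho>" "zmult (1 - cnj \<rho>) = zmult \<rho>"
    using assms z by (simp_all add: zmult_eq_xi zorder_xi_cnj zorder_xi_reflect)
  show "zmult (1 - \<rho>) = zmult \<rho>"
    using assms z zorder_xi_reflect[of "cnj \<rho>"] by (simp add: zmult_eq_xi zorder_xi_cnj)
qed

lemma sum_le_by_injection:
  fixes f :: "'a \<Rightarrow> real" and f' :: "'b \<Rightarrow> real"
  assumes "finite P" "inj_on \<phi> A" "\<phi> ` A \<subseteq> P" "\<And>a. a \<in> A \<Longrightarrow> f a \<le> f' (\<phi> a)" "\<And>p. p \<in> P \<Longrightarrow> f' p \<ge> 0"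
  shows "sum f A \<le> sum f' P"
proof -
  have "sum f A \<le> (\<Sum>a\<in>A. f' (\<phi> a))" by (rule sum_mono) (rule assms(4))
  also have "\<dots> = sum f' (\<phi> ` A)" using assms(2) by (simp add: sum.reindex)
  also have "\<dots> \<le> sum f' P" by (rule sum_mono2) (use assms in auto)
  finally show ?thesis .
qed

text \<open>Each of the other three quarters is mapped injectively into the upper right one by a
  symmetry that preserves multiplicities and does not decrease Re \<rho>, hence, as x >= 1, does not
  decrease the summand.\<close>

lemma xi_zeros_sum_le:
  assumes x: "x \<ge> 1"
  shows "(\<Sum>\<rho>\<in>xi_zeros U. zmult \<rho> * x powr (Re \<rho> - 1)) \<le>
    (\<Sum>\<rho>\<in>real_zeros. zmult \<rho> * x powr (Re \<rho> - 1)) + 4 * (\<Sum>\<rho>\<in>quarter_zeros U. zmult \<rho> * x powr (Re \<rho> - 1))"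
proof -
  define f where "f \<rho> = zmult \<rho> * x powr (Re \<rho> - 1)" for \<rho>
  have fpos: "f \<rho> \<ge> 0" for \<rho> by (simp add: f_def zmult_nonneg)
  have mono: "f a \<le> f b" if "zmult b = zmult a" "Re a \<le> Re b" for a b
    unfolding f_def using that x by (auto intro!: mult_left_mono powr_mono simp: zmult_nonneg)
  define A2 where "A2 = {\<rho> \<in> xi_zeros U. Im \<rho> > 0 \<and> Re \<rho> < 1 / 2}"
  define A3 where "A3 = {\<rho> \<in> xi_zeros U. Im \<rho> < 0 \<and> Re \<rho> \<ge> 1 / 2}"
  define A4 where "A4 = {\<rho> \<in> xi_zeros U. Im \<rho> < 0 \<and> Re \<rho> < 1 / 2}"
  define R where "R = {\<rho> \<in> xi_zeros U. Im \<rho> = 0}"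
  define Q where "Q = quarter_zeros U"
  have dec: "xi_zeros U = R \<union> (Q \<union> (A2 \<union> (A3 \<union> A4)))"
    by (auto simp: R_def Q_def A2_def A3_def A4_def xi_zeros_def quarter_zeros_def)
  have fin: "finite R" "finite Q" "finite A2" "finite A3" "finite A4"
    using finite_xi_zeros[of U] finite_quarter_zeros[of U] by (auto simp: R_def Q_def A2_def A3_def A4_def)
  have sub: "sum f (A \<union> B) \<le> sum f A + sum f B" if "finite A" "finite B" for A B
    using sum_Un[OF that, of f] sum_nonneg[of "A \<inter> B" f] fpos by simp
  have "sum f (xi_zeros U) \<le> sum f R + (sum f Q + (sum f A2 + (sum f A3 + sum f A4)))"
    unfolding dec using fin by (intro order_trans[OF sub] add_mono order_refl) auto
  moreover have "sum f R \<le> sum f real_zeros"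
    by (rule sum_mono2[OF finite_real_zeros]) (auto simp: R_def real_zeros_def xi_zeros_def fpos)
  moreover have "sum f A2 \<le> sum f Q"
  proof (rule sum_le_by_injection[where \<phi> = "\<lambda>\<rho>. 1 - cnj \<rho>"])
    show "inj_on (\<lambda>\<rho>. 1 - cnj \<rho>) A2" by (auto simp: inj_on_def)
    show "(\<lambda>\<rho>. 1 - cnj \<rho>) ` A2 \<subseteq> Q" using zmult_symmetries(5) by (auto simp: A2_def Q_def xi_zeros_def quarter_zeros_def)
    show "f \<rho> \<le> f (1 - cnj \<rho>)" if "\<rho> \<in> A2" for \<rho>
      by (rule mono) (use that zmult_symmetries(2) in \<open>auto simp: A2_def xi_zeros_def\<close>)
  qed (use fin fpos in auto)
  moreover have "sum f A3 \<le> sum f Q"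
  proof (rule sum_le_by_injection[where \<phi> = cnj])
    show "inj_on cnj A3" by (auto simp: inj_on_def)
    show "cnj ` A3 \<subseteq> Q" using zmult_symmetries(4) by (auto simp: A3_def Q_def xi_zeros_def quarter_zeros_def)
    show "f \<rho> \<le> f (cnj \<rho>)" if "\<rho> \<in> A3" for \<rho>
      by (rule mono) (use that zmult_symmetries(1) in \<open>auto simp: A3_def xi_zeros_def\<close>)
  qed (use fin fpos in auto)
  moreover have "sum f A4 \<le> sum f Q"
  proof (rule sum_le_by_injection[where \<phi> = "\<lambda>\<rho>. 1 - \<rho>"])
    show "inj_on (\<lambda>\<rho>. 1 - \<rho>) A4" by (auto simp: inj_on_def)
    show "(\<lambda>\<rho>. 1 - \<rho>) ` A4 \<subseteq> Q" using zmult_symmetries(6) by (auto simp: A4_def Q_def xi_zeros_def quarter_zeros_def)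
    show "f \<rho> \<le> f (1 - \<rho>)" if "\<rho> \<in> A4" for \<rho>
      by (rule mono) (use that zmult_symmetries(3) in \<open>auto simp: A4_def xi_zeros_def\<close>)
  qed (use fin fpos in auto)
  ultimately have "sum f (xi_zeros U) \<le> sum f real_zeros + 4 * sum f Q" by linarith
  then show ?thesis by (simp add: f_def Q_def)
qed

text \<open>A consequence of the order of growth of \<open>xi\<close>. It is applied above height x,
  against a weight that decays like 2^(-6 j).\<close>

lemma xi_zero_count_crude: "\<exists>C>0. \<forall>u\<ge>1. (\<Sum>\<rho>\<in>xi_zeros u. zmult \<rho>) \<le> C * u\<^sup>2"
proof -
  obtain A where A: "A \<ge> 0" "\<And>s. norm (xi s) \<le> exp (A * (1 + norm s)\<^sup>2)" using xi_growth by auto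
  have x2: "xi 2 \<noteq> 0" by (rule xi_nonzero_gt_1) simp
  from logderiv_partial_fractions[OF xi_holomorphic x2 A] obtain C where C: "C > 0"
    "\<And>r. r \<ge> 1 \<Longrightarrow> (\<Sum>\<rho> | \<rho> \<in> cball 2 r \<and> xi \<rho> = 0. real (nat (zorder xi \<rho>))) \<le> C * r\<^sup>2" by blast
  show ?thesis
  proof (rule exI[of _ "C * 16"], intro conjI allI impI)
    fix u :: real assume u: "u \<ge> 1"
    have "(\<Sum>\<rho>\<in>xi_zeros u. zmult \<rho>) = (\<Sum>\<rho>\<in>xi_zeros u. real (nat (zorder xi \<rho>)))"
      by (rule sum.cong) (auto simp: xi_zeros_def zmult_eq_xi)
    also have "\<dots> \<le> (\<Sum>\<rho> | \<rho> \<in> cball 2 (u + 3) \<and> xi \<rho> = 0. real (nat (zorder xi \<rho>)))"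
    proof (rule sum_mono2)
      show "finite {\<rho> \<in> cball 2 (u + 3). xi \<rho> = 0}" by (rule finite_zeros_compact[OF xi_holomorphic x2 compact_cball])
      show "xi_zeros u \<subseteq> {\<rho> \<in> cball 2 (u + 3). xi \<rho> = 0}"
      proof
        fix \<rho> assume r: "\<rho> \<in> xi_zeros u"
        have "norm (\<rho> - 2) \<le> \<bar>Re (\<rho> - 2)\<bar> + \<bar>Im (\<rho> - 2)\<bar>" by (rule cmod_le)
        also have "\<dots> \<le> 2 + u" using r xi_zero_strip[of \<rho>] by (auto simp: xi_zeros_def)
        finally show "\<rho> \<in> {\<rho> \<in> cball 2 (u + 3). xi \<rho> = 0}" using r by (simp add: xi_zeros_def dist_norm norm_minus_commute)
      qed
    qed auto
    also have "\<dots> \<le> C * (u + 3)\<^sup>2" using C(2)[of "u + 3"] u by simp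
    also have "\<dots> \<le> C * (4 * u)\<^sup>2" using u C(1) by (intro mult_left_mono power_mono) auto
    finally show "(\<Sum>\<rho>\<in>xi_zeros u. zmult \<rho>) \<le> C * 16 * u\<^sup>2" by (simp add: power_mult_distrib)
  qed (use C in simp)
qed

text \<open>Partial summation in \<open>\<sigma>\<close>: integrate the density bound against the derivative of \<open>x powr (\<sigma> - 1)\<close>.\<close>

lemma density_partial_summation:
  fixes w \<beta> :: "'a \<Rightarrow> real"
  assumes fin: "finite A" and w: "\<And>\<rho>. \<rho> \<in> A \<Longrightarrow> w \<rho> \<ge> 0"
    and \<beta>: "\<And>\<rho>. \<rho> \<in> A \<Longrightarrow> 1 / 2 \<le> \<beta> \<rho> \<and> \<beta> \<rho> \<le> 1 - e" and e: "0 \<le> e" "e < 1 / 2"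
    and N: "\<And>\<sigma>. 1 / 2 \<le> \<sigma> \<Longrightarrow> \<sigma> \<le> 1 \<Longrightarrow> (\<Sum>\<rho> | \<rho> \<in> A \<and> \<sigma> \<le> \<beta> \<rho>. w \<rho>) \<le> M * Y powr (1 - \<sigma>)"
    and x: "x > 1" and Y: "1 \<le> Y" "Y < x" and M: "M \<ge> 0"
  shows "(\<Sum>\<rho>\<in>A. w \<rho> * x powr (\<beta> \<rho> - 1)) \<le> M * (Y / x) powr e * ln x / ln (x / Y)"
proof -
  define q where "q = Y / x"
  have q: "0 < q" "q < 1" using x Y by (auto simp: q_def)
  define l where "l = ln (x / Y)"
  have lq: "ln q = - l" using x Y by (simp add: l_def q_def ln_div)
  have l: "l > 0" using x Y by (simp add: l_def)
  have lx: "l \<le> ln x" using x Y by (simp add: l_def ln_div)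
  have lnx: "ln x > 0" using x by simp
  \<comment> \<open>The power at \<beta> minus the power at 1/2 is the integral of the derivative
    over [1/2, \<beta>]. Writing the upper limit as an indicator lets the sum over zeros become the
    counting function under the integral.\<close>
  have I1: "((\<lambda>\<sigma>. if \<sigma> \<le> \<beta> \<rho> then ln x * x powr (\<sigma> - 1) else 0) has_integral (x powr (\<beta> \<rho> - 1) - x powr (- 1 / 2))) {1/2..1 - e}"
    if \<rho>: "\<rho> \<in> A" for \<rho>
  proof -
    have "((\<lambda>\<sigma>. ln x * x powr (\<sigma> - 1)) has_integral (x powr (\<beta> \<rho> - 1) - x powr (1 / 2 - 1))) {1/2..\<beta> \<rho>}"
    proof (rule fundamental_theorem_of_calculus)
      show "1 / 2 \<le> \<beta> \<rho>" using \<beta>[OF \<rho>] by simp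
      fix \<sigma> assume "\<sigma> \<in> {1/2..\<beta> \<rho>}"
      have "((\<lambda>\<sigma>. exp ((\<sigma> - 1) * ln x)) has_real_derivative ln x * exp ((\<sigma> - 1) * ln x)) (at \<sigma> within {1/2..\<beta> \<rho>})"
        by (auto intro!: derivative_eq_intros)
      then show "((\<lambda>\<sigma>. x powr (\<sigma> - 1)) has_vector_derivative ln x * x powr (\<sigma> - 1)) (at \<sigma> within {1/2..\<beta> \<rho>})"
        using x by (simp add: has_real_derivative_iff_has_vector_derivative powr_def)
    qed
    then have "((\<lambda>\<sigma>. if \<sigma> \<in> {1/2..\<beta> \<rho>} then ln x * x powr (\<sigma> - 1) else 0) has_integral (x powr (\<beta> \<rho> - 1) - x powr (1 / 2 - 1))) {1/2..1 - e}"
      by (subst has_integral_restrict) (use \<beta>[OF \<rho>] in auto)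
    moreover have "(1 / 2 - 1 :: real) = - 1 / 2" by simp
    ultimately have "((\<lambda>\<sigma>. if \<sigma> \<in> {1/2..\<beta> \<rho>} then ln x * x powr (\<sigma> - 1) else 0) has_integral (x powr (\<beta> \<rho> - 1) - x powr (- 1 / 2))) {1/2..1 - e}"
      by simp
    then show ?thesis by (rule has_integral_eq[rotated]) auto
  qed
  have I2: "((\<lambda>\<sigma>. \<Sum>\<rho>\<in>A. w \<rho> * (if \<sigma> \<le> \<beta> \<rho> then ln x * x powr (\<sigma> - 1) else 0)) has_integral
     (\<Sum>\<rho>\<in>A. w \<rho> * (x powr (\<beta> \<rho> - 1) - x powr (- 1 / 2)))) {1/2..1 - e}"
    by (intro has_integral_sum fin has_integral_mult_right I1)
  have I3: "((\<lambda>\<sigma>. M * ln x * q powr (1 - \<sigma>)) has_integral (M * ln x * (q powr e / l) - M * ln x * (q powr (1 / 2) / l))) {1/2..1 - e}"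
  proof -
    have "((\<lambda>\<sigma>. M * ln x * q powr (1 - \<sigma>)) has_integral (M * ln x * (q powr (1 - (1 - e)) / l) - M * ln x * (q powr (1 - 1 / 2) / l))) {1/2..1 - e}"
    proof (rule fundamental_theorem_of_calculus)
      show "1 / 2 \<le> 1 - e" using e by simp
      fix \<sigma> assume "\<sigma> \<in> {1/2..1 - e}"
      have "((\<lambda>\<sigma>. M * ln x * (exp ((1 - \<sigma>) * ln q) / l)) has_real_derivative M * ln x * exp ((1 - \<sigma>) * ln q)) (at \<sigma> within {1/2..1 - e})"
        using l by (auto intro!: derivative_eq_intros simp: lq)
      then show "((\<lambda>\<sigma>. M * ln x * (q powr (1 - \<sigma>) / l)) has_vector_derivative M * ln x * q powr (1 - \<sigma>)) (at \<sigma> within {1/2..1 - e})"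
        using q by (simp add: has_real_derivative_iff_has_vector_derivative powr_def)
    qed
    then show ?thesis by simp
  qed
  have qY: "x powr (\<sigma> - 1) * Y powr (1 - \<sigma>) = q powr (1 - \<sigma>)" for \<sigma>
  proof -
    have "q powr (1 - \<sigma>) = Y powr (1 - \<sigma>) / x powr (1 - \<sigma>)" unfolding q_def by (rule powr_divide)
    also have "x powr (1 - \<sigma>) = inverse (x powr (\<sigma> - 1))" using powr_minus[of x "\<sigma> - 1"] by simp
    finally show ?thesis by (simp add: field_simps)
  qed
  have "(\<Sum>\<rho>\<in>A. w \<rho> * (x powr (\<beta> \<rho> - 1) - x powr (- 1 / 2))) \<le> M * ln x * (q powr e / l) - M * ln x * (q powr (1 / 2) / l)"
  proof (rule has_integral_le[OF I2 I3])
    fix \<sigma> assume s: "\<sigma> \<in> {1/2..1 - e}"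
    have "(\<Sum>\<rho>\<in>A. w \<rho> * (if \<sigma> \<le> \<beta> \<rho> then ln x * x powr (\<sigma> - 1) else 0)) = (\<Sum>\<rho> | \<rho> \<in> A \<and> \<sigma> \<le> \<beta> \<rho>. w \<rho> * (ln x * x powr (\<sigma> - 1)))"
      using fin by (intro sum.mono_neutral_cong_right) auto
    also have "\<dots> = (\<Sum>\<rho> | \<rho> \<in> A \<and> \<sigma> \<le> \<beta> \<rho>. w \<rho>) * (ln x * x powr (\<sigma> - 1))" by (rule sum_distrib_right[symmetric])
    also have "\<dots> \<le> (M * Y powr (1 - \<sigma>)) * (ln x * x powr (\<sigma> - 1))"
      using N[of \<sigma>] s e lnx by (intro mult_right_mono) auto
    also have "\<dots> = M * ln x * (x powr (\<sigma> - 1) * Y powr (1 - \<sigma>))" by simp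
    finally show "(\<Sum>\<rho>\<in>A. w \<rho> * (if \<sigma> \<le> \<beta> \<rho> then ln x * x powr (\<sigma> - 1) else 0)) \<le> M * ln x * q powr (1 - \<sigma>)"
      unfolding qY .
  qed
  moreover have "(\<Sum>\<rho>\<in>A. w \<rho> * (x powr (\<beta> \<rho> - 1) - x powr (- 1 / 2))) = (\<Sum>\<rho>\<in>A. w \<rho> * x powr (\<beta> \<rho> - 1)) - (\<Sum>\<rho>\<in>A. w \<rho>) * x powr (- 1 / 2)"
    by (simp add: right_diff_distrib sum_subtractf sum_distrib_right)
  \<comment> \<open>The boundary term at 1/2 is absorbed by the negative contribution of the lower
    limit in the integral of the majorant, because ln x / l >= 1.\<close>
  moreover have "(\<Sum>\<rho>\<in>A. w \<rho>) * x powr (- 1 / 2) \<le> M * ln x * (q powr (1 / 2) / l)"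
  proof -
    have "{\<rho>. \<rho> \<in> A \<and> 1 / 2 \<le> \<beta> \<rho>} = A" using \<beta> by auto
    then have "(\<Sum>\<rho>\<in>A. w \<rho>) \<le> M * Y powr (1 / 2)" using N[of "1 / 2"] by simp
    then have "(\<Sum>\<rho>\<in>A. w \<rho>) * x powr (- 1 / 2) \<le> M * Y powr (1 / 2) * x powr (- 1 / 2)" by (intro mult_right_mono) auto
    also have "\<dots> = M * q powr (1 / 2)" using qY[of "1 / 2"] by (simp add: mult_ac)
    also have "\<dots> \<le> M * q powr (1 / 2) * (ln x / l)"
      using mult_left_mono[of 1 "ln x / l" "M * q powr (1 / 2)"] M lx l by simp
    finally show ?thesis by (simp add: mult_ac)
  qed
  ultimately have "(\<Sum>\<rho>\<in>A. w \<rho> * x powr (\<beta> \<rho> - 1)) \<le> M * ln x * (q powr e / l)" by linarith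
  then show ?thesis by (simp add: q_def l_def mult_ac)
qed

text \<open>With j the least index such that \<gamma> <= 2^j \<tau>, either j = 0 or \<gamma> /
  \<tau> > 2^(j - 1). In both cases the weight is at most the k-th power of 2^(1 - j), which is one
  term of the sum.\<close>

lemma dyadic_weight:
  fixes \<tau> \<gamma> :: real
  assumes "\<tau> > 0" "\<gamma> \<ge> 0" "\<gamma> \<le> 2 ^ J * \<tau>"
  shows "(1 / max 1 (\<gamma> / \<tau>)) ^ k \<le> (\<Sum>j\<le>J. 2 ^ k * (1 / 2) ^ (j * k) * (if \<gamma> \<le> 2 ^ j * \<tau> then 1 else 0))"
proof -
  define j where "j = (LEAST j. \<gamma> \<le> 2 ^ j * \<tau>)"
  have j: "\<gamma> \<le> 2 ^ j * \<tau>" "j \<le> J" unfolding j_def using assms(3) by (auto intro: LeastI Least_le)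
  have "(1 / max 1 (\<gamma> / \<tau>)) ^ k \<le> 2 ^ k * (1 / 2) ^ (j * k)"
  proof -
    have "1 / max 1 (\<gamma> / \<tau>) \<le> 2 * (1 / 2) ^ j"
    proof (cases j)
      case 0
      have "1 / max 1 (\<gamma> / \<tau>) \<le> 1 / 1" by (rule divide_left_mono) auto
      also have "1 / 1 \<le> (2 :: real)" by simp
      finally show ?thesis using 0 by simp
    next
      case (Suc i)
      then have "\<not> \<gamma> \<le> 2 ^ i * \<tau>" unfolding j_def by (metis lessI not_less_Least)
      then have "2 ^ i < \<gamma> / \<tau>" using assms by (simp add: field_simps)
      then have m: "2 ^ i \<le> max 1 (\<gamma> / \<tau>)" by simp
      have "1 / max 1 (\<gamma> / \<tau>) \<le> 1 / 2 ^ i" by (rule divide_left_mono[OF m]) auto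
      then show ?thesis using Suc by (simp add: power_one_over)
    qed
    then have "(1 / max 1 (\<gamma> / \<tau>)) ^ k \<le> (2 * (1 / 2) ^ j) ^ k" by (intro power_mono) auto
    then show ?thesis by (simp add: power_mult_distrib power_mult)
  qed
  also have "\<dots> = 2 ^ k * (1 / 2) ^ (j * k) * (if \<gamma> \<le> 2 ^ j * \<tau> then 1 else 0)" using j by simp
  also have "\<dots> \<le> (\<Sum>j\<le>J. 2 ^ k * (1 / 2) ^ (j * k) * (if \<gamma> \<le> 2 ^ j * \<tau> then 1 else 0))"
    using j by (intro member_le_sum) auto
  finally show ?thesis .
qed

text \<open>All zeros up to 2^j \<tau> are used instead of dyadic shells: this fits the cumulative
  count N(\<sigma>, T) and costs only a constant. In 2^(k + 1) the factor 2^k comes from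
  \<open>dyadic_weight\<close> and the other 2 from the geometric series.\<close>

lemma weighted_zero_sum_dyadic:
  fixes f :: "complex \<Rightarrow> real"
  assumes \<tau>: "\<tau> > 0" and f: "\<And>\<rho>. f \<rho> \<ge> 0"
    and D: "\<And>j. (1 / 2) ^ (j * k) * (\<Sum>\<rho>\<in>xi_zeros (2 ^ j * \<tau>). f \<rho>) \<le> (1 / 2) ^ j * D"
  shows "(\<Sum>\<rho>\<in>xi_zeros U. f \<rho> * (1 / max 1 (\<bar>Im \<rho>\<bar> / \<tau>)) ^ k) \<le> 2 ^ Suc k * D"
proof -
  have D0: "D \<ge> 0" using D[of 0] sum_nonneg[of "xi_zeros \<tau>" f] f by simp
  obtain J :: nat where "U / \<tau> < 2 ^ J" using real_arch_pow[of 2 "U / \<tau>"] by auto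
  then have J: "U \<le> 2 ^ J * \<tau>" using \<tau> by (simp add: field_simps)
  have "(\<Sum>\<rho>\<in>xi_zeros U. f \<rho> * (1 / max 1 (\<bar>Im \<rho>\<bar> / \<tau>)) ^ k) \<le>
     (\<Sum>\<rho>\<in>xi_zeros U. f \<rho> * (\<Sum>j\<le>J. 2 ^ k * (1 / 2) ^ (j * k) * (if \<bar>Im \<rho>\<bar> \<le> 2 ^ j * \<tau> then 1 else 0)))"
  proof (intro sum_mono mult_left_mono f dyadic_weight[OF \<tau>])
    fix \<rho> assume "\<rho> \<in> xi_zeros U"
    then show "\<bar>Im \<rho>\<bar> \<le> 2 ^ J * \<tau>" using J by (simp add: xi_zeros_def)
  qed simp
  also have "\<dots> = (\<Sum>j\<le>J. 2 ^ k * ((1 / 2) ^ (j * k) * (\<Sum>\<rho>\<in>xi_zeros U. f \<rho> * (if \<bar>Im \<rho>\<bar> \<le> 2 ^ j * \<tau> then 1 else 0))))"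
    unfolding sum_distrib_left by (subst sum.swap) (simp add: mult_ac)
  also have "\<dots> \<le> (\<Sum>j\<le>J. 2 ^ k * ((1 / 2) ^ j * D))"
  proof (intro sum_mono mult_left_mono)
    fix j
    have "(\<Sum>\<rho>\<in>xi_zeros U. f \<rho> * (if \<bar>Im \<rho>\<bar> \<le> 2 ^ j * \<tau> then 1 else 0)) \<le> (\<Sum>\<rho>\<in>xi_zeros (2 ^ j * \<tau>). f \<rho>)"
    proof -
      have "(\<Sum>\<rho>\<in>xi_zeros U. f \<rho> * (if \<bar>Im \<rho>\<bar> \<le> 2 ^ j * \<tau> then 1 else 0)) = (\<Sum>\<rho> | \<rho> \<in> xi_zeros U \<and> \<bar>Im \<rho>\<bar> \<le> 2 ^ j * \<tau>. f \<rho>)"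
        using finite_xi_zeros[of U] by (intro sum.mono_neutral_cong_right) auto
      also have "\<dots> \<le> (\<Sum>\<rho>\<in>xi_zeros (2 ^ j * \<tau>). f \<rho>)"
        by (rule sum_mono2[OF finite_xi_zeros]) (auto simp: xi_zeros_def f)
      finally show ?thesis .
    qed
    then have "(1 / 2) ^ (j * k) * (\<Sum>\<rho>\<in>xi_zeros U. f \<rho> * (if \<bar>Im \<rho>\<bar> \<le> 2 ^ j * \<tau> then 1 else 0)) \<le> (1 / 2) ^ (j * k) * (\<Sum>\<rho>\<in>xi_zeros (2 ^ j * \<tau>). f \<rho>)"
      by (intro mult_left_mono) auto
    then show "(1 / 2) ^ (j * k) * (\<Sum>\<rho>\<in>xi_zeros U. f \<rho> * (if \<bar>Im \<rho>\<bar> \<le> 2 ^ j * \<tau> then 1 else 0)) \<le> (1 / 2) ^ j * D"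
      using D[of j] by (rule order_trans)
  qed auto
  also have "\<dots> = 2 ^ k * D * (\<Sum>j\<le>J. (1 / 2) ^ j)" by (simp add: sum_distrib_left mult_ac)
  also have "\<dots> \<le> 2 ^ k * D * 2"
  proof (intro mult_left_mono)
    have "(\<Sum>j\<le>J. (1 / 2) ^ j) \<le> (\<Sum>j. (1 / 2) ^ j :: real)" by (intro sum_le_suminf summable_geometric) auto
    then show "(\<Sum>j\<le>J. (1 / 2) ^ j) \<le> (2::real)" by (simp add: suminf_geometric)
  qed (use D0 in auto)
  finally show ?thesis by (simp add: mult_ac)
qed


section \<open>The weighted sum over zeros tends to 0\<close>

lemma finite_powr_sum_tendsto_0:
  assumes "\<And>\<rho>. \<rho> \<in> A \<Longrightarrow> Re \<rho> < 1"
  shows "((\<lambda>x. \<Sum>\<rho>\<in>A. w \<rho> * x powr (Re \<rho> - 1)) \<longlongrightarrow> 0) at_top"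
proof (rule tendsto_null_sum)
  fix \<rho> assume "\<rho> \<in> A"
  then have "((\<lambda>x. x powr (Re \<rho> - 1)) \<longlongrightarrow> 0) at_top"
    using assms by (intro tendsto_neg_powr filterlim_ident) simp
  then show "((\<lambda>x. w \<rho> * x powr (Re \<rho> - 1)) \<longlongrightarrow> 0) at_top" by (rule tendsto_mult_right_zero)
qed

text \<open>Zeros up to height \<open>T0\<close> are outside the reach of condition (1) and are
  split off. For the others monotonicity of \<eta> gives the uniform bound Re \<rho> <= 1 -
  \<eta>(x), and monotonicity of h allows h(x); both need ordinates up to x, hence
  \<open>r * \<tau> \<le> x\<close>. The factor r costs r^(b (1 - \<sigma>)) <= r^b, so that the
  base \<tau>^b is the same for all dyadic heights r \<tau>.\<close>

lemma quarter_zeros_density_sum: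
  fixes T0 T2 K b x \<tau> r :: real
  assumes eta: "antimono_on {T0..} \<eta>" "\<And>T. T \<ge> T0 \<Longrightarrow> 0 \<le> \<eta> T \<and> \<eta> T < 1 / 2"
    and zero_free: "\<And>T \<sigma>. T \<ge> T0 \<Longrightarrow> \<sigma> > 1 - \<eta> T \<Longrightarrow> zeta (Complex \<sigma> T) \<noteq> 0"
    and h: "mono_on {T2..} h" and T: "T0 > 0" "T0 \<le> T2" "1 \<le> T2" and b: "b > 0" and K: "K > 0"
    and density: "\<And>T \<sigma>. T \<ge> T2 \<Longrightarrow> 1 / 2 \<le> \<sigma> \<Longrightarrow> \<sigma> \<le> 1 \<Longrightarrow>
      real (zeta_zero_count \<sigma> T) \<le> K * (T powr (b * (1 - \<sigma>)) * h T)"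
    and \<tau>: "T2 \<le> \<tau>" "\<tau> powr b < x" and r: "1 \<le> r" "r * \<tau> \<le> x"
  shows "(\<Sum>\<rho>\<in>quarter_zeros (r * \<tau>). zmult \<rho> * x powr (Re \<rho> - 1)) \<le>
    (\<Sum>\<rho>\<in>quarter_zeros T0. zmult \<rho> * x powr (Re \<rho> - 1)) +
    K * r powr b * (h x * (\<tau> powr b / x) powr \<eta> x * ln x / ln (x / \<tau> powr b))"
    and "h x \<ge> 0"
proof -
  define u where "u = r * \<tau>"
  have \<tau>1: "\<tau> \<ge> 1" using \<tau> T by simp
  have u: "\<tau> \<le> u" "u \<le> x" using r \<tau>1 by (auto simp: u_def mult_le_cancel_right1)
  have uT: "T2 \<le> u" "T0 \<le> u" using u \<tau> T by auto
  \<comment> \<open>At \<sigma> = 1 the density bound reads N <= K h, which forces h >= 0.\<close>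
  have hu: "0 \<le> h u"
  proof -
    have "0 \<le> real (zeta_zero_count 1 u)" by simp
    also have "\<dots> \<le> K * (u powr (b * (1 - 1)) * h u)" using density[of u 1] uT by simp
    finally have "0 \<le> K * (u powr (b * (1 - 1)) * h u)" .
    then show ?thesis using K u \<tau>1 by (simp add: zero_le_mult_iff)
  qed
  have hx: "h u \<le> h x" using h u uT by (auto simp: monotone_on_def)
  show "h x \<ge> 0" using hu hx by simp
  define A where "A = {\<rho> \<in> quarter_zeros u. T0 < Im \<rho>}"
  have finA: "finite A" using finite_quarter_zeros[of u] by (auto simp: A_def)
  have "(\<Sum>\<rho>\<in>A. zmult \<rho> * x powr (Re \<rho> - 1)) \<le> (K * r powr b * h x) * (\<tau> powr b / x) powr \<eta> x * ln x / ln (x / \<tau> powr b)"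
  proof (rule density_partial_summation[OF finA])
    show "1 / 2 \<le> Re \<rho> \<and> Re \<rho> \<le> 1 - \<eta> x" if "\<rho> \<in> A" for \<rho>
    proof -
      have \<rho>: "xi \<rho> = 0" "1 / 2 \<le> Re \<rho>" "T0 < Im \<rho>" "Im \<rho> \<le> u"
        using that by (auto simp: A_def quarter_zeros_def)
      have "\<rho> \<noteq> 1" using \<rho> T by auto
      then have "zeta \<rho> = 0" using \<rho> zeta_eq_0_iff_xi[of \<rho>] by simp
      then have "Re \<rho> \<le> 1 - \<eta> (Im \<rho>)" using zero_free[of "Im \<rho>" "Re \<rho>"] \<rho> by fastforce
      moreover have "\<eta> x \<le> \<eta> (Im \<rho>)" using eta(1) \<rho> u by (auto simp: monotone_on_def)
      ultimately show ?thesis using \<rho> by simp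
    qed
    show "0 \<le> \<eta> x" "\<eta> x < 1 / 2" using eta(2)[of x] uT u by auto
    show "(\<Sum>\<rho> | \<rho> \<in> A \<and> \<sigma> \<le> Re \<rho>. zmult \<rho>) \<le> K * r powr b * h x * (\<tau> powr b) powr (1 - \<sigma>)"
      if s: "1 / 2 \<le> \<sigma>" "\<sigma> \<le> 1" for \<sigma>
    proof -
      have "(\<Sum>\<rho> | \<rho> \<in> A \<and> \<sigma> \<le> Re \<rho>. zmult \<rho>) \<le> (\<Sum>\<rho> | \<rho> \<in> quarter_zeros u \<and> \<sigma> \<le> Re \<rho>. zmult \<rho>)"
        by (rule sum_mono2) (auto simp: A_def finite_quarter_zeros zmult_nonneg)
      also have "\<dots> \<le> K * (u powr (b * (1 - \<sigma>)) * h u)"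
        using density[of u \<sigma>] s uT zeta_zero_count_eq[of \<sigma> u] by simp
      also have "\<dots> \<le> K * ((r powr b * (\<tau> powr b) powr (1 - \<sigma>)) * h x)"
      proof (intro mult_left_mono mult_mono)
        have "u powr (b * (1 - \<sigma>)) = r powr (b * (1 - \<sigma>)) * (\<tau> powr b) powr (1 - \<sigma>)"
          using r \<tau>1 by (simp add: u_def powr_mult powr_powr)
        also have "r powr (b * (1 - \<sigma>)) \<le> r powr b"
          using r b s by (intro powr_mono) (auto simp: mult_le_cancel_left2)
        finally show "u powr (b * (1 - \<sigma>)) \<le> r powr b * (\<tau> powr b) powr (1 - \<sigma>)"
          by (simp add: mult_right_mono)
      qed (use K hx hu in auto)
      finally show ?thesis by (simp add: mult_ac)
    qed
    have "1 powr b \<le> \<tau> powr b" using \<tau>1 b by (intro powr_mono2) auto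
    then show "1 \<le> \<tau> powr b" by simp
    then show "1 < x" using \<tau> by simp
  qed (use K hu hx \<tau> in \<open>auto simp: zmult_nonneg\<close>)
  moreover have "(\<Sum>\<rho>\<in>quarter_zeros u. zmult \<rho> * x powr (Re \<rho> - 1)) =
    (\<Sum>\<rho>\<in>quarter_zeros T0. zmult \<rho> * x powr (Re \<rho> - 1)) + (\<Sum>\<rho>\<in>A. zmult \<rho> * x powr (Re \<rho> - 1))"
  proof -
    have "quarter_zeros u = quarter_zeros T0 \<union> A" using uT by (auto simp: A_def quarter_zeros_def)
    moreover have "quarter_zeros T0 \<inter> A = {}" by (auto simp: A_def quarter_zeros_def)
    ultimately show ?thesis
      using sum.union_disjoint[OF finite_quarter_zeros[of T0] finA] by simp
  qed
  ultimately show "(\<Sum>\<rho>\<in>quarter_zeros (r * \<tau>). zmult \<rho> * x powr (Re \<rho> - 1)) \<le>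
    (\<Sum>\<rho>\<in>quarter_zeros T0. zmult \<rho> * x powr (Re \<rho> - 1)) +
    K * r powr b * (h x * (\<tau> powr b / x) powr \<eta> x * ln x / ln (x / \<tau> powr b))"
    by (simp add: u_def mult_ac)
qed

text \<open>Up to height x the density bound applies and grows like 2^(j b), which k >= b + 1
  reduces to 2^(-j). Beyond x only the count C0 u^2 is available:
  \<open>\<tau>\<^sup>2 \<le> x\<close> bounds it by C0 2^(2 j) x, and since 2^j >= sqrt x there,
  the weight 2^(-6 j) leaves 2^(-j) C0 / sqrt x.\<close>

lemma weighted_zero_sum_le:
  fixes T0 T2 K b x \<tau> C0 :: real and k :: nat
  assumes eta: "antimono_on {T0..} \<eta>" "\<And>T. T \<ge> T0 \<Longrightarrow> 0 \<le> \<eta> T \<and> \<eta> T < 1 / 2"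
    and zero_free: "\<And>T \<sigma>. T \<ge> T0 \<Longrightarrow> \<sigma> > 1 - \<eta> T \<Longrightarrow> zeta (Complex \<sigma> T) \<noteq> 0"
    and h: "mono_on {T2..} h" and T: "T0 > 0" "T0 \<le> T2" "1 \<le> T2" and b: "b > 0" and K: "K > 0"
    and density: "\<And>T \<sigma>. T \<ge> T2 \<Longrightarrow> 1 / 2 \<le> \<sigma> \<Longrightarrow> \<sigma> \<le> 1 \<Longrightarrow>
      real (zeta_zero_count \<sigma> T) \<le> K * (T powr (b * (1 - \<sigma>)) * h T)"
    and C0: "C0 > 0" "\<And>u. u \<ge> 1 \<Longrightarrow> (\<Sum>\<rho>\<in>xi_zeros u. zmult \<rho>) \<le> C0 * u\<^sup>2"
    and \<tau>: "T2 \<le> \<tau>" "\<tau> powr b < x" "\<tau>\<^sup>2 \<le> x" and k: "k \<ge> 6" "real k \<ge> b + 1"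
  shows "(\<Sum>\<rho>\<in>xi_zeros U. zmult \<rho> * x powr (Re \<rho> - 1) * (1 / max 1 (\<bar>Im \<rho>\<bar> / \<tau>)) ^ k) \<le>
    2 ^ Suc k * ((\<Sum>\<rho>\<in>real_zeros. zmult \<rho> * x powr (Re \<rho> - 1)) +
     4 * (\<Sum>\<rho>\<in>quarter_zeros T0. zmult \<rho> * x powr (Re \<rho> - 1)) +
     4 * K * (h x * (\<tau> powr b / x) powr \<eta> x * ln x / ln (x / \<tau> powr b)) + C0 / sqrt x)"
    (is "_ \<le> 2 ^ Suc k * (?R + 4 * ?a + 4 * K * ?B + ?E)")
proof (rule weighted_zero_sum_dyadic)
  have \<tau>1: "\<tau> \<ge> 1" using \<tau> T by simp
  have \<tau>x: "\<tau> \<le> x" using \<tau>(3) \<tau>1 self_le_power[of \<tau> 2] by simp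
  have x1: "x \<ge> 1" using \<tau>x \<tau>1 by simp
  show "\<tau> > 0" using \<tau>1 by simp
  show "zmult \<rho> * x powr (Re \<rho> - 1) \<ge> 0" for \<rho> by (simp add: zmult_nonneg)
  have hx: "h x \<ge> 0"
    by (rule quarter_zeros_density_sum(2)[OF eta zero_free h T b K density \<tau>(1,2), of 1]) (use \<tau>x in auto)
  have "1 powr b \<le> \<tau> powr b" using \<tau>1 b by (intro powr_mono2) auto
  then have "x / \<tau> powr b > 1" using \<tau> by (subst less_divide_eq_1_pos) auto
  then have B0: "?B \<ge> 0" using hx x1 by (intro divide_nonneg_nonneg mult_nonneg_nonneg) auto
  have KB0: "4 * K * ?B \<ge> 0" by (rule mult_nonneg_nonneg[OF _ B0]) (use K in simp)
  have R0: "?R \<ge> 0" and a0: "?a \<ge> 0" by (auto intro!: sum_nonneg mult_nonneg_nonneg simp: zmult_nonneg)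
  have E0: "?E \<ge> 0" using C0 x1 by simp
  fix j :: nat
  have half: "(1 / 2 :: real) ^ (j * k) \<le> (1 / 2) ^ j"
    using k by (intro power_decreasing) auto
  show "(1 / 2) ^ (j * k) * (\<Sum>\<rho>\<in>xi_zeros (2 ^ j * \<tau>). zmult \<rho> * x powr (Re \<rho> - 1))
     \<le> (1 / 2) ^ j * (?R + 4 * ?a + 4 * K * ?B + ?E)"
  proof (cases "2 ^ j * \<tau> \<le> x")
    case True
    have S: "(\<Sum>\<rho>\<in>xi_zeros (2 ^ j * \<tau>). zmult \<rho> * x powr (Re \<rho> - 1)) \<le> (?R + 4 * ?a) + (2 ^ j) powr b * (4 * K * ?B)"
    proof -
      have that: "(\<Sum>\<rho>\<in>quarter_zeros (2 ^ j * \<tau>). zmult \<rho> * x powr (Re \<rho> - 1)) \<le> ?a + K * (2 ^ j) powr b * ?B"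
        by (rule quarter_zeros_density_sum(1)[OF eta zero_free h T b K density \<tau>(1,2)]) (use True in auto)
      define B where "B = ?B"
      have "4 * (K * (2 ^ j) powr b * B) = (2 ^ j) powr b * (4 * K * B)" by simp
      then show ?thesis using that xi_zeros_sum_le[OF x1, of "2 ^ j * \<tau>"] unfolding B_def[symmetric] by linarith
    qed
    have pb: "(1 / 2) ^ (j * k) * (2 ^ j) powr b \<le> (1 / 2 :: real) ^ j"
    proof -
      have "(2 ^ j :: real) powr b \<le> (2 ^ j) powr real (k - 1)" using k by (intro powr_mono) auto
      also have "\<dots> = 2 ^ (j * (k - 1))" by (simp add: powr_realpow power_mult)
      finally have "(1 / 2) ^ (j * k) * (2 ^ j) powr b \<le> (1 / 2) ^ (j * k) * (2 :: real) ^ (j * (k - 1))"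
        by (intro mult_left_mono) auto
      also have "\<dots> = (1 / 2) ^ j"
      proof -
        have "j * k = j * (k - 1) + j" using k by (cases k) auto
        then show ?thesis by (simp only: power_add power_one_over) simp
      qed
      finally show ?thesis .
    qed
    have "(1 / 2) ^ (j * k) * (\<Sum>\<rho>\<in>xi_zeros (2 ^ j * \<tau>). zmult \<rho> * x powr (Re \<rho> - 1)) \<le>
       (1 / 2) ^ (j * k) * ((?R + 4 * ?a) + (2 ^ j) powr b * (4 * K * ?B))" using S by (intro mult_left_mono) auto
    also have "\<dots> = (1 / 2) ^ (j * k) * (?R + 4 * ?a) + ((1 / 2) ^ (j * k) * (2 ^ j) powr b) * (4 * K * ?B)"
      by (simp add: algebra_simps)
    also have "\<dots> \<le> (1 / 2) ^ j * (?R + 4 * ?a) + (1 / 2) ^ j * (4 * K * ?B)"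
      by (intro add_mono mult_right_mono half pb KB0) (use R0 a0 in auto)
    also have "\<dots> = (1 / 2) ^ j * ((?R + 4 * ?a) + 4 * K * ?B)" by (rule distrib_left[symmetric])
    also have "\<dots> \<le> (1 / 2) ^ j * ((?R + 4 * ?a) + 4 * K * ?B + ?E)" using E0 by (intro mult_left_mono) auto
    finally show ?thesis by (simp add: add.assoc)
  next
    case False
    have "(\<Sum>\<rho>\<in>xi_zeros (2 ^ j * \<tau>). zmult \<rho> * x powr (Re \<rho> - 1)) \<le> (\<Sum>\<rho>\<in>xi_zeros (2 ^ j * \<tau>). zmult \<rho>)"
    proof (rule sum_mono)
      fix \<rho> assume "\<rho> \<in> xi_zeros (2 ^ j * \<tau>)"
      then have "Re \<rho> < 1" using xi_zero_strip by (auto simp: xi_zeros_def)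
      then have "x powr (Re \<rho> - 1) \<le> x powr 0" using x1 by (intro powr_mono) auto
      then show "zmult \<rho> * x powr (Re \<rho> - 1) \<le> zmult \<rho>"
        using x1 zmult_nonneg[of \<rho>] by (auto simp: mult_left_le)
    qed
    also have "\<dots> \<le> C0 * (2 ^ j * \<tau>)\<^sup>2" using False x1 by (intro C0) auto
    also have "\<dots> \<le> C0 * ((2 ^ j)\<^sup>2 * x)" unfolding power_mult_distrib
      using C0 \<tau> by (intro mult_left_mono) auto
    finally have S: "(\<Sum>\<rho>\<in>xi_zeros (2 ^ j * \<tau>). zmult \<rho> * x powr (Re \<rho> - 1)) \<le> C0 * ((2 ^ j)\<^sup>2 * x)" .
    have "(1 / 2) ^ (j * k) * (\<Sum>\<rho>\<in>xi_zeros (2 ^ j * \<tau>). zmult \<rho> * x powr (Re \<rho> - 1)) \<le>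
       (1 / 2) ^ (j * 6) * (C0 * ((2 ^ j)\<^sup>2 * x))"
      by (rule mult_mono[OF _ S]) (use k in \<open>auto intro!: power_decreasing sum_nonneg simp: zmult_nonneg\<close>)
    also have "\<dots> = (1 / 2) ^ j * (C0 * x * (1 / 2 ^ j) ^ 3)"
    proof -
      have "(1 / 2 :: real) ^ (j * 6) = (1 / 2 ^ j) ^ 6" by (simp add: power_mult power_one_over)
      then show ?thesis by (simp add: power_one_over field_simps power_numeral_reduce)
    qed
    also have "\<dots> \<le> (1 / 2) ^ j * (C0 * x * (1 / sqrt x) ^ 3)"
    proof (intro mult_left_mono power_mono)
      have "\<tau> \<le> sqrt x" using \<tau>(3) \<tau>1 by (simp add: real_le_rsqrt)
      then have "2 ^ j * \<tau> \<le> 2 ^ j * sqrt x" by (intro mult_left_mono) auto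
      then have "x \<le> 2 ^ j * sqrt x" using False by linarith
      moreover have "sqrt x * sqrt x = x" using x1 by simp
      ultimately have "sqrt x * sqrt x \<le> 2 ^ j * sqrt x" by simp
      then have "sqrt x \<le> 2 ^ j" by (rule mult_right_le_imp_le) (use x1 in simp)
      then show "1 / 2 ^ j \<le> 1 / sqrt x" using x1 by (intro divide_left_mono) auto
    qed (use C0 x1 in auto)
    also have "C0 * x * (1 / sqrt x) ^ 3 = ?E"
    proof -
      have "x = sqrt x * sqrt x" using x1 by simp
      then have "x * (1 / sqrt x) ^ 3 = (sqrt x * sqrt x) * (1 / sqrt x) ^ 3" by simp
      also have "\<dots> = 1 / sqrt x" using x1 by (simp add: power3_eq_cube field_simps)
      finally show ?thesis by (simp add: mult.assoc)
    qed
    also have "(1 / 2) ^ j * ?E \<le> (1 / 2) ^ j * (?R + 4 * ?a + 4 * K * ?B + ?E)"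
      by (rule mult_left_mono) (use R0 a0 KB0 in linarith, simp)
    finally show ?thesis .
  qed
qed


text \<open>Half of the exponent \<delta> is given up to remove the implied constant.\<close>

lemma g_eventually_ge:
  assumes delta: "\<delta> > 0" and g_pos: "\<forall>\<^sub>F x in at_top. g x > (0 :: real)"
    and g_lower: "(\<lambda>x. ln x powr \<delta>) \<in> O[at_top](g)"
  shows "\<forall>\<^sub>F x in at_top. ln x powr (\<delta> / 2) \<le> g x"
proof -
  obtain c where c: "c > 0" "\<forall>\<^sub>F x in at_top. norm (ln x powr \<delta>) \<le> c * norm (g x)"
    using landau_o.bigE[OF g_lower] by blast
  have "filterlim (\<lambda>x. ln x powr (\<delta> / 2)) at_top at_top" using delta by real_asymp
  then have "\<forall>\<^sub>F x in at_top. c \<le> ln x powr (\<delta> / 2)" by (simp add: filterlim_at_top)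
  with c(2) g_pos eventually_gt_at_top[of 1] show ?thesis
  proof eventually_elim
    case (elim x)
    have "c * ln x powr (\<delta> / 2) \<le> ln x powr (\<delta> / 2) * ln x powr (\<delta> / 2)" using elim by (intro mult_right_mono) auto
    also have "\<dots> = ln x powr \<delta>" by (simp flip: powr_add)
    also have "\<dots> \<le> c * g x" using elim by simp
    finally show ?case using c(1) by simp
  qed
qed

lemma g_eventually_ge_1:
  assumes "\<delta> > 0" "\<forall>\<^sub>F x in at_top. g x > (0 :: real)" "(\<lambda>x. ln x powr \<delta>) \<in> O[at_top](g)"
  shows "\<forall>\<^sub>F x in at_top. 1 \<le> g x"
proof -
  have "filterlim (\<lambda>x. ln x powr (\<delta> / 2)) at_top at_top" using assms(1) by real_asymp
  then have "\<forall>\<^sub>F x in at_top. 1 \<le> ln x powr (\<delta> / 2)" by (simp add: filterlim_at_top)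
  with g_eventually_ge[OF assms] show ?thesis by eventually_elim simp
qed

text \<open>With \<epsilon> = (1 - \<theta>) / 2 in the upper bound for g, half of the exponent 1 -
  \<theta> survives.\<close>

lemma tau_at_top:
  assumes \<theta>: "\<theta> < 1" and g_pos: "\<forall>\<^sub>F x in at_top. g x > (0 :: real)"
    and g_upper: "\<forall>\<epsilon>>0. g \<in> O[at_top](\<lambda>x. x powr \<epsilon>)"
  shows "filterlim (\<lambda>x. x powr (1 - \<theta>) / g x) at_top at_top"
proof -
  have "g \<in> O[at_top](\<lambda>x. x powr ((1 - \<theta>) / 2))" using g_upper \<theta> by simp
  then obtain c where c: "c > 0" "\<forall>\<^sub>F x in at_top. norm (g x) \<le> c * norm (x powr ((1 - \<theta>) / 2))"
    by (rule landau_o.bigE)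
  have "filterlim (\<lambda>x. x powr ((1 - \<theta>) / 2) / c) at_top at_top" using \<theta> c by real_asymp
  then show ?thesis
  proof (rule filterlim_at_top_mono)
    from c(2) g_pos eventually_gt_at_top[of 0]
    show "\<forall>\<^sub>F x in at_top. x powr ((1 - \<theta>) / 2) / c \<le> x powr (1 - \<theta>) / g x"
    proof eventually_elim
      case (elim x)
      have "x powr ((1 - \<theta>) / 2) * g x \<le> x powr ((1 - \<theta>) / 2) * (c * x powr ((1 - \<theta>) / 2))"
        using elim by (intro mult_left_mono) auto
      also have "\<dots> = c * (x powr ((1 - \<theta>) / 2) * x powr ((1 - \<theta>) / 2))" by simp
      also have "x powr ((1 - \<theta>) / 2) * x powr ((1 - \<theta>) / 2) = x powr (1 - \<theta>)" by (simp flip: powr_add)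
      finally show ?case using elim c(1) by (simp add: field_simps)
    qed
  qed
qed

text \<open>With c = 1 + b (\<theta> - 1) one has x / \<tau>^b = x^c g^b, and b <= 1 / (1 -
  \<theta>) means c >= 0; the two cases of condition (3) are c > 0 and c = 0. If c > 0, the quotient
  of logarithms is at most 1 / c. If c = 0, it is ln x / (b ln g), and ln g >= (\<delta> / 2) ln (ln
  x) produces the factor ln x / ln (ln x) of the condition.\<close>

lemma density_term_tendsto_0:
  fixes \<theta> \<delta> b :: real and g \<eta> h :: "real \<Rightarrow> real"
  assumes \<theta>: "\<theta> < 1" and delta: "\<delta> > 0"
    and g_pos: "\<forall>\<^sub>F x in at_top. g x > 0" and g_lower: "(\<lambda>x. ln x powr \<delta>) \<in> O[at_top](g)"
    and eta: "\<forall>\<^sub>F x in at_top. 0 \<le> \<eta> x" and h0: "\<forall>\<^sub>F x in at_top. 0 \<le> h x"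
    and b: "0 < b" "b \<le> 1 / (1 - \<theta>)"
    and cond_gt: "\<theta> > 1 - 1 / b \<longrightarrow>
      h \<in> o[at_top](\<lambda>x. x powr ((1 + b * (\<theta> - 1)) * \<eta> x))"
    and cond_eq: "\<theta> = 1 - 1 / b \<longrightarrow>
      (\<lambda>x. (ln x powr (\<delta> / 2) / g x) powr (b * \<eta> x) * (h x * ln x / ln (ln x)))
        \<in> o[at_top](\<lambda>_. 1)"
  defines "\<tau> \<equiv> \<lambda>x. x powr (1 - \<theta>) / g x"
  shows "((\<lambda>x. h x * (\<tau> x powr b / x) powr \<eta> x * ln x / ln (x / \<tau> x powr b)) \<longlongrightarrow> 0) at_top"
    and "\<forall>\<^sub>F x in at_top. \<tau> x powr b < x"
proof -
  define c where "c = 1 + b * (\<theta> - 1)"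
  have c0: "c \<ge> 0" using b \<theta> by (simp add: c_def field_simps)
  have cgt: "\<theta> > 1 - 1 / b \<longleftrightarrow> c > 0" using b by (simp add: c_def field_simps)
  have ceq: "\<theta> = 1 - 1 / b \<longleftrightarrow> c = 0" using b by (auto simp: c_def field_simps)
  have q: "\<forall>\<^sub>F x in at_top. x / \<tau> x powr b = x powr c * g x powr b"
    using g_pos eventually_gt_at_top[of 0]
  proof eventually_elim
    case (elim x)
    have "\<tau> x powr b = x powr ((1 - \<theta>) * b) / g x powr b"
      using elim by (simp add: \<tau>_def powr_divide powr_powr)
    moreover have xc: "x / x powr ((1 - \<theta>) * b) = x powr c"
    proof -
      have "x / x powr ((1 - \<theta>) * b) = x powr 1 / x powr ((1 - \<theta>) * b)" using elim by simp
      also have "\<dots> = x powr c" unfolding powr_diff[symmetric] by (simp add: c_def algebra_simps)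
      finally show ?thesis .
    qed
    ultimately show ?case by (simp flip: xc)
  qed
  note ge = g_eventually_ge[OF delta g_pos g_lower]
  note ge1 = g_eventually_ge_1[OF delta g_pos g_lower]
  have B1: "\<forall>\<^sub>F x in at_top. ln x powr (b * (\<delta> / 2)) \<le> g x powr b"
    using ge eventually_gt_at_top[of 1]
  proof eventually_elim
    case (elim x)
    have "(ln x powr (\<delta> / 2)) powr b \<le> g x powr b" using elim b by (intro powr_mono2) auto
    then show ?case by (simp add: powr_powr mult_ac)
  qed
  have big: "\<forall>\<^sub>F x in at_top. 1 < g x powr b \<and> 1 < ln (x :: real) \<and> 1 < x"
  proof -
    have "filterlim (\<lambda>x :: real. ln x powr (b * (\<delta> / 2))) at_top at_top" using b delta by real_asymp
    then have "\<forall>\<^sub>F x :: real in at_top. 2 \<le> ln x powr (b * (\<delta> / 2))" by (simp add: filterlim_at_top)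
    moreover have "\<forall>\<^sub>F x :: real in at_top. 1 < ln x" by real_asymp
    ultimately show ?thesis using B1 eventually_gt_at_top[of 1] by eventually_elim auto
  qed
  show "\<forall>\<^sub>F x in at_top. \<tau> x powr b < x"
    using q big
  proof eventually_elim
    case (elim x)
    have "1 \<le> x powr c" using elim c0 by (intro ge_one_powr_ge_zero) auto
    then have "1 * 1 < x powr c * g x powr b" using elim by (intro mult_le_less_imp_less) auto
    then have "1 < x / \<tau> x powr b" using elim by simp
    then show ?case by (cases "\<tau> x powr b = 0") (auto simp: less_divide_eq_1 split: if_splits)
  qed
  show "((\<lambda>x. h x * (\<tau> x powr b / x) powr \<eta> x * ln x / ln (x / \<tau> x powr b)) \<longlongrightarrow> 0) at_top"
  proof (cases "c = 0")
    case False
    then have c: "c > 0" using c0 by simp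
    then have "h \<in> o[at_top](\<lambda>x. x powr (c * \<eta> x))" using cond_gt cgt by (simp add: c_def)
    then have "((\<lambda>x. h x / x powr (c * \<eta> x)) \<longlongrightarrow> 0) at_top" by (rule smalloD_tendsto)
    then have lim: "((\<lambda>x. h x / x powr (c * \<eta> x) / c) \<longlongrightarrow> 0) at_top" by (rule tendsto_divide_zero)
    show ?thesis
    proof (rule tendsto_sandwich[OF _ _ tendsto_const lim])
      have "\<forall>\<^sub>F x in at_top. 0 \<le> h x * (\<tau> x powr b / x) powr \<eta> x * ln x / ln (x / \<tau> x powr b) \<and>
         h x * (\<tau> x powr b / x) powr \<eta> x * ln x / ln (x / \<tau> x powr b) \<le> h x / x powr (c * \<eta> x) / c"
        using q big h0 eta
      proof eventually_elim
        case (elim x)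
        define p where "p = x powr c * g x powr b"
        have p: "x powr c \<le> p" unfolding p_def using elim by (simp add: mult_le_cancel_left1)
        have p0: "p > 0" "x powr c > 1"
        proof -
          show "x powr c > 1" by (rule gr_one_powr) (use elim c in auto)
          then show "p > 0" using p by linarith
        qed
        have q': "\<tau> x powr b / x = 1 / p" using elim by (metis p_def divide_divide_eq_right div_by_1 mult_1 inverse_eq_divide inverse_divide)
        have l: "c * ln x \<le> ln p" using p p0 elim ln_le_cancel_iff[of "x powr c" p] by (simp add: ln_powr)
        have lx: "ln x > 0" using elim by simp
        have "(1 / p) powr \<eta> x \<le> (1 / x powr c) powr \<eta> x"
          using p p0 elim by (intro powr_mono2 divide_left_mono) auto
        also have "\<dots> = 1 / x powr (c * \<eta> x)" by (simp add: powr_divide powr_powr)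
        finally have e: "(1 / p) powr \<eta> x \<le> 1 / x powr (c * \<eta> x)" .
        have "h x * (1 / p) powr \<eta> x * ln x / ln p \<le> h x * (1 / x powr (c * \<eta> x)) * ln x / (c * ln x)"
          using e l lx c elim by (intro frac_le mult_right_mono mult_left_mono mult_nonneg_nonneg) auto
        also have "\<dots> = h x / x powr (c * \<eta> x) / c" using lx by simp
        finally have "h x * (1 / p) powr \<eta> x * ln x / ln p \<le> h x / x powr (c * \<eta> x) / c" .
        moreover have "0 < ln p" using l lx c by (meson less_le_trans mult_pos_pos)
        then have "0 \<le> h x * (1 / p) powr \<eta> x * ln x / ln p" using elim lx by simp
        ultimately show ?case using elim q' by (simp add: p_def)
      qed
      then show "\<forall>\<^sub>F x in at_top. 0 \<le> h x * (\<tau> x powr b / x) powr \<eta> x * ln x / ln (x / \<tau> x powr b)"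
        "\<forall>\<^sub>F x in at_top. h x * (\<tau> x powr b / x) powr \<eta> x * ln x / ln (x / \<tau> x powr b) \<le> h x / x powr (c * \<eta> x) / c"
        by (auto elim: eventually_mono)
    qed
  next
    case True
    define G where "G x = (ln x powr (\<delta> / 2) / g x) powr (b * \<eta> x) * (h x * ln x / ln (ln x))" for x
    have "G \<in> o[at_top](\<lambda>_. 1)" using cond_eq ceq True by (simp add: G_def[abs_def])
    then have "((\<lambda>x. G x / 1) \<longlongrightarrow> 0) at_top" by (rule smalloD_tendsto)
    then have lim: "((\<lambda>x. G x / (b * (\<delta> / 2))) \<longlongrightarrow> 0) at_top" by (intro tendsto_divide_zero) simp
    show ?thesis
    proof (rule tendsto_sandwich[OF _ _ tendsto_const lim])
      have "\<forall>\<^sub>F x in at_top. 0 \<le> h x * (\<tau> x powr b / x) powr \<eta> x * ln x / ln (x / \<tau> x powr b) \<and>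
         h x * (\<tau> x powr b / x) powr \<eta> x * ln x / ln (x / \<tau> x powr b) \<le> G x / (b * (\<delta> / 2))"
        using q big h0 eta B1 g_pos
      proof eventually_elim
        case (elim x)
        define p where "p = g x powr b"
        have p0: "p > 0" using elim by (auto simp: p_def)
        have q1: "x / \<tau> x powr b = p" using elim True by (simp add: p_def)
        then have q': "\<tau> x powr b / x = 1 / p" by (metis inverse_eq_divide inverse_divide)
        have L: "ln (ln x) > 0" "ln x > 0" using elim by auto
        have l: "b * (\<delta> / 2) * ln (ln x) \<le> ln p"
          using elim L p0 ln_le_cancel_iff[of "ln x powr (b * (\<delta> / 2))" p] by (simp add: ln_powr p_def)
        have b\<delta>: "b * (\<delta> / 2) > 0" using b delta by simp
        \<comment> \<open>The hypothesis has a larger base, a power of ln x over g in place of 1 /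
          g, and so dominates the term to be estimated.\<close>
        have "1 \<le> ln x powr (\<delta> / 2)" using elim delta by (intro ge_one_powr_ge_zero) auto
        then have "(1 / g x) powr (b * \<eta> x) \<le> (ln x powr (\<delta> / 2) / g x) powr (b * \<eta> x)"
          using elim b by (intro powr_mono2 divide_right_mono) auto
        also have "(1 / g x) powr (b * \<eta> x) = (1 / p) powr \<eta> x" by (simp add: p_def powr_divide powr_powr)
        finally have e: "(1 / p) powr \<eta> x \<le> (ln x powr (\<delta> / 2) / g x) powr (b * \<eta> x)" .
        have "h x * (1 / p) powr \<eta> x * ln x / ln p \<le>
            h x * (ln x powr (\<delta> / 2) / g x) powr (b * \<eta> x) * ln x / (b * (\<delta> / 2) * ln (ln x))"
          using e l L b(1) delta elim by (intro frac_le mult_right_mono mult_left_mono mult_nonneg_nonneg mult_pos_pos) auto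
        also have "\<dots> = G x / (b * (\<delta> / 2))" by (simp add: G_def mult_ac)
        finally have "h x * (1 / p) powr \<eta> x * ln x / ln p \<le> G x / (b * (\<delta> / 2))" .
        moreover have "0 < ln p" using l L b\<delta> by (meson less_le_trans mult_pos_pos)
        then have "0 \<le> h x * (1 / p) powr \<eta> x * ln x / ln p" using elim L by simp
        ultimately show ?case using q1 q' by simp
      qed
      then show "\<forall>\<^sub>F x in at_top. 0 \<le> h x * (\<tau> x powr b / x) powr \<eta> x * ln x / ln (x / \<tau> x powr b)"
        "\<forall>\<^sub>F x in at_top. h x * (\<tau> x powr b / x) powr \<eta> x * ln x / ln (x / \<tau> x powr b) \<le> G x / (b * (\<delta> / 2))"
        by (auto elim: eventually_mono)
    qed
  qed
qed

text \<open>U is quantified inside the filter: for fixed x the explicit formula needs the bound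
  along heights tending to infinity, so the threshold for x must not depend on U. The two finite
  sums vanish in the limit because their zeros have Re \<rho> < 1.\<close>

lemma weighted_zero_sum_small:
  fixes \<theta> \<delta> b T0 T1 :: real and g \<eta> h :: "real \<Rightarrow> real" and k :: nat
  assumes theta: "1 / 2 \<le> \<theta>" "\<theta> < 1"
    and g_pos: "\<forall>\<^sub>F x in at_top. g x > 0" and delta: "\<delta> > 0"
    and g_lower: "(\<lambda>x. ln x powr \<delta>) \<in> O[at_top](g)"
    and g_upper: "\<forall>\<epsilon>>0. g \<in> O[at_top](\<lambda>x. x powr \<epsilon>)"
    and T0: "T0 > 0"
    and eta_mono: "antimono_on {T0..} \<eta>"
    and eta_range: "\<forall>T\<ge>T0. 0 \<le> \<eta> T \<and> \<eta> T < 1 / 2"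
    and zero_free: "\<forall>T\<ge>T0. \<forall>\<sigma>. \<sigma> > 1 - \<eta> T \<longrightarrow> zeta (Complex \<sigma> T) \<noteq> 0"
    and h_mono: "mono_on {T1..} h"
    and b: "0 < b" "b \<le> 1 / (1 - \<theta>)"
    and zero_density:
      "\<exists>K>0. \<forall>\<^sub>F T in at_top. \<forall>\<sigma>\<in>{1 / 2..1}.
         real (zeta_zero_count \<sigma> T) \<le> K * (T powr (b * (1 - \<sigma>)) * h T)"
    and cond_gt: "\<theta> > 1 - 1 / b \<longrightarrow>
      h \<in> o[at_top](\<lambda>x. x powr ((1 + b * (\<theta> - 1)) * \<eta> x))"
    and cond_eq: "\<theta> = 1 - 1 / b \<longrightarrow>
      (\<lambda>x. (ln x powr (\<delta> / 2) / g x) powr (b * \<eta> x) * (h x * ln x / ln (ln x)))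
        \<in> o[at_top](\<lambda>_. 1)"
    and k: "k \<ge> 6" "real k \<ge> b + 1" and \<epsilon>: "\<epsilon> > 0"
  shows "\<forall>\<^sub>F x in at_top. \<forall>U. (\<Sum>\<rho>\<in>xi_zeros U. zmult \<rho> * x powr (Re \<rho> - 1) *
    (1 / max 1 (\<bar>Im \<rho>\<bar> / (x powr (1 - \<theta>) / g x))) ^ k) \<le> \<epsilon>"
proof -
  define \<tau> where "\<tau> x = x powr (1 - \<theta>) / g x" for x
  obtain K T3 where K: "K > 0" and density: "\<And>T \<sigma>. T \<ge> T3 \<Longrightarrow> 1 / 2 \<le> \<sigma> \<Longrightarrow> \<sigma> \<le> 1 \<Longrightarrow>
      real (zeta_zero_count \<sigma> T) \<le> K * (T powr (b * (1 - \<sigma>)) * h T)"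
  proof -
    from zero_density obtain K T3 where "K > 0" and T3: "\<forall>T\<ge>T3. \<forall>\<sigma>\<in>{1 / 2..1}.
         real (zeta_zero_count \<sigma> T) \<le> K * (T powr (b * (1 - \<sigma>)) * h T)"
      unfolding eventually_at_top_linorder by blast
    from this(1) show ?thesis by (rule that[of K T3]) (use T3 in auto)
  qed
  define T2 where "T2 = Max {T0, T1, T3, 1}"
  have T2: "T2 \<ge> T0" "T2 \<ge> T1" "T2 \<ge> T3" "T2 \<ge> 1" by (auto simp: T2_def)
  have hm: "mono_on {T2..} h" by (rule monotone_on_subset[OF h_mono]) (use T2 in auto)
  obtain C0 where C0: "C0 > 0" "\<And>u. u \<ge> 1 \<Longrightarrow> (\<Sum>\<rho>\<in>xi_zeros u. zmult \<rho>) \<le> C0 * u\<^sup>2"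
    using xi_zero_count_crude by auto
  have eta0: "\<forall>\<^sub>F x in at_top. 0 \<le> \<eta> x"
    using eventually_ge_at_top[of T0] by eventually_elim (use eta_range in auto)
  have h0: "\<forall>\<^sub>F x in at_top. 0 \<le> h x"
    using eventually_ge_at_top[of T2]
  proof eventually_elim
    case (elim x)
    have "0 \<le> real (zeta_zero_count 1 x)" by simp
    also have "\<dots> \<le> K * (x powr (b * (1 - 1)) * h x)" using density[of x 1] elim T2 by simp
    finally show ?case using K elim T2 by (simp add: zero_le_mult_iff)
  qed
  define S where "S x = 2 ^ Suc k * ((\<Sum>\<rho>\<in>real_zeros. zmult \<rho> * x powr (Re \<rho> - 1)) +
     4 * (\<Sum>\<rho>\<in>quarter_zeros T0. zmult \<rho> * x powr (Re \<rho> - 1)) +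
     4 * K * (h x * (\<tau> x powr b / x) powr \<eta> x * ln x / ln (x / \<tau> x powr b)) + C0 / sqrt x)" for x
  note B = density_term_tendsto_0[OF theta(2) delta g_pos g_lower eta0 h0 b cond_gt cond_eq, folded \<tau>_def]
  have "(S \<longlongrightarrow> 2 ^ Suc k * (0 + 4 * 0 + 4 * K * 0 + 0)) at_top"
    unfolding S_def
  proof (intro tendsto_mult tendsto_add tendsto_const finite_powr_sum_tendsto_0 B(1))
    show "Re \<rho> < 1" if "\<rho> \<in> real_zeros" for \<rho> using that xi_zero_strip by (auto simp: real_zeros_def)
    show "Re \<rho> < 1" if "\<rho> \<in> quarter_zeros T0" for \<rho> using that xi_zero_strip by (auto simp: quarter_zeros_def)
    show "((\<lambda>x. C0 / sqrt x) \<longlongrightarrow> 0) at_top" by real_asymp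
  qed
  then have "\<forall>\<^sub>F x in at_top. S x < \<epsilon>" using \<epsilon> by (intro order_tendstoD(2)) auto
  moreover have "\<forall>\<^sub>F x in at_top. T2 \<le> \<tau> x"
    using tau_at_top[OF theta(2) g_pos g_upper] unfolding \<tau>_def filterlim_at_top by blast
  \<comment> \<open>Here \<theta> >= 1/2 enters, together with g >= 1.\<close>
  moreover have "\<forall>\<^sub>F x in at_top. (\<tau> x)\<^sup>2 \<le> x"
    using g_eventually_ge_1[OF delta g_pos g_lower] eventually_ge_at_top[of 1]
  proof eventually_elim
    case (elim x)
    have "\<tau> x \<le> x powr (1 - \<theta>) / 1" unfolding \<tau>_def using elim by (intro divide_left_mono) auto
    also have "\<dots> \<le> x powr (1 / 2)" using elim theta by (auto intro!: powr_mono)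
    finally have "\<tau> x \<le> sqrt x" using elim by (simp add: powr_half_sqrt)
    moreover have "\<tau> x \<ge> 0" using elim by (simp add: \<tau>_def)
    ultimately have "(\<tau> x)\<^sup>2 \<le> (sqrt x)\<^sup>2" by (intro power_mono) auto
    then show ?case using elim by simp
  qed
  ultimately have "\<forall>\<^sub>F x in at_top. \<forall>U. (\<Sum>\<rho>\<in>xi_zeros U. zmult \<rho> * x powr (Re \<rho> - 1) *
    (1 / max 1 (\<bar>Im \<rho>\<bar> / \<tau> x)) ^ k) \<le> \<epsilon>"
    using B(2)
  proof eventually_elim
    case (elim x)
    show ?case
    proof
      fix U
      have "(\<Sum>\<rho>\<in>xi_zeros U. zmult \<rho> * x powr (Re \<rho> - 1) * (1 / max 1 (\<bar>Im \<rho>\<bar> / \<tau> x)) ^ k) \<le> S x"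
        unfolding S_def
        by (rule weighted_zero_sum_le[OF eta_mono _ _ hm T0 T2(1) T2(4) b(1) K _ C0 _ _ _ k])
          (use elim eta_range zero_free density T2 in auto)
      then show "(\<Sum>\<rho>\<in>xi_zeros U. zmult \<rho> * x powr (Re \<rho> - 1) * (1 / max 1 (\<bar>Im \<rho>\<bar> / \<tau> x)) ^ k) \<le> \<epsilon>"
        using elim by simp
    qed
  qed
  then show ?thesis by (simp add: \<tau>_def)
qed


section \<open>Primes in short intervals\<close>

text \<open>The increment of Chebyshev's psi function over (a, x].\<close>

definition psi_interval :: "real \<Rightarrow> real \<Rightarrow> real" where
  "psi_interval a x = (\<Sum>n | a < real n \<and> real n \<le> x. mangoldt n)"

lemma finite_nat_interval: "finite {n :: nat. a < real n \<and> real n \<le> x}"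
  by (rule finite_subset[of _ "{..nat \<lfloor>x\<rfloor>}"]) (auto simp: le_nat_floor)

lemma psi_interval_Suc:
  assumes "0 < a"
  shows "psi_interval a x = (\<Sum>n | a < real (Suc n) \<and> real (Suc n) \<le> x. mangoldt (Suc n))"
proof -
  have "n \<in> {n. a < real n \<and> real n \<le> x} \<longleftrightarrow> n \<in> Suc ` {n. a < real (Suc n) \<and> real (Suc n) \<le> x}" for n
    using assms by (cases n) (auto simp del: of_nat_Suc)
  then have "{n. a < real n \<and> real n \<le> x} = Suc ` {n. a < real (Suc n) \<and> real (Suc n) \<le> x}" by blast
  then show ?thesis by (simp only: psi_interval_def sum.reindex[OF inj_Suc] o_def)
qed

lemma exp_minus_1_bounds:
  fixes t :: real assumes "t \<ge> 0"
  shows "t \<le> exp t - 1" "exp t - 1 \<le> t * exp t"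
proof -
  show "t \<le> exp t - 1" using exp_ge_add_one_self[of t] by linarith
  have "(1 - t) * exp t \<le> exp (- t) * exp t" using exp_ge_add_one_self[of "- t"] by (intro mult_right_mono) auto
  then show "exp t - 1 \<le> t * exp t" by (simp add: exp_minus algebra_simps)
qed

text \<open>At s = 1 one has s + 2 = 3, and (exp(3 a) - 1) / 3 lies between a and a exp(3 a), for a
  = \<kappa> and for a = L. This isolates the main term up to a factor that is close to 1 for short
  intervals.\<close>

lemma smooth_kernel_at_1:
  fixes \<kappa> L V :: real
  assumes "\<kappa> > 0" "L > 0"
  shows "exp (3 * V) * L * \<kappa> ^ k \<le> Re (smooth_kernel k \<kappa> L V 1)"
    and "Re (smooth_kernel k \<kappa> L V 1) \<le> exp (3 * V) * L * \<kappa> ^ k * exp (3 * L + 3 * real k * \<kappa>)"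
proof -
  define r where "r = exp (3 * V) * ((exp (3 * \<kappa>) - 1) / 3) ^ k * ((exp (3 * L) - 1) / 3)"
  have "smooth_kernel k \<kappa> L V 1 = of_real (exp (V * 3) * ((exp (\<kappa> * 3) - 1) ^ k * (exp (L * 3) - 1)) / 3 ^ Suc k)"
    unfolding smooth_kernel_def by (simp add: exp_of_real[symmetric])
  then have e: "Re (smooth_kernel k \<kappa> L V 1) = r" by (simp add: r_def power_divide mult_ac)
  have l: "L \<le> (exp (3 * L) - 1) / 3" "(exp (3 * L) - 1) / 3 \<le> L * exp (3 * L)"
    using exp_minus_1_bounds[of "3 * L"] assms by auto
  have k: "\<kappa> \<le> (exp (3 * \<kappa>) - 1) / 3" "(exp (3 * \<kappa>) - 1) / 3 \<le> \<kappa> * exp (3 * \<kappa>)"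
    using exp_minus_1_bounds[of "3 * \<kappa>"] assms by auto
  have "exp (3 * V) * \<kappa> ^ k * L \<le> r" unfolding r_def
    using l k assms by (intro mult_mono power_mono mult_nonneg_nonneg) auto
  then show "exp (3 * V) * L * \<kappa> ^ k \<le> Re (smooth_kernel k \<kappa> L V 1)" by (simp add: e mult_ac)
  have "r \<le> exp (3 * V) * (\<kappa> * exp (3 * \<kappa>)) ^ k * (L * exp (3 * L))" unfolding r_def
    using l k assms by (intro mult_mono power_mono mult_nonneg_nonneg) auto
  also have "\<dots> = exp (3 * V) * L * \<kappa> ^ k * exp (3 * L + 3 * real k * \<kappa>)"
    by (simp add: power_mult_distrib exp_add exp_of_nat_mult[symmetric] mult_ac)
  finally show "Re (smooth_kernel k \<kappa> L V 1) \<le> exp (3 * V) * L * \<kappa> ^ k * exp (3 * L + 3 * real k * \<kappa>)"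
    by (simp add: e)
qed

text \<open>The condition \<open>1 \<le> \<kappa> * c * \<tau>\<close> says that the window is not
  shorter than 1 / (c \<tau>). The minimum of \<kappa> and 1 / |\<rho> + 2| is then at most \<kappa>
  c times the weight: for ordinates up to \<tau> by its first entry, for larger ones by its second.
  The factor x^3 reflects s + 2 = 3 in the main term.\<close>

lemma smooth_kernel_zero_bound:
  fixes \<kappa> L V c \<tau> x :: real
  assumes \<rho>: "xi \<rho> = 0" and \<kappa>: "0 < \<kappa>" "\<kappa> \<le> 1" and L: "0 < L" "L \<le> 1"
    and V: "V \<le> ln x" and x: "x > 0" and c: "c \<ge> 1" "\<tau> > 0" "1 \<le> \<kappa> * c * \<tau>"
  shows "norm (smooth_kernel k \<kappa> L V \<rho>) \<le>
    (exp 4 + 1) ^ Suc k * c ^ k * (x ^ 3 * L * \<kappa> ^ k) * (x powr (Re \<rho> - 1) * (1 / max 1 (\<bar>Im \<rho>\<bar> / \<tau>)) ^ k)"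
proof -
  have re: "0 < Re \<rho>" "Re \<rho> < 1" using xi_zero_strip[OF \<rho>] by auto
  have m: "min \<kappa> (1 / norm (\<rho> + 2)) \<le> \<kappa> * c * (1 / max 1 (\<bar>Im \<rho>\<bar> / \<tau>))"
  proof (cases "\<bar>Im \<rho>\<bar> / \<tau> \<le> 1")
    case True
    have "\<kappa> * 1 \<le> \<kappa> * c" using \<kappa> c by (intro mult_left_mono) auto
    then show ?thesis using True by (simp add: min_le_iff_disj)
  next
    case False
    then have I: "\<bar>Im \<rho>\<bar> > 0" using c by (cases "Im \<rho> = 0") auto
    have "1 / norm (\<rho> + 2) \<le> 1 / \<bar>Im \<rho>\<bar>"
      using abs_Im_le_cmod[of "\<rho> + 2"] I by (intro divide_left_mono) (auto intro!: mult_pos_pos)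
    also have "\<dots> \<le> (\<kappa> * c * \<tau>) / \<bar>Im \<rho>\<bar>" using c I by (intro divide_right_mono) auto
    also have "\<dots> = \<kappa> * c * (1 / max 1 (\<bar>Im \<rho>\<bar> / \<tau>))" using False by (simp add: max_def)
    finally show ?thesis by (simp add: min_le_iff_disj)
  qed
  have E: "exp (V * (Re \<rho> + 2)) \<le> x ^ 3 * x powr (Re \<rho> - 1)"
  proof -
    have "exp (V * (Re \<rho> + 2)) \<le> exp (ln x * (Re \<rho> + 2))" using V re by (auto intro!: mult_right_mono)
    also have "\<dots> = x powr (3 + (Re \<rho> - 1))" using x by (simp add: powr_def mult_ac)
    also have "\<dots> = x ^ 3 * x powr (Re \<rho> - 1)" using x by (subst powr_add) (simp add: powr_numeral)
    finally show ?thesis .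
  qed
  have "norm (smooth_kernel k \<kappa> L V \<rho>) \<le> (exp 4 + 1) ^ Suc k * exp (V * (Re \<rho> + 2)) * L * min \<kappa> (1 / norm (\<rho> + 2)) ^ k"
    by (rule smooth_kernel_bound) (use \<kappa> L re in auto)
  also have "\<dots> \<le> (exp 4 + 1) ^ Suc k * (x ^ 3 * x powr (Re \<rho> - 1)) * L * (\<kappa> * c * (1 / max 1 (\<bar>Im \<rho>\<bar> / \<tau>))) ^ k"
  proof (rule mult_mono)
    show "(exp 4 + 1) ^ Suc k * exp (V * (Re \<rho> + 2)) * L \<le> (exp 4 + 1) ^ Suc k * (x ^ 3 * x powr (Re \<rho> - 1)) * L"
      using L by (intro mult_right_mono mult_left_mono E zero_le_power add_nonneg_nonneg) auto
    show "min \<kappa> (1 / norm (\<rho> + 2)) ^ k \<le> (\<kappa> * c * (1 / max 1 (\<bar>Im \<rho>\<bar> / \<tau>))) ^ k"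
      using \<kappa> by (intro power_mono m) auto
    show "0 \<le> (exp 4 + 1) ^ Suc k * (x ^ 3 * x powr (Re \<rho> - 1)) * L"
      using L x by (intro mult_nonneg_nonneg zero_le_power add_nonneg_nonneg) auto
    show "0 \<le> min \<kappa> (1 / norm (\<rho> + 2)) ^ k" using \<kappa> by (intro zero_le_power) auto
  qed
  also have "\<dots> = (exp 4 + 1) ^ Suc k * c ^ k * (x ^ 3 * L * \<kappa> ^ k) * (x powr (Re \<rho> - 1) * (1 / max 1 (\<bar>Im \<rho>\<bar> / \<tau>)) ^ k)"
    by (simp only: power_mult_distrib mult_ac)
  finally show ?thesis .
qed

text \<open>All errors are measured against L \<kappa>^k x^3, the size of the main term when exp V
  is comparable to x. For the integral over Re s = -1 this uses \<kappa>^(-3) <= (c \<tau>)^3 <= c^3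
  x^(3/2) together with exp V <= x, which saves sqrt x.\<close>

lemma smoothed_mangoldt_estimate:
  assumes k: "k \<ge> 5"
  shows "\<exists>C>0. \<forall>\<kappa> L V c \<tau> x \<epsilon>. 0 < \<kappa> \<longrightarrow> \<kappa> \<le> 1 \<longrightarrow> 0 < L \<longrightarrow> L \<le> 1 \<longrightarrow> V \<le> ln x \<longrightarrow> 1 \<le> x \<longrightarrow>
     1 \<le> c \<longrightarrow> 0 < \<tau> \<longrightarrow> \<tau>\<^sup>2 \<le> x \<longrightarrow> 1 \<le> \<kappa> * c * \<tau> \<longrightarrow>
     (\<forall>U. (\<Sum>\<rho>\<in>xi_zeros U. zmult \<rho> * x powr (Re \<rho> - 1) * (1 / max 1 (\<bar>Im \<rho>\<bar> / \<tau>)) ^ k) \<le> \<epsilon>) \<longrightarrow>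
     \<bar>(\<Sum>n. mangoldt (Suc n) * (real (Suc n))\<^sup>2 * smooth_box L \<kappa> k (V - ln (real (Suc n)))) - Re (smooth_kernel k \<kappa> L V 1)\<bar>
      \<le> L * \<kappa> ^ k * x ^ 3 * ((exp 4 + 1) ^ Suc k * c ^ k * \<epsilon> + C * c ^ 3 / sqrt x)"
proof -
  obtain T C where C: "C > 0" and F': "\<forall>\<kappa> L V B.
    0 < \<kappa> \<and> \<kappa> \<le> 1 \<and> 0 < L \<and> L \<le> 1 \<and>
    (\<forall>n :: nat. (\<Sum>\<rho>\<in>xi_zeros (T n). zmult \<rho> * norm (smooth_kernel k \<kappa> L V \<rho>)) \<le> B) \<longrightarrow>
    \<bar>(\<Sum>n. mangoldt (Suc n) * (real (Suc n))\<^sup>2 * smooth_box L \<kappa> k (V - ln (real (Suc n))))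
      - Re (smooth_kernel k \<kappa> L V 1)\<bar> \<le> B + C * exp V * L * \<kappa> ^ (k - 3)"
    using smooth_explicit_formula[OF k] by (elim exE conjE)
  have F: "\<And>\<kappa> L V B. 0 < \<kappa> \<Longrightarrow> \<kappa> \<le> 1 \<Longrightarrow> 0 < L \<Longrightarrow> L \<le> 1 \<Longrightarrow>
     (\<And>n :: nat. (\<Sum>\<rho>\<in>xi_zeros (T n). zmult \<rho> * norm (smooth_kernel k \<kappa> L V \<rho>)) \<le> B) \<Longrightarrow>
     \<bar>(\<Sum>n. mangoldt (Suc n) * (real (Suc n))\<^sup>2 * smooth_box L \<kappa> k (V - ln (real (Suc n)))) - Re (smooth_kernel k \<kappa> L V 1)\<bar>
      \<le> B + C * exp V * L * \<kappa> ^ (k - 3)"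
    by (rule F'[rule_format]) blast
  show ?thesis
  proof (rule exI[of _ C], intro conjI allI impI)
    fix \<kappa> L V c \<tau> x \<epsilon> :: real
    assume \<kappa>: "0 < \<kappa>" "\<kappa> \<le> 1" and L: "0 < L" "L \<le> 1" and V: "V \<le> ln x" and x: "1 \<le> x"
      and c: "1 \<le> c" and \<tau>: "0 < \<tau>" "\<tau>\<^sup>2 \<le> x" and \<kappa>c: "1 \<le> \<kappa> * c * \<tau>"
      and Z: "\<forall>U. (\<Sum>\<rho>\<in>xi_zeros U. zmult \<rho> * x powr (Re \<rho> - 1) * (1 / max 1 (\<bar>Im \<rho>\<bar> / \<tau>)) ^ k) \<le> \<epsilon>"
    define P where "P = (exp 4 + 1) ^ Suc k * c ^ k * (x ^ 3 * L * \<kappa> ^ k)"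
    have P: "P \<ge> 0" using c x L \<kappa> by (auto simp: P_def intro!: mult_nonneg_nonneg zero_le_power add_nonneg_nonneg)
    have S: "(\<Sum>\<rho>\<in>xi_zeros U. zmult \<rho> * norm (smooth_kernel k \<kappa> L V \<rho>)) \<le> P * \<epsilon>" for U
    proof -
      have "(\<Sum>\<rho>\<in>xi_zeros U. zmult \<rho> * norm (smooth_kernel k \<kappa> L V \<rho>)) \<le>
        (\<Sum>\<rho>\<in>xi_zeros U. zmult \<rho> * (P * (x powr (Re \<rho> - 1) * (1 / max 1 (\<bar>Im \<rho>\<bar> / \<tau>)) ^ k)))"
        unfolding P_def
        by (intro sum_mono mult_left_mono zmult_nonneg smooth_kernel_zero_bound)
          (use \<kappa> L V x c \<tau> \<kappa>c in \<open>auto simp: xi_zeros_def\<close>)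
      also have "\<dots> = P * (\<Sum>\<rho>\<in>xi_zeros U. zmult \<rho> * x powr (Re \<rho> - 1) * (1 / max 1 (\<bar>Im \<rho>\<bar> / \<tau>)) ^ k)"
        by (simp only: sum_distrib_left mult_ac)
      also have "\<dots> \<le> P * \<epsilon>" using Z P by (intro mult_left_mono) auto
      finally show ?thesis .
    qed
    have E: "C * exp V * L * \<kappa> ^ (k - 3) \<le> L * \<kappa> ^ k * x ^ 3 * (C * c ^ 3 / sqrt x)"
    proof -
      have "\<tau> \<le> sqrt x" using \<tau> by (simp add: real_le_rsqrt)
      then have "\<kappa> * c * \<tau> \<le> \<kappa> * c * sqrt x" using \<kappa> c by (intro mult_left_mono) auto
      then have "1 ^ 3 \<le> (\<kappa> * c * sqrt x) ^ 3" using \<kappa>c by (intro power_mono) auto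
      then have 1: "1 \<le> \<kappa> ^ 3 * c ^ 3 * sqrt x ^ 3" by (simp add: power_mult_distrib)
      have 2: "exp V \<le> x" using V x by (metis exp_le_cancel_iff exp_ln less_le_trans zero_less_one)
      have k3: "\<kappa> ^ k = \<kappa> ^ (k - 3) * \<kappa> ^ 3" using k by (simp flip: power_add)
      have "C * exp V * L * \<kappa> ^ (k - 3) * 1 \<le> C * x * L * \<kappa> ^ (k - 3) * (\<kappa> ^ 3 * c ^ 3 * sqrt x ^ 3)"
        using 1 2 C L \<kappa> x by (intro mult_mono mult_left_mono mult_right_mono mult_nonneg_nonneg) auto
      also have "\<dots> = L * \<kappa> ^ k * (C * c ^ 3) * (x * sqrt x ^ 3)" unfolding k3 by (simp only: mult_ac)
      also have "x * sqrt x ^ 3 = x * x * sqrt x" using x by (simp add: power3_eq_cube)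
      also have "\<dots> \<le> x ^ 3 / sqrt x"
      proof -
        have "x * x * sqrt x * sqrt x = x ^ 3" using x by (simp add: power3_eq_cube)
        then show ?thesis using x by (subst pos_le_divide_eq) auto
      qed
      finally show ?thesis using C L \<kappa> c by (simp add: mult_left_mono mult_ac)
    qed
    have "\<bar>(\<Sum>n. mangoldt (Suc n) * (real (Suc n))\<^sup>2 * smooth_box L \<kappa> k (V - ln (real (Suc n)))) - Re (smooth_kernel k \<kappa> L V 1)\<bar>
      \<le> P * \<epsilon> + C * exp V * L * \<kappa> ^ (k - 3)"
      by (rule F[OF \<kappa> L S])
    also have "\<dots> \<le> P * \<epsilon> + L * \<kappa> ^ k * x ^ 3 * (C * c ^ 3 / sqrt x)" using E by simp
    also have "\<dots> = L * \<kappa> ^ k * x ^ 3 * ((exp 4 + 1) ^ Suc k * c ^ k * \<epsilon> + C * c ^ 3 / sqrt x)"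
      by (simp only: P_def distrib_left mult_ac)
    finally show "\<bar>(\<Sum>n. mangoldt (Suc n) * (real (Suc n))\<^sup>2 * smooth_box L \<kappa> k (V - ln (real (Suc n)))) - Re (smooth_kernel k \<kappa> L V 1)\<bar>
      \<le> L * \<kappa> ^ k * x ^ 3 * ((exp 4 + 1) ^ Suc k * c ^ k * \<epsilon> + C * c ^ 3 / sqrt x)" .
  qed (rule C)
qed

text \<open>V and L are such that V - ln n lies on the plateau for a < n <= x; all other terms are
  nonnegative.\<close>

lemma psi_interval_le_smooth:
  assumes \<kappa>: "\<kappa> > 0" and L: "L > 0" and k: "k \<ge> 1" and a: "0 < a"
    and V: "V + real k * \<kappa> = ln a" "V + L = ln x" and x: "x > 0"
  shows "a\<^sup>2 * \<kappa> ^ k * psi_interval a x \<le>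
    (\<Sum>n. mangoldt (Suc n) * (real (Suc n))\<^sup>2 * smooth_box L \<kappa> k (V - ln (real (Suc n))))"
proof -
  define N where "N = {n. a < real (Suc n) \<and> real (Suc n) \<le> x}"
  define f where "f n = mangoldt (Suc n) * (real (Suc n))\<^sup>2 * smooth_box L \<kappa> k (V - ln (real (Suc n)))" for n
  note box = smooth_box_facts[OF \<kappa> L k]
  have f0: "f n \<ge> 0" for n using box[of "V - ln (real (Suc n))"] by (auto simp: f_def mangoldt_nonneg intro!: mult_nonneg_nonneg)
  have finN: "finite N" unfolding N_def
    by (rule finite_subset[of _ "{..nat \<lfloor>x\<rfloor>}"]) (auto intro!: le_nat_floor)
  have "a\<^sup>2 * \<kappa> ^ k * psi_interval a x = (\<Sum>n\<in>N. a\<^sup>2 * \<kappa> ^ k * mangoldt (Suc n))"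
    by (simp only: psi_interval_Suc[OF a] N_def[symmetric] sum_distrib_left)
  also have "\<dots> \<le> sum f N"
  proof (rule sum_mono)
    fix n assume n: "n \<in> N"
    define u where "u = real (Suc n)"
    have u: "a < u" "u \<le> x" "0 < u" using n a by (auto simp: N_def u_def)
    have "ln a \<le> ln u" "ln u \<le> ln x" using u a by auto
    then have b: "smooth_box L \<kappa> k (V - ln u) = \<kappa> ^ k" using box[of "V - ln u"] V by simp
    have "a\<^sup>2 * (\<kappa> ^ k * mangoldt (Suc n)) \<le> u\<^sup>2 * (\<kappa> ^ k * mangoldt (Suc n))"
      using u a \<kappa> by (intro mult_right_mono power_mono mult_nonneg_nonneg mangoldt_nonneg) auto
    then show "a\<^sup>2 * \<kappa> ^ k * mangoldt (Suc n) \<le> f n" by (simp only: f_def u_def[symmetric] b mult_ac)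
  qed
  also have "\<dots> \<le> suminf f"
  proof (rule sum_le_suminf)
    show "summable f" unfolding f_def by (rule sums_summable[OF mangoldt_smooth_sum(2)[OF k]])
  qed (use finN f0 in auto)
  finally show ?thesis unfolding f_def .
qed

text \<open>Here V and L are such that the box, as a function of ln n, is supported in [ln a, ln x];
  it is at most \<kappa>^k there.\<close>

lemma smooth_le_psi_interval:
  assumes \<kappa>: "\<kappa> > 0" and L: "L > 0" and k: "k \<ge> 1" and a: "0 < a"
    and V: "V = ln a" "V + L + real k * \<kappa> = ln x" and x: "x > 0"
  shows "(\<Sum>n. mangoldt (Suc n) * (real (Suc n))\<^sup>2 * smooth_box L \<kappa> k (V - ln (real (Suc n)))) \<le>
     x\<^sup>2 * \<kappa> ^ k * psi_interval a x"
proof -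
  define N where "N = {n. a < real (Suc n) \<and> real (Suc n) \<le> x}"
  define f where "f n = mangoldt (Suc n) * (real (Suc n))\<^sup>2 * smooth_box L \<kappa> k (V - ln (real (Suc n)))" for n
  note box = smooth_box_facts[OF \<kappa> L k]
  have finN: "finite N" unfolding N_def
    by (rule finite_subset[of _ "{..nat \<lfloor>x\<rfloor>}"]) (auto intro!: le_nat_floor)
  have "suminf f = sum f N"
  proof (rule suminf_finite[OF finN])
    fix n assume n: "n \<notin> N"
    define u where "u = real (Suc n)"
    have u: "u > 0" by (simp add: u_def)
    have "u \<le> a \<or> x \<le> u" using n by (auto simp: N_def u_def)
    then have "ln u \<le> ln a \<or> ln x \<le> ln u" using a x u by auto
    then have "V - ln u \<ge> 0 \<or> V - ln u \<le> - (L + real k * \<kappa>)" using V by auto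
    then have "smooth_box L \<kappa> k (V - ln u) = 0" using box[of "V - ln u"] by auto
    then show "f n = 0" by (simp add: f_def u_def)
  qed
  also have "\<dots> \<le> (\<Sum>n\<in>N. x\<^sup>2 * \<kappa> ^ k * mangoldt (Suc n))"
  proof (rule sum_mono)
    fix n assume n: "n \<in> N"
    define u where "u = real (Suc n)"
    have u: "a < u" "u \<le> x" "0 < u" using n a by (auto simp: N_def u_def)
    have "mangoldt (Suc n) * (u\<^sup>2 * smooth_box L \<kappa> k (V - ln u)) \<le> mangoldt (Suc n) * (x\<^sup>2 * \<kappa> ^ k)"
      using u box[of "V - ln u"] by (intro mult_left_mono mult_mono power_mono mangoldt_nonneg) auto
    then show "f n \<le> x\<^sup>2 * \<kappa> ^ k * mangoldt (Suc n)" by (simp only: f_def u_def[symmetric] mult_ac)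
  qed
  also have "\<dots> = x\<^sup>2 * \<kappa> ^ k * psi_interval a x"
    by (simp only: psi_interval_Suc[OF a] N_def[symmetric] sum_distrib_left)
  finally show ?thesis unfolding f_def .
qed


text \<open>Here t stands for y / x, and l = - ln (1 - t) is the length of the interval on the
  logarithmic scale. The k windows together take up a fraction \<mu> of it; the minorant has a box
  of length (1 - \<mu>) l and the majorant one of length (1 + \<mu>) l.\<close>

lemma psi_interval_bounds:
  assumes k: "k \<ge> 5"
  shows "\<exists>C>0. \<forall>\<mu> t x \<epsilon>. 0 < \<mu> \<longrightarrow> \<mu> \<le> 1 / 2 \<longrightarrow> 0 < t \<longrightarrow> t \<le> 1 / 4 \<longrightarrow> 1 \<le> x \<longrightarrow> (1 / t)\<^sup>2 \<le> x \<longrightarrow>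
     (\<forall>U. (\<Sum>\<rho>\<in>xi_zeros U. zmult \<rho> * x powr (Re \<rho> - 1) * (1 / max 1 (\<bar>Im \<rho>\<bar> / (1 / t))) ^ k) \<le> \<epsilon>) \<longrightarrow>
     (let E = (exp 4 + 1) ^ Suc k * (real k / \<mu>) ^ k * \<epsilon> + C * (real k / \<mu>) ^ 3 / sqrt x; l = - ln (1 - t)
      in (1 - \<mu>) * (l / t) * ((1 - t) ^ 3 - E) \<le> psi_interval (x - t * x) x / (t * x) \<and>
         psi_interval (x - t * x) x / (t * x) \<le> (1 + \<mu>) * (l / t) * ((exp (3 * \<mu> * l) + E) / (1 - t)\<^sup>2))"
proof -
  obtain C where C: "C > 0" and est: "\<forall>\<kappa> L V c \<tau> x \<epsilon>. 0 < \<kappa> \<longrightarrow> \<kappa> \<le> 1 \<longrightarrow> 0 < L \<longrightarrow> L \<le> 1 \<longrightarrow> V \<le> ln x \<longrightarrow> 1 \<le> x \<longrightarrow>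
     1 \<le> c \<longrightarrow> 0 < \<tau> \<longrightarrow> \<tau>\<^sup>2 \<le> x \<longrightarrow> 1 \<le> \<kappa> * c * \<tau> \<longrightarrow>
     (\<forall>U. (\<Sum>\<rho>\<in>xi_zeros U. zmult \<rho> * x powr (Re \<rho> - 1) * (1 / max 1 (\<bar>Im \<rho>\<bar> / \<tau>)) ^ k) \<le> \<epsilon>) \<longrightarrow>
     \<bar>(\<Sum>n. mangoldt (Suc n) * (real (Suc n))\<^sup>2 * smooth_box L \<kappa> k (V - ln (real (Suc n)))) - Re (smooth_kernel k \<kappa> L V 1)\<bar>
      \<le> L * \<kappa> ^ k * x ^ 3 * ((exp 4 + 1) ^ Suc k * c ^ k * \<epsilon> + C * c ^ 3 / sqrt x)"
    using smoothed_mangoldt_estimate[OF k] by (elim exE conjE)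
  show ?thesis
  proof (rule exI[of _ C], intro conjI allI impI)
    fix \<mu> t x \<epsilon> :: real
    assume lam: "0 < \<mu>" "\<mu> \<le> 1 / 2" and t: "0 < t" "t \<le> 1 / 4" and x: "1 \<le> x" and tx: "(1 / t)\<^sup>2 \<le> x"
      and Z: "\<forall>U. (\<Sum>\<rho>\<in>xi_zeros U. zmult \<rho> * x powr (Re \<rho> - 1) * (1 / max 1 (\<bar>Im \<rho>\<bar> / (1 / t))) ^ k) \<le> \<epsilon>"
    \<comment> \<open>With \<kappa> = \<mu> l / k this makes \<kappa> c / t equal to l / t >= 1, the
      condition of \<open>smooth_kernel_zero_bound\<close> for \<tau> = 1 / t.\<close>
    define c where "c = real k / \<mu>"
    define E where "E = (exp 4 + 1) ^ Suc k * c ^ k * \<epsilon> + C * c ^ 3 / sqrt x"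
    define l where "l = - ln (1 - t)"
    define \<kappa> where "\<kappa> = \<mu> * l / real k"
    define a where "a = x - t * x"
    define \<psi> where "\<psi> = psi_interval a x"
    have a: "a = x * (1 - t)" "a > 0" using t x by (auto simp: a_def algebra_simps)
    have l1: "t \<le> l" using ln_le_minus_one[of "1 - t"] t by (simp add: l_def)
    have l2: "l \<le> 1 / 2"
    proof -
      have "l = ln (1 / (1 - t))" using t by (simp add: l_def ln_div)
      also have "\<dots> \<le> 1 / (1 - t) - 1" using t by (intro ln_le_minus_one) auto
      also have "\<dots> \<le> 1 / 2" using t by (simp add: field_simps)
      finally show ?thesis .
    qed
    have l0: "l > 0" using l1 t by simp
    have lna: "ln a = ln x - l" using a x t by (simp add: l_def ln_mult)
    have k0: "real k > 0" using k by simp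
    have k\<kappa>: "real k * \<kappa> = \<mu> * l" using k by (simp add: \<kappa>_def)
    have \<kappa>0: "\<kappa> > 0" using lam l0 k by (simp add: \<kappa>_def)
    have "\<mu> * l \<le> (1 / 2) * (1 / 2)" using lam l0 l2 by (intro mult_mono) auto
    then have ll: "\<mu> * l \<le> 1 / 4" by simp
    moreover have "\<kappa> * 1 \<le> \<kappa> * real k" using \<kappa>0 k by (intro mult_left_mono) auto
    ultimately have \<kappa>1: "\<kappa> \<le> 1" using k\<kappa> by (simp add: mult.commute)
    have c1: "1 \<le> c" using lam k by (simp add: c_def field_simps)
    have "\<kappa> * c * (1 / t) = l / t" using lam k by (simp add: \<kappa>_def c_def)
    then have \<kappa>c: "1 \<le> \<kappa> * c * (1 / t)" using l1 t by simp
    have t0: "0 < 1 / t" using t by simp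
    define S where "S L V = (\<Sum>n. mangoldt (Suc n) * (real (Suc n))\<^sup>2 * smooth_box L \<kappa> k (V - ln (real (Suc n))))" for L V
    have main: "\<bar>S L V - Re (smooth_kernel k \<kappa> L V 1)\<bar> \<le> L * \<kappa> ^ k * x ^ 3 * E"
      if "0 < L" "L \<le> 1" "V \<le> ln x" for L V
      using est[rule_format, OF \<kappa>0 \<kappa>1 that x c1 t0 tx \<kappa>c Z[rule_format]] by (simp only: S_def E_def)
    have p0: "\<kappa> ^ k > 0" using \<kappa>0 by simp
    have x0: "x > 0" using x by simp
    have k1: "k \<ge> 1" using k by simp
    have low: "(1 - \<mu>) * (l / t) * ((1 - t) ^ 3 - E) \<le> \<psi> / (t * x)"
    proof -
      define L where "L = (1 - \<mu>) * l"
      have "l * (1 - \<mu>) \<le> 1 * 1" using lam l0 l2 by (intro mult_mono) auto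
      then have L: "0 < L" "L \<le> 1" using lam l0 by (auto simp: L_def mult_ac)
      have "S L (ln a) \<le> x\<^sup>2 * \<kappa> ^ k * \<psi>" unfolding S_def \<psi>_def
        by (rule smooth_le_psi_interval) (use \<kappa>0 L k1 a(2) x0 in \<open>auto simp: k\<kappa> lna L_def left_diff_distrib\<close>)
      moreover have "exp (3 * ln a) * L * \<kappa> ^ k \<le> Re (smooth_kernel k \<kappa> L (ln a) 1)"
        by (rule smooth_kernel_at_1[OF \<kappa>0 L(1)])
      moreover have "\<bar>S L (ln a) - Re (smooth_kernel k \<kappa> L (ln a) 1)\<bar> \<le> L * \<kappa> ^ k * x ^ 3 * E"
        by (rule main[OF L]) (use lna l0 in simp)
      ultimately have "exp (3 * ln a) * L * \<kappa> ^ k - L * \<kappa> ^ k * x ^ 3 * E \<le> x\<^sup>2 * \<kappa> ^ k * \<psi>" by linarith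
      moreover have "exp (3 * ln a) = x ^ 3 * (1 - t) ^ 3"
        using a exp_of_nat_mult[of 3 "ln a"] by (simp add: power_mult_distrib)
      ultimately have "x ^ 3 * (1 - t) ^ 3 * L * \<kappa> ^ k - L * \<kappa> ^ k * x ^ 3 * E \<le> x\<^sup>2 * \<kappa> ^ k * \<psi>" by simp
      moreover have "x ^ 3 * (1 - t) ^ 3 * L * \<kappa> ^ k - L * \<kappa> ^ k * x ^ 3 * E = \<kappa> ^ k * x\<^sup>2 * (x * L * ((1 - t) ^ 3 - E))"
        by (simp add: right_diff_distrib power3_eq_cube power2_eq_square mult_ac)
      ultimately have "\<kappa> ^ k * x\<^sup>2 * (x * L * ((1 - t) ^ 3 - E)) \<le> \<kappa> ^ k * x\<^sup>2 * \<psi>"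
        by (simp only: mult_ac)
      then have "x * L * ((1 - t) ^ 3 - E) \<le> \<psi>" by (rule mult_left_le_imp_le) (use p0 x0 in simp)
      then have "x * L * ((1 - t) ^ 3 - E) / (t * x) \<le> \<psi> / (t * x)" using t x0 by (intro divide_right_mono) auto
      also have "x * L * ((1 - t) ^ 3 - E) / (t * x) = (1 - \<mu>) * (l / t) * ((1 - t) ^ 3 - E)"
        using x0 by (simp add: L_def)
      finally show ?thesis .
    qed
    have up: "\<psi> / (t * x) \<le> (1 + \<mu>) * (l / t) * ((exp (3 * \<mu> * l) + E) / (1 - t)\<^sup>2)"
    proof -
      define L where "L = (1 + \<mu>) * l"
      define V where "V = ln x - L"
      have L: "0 < L" "L \<le> 1" using lam l0 ll l2 by (auto simp: L_def algebra_simps add_pos_pos)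
      have "a\<^sup>2 * \<kappa> ^ k * \<psi> \<le> S L V" unfolding S_def \<psi>_def
        by (rule psi_interval_le_smooth) (use \<kappa>0 L k1 a(2) x0 in \<open>auto simp: k\<kappa> lna L_def V_def distrib_right\<close>)
      moreover have "Re (smooth_kernel k \<kappa> L V 1) \<le> exp (3 * V) * L * \<kappa> ^ k * exp (3 * L + 3 * real k * \<kappa>)"
        by (rule smooth_kernel_at_1[OF \<kappa>0 L(1)])
      moreover have "exp (3 * V) * L * \<kappa> ^ k * exp (3 * L + 3 * real k * \<kappa>) = L * \<kappa> ^ k * x ^ 3 * exp (3 * \<mu> * l)"
      proof -
        have "exp (3 * V) * exp (3 * L + 3 * real k * \<kappa>) = exp (3 * ln x + 3 * \<mu> * l)"
          unfolding exp_add[symmetric] using k\<kappa> by (simp add: V_def algebra_simps)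
        also have "\<dots> = x ^ 3 * exp (3 * \<mu> * l)"
          using x0 exp_of_nat_mult[of 3 "ln x"] by (simp add: exp_add)
        finally show ?thesis by (simp add: mult_ac)
      qed
      moreover have "\<bar>S L V - Re (smooth_kernel k \<kappa> L V 1)\<bar> \<le> L * \<kappa> ^ k * x ^ 3 * E"
        by (rule main[OF L]) (use L V_def in simp)
      ultimately have "a\<^sup>2 * \<kappa> ^ k * \<psi> \<le> L * \<kappa> ^ k * x ^ 3 * exp (3 * \<mu> * l) + L * \<kappa> ^ k * x ^ 3 * E" by linarith
      then have "\<kappa> ^ k * x\<^sup>2 * ((1 - t)\<^sup>2 * \<psi>) \<le> \<kappa> ^ k * x\<^sup>2 * (x * L * (exp (3 * \<mu> * l) + E))"
        by (simp add: a(1) algebra_simps power3_eq_cube power2_eq_square)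
      then have "(1 - t)\<^sup>2 * \<psi> \<le> x * L * (exp (3 * \<mu> * l) + E)" by (rule mult_left_le_imp_le) (use p0 x0 in simp)
      then have "\<psi> \<le> x * L * (exp (3 * \<mu> * l) + E) / (1 - t)\<^sup>2" using t by (subst pos_le_divide_eq) (auto simp: mult.commute)
      then have "\<psi> / (t * x) \<le> x * L * (exp (3 * \<mu> * l) + E) / (1 - t)\<^sup>2 / (t * x)" using t x0 by (intro divide_right_mono) auto
      also have "x * L * (exp (3 * \<mu> * l) + E) / (1 - t)\<^sup>2 / (t * x) = (1 + \<mu>) * (l / t) * ((exp (3 * \<mu> * l) + E) / (1 - t)\<^sup>2)"
        using x0 by (simp add: L_def mult_ac)
      finally show ?thesis .
    qed
    show "let E = (exp 4 + 1) ^ Suc k * (real k / \<mu>) ^ k * \<epsilon> + C * (real k / \<mu>) ^ 3 / sqrt x; l = - ln (1 - t)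
      in (1 - \<mu>) * (l / t) * ((1 - t) ^ 3 - E) \<le> psi_interval (x - t * x) x / (t * x) \<and>
         psi_interval (x - t * x) x / (t * x) \<le> (1 + \<mu>) * (l / t) * ((exp (3 * \<mu> * l) + E) / (1 - t)\<^sup>2)"
      using low up unfolding Let_def c_def[symmetric] E_def[symmetric] l_def[symmetric] a_def[symmetric] \<psi>_def[symmetric] by blast
  qed (rule C)
qed

text \<open>The relative window \<mu> is fixed before x tends to infinity. The error carries a
  factor K of order \<mu>^(-k), but for fixed \<mu> the zero sum can be demanded below \<mu> / K.
  The two bounds then tend to (1 - \<mu>)^2 and (1 + \<mu>)^2.\<close>

lemma psi_interval_asymptotic:
  fixes y :: "real \<Rightarrow> real"
  assumes k: "k \<ge> 5" and y_pos: "\<forall>\<^sub>F x in at_top. 0 < y x"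
    and lim: "filterlim (\<lambda>x. x / y x) at_top at_top" and large: "\<forall>\<^sub>F x in at_top. (x / y x)\<^sup>2 \<le> x"
    and zeros: "\<And>\<epsilon>. \<epsilon> > 0 \<Longrightarrow> \<forall>\<^sub>F x in at_top. \<forall>U. (\<Sum>\<rho>\<in>xi_zeros U. zmult \<rho> * x powr (Re \<rho> - 1) *
      (1 / max 1 (\<bar>Im \<rho>\<bar> / (x / y x))) ^ k) \<le> \<epsilon>"
  shows "((\<lambda>x. psi_interval (x - y x) x / y x) \<longlongrightarrow> 1) at_top"
proof -
  define t where "t x = y x / x" for x
  have "filterlim (\<lambda>x. inverse (x / y x)) (at_right 0) at_top"
    by (rule filterlim_compose[OF filterlim_inverse_at_right_top lim])
  then have t0: "filterlim t (at_right 0) at_top" by (simp add: t_def[abs_def])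
  obtain C where C: "C > 0" and bnd: "\<And>\<mu> t x \<epsilon>. 0 < \<mu> \<Longrightarrow> \<mu> \<le> 1 / 2 \<Longrightarrow> 0 < t \<Longrightarrow> t \<le> 1 / 4 \<Longrightarrow> 1 \<le> x \<Longrightarrow> (1 / t)\<^sup>2 \<le> x \<Longrightarrow>
     (\<And>U. (\<Sum>\<rho>\<in>xi_zeros U. zmult \<rho> * x powr (Re \<rho> - 1) * (1 / max 1 (\<bar>Im \<rho>\<bar> / (1 / t))) ^ k) \<le> \<epsilon>) \<Longrightarrow>
     (let E = (exp 4 + 1) ^ Suc k * (real k / \<mu>) ^ k * \<epsilon> + C * (real k / \<mu>) ^ 3 / sqrt x; l = - ln (1 - t)
      in (1 - \<mu>) * (l / t) * ((1 - t) ^ 3 - E) \<le> psi_interval (x - t * x) x / (t * x) \<and>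
         psi_interval (x - t * x) x / (t * x) \<le> (1 + \<mu>) * (l / t) * ((exp (3 * \<mu> * l) + E) / (1 - t)\<^sup>2))"
    using psi_interval_bounds[OF k] by blast
  show ?thesis
  proof (rule tendstoI)
    fix e :: real assume e: "e > 0"
    \<comment> \<open>Both limits lie strictly within 5 \<mu> of 1, which leaves room to pass from
      limits to eventual inequalities; the cap 1/2 is the one in
      \<open>psi_interval_bounds\<close>.\<close>
    define \<mu> where "\<mu> = min (1 / 2) (e / 5)"
    have lam: "0 < \<mu>" "\<mu> \<le> 1 / 2" "5 * \<mu> \<le> e" using e by (auto simp: \<mu>_def)
    define K where "K = (exp 4 + 1) ^ Suc k * (real k / \<mu>) ^ k"
    have K: "K > 0" unfolding K_def using k lam by (intro mult_pos_pos zero_less_power add_pos_pos) auto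
    define D where "D = C * (real k / \<mu>) ^ 3"
    define E where "E x = \<mu> + D / sqrt x" for x
    have E: "(E \<longlongrightarrow> \<mu>) at_top"
    proof -
      have "((\<lambda>x. D / sqrt x) \<longlongrightarrow> 0) at_top" by real_asymp
      from tendsto_add[OF tendsto_const this] show ?thesis by (simp add: E_def[abs_def])
    qed
    define l where "l x = - ln (1 - t x)" for x
    have lt: "((\<lambda>x. l x / t x) \<longlongrightarrow> 1) at_top"
    proof -
      have "((\<lambda>t::real. - ln (1 - t) / t) \<longlongrightarrow> 1) (at_right 0)" by real_asymp
      from filterlim_compose[OF this t0] show ?thesis by (simp add: l_def)
    qed
    have l: "(l \<longlongrightarrow> 0) at_top"
    proof -
      have "((\<lambda>t::real. - ln (1 - t)) \<longlongrightarrow> 0) (at_right 0)" by real_asymp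
      from filterlim_compose[OF this t0] show ?thesis by (simp add: l_def[abs_def])
    qed
    have t: "(t \<longlongrightarrow> 0) at_top" using t0 by (simp add: filterlim_at)
    have "((\<lambda>x. (1 - \<mu>) * (l x / t x) * ((1 - t x) ^ 3 - E x)) \<longlongrightarrow> (1 - \<mu>) * 1 * ((1 - 0) ^ 3 - \<mu>)) at_top"
      by (intro tendsto_intros lt t E)
    moreover have "1 - 5 * \<mu> < (1 - \<mu>) * 1 * ((1 - 0) ^ 3 - \<mu>)"
    proof -
      have "(1 - \<mu>) * (1 - \<mu>) = 1 - 2 * \<mu> + \<mu> * \<mu>" by (simp add: algebra_simps)
      moreover have "\<mu> * \<mu> \<ge> 0" by simp
      ultimately have "1 - 5 * \<mu> < (1 - \<mu>) * (1 - \<mu>)" using lam(1) by linarith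
      then show ?thesis by simp
    qed
    ultimately have low: "\<forall>\<^sub>F x in at_top. 1 - 5 * \<mu> < (1 - \<mu>) * (l x / t x) * ((1 - t x) ^ 3 - E x)"
      by (rule order_tendstoD(1))
    have "((\<lambda>x. (1 + \<mu>) * (l x / t x) * ((exp (3 * \<mu> * l x) + E x) / (1 - t x)\<^sup>2)) \<longlongrightarrow>
      (1 + \<mu>) * 1 * ((exp (3 * \<mu> * 0) + \<mu>) / (1 - 0)\<^sup>2)) at_top"
      by (intro tendsto_intros lt l t E) auto
    moreover have "(1 + \<mu>) * 1 * ((exp (3 * \<mu> * 0) + \<mu>) / (1 - 0)\<^sup>2) < 1 + 5 * \<mu>"
    proof -
      have "(1 + \<mu>) * (1 + \<mu>) = 1 + 2 * \<mu> + \<mu> * \<mu>" by (simp add: algebra_simps)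
      moreover have "\<mu> * \<mu> \<le> \<mu> * 1" using lam by (intro mult_left_mono) auto
      ultimately have "(1 + \<mu>) * (1 + \<mu>) < 1 + 5 * \<mu>" using lam(1) by linarith
      then show ?thesis by simp
    qed
    ultimately have up: "\<forall>\<^sub>F x in at_top. (1 + \<mu>) * (l x / t x) * ((exp (3 * \<mu> * l x) + E x) / (1 - t x)\<^sup>2) < 1 + 5 * \<mu>"
      by (rule order_tendstoD(2))
    have small: "\<forall>\<^sub>F x in at_top. t x < 1 / 4" using t by (rule order_tendstoD(2)) simp
    have "\<mu> / K > 0" using lam K by simp
    from zeros[OF this] low up small y_pos large eventually_ge_at_top[of 1]
    show "\<forall>\<^sub>F x in at_top. dist (psi_interval (x - y x) x / y x) 1 < e"
    proof eventually_elim
      case (elim x)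
      have tx: "t x * x = y x" "1 / t x = x / y x" "t x > 0" using elim by (auto simp: t_def)
      have EE: "K * (\<mu> / K) + D / sqrt x = E x" using K by (simp add: E_def)
      have "(1 - \<mu>) * (l x / t x) * ((1 - t x) ^ 3 - E x) \<le> psi_interval (x - y x) x / y x \<and>
         psi_interval (x - y x) x / y x \<le> (1 + \<mu>) * (l x / t x) * ((exp (3 * \<mu> * l x) + E x) / (1 - t x)\<^sup>2)"
        using bnd[of \<mu> "t x" x "\<mu> / K"] lam elim tx
        unfolding Let_def K_def[symmetric] D_def[symmetric] EE l_def[symmetric] tx(1,2) by simp
      then have "1 - 5 * \<mu> < psi_interval (x - y x) x / y x" "psi_interval (x - y x) x / y x < 1 + 5 * \<mu>"
        using elim by linarith+
      then show ?case using lam(3) by (simp add: dist_real_def abs_less_iff)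
    qed
  qed
qed


text \<open>About sqrt x squares lie below x; counted with weight ln x they can exceed y when
  \<theta> = 1/2. Those inside the interval have roots in (sqrt a, sqrt x], and sqrt x - sqrt a <=
  (x - a) / sqrt x makes their number negligible.\<close>

lemma card_squares_le:
  assumes "0 \<le> a" "a < x"
  shows "real (card {n :: nat. a < real n \<and> real n \<le> x \<and> (\<exists>m. n = m\<^sup>2)}) \<le> (x - a) / sqrt x + 1"
proof -
  have "{n :: nat. a < real n \<and> real n \<le> x \<and> (\<exists>m. n = m\<^sup>2)} \<subseteq> (\<lambda>m. m\<^sup>2) ` {nat \<lfloor>sqrt a\<rfloor> + 1..nat \<lfloor>sqrt x\<rfloor>}"
  proof clarify
    fix m :: nat assume m: "a < real (m\<^sup>2)" "real (m\<^sup>2) \<le> x"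
    have "sqrt a < real m" using m assms by (intro real_less_lsqrt) auto
    then have 1: "nat \<lfloor>sqrt a\<rfloor> + 1 \<le> m" using assms by (simp add: Suc_le_eq nat_less_iff floor_less_iff)
    have "real m \<le> sqrt x" using m by (intro real_le_rsqrt) auto
    then have 2: "m \<le> nat \<lfloor>sqrt x\<rfloor>" by (rule le_nat_floor)
    show "m\<^sup>2 \<in> (\<lambda>m. m\<^sup>2) ` {nat \<lfloor>sqrt a\<rfloor> + 1..nat \<lfloor>sqrt x\<rfloor>}" using 1 2 by auto
  qed
  then have "card {n :: nat. a < real n \<and> real n \<le> x \<and> (\<exists>m. n = m\<^sup>2)} \<le> card {nat \<lfloor>sqrt a\<rfloor> + 1..nat \<lfloor>sqrt x\<rfloor>}"
    by (rule surj_card_le[OF finite_atLeastAtMost])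
  also have "\<dots> = nat \<lfloor>sqrt x\<rfloor> - nat \<lfloor>sqrt a\<rfloor>" by simp
  finally have "real (card {n :: nat. a < real n \<and> real n \<le> x \<and> (\<exists>m. n = m\<^sup>2)}) \<le> real (nat \<lfloor>sqrt x\<rfloor> - nat \<lfloor>sqrt a\<rfloor>)" by simp
  also have "\<dots> = real (nat \<lfloor>sqrt x\<rfloor>) - real (nat \<lfloor>sqrt a\<rfloor>)"
    using assms by (intro of_nat_diff nat_mono floor_mono) auto
  also have "\<dots> \<le> sqrt x - (sqrt a - 1)"
  proof -
    have "real (nat \<lfloor>sqrt x\<rfloor>) \<le> sqrt x" using assms by simp
    moreover have "sqrt a - 1 \<le> real (nat \<lfloor>sqrt a\<rfloor>)" using assms by linarith
    ultimately show ?thesis by linarith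
  qed
  also have "\<dots> = (sqrt x - sqrt a) + 1" by simp
  also have "sqrt x - sqrt a \<le> (x - a) / sqrt x"
  proof -
    have "sqrt x * sqrt a \<ge> sqrt a * sqrt a" using assms by (intro mult_right_mono) auto
    then have "(sqrt x - sqrt a) * sqrt x \<le> x - a" using assms by (simp add: algebra_simps)
    then show ?thesis using assms by (subst pos_le_divide_eq) auto
  qed
  finally show ?thesis by simp
qed

text \<open>From cubes on, a count of everything up to x is affordable: the base is at most x^(1/3),
  and the exponent is at most ln x / ln 2 <= 2 ln x.\<close>

lemma card_higher_powers_le:
  assumes "x \<ge> 1"
  shows "real (card {n :: nat. real n \<le> x \<and> (\<exists>p j. 2 \<le> p \<and> 3 \<le> j \<and> n = p ^ j)}) \<le> (x powr (1 / 3) + 1) * (2 * ln x + 1)"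
proof -
  define A where "A = {..nat \<lfloor>x powr (1 / 3)\<rfloor>}"
  define B where "B = {..nat \<lfloor>2 * ln x\<rfloor>}"
  have "{n :: nat. real n \<le> x \<and> (\<exists>p j. 2 \<le> p \<and> 3 \<le> j \<and> n = p ^ j)} \<subseteq> (\<lambda>(p, j). p ^ j) ` (A \<times> B)"
  proof clarify
    fix p j :: nat assume p: "2 \<le> p" "3 \<le> j" and x: "real (p ^ j) \<le> x"
    have "real p ^ 3 \<le> real p ^ j" using p by (intro power_increasing) auto
    then have "(real p ^ 3) powr (1 / 3) \<le> x powr (1 / 3)" using x by (intro powr_mono2) auto
    then have "real p \<le> x powr (1 / 3)" using p by (simp add: powr_powr flip: powr_numeral)
    then have 1: "p \<in> A" by (auto simp: A_def intro: le_nat_floor)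
    have "2 ^ j \<le> real p ^ j" using p by (intro power_mono) auto
    then have "ln (2 ^ j) \<le> ln x" using x assms by (subst ln_le_cancel_iff) auto
    then have "real j * ln 2 \<le> ln x" by (simp add: ln_realpow)
    moreover have "real j * (1 / 2) \<le> real j * ln 2" using ln2_ge_two_thirds by (intro mult_left_mono) auto
    ultimately have "real j \<le> 2 * ln x" by simp
    then have 2: "j \<in> B" by (auto simp: B_def intro: le_nat_floor)
    show "p ^ j \<in> (\<lambda>(p, j). p ^ j) ` (A \<times> B)" using 1 2 by auto
  qed
  then have "card {n :: nat. real n \<le> x \<and> (\<exists>p j. 2 \<le> p \<and> 3 \<le> j \<and> n = p ^ j)} \<le> card (A \<times> B)"
    by (rule surj_card_le[rotated]) (simp add: A_def B_def)
  then have "real (card {n :: nat. real n \<le> x \<and> (\<exists>p j. 2 \<le> p \<and> 3 \<le> j \<and> n = p ^ j)}) \<le> real (card A) * real (card B)"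
    by (simp only: card_cartesian_product of_nat_mult[symmetric] of_nat_le_iff)
  also have "\<dots> \<le> (x powr (1 / 3) + 1) * (2 * ln x + 1)"
  proof (intro mult_mono)
    show "real (card A) \<le> x powr (1 / 3) + 1" by (simp add: A_def)
    show "real (card B) \<le> 2 * ln x + 1" using assms by (simp add: B_def)
  qed auto
  finally show ?thesis .
qed

lemma prime_pi_diff:
  assumes "a \<le> x"
  shows "real (prime_pi x) - real (prime_pi a) = real (card {p :: nat. prime p \<and> a < real p \<and> real p \<le> x})"
proof -
  have fin: "finite {p :: nat. prime p \<and> real p \<le> a}" for a
    by (rule finite_subset[of _ "{..nat \<lfloor>a\<rfloor>}"]) (auto simp: le_nat_floor)
  have "{p :: nat. prime p \<and> real p \<le> x} = {p. prime p \<and> real p \<le> a} \<union> {p. prime p \<and> a < real p \<and> real p \<le> x}"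
    using assms by auto
  moreover have "finite {p :: nat. prime p \<and> a < real p \<and> real p \<le> x}"
    by (rule finite_subset[OF _ fin[of x]]) auto
  ultimately have "prime_pi x = prime_pi a + card {p :: nat. prime p \<and> a < real p \<and> real p \<le> x}"
    unfolding prime_pi_def using fin[of a] by (simp, subst card_Un_disjoint) auto
  then show ?thesis by simp
qed

text \<open>A prime power in (a, x] is a prime, a square, or has exponent at least 3; the last two
  kinds are counted separately, each number with weight at most ln x.\<close>

lemma psi_interval_prime_bounds:
  assumes a: "1 \<le> a" "a < x"
  defines "P \<equiv> real (prime_pi x) - real (prime_pi a)"
  shows "P * ln a \<le> psi_interval a x"
    and "psi_interval a x \<le> (P + ((x - a) / sqrt x + 1) + (x powr (1 / 3) + 1) * (2 * ln x + 1)) * ln x"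
proof -
  define N where "N = {n :: nat. a < real n \<and> real n \<le> x}"
  define Q where "Q = {p \<in> N. prime p}"
  define S where "S = {n :: nat. a < real n \<and> real n \<le> x \<and> (\<exists>m. n = m\<^sup>2)}"
  define H where "H = {n :: nat. real n \<le> x \<and> (\<exists>p j. 2 \<le> p \<and> 3 \<le> j \<and> n = p ^ j)}"
  have finN: "finite N" unfolding N_def by (rule finite_nat_interval)
  have finH: "finite H"
    by (rule finite_subset[of _ "{..nat \<lfloor>x\<rfloor>}"]) (auto simp: H_def intro!: le_nat_floor)
  have finS: "finite S" by (rule finite_subset[OF _ finN]) (auto simp: S_def N_def)
  have finQ: "finite Q" using finN by (simp add: Q_def)
  have P: "P = real (card Q)"
  proof -
    have "Q = {p :: nat. prime p \<and> a < real p \<and> real p \<le> x}" by (auto simp: Q_def N_def)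
    then show ?thesis using a by (simp add: P_def prime_pi_diff)
  qed
  have psi: "psi_interval a x = (\<Sum>n\<in>N. mangoldt n)" by (simp add: psi_interval_def N_def)
  have "P * ln a = (\<Sum>n\<in>Q. ln a)" by (simp add: P)
  also have "\<dots> \<le> (\<Sum>n\<in>Q. mangoldt n)"
    using a by (intro sum_mono) (auto simp: Q_def N_def)
  also have "\<dots> \<le> psi_interval a x" unfolding psi
    using finN by (intro sum_mono2) (auto simp: Q_def mangoldt_nonneg)
  finally show "P * ln a \<le> psi_interval a x" .
  have "psi_interval a x = (\<Sum>n | n \<in> N \<and> primepow n. mangoldt n)" unfolding psi
    using finN by (intro sum.mono_neutral_right) (auto simp: mangoldt_def)
  also have "\<dots> \<le> (\<Sum>n | n \<in> N \<and> primepow n. ln x)"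
  proof (rule sum_mono)
    fix n assume "n \<in> {n. n \<in> N \<and> primepow n}"
    then have n: "1 \<le> real n" "real n \<le> x" using a by (auto simp: N_def)
    have "mangoldt n \<le> ln (real n)" using n by (intro mangoldt_le) auto
    also have "\<dots> \<le> ln x" using n by simp
    finally show "mangoldt n \<le> ln x" .
  qed
  also have "\<dots> = real (card {n. n \<in> N \<and> primepow n}) * ln x" by simp
  also have "\<dots> \<le> real (card (Q \<union> (S \<union> H))) * ln x"
  proof -
    have "{n. n \<in> N \<and> primepow n} \<subseteq> Q \<union> (S \<union> H)"
    proof
      fix n assume n: "n \<in> {n. n \<in> N \<and> primepow n}"
      then obtain p j where p: "prime p" "j > 0" "n = p ^ j" by (auto simp: primepow_def)
      have p2: "2 \<le> p" using p(1) by (rule prime_ge_2_nat)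
      consider "j = 1" | "j = 2" | "3 \<le> j" using p(2) by linarith
      then show "n \<in> Q \<union> (S \<union> H)"
        by cases (use n p p2 in \<open>auto simp: Q_def S_def H_def N_def\<close>)
    qed
    then have "card {n. n \<in> N \<and> primepow n} \<le> card (Q \<union> (S \<union> H))"
      using finQ finS finH by (intro card_mono) auto
    then show ?thesis using a by (intro mult_right_mono) auto
  qed
  also have "\<dots> \<le> (P + ((x - a) / sqrt x + 1) + (x powr (1 / 3) + 1) * (2 * ln x + 1)) * ln x"
  proof (rule mult_right_mono)
    have "card (Q \<union> (S \<union> H)) \<le> card Q + (card S + card H)"
      using card_Un_le[of Q "S \<union> H"] card_Un_le[of S H] by linarith
    then have "real (card (Q \<union> (S \<union> H))) \<le> real (card Q) + (real (card S) + real (card H))" by linarith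
    moreover have "real (card S) \<le> (x - a) / sqrt x + 1" unfolding S_def using a by (intro card_squares_le) auto
    moreover have "real (card H) \<le> (x powr (1 / 3) + 1) * (2 * ln x + 1)" unfolding H_def
      using a by (intro card_higher_powers_le) auto
    ultimately show "real (card (Q \<union> (S \<union> H))) \<le> P + ((x - a) / sqrt x + 1) + (x powr (1 / 3) + 1) * (2 * ln x + 1)"
      using P by linarith
  qed (use a in simp)
  finally show "psi_interval a x \<le> (P + ((x - a) / sqrt x + 1) + (x powr (1 / 3) + 1) * (2 * ln x + 1)) * ln x" .
qed

text \<open>As y <= x / 2, primes in the interval have logarithm at least ln (x / 2), which is
  asymptotic to ln x. \<open>R\<close> collects the contribution of squares and higher powers
  relative to y, where y >= sqrt x is used.\<close>

lemma prime_pi_diff_asymptotic: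
  fixes y :: "real \<Rightarrow> real"
  assumes psi: "((\<lambda>x. psi_interval (x - y x) x / y x) \<longlongrightarrow> 1) at_top"
    and y_le: "\<forall>\<^sub>F x in at_top. y x \<le> x / 2" and y_ge: "\<forall>\<^sub>F x in at_top. sqrt x \<le> y x"
  shows "(\<lambda>x. real (prime_pi x) - real (prime_pi (x - y x))) \<sim>[at_top] (\<lambda>x. y x / ln x)"
proof (rule asymp_equivI')
  define P where "P x = real (prime_pi x) - real (prime_pi (x - y x))" for x
  define R where "R x = ln x / sqrt x + (1 + (x powr (1 / 3) + 1) * (2 * ln x + 1)) * ln x / sqrt x" for x :: real
  have "(R \<longlongrightarrow> 0) at_top" unfolding R_def by real_asymp
  from tendsto_diff[OF psi this] have low: "((\<lambda>x. psi_interval (x - y x) x / y x - R x) \<longlongrightarrow> 1) at_top" by simp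
  have "((\<lambda>x::real. ln x / ln (x / 2)) \<longlongrightarrow> 1) at_top" by real_asymp
  from tendsto_mult[OF psi this] have up: "((\<lambda>x. psi_interval (x - y x) x / y x * (ln x / ln (x / 2))) \<longlongrightarrow> 1) at_top" by simp
  have "\<forall>\<^sub>F x in at_top. psi_interval (x - y x) x / y x - R x \<le> P x / (y x / ln x) \<and>
    P x / (y x / ln x) \<le> psi_interval (x - y x) x / y x * (ln x / ln (x / 2))"
    using y_le y_ge eventually_gt_at_top[of 4]
  proof eventually_elim
    case (elim x)
    define a where "a = x - y x"
    have sx: "0 < sqrt x" "sqrt x \<le> y x" using elim by auto
    have y: "0 < y x" using sx by linarith
    have a: "1 \<le> a" "a < x" "x / 2 \<le> a" using elim y by (auto simp: a_def)
    have l: "0 < ln x" "0 < ln (x / 2)" "ln (x / 2) \<le> ln a" using elim a by auto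
    note B = psi_interval_prime_bounds[OF a(1,2)]
    have P0: "P x \<ge> 0" using prime_pi_diff[of a x] a by (simp add: P_def a_def)
    have Pa: "P x = real (prime_pi x) - real (prime_pi a)" by (simp add: P_def a_def)
    have "P x * ln (x / 2) \<le> P x * ln a" using P0 l by (intro mult_left_mono) auto
    also have "\<dots> \<le> psi_interval a x" using B(1) Pa by simp
    finally have "P x \<le> psi_interval a x / ln (x / 2)" using l by (simp add: pos_le_divide_eq)
    then have "P x * (ln x / y x) \<le> psi_interval a x / ln (x / 2) * (ln x / y x)"
      using l y by (intro mult_right_mono) auto
    then have 1: "P x / (y x / ln x) \<le> psi_interval a x / y x * (ln x / ln (x / 2))" by (simp add: mult_ac)
    define W where "W = (1 + (x powr (1 / 3) + 1) * (2 * ln x + 1)) * ln x"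
    have W: "W \<ge> 0" unfolding W_def using l by (intro mult_nonneg_nonneg add_nonneg_nonneg) auto
    have "psi_interval a x \<le> P x * ln x + y x * ln x / sqrt x + W"
      using B(2) unfolding Pa[symmetric] by (simp add: W_def a_def algebra_simps)
    then have "psi_interval a x / y x \<le> (P x * ln x + y x * ln x / sqrt x + W) / y x"
      using y by (intro divide_right_mono) auto
    also have "\<dots> = P x / (y x / ln x) + ln x / sqrt x + W / y x" using y by (simp add: add_divide_distrib)
    also have "\<dots> \<le> P x / (y x / ln x) + ln x / sqrt x + W / sqrt x"
      using W sx y by (intro add_left_mono divide_left_mono mult_pos_pos) auto
    finally have "psi_interval a x / y x - R x \<le> P x / (y x / ln x)" by (simp add: R_def W_def)
    with 1 show ?case by (simp add: a_def)
  qed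
  then have "\<forall>\<^sub>F x in at_top. psi_interval (x - y x) x / y x - R x \<le> P x / (y x / ln x)"
    "\<forall>\<^sub>F x in at_top. P x / (y x / ln x) \<le> psi_interval (x - y x) x / y x * (ln x / ln (x / 2))"
    by (auto elim: eventually_mono)
  from tendsto_sandwich[OF this low up]
  show "((\<lambda>x. (real (prime_pi x) - real (prime_pi (x - y x))) / (y x / ln x)) \<longlongrightarrow> 1) at_top"
    by (simp add: P_def)
qed

theorem theorem2p3:
  fixes \<theta> \<delta> b T0 T1 :: real
    and g y \<eta> h :: "real \<Rightarrow> real"
  assumes theta: "1 / 2 \<le> \<theta>" "\<theta> < 1"
    and y_def: "\<forall>\<^sub>F x in at_top. y x = x powr \<theta> * g x"
    and y_le: "\<forall>\<^sub>F x in at_top. y x \<le> x / 2"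
    and g_pos: "\<forall>\<^sub>F x in at_top. g x > 0"
    and delta: "\<delta> > 0"
    and g_lower: "(\<lambda>x. ln x powr \<delta>) \<in> O[at_top](g)"
    and g_upper: "\<forall>\<epsilon>>0. g \<in> O[at_top](\<lambda>x. x powr \<epsilon>)"
    \<comment> \<open>condition (1)\<close>
    and T0: "T0 \<ge> 3"
    and eta_mono: "antimono_on {T0..} \<eta>"
    and eta_range: "\<forall>T\<ge>T0. 0 \<le> \<eta> T \<and> \<eta> T < 1 / 2"
    and zero_free: "\<forall>T\<ge>T0. \<forall>\<sigma>. \<sigma> > 1 - \<eta> T \<longrightarrow> zeta (Complex \<sigma> T) \<noteq> 0"
    \<comment> \<open>condition (2)\<close>
    and h_mono: "mono_on {T1..} h"
    and b: "0 < b" "b \<le> 1 / (1 - \<theta>)"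
    and zero_density:
      "\<exists>K>0. \<forall>\<^sub>F T in at_top. \<forall>\<sigma>\<in>{1 / 2..1}.
         real (zeta_zero_count \<sigma> T) \<le> K * (T powr (b * (1 - \<sigma>)) * h T)"
    \<comment> \<open>condition (3)\<close>
    and cond_gt: "\<theta> > 1 - 1 / b \<longrightarrow>
      h \<in> o[at_top](\<lambda>x. x powr ((1 + b * (\<theta> - 1)) * \<eta> x))"
    and cond_eq: "\<theta> = 1 - 1 / b \<longrightarrow>
      (\<lambda>x. (ln x powr (\<delta> / 2) / g x) powr (b * \<eta> x) * (h x * ln x / ln (ln x)))
        \<in> o[at_top](\<lambda>_. 1)"
    and cond_half: "b = 2 \<and> \<theta> = 1 / 2 \<longrightarrow> (\<lambda>x. ln x powr (1 + \<delta>)) \<in> O[at_top](g)"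
  shows "(\<lambda>x. real (prime_pi x) - real (prime_pi (x - y x))) \<sim>[at_top] (\<lambda>x. y x / ln x)"
proof -
  \<comment> \<open>The choice k >= b + 1 makes the dyadic sum converge below height x, and k >= 6
    serves the zeros above x and implies the k >= 5 of the explicit formula.\<close>
  define k where "k = max 6 (nat \<lceil>b + 1\<rceil>)"
  have k: "k \<ge> 6" "real k \<ge> b + 1" "k \<ge> 5" unfolding k_def using b(1) by linarith+
  have g1: "\<forall>\<^sub>F x in at_top. 1 \<le> g x" by (rule g_eventually_ge_1[OF delta g_pos g_lower])
  have \<tau>: "\<forall>\<^sub>F x in at_top. x powr (1 - \<theta>) / g x = x / y x"
    using y_def eventually_gt_at_top[of 0]
  proof eventually_elim
    case (elim x)
    have "x = x powr (1 - \<theta>) * x powr \<theta>" using elim by (simp flip: powr_add)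
    then have "x / y x = x powr (1 - \<theta>) * x powr \<theta> / (x powr \<theta> * g x)" using elim by simp
    also have "\<dots> = x powr (1 - \<theta>) / g x" using elim by simp
    finally show ?case ..
  qed
  have y_ge: "\<forall>\<^sub>F x in at_top. sqrt x \<le> y x"
    using y_def g1 eventually_ge_at_top[of 1]
  proof eventually_elim
    case (elim x)
    have "x powr (1 / 2) * 1 \<le> x powr \<theta> * g x" using elim theta by (intro mult_mono powr_mono) auto
    then show ?case using elim by (simp add: powr_half_sqrt)
  qed
  have y_pos: "\<forall>\<^sub>F x in at_top. 0 < y x"
    using y_ge eventually_gt_at_top[of 0] by eventually_elim (auto intro: less_le_trans[rotated])
  have lim: "filterlim (\<lambda>x. x / y x) at_top at_top"
    using tau_at_top[OF theta(2) g_pos g_upper] filterlim_cong[OF refl refl \<tau>] by simp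
  have large: "\<forall>\<^sub>F x in at_top. (x / y x)\<^sup>2 \<le> x"
    using y_ge eventually_gt_at_top[of 0]
  proof eventually_elim
    case (elim x)
    then have "x / y x \<le> x / sqrt x" by (intro divide_left_mono mult_pos_pos) (auto intro: less_le_trans[rotated])
    also have "\<dots> = sqrt x" using elim by (simp add: real_div_sqrt)
    finally have "(x / y x)\<^sup>2 \<le> (sqrt x)\<^sup>2"
      using elim by (intro power_mono divide_nonneg_nonneg) (auto intro: order_trans[rotated])
    then show ?case using elim by simp
  qed
  have "((\<lambda>x. psi_interval (x - y x) x / y x) \<longlongrightarrow> 1) at_top"
  proof (rule psi_interval_asymptotic[OF k(3) y_pos lim large])
    fix \<epsilon> :: real assume "\<epsilon> > 0"
    have "T0 > 0" using T0 by simp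
    from weighted_zero_sum_small[OF theta g_pos delta g_lower g_upper this eta_mono eta_range zero_free
        h_mono b zero_density cond_gt cond_eq k(1,2) \<open>\<epsilon> > 0\<close>] \<tau>
    show "\<forall>\<^sub>F x in at_top. \<forall>U. (\<Sum>\<rho>\<in>xi_zeros U. zmult \<rho> * x powr (Re \<rho> - 1) *
      (1 / max 1 (\<bar>Im \<rho>\<bar> / (x / y x))) ^ k) \<le> \<epsilon>"
      by eventually_elim simp
  qed
  then show ?thesis by (rule prime_pi_diff_asymptotic[OF _ y_le y_ge])
qed

end
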